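(* Let $\mathrm{SMC}_{/\sim}$ be the category obtained from the 2-category $\mathrm{SMC}$ of (small) symmetric monoidal categories, symmetric (lax) monoidal functors and monoidal natural transformations by quotienting 1-cells by the congruence $\sim$ generated by the 2-cells. With $@$, $\mathcal I$, $A$, $R$, $L$, $S$ as defined in the context, and $F^{\sim}$ denoting the $\sim$-class of a 1-cell $F$, the tuple $$(\mathrm{SMC}_{/\sim},\ @,\ \mathcal I,\ A^{\sim},\ R^{\sim},\ L^{\sim},\ S^{\sim})$$ is a symmetric monoidal closed category (with tensor $@$, unit $\mathcal I$, associativity $A^\sim$, right and left unit isomorphisms $R^\sim$, $L^\sim$ and symmetry $S^\sim$). Moreover, for any symmetric monoidal category $\mathcal B$, the right adjoint to $-\,@\,\mathcal B:\mathrm{SMC}_{/\sim}\to\mathrm{SMC}_{/\sim}$ sends any symmetric monoidal category $\mathcal C$ to $[\mathcal B,\mathcal C]$ and, for any symmetric monoidal functor $F:\mathcal C\to\mathcal C'$, sends $F^{\sim}$ to $[\mathcal B,F]^{\sim}:[\mathcal B,\mathcal C]\to[\mathcal B,\mathcal C']$.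
   Context: **Basics.** All symmetric monoidal categories are small, with tensor $\otimes$, unit $I$ and natural isomorphisms $ass_{a,b,c}:a\otimes(b\otimes c)\to(a\otimes b)\otimes c$, $r_a:a\otimes I\to a$, $l_a:I\otimes a\to a$, $s_{a,b}:a\otimes b\to b\otimes a$ satisfying the usual coherence axioms. A symmetric monoidal functor $F:\mathcal A\to\mathcal B$ is a lax one: a functor with an arrow $F^0:I\to F(I)$ and a natural family $F^2_{x,y}:Fx\otimes Fy\to F(x\otimes y)$ satisfying the usual associativity, unit and symmetry axioms; it is strict (resp. strong) if $F^0$ and all $F^2_{x,y}$ are identities (resp. isomorphisms). $\mathrm{SMC}$ is the 2-category of symmetric monoidal categories, symmetric monoidal functors and monoidal natural transformations. **Internal hom.** $[\mathcal A,\mathcal B]$ is the category $\mathrm{SMC}(\mathcal A,\mathcal B)$ with the pointwise symmetric monoidal structure: $(F\Box G)(a)=Fa\otimes Ga$, $(F\Box G)^0$ is $I\cong I\otimes I\xrightarrow{F^0\otimes G^0}F(I)\otimes G(I)$, $(F\Box G)^2_{a,b}$ is the canonical interchange $(Fa\otimes Ga)\otimes(Fb\otimes Gb)\cong(Fa\otimes Fb)\otimes(Ga\otimes Gb)$ followed by $F^2_{a,b}\otimes G^2_{a,b}$; $(\sigma\Box\tau)_a=\sigma_a\otimes\tau_a$; the unit is the constant functor at $I_{\mathcal B}$ (with $I\to I$ the identity and $I\otimes I\to I$ the canonical arrow); $ass,r,l,s$ are pointwise. For $F:\mathcal B\to\mathcal C$, $[\mathcal A,F]:[\mathcal A,\mathcal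 B]\to[\mathcal A,\mathcal C]$ is $H\mapsto F\circ H$, $\theta\mapsto F*\theta$, with $[\mathcal A,F]^0$ having all components $F^0$ and $[\mathcal A,F]^2_{H,K}$ having component $F^2_{Ha,Ka}$ at $a$. For $F:\mathcal C\to\mathcal A$, $[F,\mathcal B]:[\mathcal A,\mathcal B]\to[\mathcal C,\mathcal B]$ (also written $[F,1]$) is precomposition with $F$, which is strict. **Duality.** For $F:\mathcal A\to[\mathcal B,\mathcal C]$ in $\mathrm{SMC}$, its dual $F^*:\mathcal B\to[\mathcal A,\mathcal C]$ is given by $F^*(b)(a)=F(a)(b)$, $F^*(b)(f)=F(f)_b$, $(F^*b)^0=(F^0)_b$, $(F^*b)^2_{a,a'}=(F^2_{a,a'})_b$, $F^*(g)_a=F(a)(g)$, $((F^* )^0)_a=(Fa)^0$, $((F^* )^2_{b,b'})_a=(Fa)^2_{b,b'}$. **Tensor.** $\mathcal A\otimes\mathcal B$ is the following symmetric monoidal category. Its objects are the formal words freely generated from a constant $I$ and symbols $a\otimes b$ ($a$ in $\mathcal A$, $b$ in $\mathcal B$) under a formal binary operation $X\otimes Y$. Its arrows are freely generated, under composition and the operations $p\mapsto X\otimes p$, $p\mapsto p\otimes X$ for objects $X$, by formal arrows $ass,r,l$ (with formal inverses) and $s$ for all objects, and by arrows $\alpha_b:I\to I_{\mathcal A}\otimes b$; $\beta_a:I\to a\otimes I_{\mathcal B}$; $\gamma_{a,a',b}:(a\otimes b)\otimes(a'\otimes b)\to(a\otimes a')\otimes b$; $\delta_{a,b,b'}:(a\otimes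 b)\otimes(a\otimes b')\to a\otimes(b\otimes b')$; $a\otimes g:a\otimes b\to a\otimes b'$ for $g:b\to b'$ in $\mathcal B$; $f\otimes b:a\otimes b\to a'\otimes b$ for $f:a\to a'$ in $\mathcal A$; modulo the smallest congruence, compatible with all $X\otimes-$ and $-\otimes X$, such that: (i) $\otimes$ is a bifunctor and $\otimes,I,ass,r,l,s$ form a symmetric monoidal structure; (ii) for each $a$, $b\mapsto a\otimes b$, $g\mapsto a\otimes g$ with structure $\beta_a$, $\delta_{a,-,-}$ is a symmetric monoidal functor $\eta(a):\mathcal B\to\mathcal A\otimes\mathcal B$; (iii) for each $b$, $a\mapsto a\otimes b$, $f\mapsto f\otimes b$ with structure $\alpha_b$, $\gamma_{-,-,b}$ is a symmetric monoidal functor $\mathcal A\to\mathcal A\otimes\mathcal B$; (iv) for each $f:a\to a'$ the family $(f\otimes b)_b$, and for each $g:b\to b'$ the family $(a\otimes g)_a$, is a monoidal natural transformation between the corresponding functors of (ii), resp. (iii); (v) with $c:I\otimes I\to I$ canonical, $\alpha_{b\otimes b'}\circ c=\delta_{I_{\mathcal A},b,b'}\circ(\alpha_b\otimes\alpha_{b'})$, $\beta_{a\otimes a'}\circ c=\gamma_{a,a',I_{\mathcal B}}\circ(\beta_a\otimes\beta_{a'})$, and $\beta_{I_{\mathcal A}}=\alpha_{I_{\mathcal B}}$; (vi) $\gamma_{a,a',b\otimes b'}\circ(\delta_{a,b,b'}\otimes\delta_{a',b,b'})=\delta_{a\otimes a',b,b'}\circ(\gamma_{a,a',b}\otimes\gamma_{a,a',b'})\circ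 m$, where $m$ is the canonical isomorphism exchanging the two middle factors $a\otimes b'$ and $a'\otimes b$. The symmetric monoidal functor $\eta:\mathcal A\to[\mathcal B,\mathcal A\otimes\mathcal B]$ is $a\mapsto\eta(a)$, $\eta(f)_b=f\otimes b$, $(\eta^0)_b=\alpha_b$, $(\eta^2_{a,a'})_b=\gamma_{a,a',b}$. **$En$ and $Rn$.** For $F:\mathcal A\to[\mathcal B,\mathcal C]$, $En(F):\mathcal A\otimes\mathcal B\to\mathcal C$ is the strict symmetric monoidal functor with $a\otimes b\mapsto F(a)(b)$, $\alpha_b\mapsto(F^0)_b$, $\beta_a\mapsto(Fa)^0$, $\gamma_{a,a',b}\mapsto(F^2_{a,a'})_b$, $\delta_{a,b,b'}\mapsto(Fa)^2_{b,b'}$, $f\otimes b\mapsto F(f)_b$, $a\otimes g\mapsto F(a)(g)$. For a 2-cell $\sigma:F\to G$, $En(\sigma)$ is the monoidal transformation with $En(\sigma)_I=1$, $En(\sigma)_{a\otimes b}=(\sigma_a)_b$, $En(\sigma)_{X\otimes Y}=En(\sigma)_X\otimes En(\sigma)_Y$. $Rn:[\mathcal A\otimes\mathcal B,\mathcal C]\to[\mathcal A,[\mathcal B,\mathcal C]]$ is the strict functor $F\mapsto[\mathcal B,F]\circ\eta$, $\sigma\mapsto[\mathcal B,\sigma]*\eta$. One has $Rn\circ En=1$ and a natural $\epsilon_F:En(Rn(F))\to F$ with $(\epsilon_F)_{a\otimes b}=1$, $(\epsilon_F)_I=F^0$, $(\epsilon_F)_{X\otimes Y}=F^2_{X,Y}\circ((\epsilon_F)_X\otimes(\epsilon_F)_Y)$.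 $En:[\mathcal A,[\mathcal B,\mathcal C]]\to[\mathcal A\otimes\mathcal B,\mathcal C]$ is a (strong) symmetric monoidal functor with $En^2_{F,G}$ the inverse of $\epsilon_{En(F)\Box En(G)}:En(F\Box G)\to En(F)\Box En(G)$ and $En^0$ the inverse of $\epsilon$ at the unit of $[\mathcal A\otimes\mathcal B,\mathcal C]$. **Tensor on 1-cells.** For $F:\mathcal A\to\mathcal C$, $F\otimes\mathcal B=En(\eta\circ F):\mathcal A\otimes\mathcal B\to\mathcal C\otimes\mathcal B$ with $\eta:\mathcal C\to[\mathcal B,\mathcal C\otimes\mathcal B]$; for $G:\mathcal B\to\mathcal D$, $\mathcal A\otimes G=En([G,1]\circ\eta):\mathcal A\otimes\mathcal B\to\mathcal A\otimes\mathcal D$ with $\eta:\mathcal A\to[\mathcal D,\mathcal A\otimes\mathcal D]$; $F\otimes G=(F\otimes\mathcal D)\circ(\mathcal A\otimes G)$. This is part of a 2-functor $\mathrm{SMC}\times\mathrm{SMC}\to\mathrm{SMC}$. **Unit and canonical arrows.** $\mathcal I$ is the free symmetric monoidal category on one generating object $\star$: for each symmetric monoidal category $\mathcal X$ and object $x$ there is a unique strict symmetric monoidal functor $\mathcal I\to\mathcal X$ sending $\star$ to $x$ (its objects are the formal words in $I,\star,\otimes$). $v:\mathcal I\to[\mathcal A,\mathcal A]$ is the strict symmetric monoidal functor with $v(\star)=1_{\mathcal A}$, and $v^*:\mathcal A\to[\mathcal I,\mathcal A]$ its dual. Then: - $S_{\mathcal A,\mathcal B}=En(\eta^* ):\mathcal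 A\otimes\mathcal B\to\mathcal B\otimes\mathcal A$, where $\eta^*:\mathcal A\to[\mathcal B,\mathcal B\otimes\mathcal A]$ is the dual of $\eta:\mathcal B\to[\mathcal A,\mathcal B\otimes\mathcal A]$; - $A_{\mathcal A,\mathcal B,\mathcal C}:\mathcal A\otimes(\mathcal B\otimes\mathcal C)\to(\mathcal A\otimes\mathcal B)\otimes\mathcal C$ is $En$ of the composite $\mathcal A\xrightarrow{\eta}[\mathcal B,\mathcal A\otimes\mathcal B]\xrightarrow{[\mathcal B,\eta]}[\mathcal B,[\mathcal C,(\mathcal A\otimes\mathcal B)\otimes\mathcal C]]\xrightarrow{En}[\mathcal B\otimes\mathcal C,(\mathcal A\otimes\mathcal B)\otimes\mathcal C]$; - $L_{\mathcal A}=En(v):\mathcal I\otimes\mathcal A\to\mathcal A$ and $R_{\mathcal A}=En(v^* ):\mathcal A\otimes\mathcal I\to\mathcal A$. **Quotient.** $\sim$ is the equivalence relation on 1-cells of $\mathrm{SMC}$ generated by the pairs $(F,G)$ of parallel 1-cells such that there is a 2-cell $F\to G$; it is compatible with composition. $\mathrm{SMC}_{/\sim}$ has the same objects as $\mathrm{SMC}$, arrows the $\sim$-classes $F^{\sim}$, and composition and identities induced from $\mathrm{SMC}$. The functor $@:\mathrm{SMC}_{/\sim}\times\mathrm{SMC}_{/\sim}\to\mathrm{SMC}_{/\sim}$ is $\mathcal A@\mathcal B=\mathcal A\otimes\mathcal B$, $F^{\sim}@G^{\sim}=(F\otimes G)^{\sim}$. *)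

theory Defs
  imports "HOL-Library.FuncSet"
begin

section \<open>Symmetric monoidal categories\<close>

text \<open>
  A small category has a set of objects and a set of arrows, each contained in some type. The
  values of the operations outside these carriers are irrelevant.
  \<open>g \<cdot>\<^bsub>C\<^esub> f\<close> is the composite of \<open>f\<close> followed by \<open>g\<close>;
  \<open>\<otimes>\<close> is the tensor of objects and \<open>\<boxtimes>\<close> the tensor of arrows.
\<close>

record ('o, 'm) smc =
  Ob :: "'o set"
  Ar :: "'m set"
  dm :: "'m \<Rightarrow> 'o"
  cd :: "'m \<Rightarrow> 'o"
  idt :: "'o \<Rightarrow> 'm"
  cmp :: "'m \<Rightarrow> 'm \<Rightarrow> 'm" (infixr \<open>\<cdot>\<index>\<close> 75)
  tensO :: "'o \<Rightarrow> 'o \<Rightarrow> 'o" (infixr \<open>\<otimes>\<index>\<close> 80)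
  tensA :: "'m \<Rightarrow> 'm \<Rightarrow> 'm" (infixr \<open>\<boxtimes>\<index>\<close> 80)
  unt :: 'o
  ass :: "'o \<Rightarrow> 'o \<Rightarrow> 'o \<Rightarrow> 'm"
  runit :: "'o \<Rightarrow> 'm"
  lunit :: "'o \<Rightarrow> 'm"
  symm :: "'o \<Rightarrow> 'o \<Rightarrow> 'm"

definition hom :: "('o, 'm) smc \<Rightarrow> 'o \<Rightarrow> 'o \<Rightarrow> 'm set" where
  "hom C a b = {f \<in> Ar C. dm C f = a \<and> cd C f = b}"

definition is_inv :: "('o, 'm) smc \<Rightarrow> 'm \<Rightarrow> 'm \<Rightarrow> bool" where
  "is_inv C f g \<longleftrightarrow> f \<in> Ar C \<and> g \<in> hom C (cd C f) (dm C f) \<and>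
     g \<cdot>\<^bsub>C\<^esub> f = idt C (dm C f) \<and> f \<cdot>\<^bsub>C\<^esub> g = idt C (cd C f)"

definition iso :: "('o, 'm) smc \<Rightarrow> 'm \<Rightarrow> bool" where
  "iso C f \<longleftrightarrow> (\<exists>g. is_inv C f g)"

definition inverse_of :: "('o, 'm) smc \<Rightarrow> 'm \<Rightarrow> 'm" where
  "inverse_of C f = (THE g. is_inv C f g)"

locale category =
  fixes C :: "('o, 'm) smc" (structure)
  assumes dm_Ob: "f \<in> Ar C \<Longrightarrow> dm C f \<in> Ob C"
    and cd_Ob: "f \<in> Ar C \<Longrightarrow> cd C f \<in> Ob C"
    and idt_hom: "a \<in> Ob C \<Longrightarrow> idt C a \<in> hom C a a"
    and cmp_hom: "f \<in> hom C a b \<Longrightarrow> g \<in> hom C b c \<Longrightarrow> g \<cdot> f \<in> hom C a c"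
    and idt_right: "f \<in> hom C a b \<Longrightarrow> f \<cdot> idt C a = f"
    and idt_left: "f \<in> hom C a b \<Longrightarrow> idt C b \<cdot> f = f"
    and cmp_assoc: "f \<in> hom C a b \<Longrightarrow> g \<in> hom C b c \<Longrightarrow> h \<in> hom C c d \<Longrightarrow>
          (h \<cdot> g) \<cdot> f = h \<cdot> (g \<cdot> f)"

locale symmetric_monoidal_category = category C
  for C :: "('o, 'm) smc" (structure) +
  assumes tensO_Ob: "a \<in> Ob C \<Longrightarrow> b \<in> Ob C \<Longrightarrow> a \<otimes> b \<in> Ob C"
    and unt_Ob: "unt C \<in> Ob C"
    and tensA_hom: "f \<in> hom C a b \<Longrightarrow> g \<in> hom C c d \<Longrightarrow> f \<boxtimes> g \<in> hom C (a \<otimes> c) (b \<otimes> d)"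
    and tensA_idt: "a \<in> Ob C \<Longrightarrow> b \<in> Ob C \<Longrightarrow> idt C a \<boxtimes> idt C b = idt C (a \<otimes> b)"
    and tensA_cmp: "f \<in> hom C a b \<Longrightarrow> f' \<in> hom C b c \<Longrightarrow>
          g \<in> hom C a' b' \<Longrightarrow> g' \<in> hom C b' c' \<Longrightarrow>
          (f' \<cdot> f) \<boxtimes> (g' \<cdot> g) = (f' \<boxtimes> g') \<cdot> (f \<boxtimes> g)"
    and ass_hom: "a \<in> Ob C \<Longrightarrow> b \<in> Ob C \<Longrightarrow> c \<in> Ob C \<Longrightarrow>
          ass C a b c \<in> hom C (a \<otimes> (b \<otimes> c)) ((a \<otimes> b) \<otimes> c)"
    and ass_iso: "a \<in> Ob C \<Longrightarrow> b \<in> Ob C \<Longrightarrow> c \<in> Ob C \<Longrightarrow> iso C (ass C a b c)"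
    and ass_nat: "f \<in> hom C a a' \<Longrightarrow> g \<in> hom C b b' \<Longrightarrow> h \<in> hom C c c' \<Longrightarrow>
          ass C a' b' c' \<cdot> (f \<boxtimes> (g \<boxtimes> h)) = ((f \<boxtimes> g) \<boxtimes> h) \<cdot> ass C a b c"
    and runit_hom: "a \<in> Ob C \<Longrightarrow> runit C a \<in> hom C (a \<otimes> unt C) a"
    and runit_iso: "a \<in> Ob C \<Longrightarrow> iso C (runit C a)"
    and runit_nat: "f \<in> hom C a b \<Longrightarrow> runit C b \<cdot> (f \<boxtimes> idt C (unt C)) = f \<cdot> runit C a"
    and lunit_hom: "a \<in> Ob C \<Longrightarrow> lunit C a \<in> hom C (unt C \<otimes> a) a"
    and lunit_iso: "a \<in> Ob C \<Longrightarrow> iso C (lunit C a)"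
    and lunit_nat: "f \<in> hom C a b \<Longrightarrow> lunit C b \<cdot> (idt C (unt C) \<boxtimes> f) = f \<cdot> lunit C a"
    and symm_hom: "a \<in> Ob C \<Longrightarrow> b \<in> Ob C \<Longrightarrow> symm C a b \<in> hom C (a \<otimes> b) (b \<otimes> a)"
    and symm_nat: "f \<in> hom C a a' \<Longrightarrow> g \<in> hom C b b' \<Longrightarrow>
          symm C a' b' \<cdot> (f \<boxtimes> g) = (g \<boxtimes> f) \<cdot> symm C a b"
    and pentagon: "a \<in> Ob C \<Longrightarrow> b \<in> Ob C \<Longrightarrow> c \<in> Ob C \<Longrightarrow> d \<in> Ob C \<Longrightarrow>
          ass C (a \<otimes> b) c d \<cdot> ass C a b (c \<otimes> d) =
          (ass C a b c \<boxtimes> idt C d) \<cdot> ass C a (b \<otimes> c) d \<cdot> (idt C a \<boxtimes> ass C b c d)"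
    and triangle: "a \<in> Ob C \<Longrightarrow> b \<in> Ob C \<Longrightarrow>
          (runit C a \<boxtimes> idt C b) \<cdot> ass C a (unt C) b = idt C a \<boxtimes> lunit C b"
    and symm_symm: "a \<in> Ob C \<Longrightarrow> b \<in> Ob C \<Longrightarrow> symm C b a \<cdot> symm C a b = idt C (a \<otimes> b)"
    and symm_unit: "a \<in> Ob C \<Longrightarrow> lunit C a \<cdot> symm C a (unt C) = runit C a"
    and hexagon: "a \<in> Ob C \<Longrightarrow> b \<in> Ob C \<Longrightarrow> c \<in> Ob C \<Longrightarrow>
          ass C c a b \<cdot> symm C (a \<otimes> b) c \<cdot> ass C a b c =
          (symm C a c \<boxtimes> idt C b) \<cdot> ass C a c b \<cdot> (idt C a \<boxtimes> symm C b c)"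

text \<open>The canonical isomorphism \<open>(a \<otimes> b) \<otimes> (c \<otimes> d) \<rightarrow> (a \<otimes> c) \<otimes> (b \<otimes> d)\<close>.\<close>

definition interchange :: "('o, 'm) smc \<Rightarrow> 'o \<Rightarrow> 'o \<Rightarrow> 'o \<Rightarrow> 'o \<Rightarrow> 'm" where
  "interchange C a b c d =
     inverse_of C (ass C (a \<otimes>\<^bsub>C\<^esub> c) b d) \<cdot>\<^bsub>C\<^esub>
     (ass C a c b \<boxtimes>\<^bsub>C\<^esub> idt C d) \<cdot>\<^bsub>C\<^esub>
     ((idt C a \<boxtimes>\<^bsub>C\<^esub> symm C b c) \<boxtimes>\<^bsub>C\<^esub> idt C d) \<cdot>\<^bsub>C\<^esub>
     (inverse_of C (ass C a b c) \<boxtimes>\<^bsub>C\<^esub> idt C d) \<cdot>\<^bsub>C\<^esub>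
     ass C (a \<otimes>\<^bsub>C\<^esub> b) c d"


section \<open>Symmetric monoidal functors and monoidal natural transformations\<close>

text \<open>
  All components are required to be extensional (that is, \<open>undefined\<close> outside the carriers of the
  source), so that HOL equality of functors and of transformations is the mathematical one.
\<close>

record ('o, 'm, 'p, 'n) smf =
  FO :: "'o \<Rightarrow> 'p"
  FA :: "'m \<Rightarrow> 'n"
  F0 :: 'n
  F2 :: "'o \<Rightarrow> 'o \<Rightarrow> 'n"

locale symmetric_monoidal_functor =
  source: symmetric_monoidal_category A + target: symmetric_monoidal_category B
  for A :: "('o, 'm) smc" and B :: "('p, 'n) smc" and F :: "('o, 'm, 'p, 'n) smf" +
  assumes FO_ext: "FO F \<in> extensional (Ob A)"
    and FA_ext: "FA F \<in> extensional (Ar A)"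
    and F2_ext: "F2 F \<in> extensional (Ob A)" "x \<in> Ob A \<Longrightarrow> F2 F x \<in> extensional (Ob A)"
    and FO_Ob: "x \<in> Ob A \<Longrightarrow> FO F x \<in> Ob B"
    and FA_hom: "f \<in> hom A x y \<Longrightarrow> FA F f \<in> hom B (FO F x) (FO F y)"
    and FA_idt: "x \<in> Ob A \<Longrightarrow> FA F (idt A x) = idt B (FO F x)"
    and FA_cmp: "f \<in> hom A x y \<Longrightarrow> g \<in> hom A y z \<Longrightarrow>
          FA F (g \<cdot>\<^bsub>A\<^esub> f) = FA F g \<cdot>\<^bsub>B\<^esub> FA F f"
    and F0_hom: "F0 F \<in> hom B (unt B) (FO F (unt A))"
    and F2_hom: "x \<in> Ob A \<Longrightarrow> y \<in> Ob A \<Longrightarrow>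
          F2 F x y \<in> hom B (FO F x \<otimes>\<^bsub>B\<^esub> FO F y) (FO F (x \<otimes>\<^bsub>A\<^esub> y))"
    and F2_nat: "f \<in> hom A x x' \<Longrightarrow> g \<in> hom A y y' \<Longrightarrow>
          F2 F x' y' \<cdot>\<^bsub>B\<^esub> (FA F f \<boxtimes>\<^bsub>B\<^esub> FA F g) = FA F (f \<boxtimes>\<^bsub>A\<^esub> g) \<cdot>\<^bsub>B\<^esub> F2 F x y"
    and F2_ass: "x \<in> Ob A \<Longrightarrow> y \<in> Ob A \<Longrightarrow> z \<in> Ob A \<Longrightarrow>
          FA F (ass A x y z) \<cdot>\<^bsub>B\<^esub> F2 F x (y \<otimes>\<^bsub>A\<^esub> z) \<cdot>\<^bsub>B\<^esub> (idt B (FO F x) \<boxtimes>\<^bsub>B\<^esub> F2 F y z) =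
          F2 F (x \<otimes>\<^bsub>A\<^esub> y) z \<cdot>\<^bsub>B\<^esub> (F2 F x y \<boxtimes>\<^bsub>B\<^esub> idt B (FO F z)) \<cdot>\<^bsub>B\<^esub>
            ass B (FO F x) (FO F y) (FO F z)"
    and F2_runit: "x \<in> Ob A \<Longrightarrow>
          FA F (runit A x) \<cdot>\<^bsub>B\<^esub> F2 F x (unt A) \<cdot>\<^bsub>B\<^esub> (idt B (FO F x) \<boxtimes>\<^bsub>B\<^esub> F0 F) =
          runit B (FO F x)"
    and F2_lunit: "x \<in> Ob A \<Longrightarrow>
          FA F (lunit A x) \<cdot>\<^bsub>B\<^esub> F2 F (unt A) x \<cdot>\<^bsub>B\<^esub> (F0 F \<boxtimes>\<^bsub>B\<^esub> idt B (FO F x)) =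
          lunit B (FO F x)"
    and F2_symm: "x \<in> Ob A \<Longrightarrow> y \<in> Ob A \<Longrightarrow>
          FA F (symm A x y) \<cdot>\<^bsub>B\<^esub> F2 F x y = F2 F y x \<cdot>\<^bsub>B\<^esub> symm B (FO F x) (FO F y)"

locale monoidal_transformation =
  source: symmetric_monoidal_functor A B F + target: symmetric_monoidal_functor A B G
  for A :: "('o, 'm) smc" and B :: "('p, 'n) smc" and F G :: "('o, 'm, 'p, 'n) smf"
    and \<sigma> :: "'o \<Rightarrow> 'n" +
  assumes tr_ext: "\<sigma> \<in> extensional (Ob A)"
    and tr_hom: "x \<in> Ob A \<Longrightarrow> \<sigma> x \<in> hom B (FO F x) (FO G x)"
    and tr_nat: "f \<in> hom A x y \<Longrightarrow> \<sigma> y \<cdot>\<^bsub>B\<^esub> FA F f = FA G f \<cdot>\<^bsub>B\<^esub> \<sigma> x"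
    and tr_unit: "\<sigma> (unt A) \<cdot>\<^bsub>B\<^esub> F0 F = F0 G"
    and tr_tens: "x \<in> Ob A \<Longrightarrow> y \<in> Ob A \<Longrightarrow>
          \<sigma> (x \<otimes>\<^bsub>A\<^esub> y) \<cdot>\<^bsub>B\<^esub> F2 F x y = F2 G x y \<cdot>\<^bsub>B\<^esub> (\<sigma> x \<boxtimes>\<^bsub>B\<^esub> \<sigma> y)"

definition smf_id :: "('o, 'm) smc \<Rightarrow> ('o, 'm, 'o, 'm) smf" where
  "smf_id A = \<lparr>FO = (\<lambda>x\<in>Ob A. x), FA = (\<lambda>f\<in>Ar A. f), F0 = idt A (unt A),
     F2 = (\<lambda>x\<in>Ob A. \<lambda>y\<in>Ob A. idt A (x \<otimes>\<^bsub>A\<^esub> y))\<rparr>"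

text \<open>\<open>smf_comp A C G F\<close> is \<open>G \<circ> F : A \<rightarrow> C\<close>.\<close>

definition smf_comp :: "('o, 'm) smc \<Rightarrow> ('q, 'k) smc \<Rightarrow> ('p, 'n, 'q, 'k) smf \<Rightarrow>
    ('o, 'm, 'p, 'n) smf \<Rightarrow> ('o, 'm, 'q, 'k) smf" where
  "smf_comp A C G F = \<lparr>FO = (\<lambda>x\<in>Ob A. FO G (FO F x)), FA = (\<lambda>f\<in>Ar A. FA G (FA F f)),
     F0 = FA G (F0 F) \<cdot>\<^bsub>C\<^esub> F0 G,
     F2 = (\<lambda>x\<in>Ob A. \<lambda>y\<in>Ob A. FA G (F2 F x y) \<cdot>\<^bsub>C\<^esub> F2 G (FO F x) (FO F y))\<rparr>"


section \<open>Internal hom\<close>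

text \<open>An arrow of \<open>[A, B]\<close> is a triple of source, target and family of components.\<close>

type_synonym ('o, 'm, 'p, 'n) transf =
  "('o, 'm, 'p, 'n) smf \<times> ('o, 'm, 'p, 'n) smf \<times> ('o \<Rightarrow> 'n)"

definition comp_at :: "('o, 'm, 'p, 'n) transf \<Rightarrow> 'o \<Rightarrow> 'n" where
  "comp_at \<theta> x = snd (snd \<theta>) x"

definition smf_box :: "('o, 'm) smc \<Rightarrow> ('p, 'n) smc \<Rightarrow> ('o, 'm, 'p, 'n) smf \<Rightarrow>
    ('o, 'm, 'p, 'n) smf \<Rightarrow> ('o, 'm, 'p, 'n) smf" where
  "smf_box A B F G = \<lparr>FO = (\<lambda>a\<in>Ob A. FO F a \<otimes>\<^bsub>B\<^esub> FO G a),
     FA = (\<lambda>f\<in>Ar A. FA F f \<boxtimes>\<^bsub>B\<^esub> FA G f),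
     F0 = (F0 F \<boxtimes>\<^bsub>B\<^esub> F0 G) \<cdot>\<^bsub>B\<^esub> inverse_of B (runit B (unt B)),
     F2 = (\<lambda>a\<in>Ob A. \<lambda>b\<in>Ob A. (F2 F a b \<boxtimes>\<^bsub>B\<^esub> F2 G a b) \<cdot>\<^bsub>B\<^esub>
        interchange B (FO F a) (FO G a) (FO F b) (FO G b))\<rparr>"

definition smf_const :: "('o, 'm) smc \<Rightarrow> ('p, 'n) smc \<Rightarrow> ('o, 'm, 'p, 'n) smf" where
  "smf_const A B = \<lparr>FO = (\<lambda>a\<in>Ob A. unt B), FA = (\<lambda>f\<in>Ar A. idt B (unt B)),
     F0 = idt B (unt B), F2 = (\<lambda>a\<in>Ob A. \<lambda>b\<in>Ob A. runit B (unt B))\<rparr>"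

definition ihom :: "('o, 'm) smc \<Rightarrow> ('p, 'n) smc \<Rightarrow>
    (('o, 'm, 'p, 'n) smf, ('o, 'm, 'p, 'n) transf) smc" where
  "ihom A B = \<lparr>
     Ob = {F. symmetric_monoidal_functor A B F},
     Ar = {(F, G, \<sigma>). monoidal_transformation A B F G \<sigma>},
     dm = (\<lambda>(F, G, \<sigma>). F),
     cd = (\<lambda>(F, G, \<sigma>). G),
     idt = (\<lambda>F. (F, F, \<lambda>a\<in>Ob A. idt B (FO F a))),
     cmp = (\<lambda>(G', H, \<tau>) (F, G, \<sigma>). (F, H, \<lambda>a\<in>Ob A. \<tau> a \<cdot>\<^bsub>B\<^esub> \<sigma> a)),
     tensO = smf_box A B,
     tensA = (\<lambda>(F, G, \<sigma>) (F', G', \<tau>).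
        (smf_box A B F F', smf_box A B G G', \<lambda>a\<in>Ob A. \<sigma> a \<boxtimes>\<^bsub>B\<^esub> \<tau> a)),
     unt = smf_const A B,
     ass = (\<lambda>F G H. (smf_box A B F (smf_box A B G H), smf_box A B (smf_box A B F G) H,
        \<lambda>a\<in>Ob A. ass B (FO F a) (FO G a) (FO H a))),
     runit = (\<lambda>F. (smf_box A B F (smf_const A B), F, \<lambda>a\<in>Ob A. runit B (FO F a))),
     lunit = (\<lambda>F. (smf_box A B (smf_const A B) F, F, \<lambda>a\<in>Ob A. lunit B (FO F a))),
     symm = (\<lambda>F G. (smf_box A B F G, smf_box A B G F, \<lambda>a\<in>Ob A. symm B (FO F a) (FO G a)))\<rparr>"

text \<open>\<open>[A, F] : [A, B] \<rightarrow> [A, C]\<close> for \<open>F : B \<rightarrow> C\<close>.\<close>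

definition post :: "('o, 'm) smc \<Rightarrow> ('p, 'n) smc \<Rightarrow> ('q, 'k) smc \<Rightarrow> ('p, 'n, 'q, 'k) smf \<Rightarrow>
    (('o, 'm, 'p, 'n) smf, ('o, 'm, 'p, 'n) transf, ('o, 'm, 'q, 'k) smf, ('o, 'm, 'q, 'k) transf) smf" where
  "post A B C F = \<lparr>
     FO = (\<lambda>H\<in>Ob (ihom A B). smf_comp A C F H),
     FA = (\<lambda>\<theta>\<in>Ar (ihom A B). (smf_comp A C F (dm (ihom A B) \<theta>), smf_comp A C F (cd (ihom A B) \<theta>),
        \<lambda>a\<in>Ob A. FA F (comp_at \<theta> a))),
     F0 = (smf_const A C, smf_comp A C F (smf_const A B), \<lambda>a\<in>Ob A. F0 F),
     F2 = (\<lambda>H\<in>Ob (ihom A B). \<lambda>K\<in>Ob (ihom A B).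
        (smf_box A C (smf_comp A C F H) (smf_comp A C F K), smf_comp A C F (smf_box A B H K),
         \<lambda>a\<in>Ob A. F2 F (FO H a) (FO K a)))\<rparr>"

text \<open>\<open>[F, B] : [A, B] \<rightarrow> [C, B]\<close> for \<open>F : C \<rightarrow> A\<close>.\<close>

definition pre :: "('q, 'k) smc \<Rightarrow> ('o, 'm) smc \<Rightarrow> ('p, 'n) smc \<Rightarrow> ('q, 'k, 'o, 'm) smf \<Rightarrow>
    (('o, 'm, 'p, 'n) smf, ('o, 'm, 'p, 'n) transf, ('q, 'k, 'p, 'n) smf, ('q, 'k, 'p, 'n) transf) smf" where
  "pre C A B F = \<lparr>
     FO = (\<lambda>H\<in>Ob (ihom A B). smf_comp C B H F),
     FA = (\<lambda>\<theta>\<in>Ar (ihom A B). (smf_comp C B (dm (ihom A B) \<theta>) F, smf_comp C B (cd (ihom A B) \<theta>) F,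
        \<lambda>c\<in>Ob C. comp_at \<theta> (FO F c))),
     F0 = idt (ihom C B) (unt (ihom C B)),
     F2 = (\<lambda>H\<in>Ob (ihom A B). \<lambda>K\<in>Ob (ihom A B).
        idt (ihom C B) (smf_box C B (smf_comp C B H F) (smf_comp C B K F)))\<rparr>"

text \<open>\<open>dual A B C F : B \<rightarrow> [A, C]\<close> for \<open>F : A \<rightarrow> [B, C]\<close>; \<open>dual_ob A F b\<close> is its value at \<open>b\<close>.\<close>

definition dual_ob :: "('o, 'm) smc \<Rightarrow>
    ('o, 'm, ('p, 'n, 'q, 'k) smf, ('p, 'n, 'q, 'k) transf) smf \<Rightarrow> 'p \<Rightarrow> ('o, 'm, 'q, 'k) smf" where
  "dual_ob A F b = \<lparr>
     FO = (\<lambda>a\<in>Ob A. FO (FO F a) b),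
     FA = (\<lambda>f\<in>Ar A. comp_at (FA F f) b),
     F0 = comp_at (F0 F) b,
     F2 = (\<lambda>a\<in>Ob A. \<lambda>a'\<in>Ob A. comp_at (F2 F a a') b)\<rparr>"

definition dual :: "('o, 'm) smc \<Rightarrow> ('p, 'n) smc \<Rightarrow> ('q, 'k) smc \<Rightarrow>
    ('o, 'm, ('p, 'n, 'q, 'k) smf, ('p, 'n, 'q, 'k) transf) smf \<Rightarrow>
    ('p, 'n, ('o, 'm, 'q, 'k) smf, ('o, 'm, 'q, 'k) transf) smf" where
  "dual A B C F = \<lparr>
     FO = (\<lambda>b\<in>Ob B. dual_ob A F b),
     FA = (\<lambda>g\<in>Ar B. (dual_ob A F (dm B g), dual_ob A F (cd B g), \<lambda>a\<in>Ob A. FA (FO F a) g)),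
     F0 = (smf_const A C, dual_ob A F (unt B), \<lambda>a\<in>Ob A. F0 (FO F a)),
     F2 = (\<lambda>b\<in>Ob B. \<lambda>b'\<in>Ob B.
        (smf_box A C (dual_ob A F b) (dual_ob A F b'), dual_ob A F (b \<otimes>\<^bsub>B\<^esub> b'),
         \<lambda>a\<in>Ob A. F2 (FO F a) b b'))\<rparr>"


section \<open>Symmetric monoidal categories given by generators and relations\<close>

text \<open>
  Objects are words over object generators. Arrows are terms over the structural arrows and arrow
  generators, under composition and whiskering by objects, modulo a congruence.
  \<open>LeftT X p\<close> is \<open>X \<otimes> p\<close> and \<open>RightT p X\<close> is \<open>p \<otimes> X\<close>.
\<close>

datatype (word_gens: 'g) word = UnitW | GenW 'g | TensW "'g word" "'g word"

datatype ('g, 'k) tm =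
    IdT "'g word"
  | CompT "('g, 'k) tm" "('g, 'k) tm"
  | LeftT "'g word" "('g, 'k) tm"
  | RightT "('g, 'k) tm" "'g word"
  | AssT "'g word" "'g word" "'g word"
  | AssInvT "'g word" "'g word" "'g word"
  | RunitT "'g word"
  | RunitInvT "'g word"
  | LunitT "'g word"
  | LunitInvT "'g word"
  | SymmT "'g word" "'g word"
  | GenT 'k

primrec tdom :: "('k \<Rightarrow> 'g word) \<Rightarrow> ('g, 'k) tm \<Rightarrow> 'g word" where
  "tdom kd (IdT X) = X"
| "tdom kd (CompT q p) = tdom kd p"
| "tdom kd (LeftT X p) = TensW X (tdom kd p)"
| "tdom kd (RightT p X) = TensW (tdom kd p) X"
| "tdom kd (AssT X Y Z) = TensW X (TensW Y Z)"
| "tdom kd (AssInvT X Y Z) = TensW (TensW X Y) Z"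
| "tdom kd (RunitT X) = TensW X UnitW"
| "tdom kd (RunitInvT X) = X"
| "tdom kd (LunitT X) = TensW UnitW X"
| "tdom kd (LunitInvT X) = X"
| "tdom kd (SymmT X Y) = TensW X Y"
| "tdom kd (GenT k) = kd k"

primrec tcod :: "('k \<Rightarrow> 'g word) \<Rightarrow> ('g, 'k) tm \<Rightarrow> 'g word" where
  "tcod kc (IdT X) = X"
| "tcod kc (CompT q p) = tcod kc q"
| "tcod kc (LeftT X p) = TensW X (tcod kc p)"
| "tcod kc (RightT p X) = TensW (tcod kc p) X"
| "tcod kc (AssT X Y Z) = TensW (TensW X Y) Z"
| "tcod kc (AssInvT X Y Z) = TensW X (TensW Y Z)"
| "tcod kc (RunitT X) = X"
| "tcod kc (RunitInvT X) = TensW X UnitW"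
| "tcod kc (LunitT X) = X"
| "tcod kc (LunitInvT X) = TensW UnitW X"
| "tcod kc (SymmT X Y) = TensW Y X"
| "tcod kc (GenT k) = kc k"

definition tensT :: "('k \<Rightarrow> 'g word) \<Rightarrow> ('k \<Rightarrow> 'g word) \<Rightarrow> ('g, 'k) tm \<Rightarrow> ('g, 'k) tm \<Rightarrow> ('g, 'k) tm" where
  "tensT kd kc p q = CompT (RightT p (tcod kc q)) (LeftT (tdom kd p) q)"

record ('g, 'k) presentation =
  ogens :: "'g set"
  agens :: "'k set"
  adom :: "'k \<Rightarrow> 'g word"
  acod :: "'k \<Rightarrow> 'g word"
  rels :: "('g, 'k) tm \<Rightarrow> ('g, 'k) tm \<Rightarrow> bool"

definition words :: "('g, 'k) presentation \<Rightarrow> 'g word set" where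
  "words P = {X. word_gens X \<subseteq> ogens P}"

primrec wf_tm :: "('g, 'k) presentation \<Rightarrow> ('g, 'k) tm \<Rightarrow> bool" where
  "wf_tm P (IdT X) = (X \<in> words P)"
| "wf_tm P (CompT q p) = (wf_tm P q \<and> wf_tm P p \<and> tcod (acod P) p = tdom (adom P) q)"
| "wf_tm P (LeftT X p) = (X \<in> words P \<and> wf_tm P p)"
| "wf_tm P (RightT p X) = (wf_tm P p \<and> X \<in> words P)"
| "wf_tm P (AssT X Y Z) = (X \<in> words P \<and> Y \<in> words P \<and> Z \<in> words P)"
| "wf_tm P (AssInvT X Y Z) = (X \<in> words P \<and> Y \<in> words P \<and> Z \<in> words P)"
| "wf_tm P (RunitT X) = (X \<in> words P)"
| "wf_tm P (RunitInvT X) = (X \<in> words P)"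
| "wf_tm P (LunitT X) = (X \<in> words P)"
| "wf_tm P (LunitInvT X) = (X \<in> words P)"
| "wf_tm P (SymmT X Y) = (X \<in> words P \<and> Y \<in> words P)"
| "wf_tm P (GenT k) = (k \<in> agens P)"

text \<open>
  The equations of a symmetric monoidal category, for a tensor presented by whiskerings. They are
  stated without typing conditions; rule \<open>base\<close> of \<open>tm_eq\<close> admits well-typed instances only.
\<close>

inductive smc_rel :: "('k \<Rightarrow> 'g word) \<Rightarrow> ('k \<Rightarrow> 'g word) \<Rightarrow> ('g, 'k) tm \<Rightarrow> ('g, 'k) tm \<Rightarrow> bool"
  for kd kc where
  id_right: "smc_rel kd kc (CompT p (IdT (tdom kd p))) p"
| id_left: "smc_rel kd kc (CompT (IdT (tcod kc p)) p) p"
| comp_assoc: "smc_rel kd kc (CompT (CompT r q) p) (CompT r (CompT q p))"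
| left_id: "smc_rel kd kc (LeftT X (IdT Y)) (IdT (TensW X Y))"
| left_comp: "smc_rel kd kc (LeftT X (CompT q p)) (CompT (LeftT X q) (LeftT X p))"
| right_id: "smc_rel kd kc (RightT (IdT Y) X) (IdT (TensW Y X))"
| right_comp: "smc_rel kd kc (RightT (CompT q p) X) (CompT (RightT q X) (RightT p X))"
| left_right: "smc_rel kd kc
    (CompT (RightT p (tcod kc q)) (LeftT (tdom kd p) q))
    (CompT (LeftT (tcod kc p) q) (RightT p (tdom kd q)))"
| ass_inv1: "smc_rel kd kc (CompT (AssInvT X Y Z) (AssT X Y Z)) (IdT (TensW X (TensW Y Z)))"
| ass_inv2: "smc_rel kd kc (CompT (AssT X Y Z) (AssInvT X Y Z)) (IdT (TensW (TensW X Y) Z))"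
| runit_inv1: "smc_rel kd kc (CompT (RunitInvT X) (RunitT X)) (IdT (TensW X UnitW))"
| runit_inv2: "smc_rel kd kc (CompT (RunitT X) (RunitInvT X)) (IdT X)"
| lunit_inv1: "smc_rel kd kc (CompT (LunitInvT X) (LunitT X)) (IdT (TensW UnitW X))"
| lunit_inv2: "smc_rel kd kc (CompT (LunitT X) (LunitInvT X)) (IdT X)"
| ass_nat: "smc_rel kd kc
    (CompT (AssT (tcod kc p) (tcod kc q) (tcod kc r)) (tensT kd kc p (tensT kd kc q r)))
    (CompT (tensT kd kc (tensT kd kc p q) r) (AssT (tdom kd p) (tdom kd q) (tdom kd r)))"
| runit_nat: "smc_rel kd kc (CompT (RunitT (tcod kc p)) (RightT p UnitW)) (CompT p (RunitT (tdom kd p)))"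
| lunit_nat: "smc_rel kd kc (CompT (LunitT (tcod kc p)) (LeftT UnitW p)) (CompT p (LunitT (tdom kd p)))"
| symm_nat: "smc_rel kd kc
    (CompT (SymmT (tcod kc p) (tcod kc q)) (tensT kd kc p q))
    (CompT (tensT kd kc q p) (SymmT (tdom kd p) (tdom kd q)))"
| pentagon: "smc_rel kd kc
    (CompT (AssT (TensW X Y) Z W) (AssT X Y (TensW Z W)))
    (CompT (RightT (AssT X Y Z) W) (CompT (AssT X (TensW Y Z) W) (LeftT X (AssT Y Z W))))"
| triangle: "smc_rel kd kc (CompT (RightT (RunitT X) Y) (AssT X UnitW Y)) (LeftT X (LunitT Y))"
| symm_symm: "smc_rel kd kc (CompT (SymmT Y X) (SymmT X Y)) (IdT (TensW X Y))"
| symm_unit: "smc_rel kd kc (CompT (LunitT X) (SymmT X UnitW)) (RunitT X)"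
| hexagon: "smc_rel kd kc
    (CompT (AssT Z X Y) (CompT (SymmT (TensW X Y) Z) (AssT X Y Z)))
    (CompT (RightT (SymmT X Z) Y) (CompT (AssT X Z Y) (LeftT X (SymmT Y Z))))"

inductive tm_eq :: "('g, 'k) presentation \<Rightarrow> ('g, 'k) tm \<Rightarrow> ('g, 'k) tm \<Rightarrow> bool"
  for P where
  base: "smc_rel (adom P) (acod P) p q \<or> rels P p q \<Longrightarrow> wf_tm P p \<Longrightarrow> wf_tm P q \<Longrightarrow>
    tdom (adom P) p = tdom (adom P) q \<Longrightarrow> tcod (acod P) p = tcod (acod P) q \<Longrightarrow> tm_eq P p q"
| refl: "wf_tm P p \<Longrightarrow> tm_eq P p p"
| sym: "tm_eq P p q \<Longrightarrow> tm_eq P q p"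
| trans: "tm_eq P p q \<Longrightarrow> tm_eq P q r \<Longrightarrow> tm_eq P p r"
| comp: "tm_eq P p p' \<Longrightarrow> tm_eq P q q' \<Longrightarrow> tcod (acod P) p = tdom (adom P) q \<Longrightarrow>
    tm_eq P (CompT q p) (CompT q' p')"
| left: "X \<in> words P \<Longrightarrow> tm_eq P p p' \<Longrightarrow> tm_eq P (LeftT X p) (LeftT X p')"
| right: "X \<in> words P \<Longrightarrow> tm_eq P p p' \<Longrightarrow> tm_eq P (RightT p X) (RightT p' X)"

definition tm_class :: "('g, 'k) presentation \<Rightarrow> ('g, 'k) tm \<Rightarrow> ('g, 'k) tm set" where
  "tm_class P p = {q. tm_eq P p q}"

definition tm_rep :: "('g, 'k) tm set \<Rightarrow> ('g, 'k) tm" where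
  "tm_rep c = (SOME p. p \<in> c)"

definition presented :: "('g, 'k) presentation \<Rightarrow> ('g word, ('g, 'k) tm set) smc" where
  "presented P = \<lparr>
     Ob = words P,
     Ar = {tm_class P p |p. wf_tm P p},
     dm = (\<lambda>c. tdom (adom P) (tm_rep c)),
     cd = (\<lambda>c. tcod (acod P) (tm_rep c)),
     idt = (\<lambda>X. tm_class P (IdT X)),
     cmp = (\<lambda>d c. tm_class P (CompT (tm_rep d) (tm_rep c))),
     tensO = TensW,
     tensA = (\<lambda>c d. tm_class P (tensT (adom P) (acod P) (tm_rep c) (tm_rep d))),
     unt = UnitW,
     ass = (\<lambda>X Y Z. tm_class P (AssT X Y Z)),
     runit = (\<lambda>X. tm_class P (RunitT X)),
     lunit = (\<lambda>X. tm_class P (LunitT X)),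
     symm = (\<lambda>X Y. tm_class P (SymmT X Y))\<rparr>"

text \<open>
  The strict symmetric monoidal functor out of \<open>presented P\<close> with prescribed values on generators.
\<close>

primrec eval_word :: "('o, 'm) smc \<Rightarrow> ('g \<Rightarrow> 'o) \<Rightarrow> 'g word \<Rightarrow> 'o" where
  "eval_word C u UnitW = unt C"
| "eval_word C u (GenW g) = u g"
| "eval_word C u (TensW X Y) = eval_word C u X \<otimes>\<^bsub>C\<^esub> eval_word C u Y"

primrec eval_tm :: "('o, 'm) smc \<Rightarrow> ('g \<Rightarrow> 'o) \<Rightarrow> ('k \<Rightarrow> 'm) \<Rightarrow> ('g, 'k) tm \<Rightarrow> 'm" where
  "eval_tm C u w (IdT X) = idt C (eval_word C u X)"
| "eval_tm C u w (CompT q p) = eval_tm C u w q \<cdot>\<^bsub>C\<^esub> eval_tm C u w p"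
| "eval_tm C u w (LeftT X p) = idt C (eval_word C u X) \<boxtimes>\<^bsub>C\<^esub> eval_tm C u w p"
| "eval_tm C u w (RightT p X) = eval_tm C u w p \<boxtimes>\<^bsub>C\<^esub> idt C (eval_word C u X)"
| "eval_tm C u w (AssT X Y Z) = ass C (eval_word C u X) (eval_word C u Y) (eval_word C u Z)"
| "eval_tm C u w (AssInvT X Y Z) =
     inverse_of C (ass C (eval_word C u X) (eval_word C u Y) (eval_word C u Z))"
| "eval_tm C u w (RunitT X) = runit C (eval_word C u X)"
| "eval_tm C u w (RunitInvT X) = inverse_of C (runit C (eval_word C u X))"
| "eval_tm C u w (LunitT X) = lunit C (eval_word C u X)"
| "eval_tm C u w (LunitInvT X) = inverse_of C (lunit C (eval_word C u X))"
| "eval_tm C u w (SymmT X Y) = symm C (eval_word C u X) (eval_word C u Y)"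
| "eval_tm C u w (GenT k) = w k"

definition strict_ext :: "('g, 'k) presentation \<Rightarrow> ('o, 'm) smc \<Rightarrow> ('g \<Rightarrow> 'o) \<Rightarrow> ('k \<Rightarrow> 'm) \<Rightarrow>
    ('g word, ('g, 'k) tm set, 'o, 'm) smf" where
  "strict_ext P C u w = \<lparr>
     FO = (\<lambda>X\<in>Ob (presented P). eval_word C u X),
     FA = (\<lambda>c\<in>Ar (presented P). eval_tm C u w (tm_rep c)),
     F0 = idt C (unt C),
     F2 = (\<lambda>X\<in>Ob (presented P). \<lambda>Y\<in>Ob (presented P). idt C (eval_word C u (TensW X Y)))\<rparr>"


section \<open>Tensor of symmetric monoidal categories\<close>

text \<open>
  Arrow generators: \<open>AlphaG b : I \<rightarrow> I\<^sub>A \<otimes> b\<close>, \<open>BetaG a : I \<rightarrow> a \<otimes> I\<^sub>B\<close>,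
  \<open>GammaG a a' b : (a \<otimes> b) \<otimes> (a' \<otimes> b) \<rightarrow> (a \<otimes> a') \<otimes> b\<close>,
  \<open>DeltaG a b b' : (a \<otimes> b) \<otimes> (a \<otimes> b') \<rightarrow> a \<otimes> (b \<otimes> b')\<close>,
  \<open>ObAr a g : a \<otimes> b \<rightarrow> a \<otimes> b'\<close> and \<open>ArOb f b : a \<otimes> b \<rightarrow> a' \<otimes> b\<close>.
\<close>

datatype ('o, 'm, 'p, 'n) tgen =
    AlphaG 'p
  | BetaG 'o
  | GammaG 'o 'o 'p
  | DeltaG 'o 'p 'p
  | ObAr 'o 'n
  | ArOb 'm 'p

primrec tgen_dom :: "('o, 'm) smc \<Rightarrow> ('p, 'n) smc \<Rightarrow> ('o, 'm, 'p, 'n) tgen \<Rightarrow> ('o \<times> 'p) word" where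
  "tgen_dom A B (AlphaG b) = UnitW"
| "tgen_dom A B (BetaG a) = UnitW"
| "tgen_dom A B (GammaG a a' b) = TensW (GenW (a, b)) (GenW (a', b))"
| "tgen_dom A B (DeltaG a b b') = TensW (GenW (a, b)) (GenW (a, b'))"
| "tgen_dom A B (ObAr a g) = GenW (a, dm B g)"
| "tgen_dom A B (ArOb f b) = GenW (dm A f, b)"

primrec tgen_cod :: "('o, 'm) smc \<Rightarrow> ('p, 'n) smc \<Rightarrow> ('o, 'm, 'p, 'n) tgen \<Rightarrow> ('o \<times> 'p) word" where
  "tgen_cod A B (AlphaG b) = GenW (unt A, b)"
| "tgen_cod A B (BetaG a) = GenW (a, unt B)"
| "tgen_cod A B (GammaG a a' b) = GenW (a \<otimes>\<^bsub>A\<^esub> a', b)"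
| "tgen_cod A B (DeltaG a b b') = GenW (a, b \<otimes>\<^bsub>B\<^esub> b')"
| "tgen_cod A B (ObAr a g) = GenW (a, cd B g)"
| "tgen_cod A B (ArOb f b) = GenW (cd A f, b)"

text \<open>
  The equations saying that \<open>u\<close> (on objects), \<open>v\<close> (on arrows), \<open>\<phi>0\<close>, \<open>\<phi>2\<close> form a symmetric
  monoidal functor from \<open>X\<close>; \<open>T\<close> is the tensor of terms.
\<close>

inductive functor_rel :: "('o, 'm) smc \<Rightarrow> (('g, 'k) tm \<Rightarrow> ('g, 'k) tm \<Rightarrow> ('g, 'k) tm) \<Rightarrow>
    ('o \<Rightarrow> 'g word) \<Rightarrow> ('m \<Rightarrow> ('g, 'k) tm) \<Rightarrow> ('g, 'k) tm \<Rightarrow> ('o \<Rightarrow> 'o \<Rightarrow> ('g, 'k) tm) \<Rightarrow>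
    ('g, 'k) tm \<Rightarrow> ('g, 'k) tm \<Rightarrow> bool"
  for X T u v \<phi>0 \<phi>2 where
  fun_id: "x \<in> Ob X \<Longrightarrow> functor_rel X T u v \<phi>0 \<phi>2 (v (idt X x)) (IdT (u x))"
| fun_comp: "f \<in> hom X x y \<Longrightarrow> g \<in> hom X y z \<Longrightarrow>
    functor_rel X T u v \<phi>0 \<phi>2 (v (g \<cdot>\<^bsub>X\<^esub> f)) (CompT (v g) (v f))"
| fun_nat: "f \<in> hom X x x' \<Longrightarrow> g \<in> hom X y y' \<Longrightarrow>
    functor_rel X T u v \<phi>0 \<phi>2 (CompT (\<phi>2 x' y') (T (v f) (v g))) (CompT (v (f \<boxtimes>\<^bsub>X\<^esub> g)) (\<phi>2 x y))"
| fun_ass: "x \<in> Ob X \<Longrightarrow> y \<in> Ob X \<Longrightarrow> z \<in> Ob X \<Longrightarrow>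
    functor_rel X T u v \<phi>0 \<phi>2
      (CompT (v (ass X x y z)) (CompT (\<phi>2 x (y \<otimes>\<^bsub>X\<^esub> z)) (LeftT (u x) (\<phi>2 y z))))
      (CompT (\<phi>2 (x \<otimes>\<^bsub>X\<^esub> y) z) (CompT (RightT (\<phi>2 x y) (u z)) (AssT (u x) (u y) (u z))))"
| fun_runit: "x \<in> Ob X \<Longrightarrow>
    functor_rel X T u v \<phi>0 \<phi>2
      (CompT (v (runit X x)) (CompT (\<phi>2 x (unt X)) (LeftT (u x) \<phi>0))) (RunitT (u x))"
| fun_lunit: "x \<in> Ob X \<Longrightarrow>
    functor_rel X T u v \<phi>0 \<phi>2
      (CompT (v (lunit X x)) (CompT (\<phi>2 (unt X) x) (RightT \<phi>0 (u x)))) (LunitT (u x))"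
| fun_symm: "x \<in> Ob X \<Longrightarrow> y \<in> Ob X \<Longrightarrow>
    functor_rel X T u v \<phi>0 \<phi>2 (CompT (v (symm X x y)) (\<phi>2 x y)) (CompT (\<phi>2 y x) (SymmT (u x) (u y)))"

text \<open>The canonical \<open>(X \<otimes> Y) \<otimes> (Z \<otimes> W) \<rightarrow> (X \<otimes> Z) \<otimes> (Y \<otimes> W)\<close> as a term.\<close>

definition interchangeT :: "'g word \<Rightarrow> 'g word \<Rightarrow> 'g word \<Rightarrow> 'g word \<Rightarrow> ('g, 'k) tm" where
  "interchangeT X Y Z W =
     CompT (AssInvT (TensW X Z) Y W)
       (CompT (RightT (AssT X Z Y) W)
         (CompT (RightT (LeftT X (SymmT Y Z)) W)
           (CompT (RightT (AssInvT X Y Z) W)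
             (AssT (TensW X Y) Z W))))"

abbreviation tensG :: "('o, 'm) smc \<Rightarrow> ('p, 'n) smc \<Rightarrow> ('o \<times> 'p, ('o, 'm, 'p, 'n) tgen) tm \<Rightarrow>
    ('o \<times> 'p, ('o, 'm, 'p, 'n) tgen) tm \<Rightarrow> ('o \<times> 'p, ('o, 'm, 'p, 'n) tgen) tm" where
  "tensG A B \<equiv> tensT (tgen_dom A B) (tgen_cod A B)"

inductive tensor_rel :: "('o, 'm) smc \<Rightarrow> ('p, 'n) smc \<Rightarrow>
    ('o \<times> 'p, ('o, 'm, 'p, 'n) tgen) tm \<Rightarrow> ('o \<times> 'p, ('o, 'm, 'p, 'n) tgen) tm \<Rightarrow> bool"
  for A B where
  left_functor: "a \<in> Ob A \<Longrightarrow>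
    functor_rel B (tensG A B) (\<lambda>b. GenW (a, b)) (\<lambda>g. GenT (ObAr a g))
      (GenT (BetaG a)) (\<lambda>b b'. GenT (DeltaG a b b')) p q \<Longrightarrow> tensor_rel A B p q"
| right_functor: "b \<in> Ob B \<Longrightarrow>
    functor_rel A (tensG A B) (\<lambda>a. GenW (a, b)) (\<lambda>f. GenT (ArOb f b))
      (GenT (AlphaG b)) (\<lambda>a a'. GenT (GammaG a a' b)) p q \<Longrightarrow> tensor_rel A B p q"
| transf_nat: "f \<in> hom A a a' \<Longrightarrow> g \<in> hom B b b' \<Longrightarrow>
    tensor_rel A B (CompT (GenT (ArOb f b')) (GenT (ObAr a g))) (CompT (GenT (ObAr a' g)) (GenT (ArOb f b)))"
| left_transf_unit: "f \<in> hom A a a' \<Longrightarrow>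
    tensor_rel A B (CompT (GenT (ArOb f (unt B))) (GenT (BetaG a))) (GenT (BetaG a'))"
| left_transf_tens: "f \<in> hom A a a' \<Longrightarrow> b \<in> Ob B \<Longrightarrow> b' \<in> Ob B \<Longrightarrow>
    tensor_rel A B
      (CompT (GenT (ArOb f (b \<otimes>\<^bsub>B\<^esub> b'))) (GenT (DeltaG a b b')))
      (CompT (GenT (DeltaG a' b b')) (tensG A B (GenT (ArOb f b)) (GenT (ArOb f b'))))"
| right_transf_unit: "g \<in> hom B b b' \<Longrightarrow>
    tensor_rel A B (CompT (GenT (ObAr (unt A) g)) (GenT (AlphaG b))) (GenT (AlphaG b'))"
| right_transf_tens: "g \<in> hom B b b' \<Longrightarrow> a \<in> Ob A \<Longrightarrow> a' \<in> Ob A \<Longrightarrow>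
    tensor_rel A B
      (CompT (GenT (ObAr (a \<otimes>\<^bsub>A\<^esub> a') g)) (GenT (GammaG a a' b)))
      (CompT (GenT (GammaG a a' b')) (tensG A B (GenT (ObAr a g)) (GenT (ObAr a' g))))"
| alpha_tens: "b \<in> Ob B \<Longrightarrow> b' \<in> Ob B \<Longrightarrow>
    tensor_rel A B
      (CompT (GenT (AlphaG (b \<otimes>\<^bsub>B\<^esub> b'))) (RunitT UnitW))
      (CompT (GenT (DeltaG (unt A) b b')) (tensG A B (GenT (AlphaG b)) (GenT (AlphaG b'))))"
| beta_tens: "a \<in> Ob A \<Longrightarrow> a' \<in> Ob A \<Longrightarrow>
    tensor_rel A B
      (CompT (GenT (BetaG (a \<otimes>\<^bsub>A\<^esub> a'))) (RunitT UnitW))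
      (CompT (GenT (GammaG a a' (unt B))) (tensG A B (GenT (BetaG a)) (GenT (BetaG a'))))"
| beta_alpha: "tensor_rel A B (GenT (BetaG (unt A))) (GenT (AlphaG (unt B)))"
| gamma_delta: "a \<in> Ob A \<Longrightarrow> a' \<in> Ob A \<Longrightarrow> b \<in> Ob B \<Longrightarrow> b' \<in> Ob B \<Longrightarrow>
    tensor_rel A B
      (CompT (GenT (GammaG a a' (b \<otimes>\<^bsub>B\<^esub> b')))
        (tensG A B (GenT (DeltaG a b b')) (GenT (DeltaG a' b b'))))
      (CompT (GenT (DeltaG (a \<otimes>\<^bsub>A\<^esub> a') b b'))
        (CompT (tensG A B (GenT (GammaG a a' b)) (GenT (GammaG a a' b')))
          (interchangeT (GenW (a, b)) (GenW (a, b')) (GenW (a', b)) (GenW (a', b')))))"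

definition tensor_pres :: "('o, 'm) smc \<Rightarrow> ('p, 'n) smc \<Rightarrow>
    ('o \<times> 'p, ('o, 'm, 'p, 'n) tgen) presentation" where
  "tensor_pres A B = \<lparr>
     ogens = Ob A \<times> Ob B,
     agens = {AlphaG b |b. b \<in> Ob B} \<union> {BetaG a |a. a \<in> Ob A} \<union>
       {GammaG a a' b |a a' b. a \<in> Ob A \<and> a' \<in> Ob A \<and> b \<in> Ob B} \<union>
       {DeltaG a b b' |a b b'. a \<in> Ob A \<and> b \<in> Ob B \<and> b' \<in> Ob B} \<union>
       {ObAr a g |a g. a \<in> Ob A \<and> g \<in> Ar B} \<union> {ArOb f b |f b. f \<in> Ar A \<and> b \<in> Ob B},
     adom = tgen_dom A B,
     acod = tgen_cod A B,
     rels = tensor_rel A B\<rparr>"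

type_synonym ('o, 'p) tens_ob = "('o \<times> 'p) word"
type_synonym ('o, 'm, 'p, 'n) tens_ar = "('o \<times> 'p, ('o, 'm, 'p, 'n) tgen) tm set"

definition tensor :: "('o, 'm) smc \<Rightarrow> ('p, 'n) smc \<Rightarrow>
    (('o, 'p) tens_ob, ('o, 'm, 'p, 'n) tens_ar) smc" where
  "tensor A B = presented (tensor_pres A B)"

definition gen_arrow :: "('o, 'm) smc \<Rightarrow> ('p, 'n) smc \<Rightarrow> ('o, 'm, 'p, 'n) tgen \<Rightarrow>
    ('o, 'm, 'p, 'n) tens_ar" where
  "gen_arrow A B k = tm_class (tensor_pres A B) (GenT k)"

definition eta_ob :: "('o, 'm) smc \<Rightarrow> ('p, 'n) smc \<Rightarrow> 'o \<Rightarrow>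
    ('p, 'n, ('o, 'p) tens_ob, ('o, 'm, 'p, 'n) tens_ar) smf" where
  "eta_ob A B a = \<lparr>
     FO = (\<lambda>b\<in>Ob B. GenW (a, b)),
     FA = (\<lambda>g\<in>Ar B. gen_arrow A B (ObAr a g)),
     F0 = gen_arrow A B (BetaG a),
     F2 = (\<lambda>b\<in>Ob B. \<lambda>b'\<in>Ob B. gen_arrow A B (DeltaG a b b'))\<rparr>"

text \<open>\<open>\<eta> : A \<rightarrow> [B, A \<otimes> B]\<close>\<close>

definition eta :: "('o, 'm) smc \<Rightarrow> ('p, 'n) smc \<Rightarrow>
    ('o, 'm, ('p, 'n, ('o, 'p) tens_ob, ('o, 'm, 'p, 'n) tens_ar) smf,
     ('p, 'n, ('o, 'p) tens_ob, ('o, 'm, 'p, 'n) tens_ar) transf) smf" where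
  "eta A B = \<lparr>
     FO = (\<lambda>a\<in>Ob A. eta_ob A B a),
     FA = (\<lambda>f\<in>Ar A. (eta_ob A B (dm A f), eta_ob A B (cd A f), \<lambda>b\<in>Ob B. gen_arrow A B (ArOb f b))),
     F0 = (smf_const B (tensor A B), eta_ob A B (unt A), \<lambda>b\<in>Ob B. gen_arrow A B (AlphaG b)),
     F2 = (\<lambda>a\<in>Ob A. \<lambda>a'\<in>Ob A.
        (smf_box B (tensor A B) (eta_ob A B a) (eta_ob A B a'), eta_ob A B (a \<otimes>\<^bsub>A\<^esub> a'),
         \<lambda>b\<in>Ob B. gen_arrow A B (GammaG a a' b)))\<rparr>"


section \<open>The functors \<open>En\<close> and \<open>Rn\<close>\<close>

text \<open>\<open>En A B C F : A \<otimes> B \<rightarrow> C\<close> for \<open>F : A \<rightarrow> [B, C]\<close>.\<close>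

definition En :: "('o, 'm) smc \<Rightarrow> ('p, 'n) smc \<Rightarrow> ('q, 'k) smc \<Rightarrow>
    ('o, 'm, ('p, 'n, 'q, 'k) smf, ('p, 'n, 'q, 'k) transf) smf \<Rightarrow>
    (('o, 'p) tens_ob, ('o, 'm, 'p, 'n) tens_ar, 'q, 'k) smf" where
  "En A B C F = strict_ext (tensor_pres A B) C
     (\<lambda>(a, b). FO (FO F a) b)
     (\<lambda>k. case k of
        AlphaG b \<Rightarrow> comp_at (F0 F) b
      | BetaG a \<Rightarrow> F0 (FO F a)
      | GammaG a a' b \<Rightarrow> comp_at (F2 F a a') b
      | DeltaG a b b' \<Rightarrow> F2 (FO F a) b b'
      | ObAr a g \<Rightarrow> FA (FO F a) g
      | ArOb f b \<Rightarrow> comp_at (FA F f) b)"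

text \<open>\<open>Rn A B C F : A \<rightarrow> [B, C]\<close> for \<open>F : A \<otimes> B \<rightarrow> C\<close>.\<close>

definition Rn :: "('o, 'm) smc \<Rightarrow> ('p, 'n) smc \<Rightarrow> ('q, 'k) smc \<Rightarrow>
    (('o, 'p) tens_ob, ('o, 'm, 'p, 'n) tens_ar, 'q, 'k) smf \<Rightarrow>
    ('o, 'm, ('p, 'n, 'q, 'k) smf, ('p, 'n, 'q, 'k) transf) smf" where
  "Rn A B C F = smf_comp A (ihom B C) (post B (tensor A B) C F) (eta A B)"

primrec eps_comp :: "('q, 'k) smc \<Rightarrow> (('o, 'p) tens_ob, ('o, 'm, 'p, 'n) tens_ar, 'q, 'k) smf \<Rightarrow>
    ('o, 'p) tens_ob \<Rightarrow> 'k" where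
  "eps_comp C F UnitW = F0 F"
| "eps_comp C F (GenW ab) = idt C (FO F (GenW ab))"
| "eps_comp C F (TensW X Y) = F2 F X Y \<cdot>\<^bsub>C\<^esub> (eps_comp C F X \<boxtimes>\<^bsub>C\<^esub> eps_comp C F Y)"

text \<open>\<open>\<epsilon>\<^sub>F : En (Rn F) \<rightarrow> F\<close>, an arrow of \<open>[A \<otimes> B, C]\<close>.\<close>

definition eps :: "('o, 'm) smc \<Rightarrow> ('p, 'n) smc \<Rightarrow> ('q, 'k) smc \<Rightarrow>
    (('o, 'p) tens_ob, ('o, 'm, 'p, 'n) tens_ar, 'q, 'k) smf \<Rightarrow>
    (('o, 'p) tens_ob, ('o, 'm, 'p, 'n) tens_ar, 'q, 'k) transf" where
  "eps A B C F = (En A B C (Rn A B C F), F, \<lambda>X\<in>Ob (tensor A B). eps_comp C F X)"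

primrec En_comp :: "('q, 'k) smc \<Rightarrow> ('o, 'm, ('p, 'n, 'q, 'k) smf, ('p, 'n, 'q, 'k) transf) transf \<Rightarrow>
    ('o, 'p) tens_ob \<Rightarrow> 'k" where
  "En_comp C \<sigma> UnitW = idt C (unt C)"
| "En_comp C \<sigma> (GenW ab) = comp_at (comp_at \<sigma> (fst ab)) (snd ab)"
| "En_comp C \<sigma> (TensW X Y) = En_comp C \<sigma> X \<boxtimes>\<^bsub>C\<^esub> En_comp C \<sigma> Y"

text \<open>
  \<open>En\<close> as a symmetric monoidal functor \<open>[A, [B, C]] \<rightarrow> [A \<otimes> B, C]\<close>. Its structure arrows are well
  typed because \<open>Rn\<close> is strict and \<open>Rn (En F) = F\<close>.
\<close>

definition En_functor :: "('o, 'm) smc \<Rightarrow> ('p, 'n) smc \<Rightarrow> ('q, 'k) smc \<Rightarrow>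
    (('o, 'm, ('p, 'n, 'q, 'k) smf, ('p, 'n, 'q, 'k) transf) smf,
     ('o, 'm, ('p, 'n, 'q, 'k) smf, ('p, 'n, 'q, 'k) transf) transf,
     (('o, 'p) tens_ob, ('o, 'm, 'p, 'n) tens_ar, 'q, 'k) smf,
     (('o, 'p) tens_ob, ('o, 'm, 'p, 'n) tens_ar, 'q, 'k) transf) smf" where
  "En_functor A B C = \<lparr>
     FO = (\<lambda>F\<in>Ob (ihom A (ihom B C)). En A B C F),
     FA = (\<lambda>\<sigma>\<in>Ar (ihom A (ihom B C)).
        (En A B C (dm (ihom A (ihom B C)) \<sigma>), En A B C (cd (ihom A (ihom B C)) \<sigma>),
         \<lambda>X\<in>Ob (tensor A B). En_comp C \<sigma> X)),
     F0 = inverse_of (ihom (tensor A B) C) (eps A B C (unt (ihom (tensor A B) C))),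
     F2 = (\<lambda>F\<in>Ob (ihom A (ihom B C)). \<lambda>G\<in>Ob (ihom A (ihom B C)).
        inverse_of (ihom (tensor A B) C)
          (eps A B C (smf_box (tensor A B) C (En A B C F) (En A B C G))))\<rparr>"


section \<open>Tensor of functors, unit, and canonical functors\<close>

text \<open>\<open>F \<otimes> B : A \<otimes> B \<rightarrow> C \<otimes> B\<close> for \<open>F : A \<rightarrow> C\<close>, and \<open>A \<otimes> G : A \<otimes> B \<rightarrow> A \<otimes> D\<close> for \<open>G : B \<rightarrow> D\<close>.\<close>

definition tensor_left :: "('o, 'm) smc \<Rightarrow> ('q, 'k) smc \<Rightarrow> ('p, 'n) smc \<Rightarrow> ('o, 'm, 'q, 'k) smf \<Rightarrow>
    (('o, 'p) tens_ob, ('o, 'm, 'p, 'n) tens_ar, ('q, 'p) tens_ob, ('q, 'k, 'p, 'n) tens_ar) smf" where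
  "tensor_left A C B F = En A B (tensor C B) (smf_comp A (ihom B (tensor C B)) (eta C B) F)"

definition tensor_right :: "('o, 'm) smc \<Rightarrow> ('p, 'n) smc \<Rightarrow> ('r, 'l) smc \<Rightarrow> ('p, 'n, 'r, 'l) smf \<Rightarrow>
    (('o, 'p) tens_ob, ('o, 'm, 'p, 'n) tens_ar, ('o, 'r) tens_ob, ('o, 'm, 'r, 'l) tens_ar) smf" where
  "tensor_right A B D G = En A B (tensor A D)
     (smf_comp A (ihom B (tensor A D)) (pre B D (tensor A D) G) (eta A D))"

definition tensor_smf :: "('o, 'm) smc \<Rightarrow> ('q, 'k) smc \<Rightarrow> ('p, 'n) smc \<Rightarrow> ('r, 'l) smc \<Rightarrow>
    ('o, 'm, 'q, 'k) smf \<Rightarrow> ('p, 'n, 'r, 'l) smf \<Rightarrow>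
    (('o, 'p) tens_ob, ('o, 'm, 'p, 'n) tens_ar, ('q, 'r) tens_ob, ('q, 'k, 'r, 'l) tens_ar) smf" where
  "tensor_smf A C B D F G =
     smf_comp (tensor A B) (tensor C D) (tensor_left A C D F) (tensor_right A B D G)"

text \<open>The free symmetric monoidal category on one object; there are no arrow generators.\<close>

definition unit_pres :: "(unit, unit) presentation" where
  "unit_pres = \<lparr>ogens = UNIV, agens = {}, adom = (\<lambda>_. UnitW), acod = (\<lambda>_. UnitW), rels = (\<lambda>_ _. False)\<rparr>"

type_synonym unit_ob = "unit word"
type_synonym unit_ar = "(unit, unit) tm set"

definition unit_smc :: "(unit_ob, unit_ar) smc" where
  "unit_smc = presented unit_pres"

definition v_functor :: "('o, 'm) smc \<Rightarrow>
    (unit_ob, unit_ar, ('o, 'm, 'o, 'm) smf, ('o, 'm, 'o, 'm) transf) smf" where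
  "v_functor A = strict_ext unit_pres (ihom A A) (\<lambda>_. smf_id A) (\<lambda>_. undefined)"

definition S_functor :: "('o, 'm) smc \<Rightarrow> ('p, 'n) smc \<Rightarrow>
    (('o, 'p) tens_ob, ('o, 'm, 'p, 'n) tens_ar, ('p, 'o) tens_ob, ('p, 'n, 'o, 'm) tens_ar) smf" where
  "S_functor A B = En A B (tensor B A) (dual B A (tensor B A) (eta B A))"

definition A_functor :: "('o, 'm) smc \<Rightarrow> ('p, 'n) smc \<Rightarrow> ('q, 'k) smc \<Rightarrow>
    (('o, ('p, 'q) tens_ob) tens_ob, ('o, 'm, ('p, 'q) tens_ob, ('p, 'n, 'q, 'k) tens_ar) tens_ar,
     (('o, 'p) tens_ob, 'q) tens_ob, (('o, 'p) tens_ob, ('o, 'm, 'p, 'n) tens_ar, 'q, 'k) tens_ar) smf" where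
  "A_functor A B C =
     (let AB = tensor A B; ABC = tensor AB C in
      En A (tensor B C) ABC
        (smf_comp A (ihom (tensor B C) ABC)
          (En_functor B C ABC)
          (smf_comp A (ihom B (ihom C ABC))
            (post B AB (ihom C ABC) (eta AB C))
            (eta A B))))"

definition L_functor :: "('o, 'm) smc \<Rightarrow>
    ((unit_ob, 'o) tens_ob, (unit_ob, unit_ar, 'o, 'm) tens_ar, 'o, 'm) smf" where
  "L_functor A = En unit_smc A A (v_functor A)"

definition R_functor :: "('o, 'm) smc \<Rightarrow>
    (('o, unit_ob) tens_ob, ('o, 'm, unit_ob, unit_ar) tens_ar, 'o, 'm) smf" where
  "R_functor A = En A unit_smc A (dual unit_smc A A (v_functor A))"


section \<open>The quotient of SMC by its 2-cells\<close>

definition two_cells :: "('o, 'm) smc \<Rightarrow> ('p, 'n) smc \<Rightarrow>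
    (('o, 'm, 'p, 'n) smf \<times> ('o, 'm, 'p, 'n) smf) set" where
  "two_cells A B = {(F, G). \<exists>\<sigma>. monoidal_transformation A B F G \<sigma>}"

definition sim :: "('o, 'm) smc \<Rightarrow> ('p, 'n) smc \<Rightarrow>
    (('o, 'm, 'p, 'n) smf \<times> ('o, 'm, 'p, 'n) smf) set" where
  "sim A B = {(F, G). symmetric_monoidal_functor A B F \<and> symmetric_monoidal_functor A B G \<and>
     (F, G) \<in> (two_cells A B \<union> (two_cells A B)\<inverse>)\<^sup>*}"

text \<open>
  An arrow of the quotient: its source, its target, and a class of parallel functors. Operations on
  arrows are defined by uniting the classes obtained from all representatives, so that they produce
  a class exactly if the operation is compatible with \<open>sim\<close>.

  No HOL type contains all small symmetric monoidal categories, so the objects of the quotient are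
  the symmetric monoidal categories over arbitrary types and there is no record for the quotient
  itself: it is given by \<open>qhom\<close>, \<open>qid\<close> and \<open>\<odot>\<close>, polymorphic in these types.
\<close>

record ('o, 'm, 'p, 'n) qarrow =
  qdom :: "('o, 'm) smc"
  qcod :: "('p, 'n) smc"
  qcls :: "('o, 'm, 'p, 'n) smf set"

definition qclass :: "('o, 'm) smc \<Rightarrow> ('p, 'n) smc \<Rightarrow> ('o, 'm, 'p, 'n) smf \<Rightarrow>
    ('o, 'm, 'p, 'n) qarrow" where
  "qclass A B F = \<lparr>qdom = A, qcod = B, qcls = sim A B `` {F}\<rparr>"

definition qhom :: "('o, 'm) smc \<Rightarrow> ('p, 'n) smc \<Rightarrow> ('o, 'm, 'p, 'n) qarrow set" where
  "qhom A B = {qclass A B F |F. symmetric_monoidal_functor A B F}"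

definition qid :: "('o, 'm) smc \<Rightarrow> ('o, 'm, 'o, 'm) qarrow" where
  "qid A = qclass A A (smf_id A)"

definition qcomp :: "('p, 'n, 'q, 'k) qarrow \<Rightarrow> ('o, 'm, 'p, 'n) qarrow \<Rightarrow> ('o, 'm, 'q, 'k) qarrow"
    (infixr \<open>\<odot>\<close> 60) where
  "Q \<odot> P = \<lparr>qdom = qdom P, qcod = qcod Q,
     qcls = (\<Union>G\<in>qcls Q. \<Union>F\<in>qcls P. sim (qdom P) (qcod Q) `` {smf_comp (qdom P) (qcod Q) G F})\<rparr>"

definition qiso :: "('o, 'm, 'p, 'n) qarrow \<Rightarrow> bool" where
  "qiso P \<longleftrightarrow> (\<exists>Q\<in>qhom (qcod P) (qdom P). Q \<odot> P = qid (qdom P) \<and> P \<odot> Q = qid (qcod P))"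

definition qtensor :: "('o, 'm, 'q, 'k) qarrow \<Rightarrow> ('p, 'n, 'r, 'l) qarrow \<Rightarrow>
    (('o, 'p) tens_ob, ('o, 'm, 'p, 'n) tens_ar, ('q, 'r) tens_ob, ('q, 'k, 'r, 'l) tens_ar) qarrow"
    (infixr \<open>@@\<close> 65) where
  "P @@ Q = \<lparr>qdom = tensor (qdom P) (qdom Q), qcod = tensor (qcod P) (qcod Q),
     qcls = (\<Union>F\<in>qcls P. \<Union>G\<in>qcls Q.
        sim (tensor (qdom P) (qdom Q)) (tensor (qcod P) (qcod Q)) ``
          {tensor_smf (qdom P) (qcod P) (qdom Q) (qcod Q) F G})\<rparr>"

text \<open>The action of \<open>[B, -]\<close> on arrows of the quotient.\<close>

definition qihom :: "('o, 'm) smc \<Rightarrow> ('p, 'n, 'q, 'k) qarrow \<Rightarrow>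
    (('o, 'm, 'p, 'n) smf, ('o, 'm, 'p, 'n) transf, ('o, 'm, 'q, 'k) smf, ('o, 'm, 'q, 'k) transf) qarrow" where
  "qihom B P = \<lparr>qdom = ihom B (qdom P), qcod = ihom B (qcod P),
     qcls = (\<Union>F\<in>qcls P. sim (ihom B (qdom P)) (ihom B (qcod P)) `` {post B (qdom P) (qcod P) F})\<rparr>"

text \<open>Transposition: \<open>qRn A B\<close> takes arrows \<open>A \<otimes> B \<rightarrow> C\<close> to arrows \<open>A \<rightarrow> [B, C]\<close>.\<close>

definition qRn :: "('o, 'm) smc \<Rightarrow> ('p, 'n) smc \<Rightarrow>
    (('o, 'p) tens_ob, ('o, 'm, 'p, 'n) tens_ar, 'q, 'k) qarrow \<Rightarrow>
    ('o, 'm, ('p, 'n, 'q, 'k) smf, ('p, 'n, 'q, 'k) transf) qarrow" where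
  "qRn A B P = \<lparr>qdom = A, qcod = ihom B (qcod P),
     qcls = (\<Union>F\<in>qcls P. sim A (ihom B (qcod P)) `` {Rn A B (qcod P) F})\<rparr>"

definition qA where "qA A B C = qclass (tensor A (tensor B C)) (tensor (tensor A B) C) (A_functor A B C)"
definition qR where "qR A = qclass (tensor A unit_smc) A (R_functor A)"
definition qL where "qL A = qclass (tensor unit_smc A) A (L_functor A)"
definition qS where "qS A B = qclass (tensor A B) (tensor B A) (S_functor A B)"

end

theory Submission
  imports Defs
begin

text \<open>
  The tensor product represents functors of two variables: transposition \<open>Rn\<close> has a section \<open>En\<close>,
  and \<open>\<epsilon> : En (Rn F) \<rightarrow> F\<close> is a 2-cell, so modulo \<open>\<sim>\<close> transposition is bijective, and so is its internal
  version \<open>[A \<otimes> B, C] \<rightarrow> [A, [B, C]]\<close>. The naturality laws and the coherence diagrams can therefore be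
  checked after transposing away all tensors, where they become equations between functors into iterated
  internal homs built from \<open>\<eta>\<close>, duality, and pre- and postcomposition: the transpose of \<open>A\<close> is
  \<open>[B, \<eta>] \<circ> \<eta>\<close>, that of \<open>S\<close> is the dual \<open>\<eta>\<^sup>*\<close>, and a functor out of \<open>\<I>\<close> is determined up to \<open>\<sim>\<close> by
  its value at \<open>\<star>\<close>.
\<close>

text \<open>The functors are lax, so a functor out of \<open>A \<otimes> B\<close> is not determined
  by its values on generators, not even up to isomorphism: at the unit and at tensor words
  \<open>eps\<close> is built from \<open>F0\<close> and \<open>F2\<close>, which need not be
  invertible. Transposition is thus no equivalence of hom-categories and becomes bijective only once
  2-cells are collapsed. The internal version is forced by iterated tensors: a functor out of
  \<open>A \<otimes> (B \<otimes> C)\<close> transposes to one into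
  \<open>[B \<otimes> C, X]\<close>, and removing the second tensor means composing with a functor
  between internal homs. The structure arrows of \<open>En\<close> as such a functor are inverses of
  \<open>eps\<close>; they exist because they are taken at the unit and at tensors of strict
  functors, which are strong. Coherence is needed earlier: the pointwise tensor of lax functors
  contains an exchange of middle factors, and its axioms leave purely structural diagrams.\<close>

abbreviation SMC where "SMC \<equiv> symmetric_monoidal_category"
abbreviation SMF where "SMF \<equiv> symmetric_monoidal_functor"
abbreviation MT where "MT \<equiv> monoidal_transformation"

lemma hom_iff: "f \<in> hom C a b \<longleftrightarrow> f \<in> Ar C \<and> dm C f = a \<and> cd C f = b"
  by (auto simp: hom_def)

section \<open>Composition, identities and isomorphisms\<close>

context category begin

lemma Ob_dm [simp]: "f \<in> Ar C \<Longrightarrow> dm C f \<in> Ob C" by (rule dm_Ob)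
lemma Ob_cd [simp]: "f \<in> Ar C \<Longrightarrow> cd C f \<in> Ob C" by (rule cd_Ob)

lemma idt_Ar [simp]: "a \<in> Ob C \<Longrightarrow> idt C a \<in> Ar C"
  and dm_idt [simp]: "a \<in> Ob C \<Longrightarrow> dm C (idt C a) = a"
  and cd_idt [simp]: "a \<in> Ob C \<Longrightarrow> cd C (idt C a) = a"
  using idt_hom by (auto simp: hom_iff)

lemma cmp_typing:
  assumes "f \<in> Ar C" "g \<in> Ar C" "dm C g = cd C f"
  shows "g \<cdot> f \<in> hom C (dm C f) (cd C g)"
  using assms cmp_hom[of f "dm C f" "cd C f" g "cd C g"] by (auto simp: hom_iff)

lemma cmp_Ar [simp]: "f \<in> Ar C \<Longrightarrow> g \<in> Ar C \<Longrightarrow> dm C g = cd C f \<Longrightarrow> g \<cdot> f \<in> Ar C"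
  and dm_cmp [simp]: "f \<in> Ar C \<Longrightarrow> g \<in> Ar C \<Longrightarrow> dm C g = cd C f \<Longrightarrow> dm C (g \<cdot> f) = dm C f"
  and cd_cmp [simp]: "f \<in> Ar C \<Longrightarrow> g \<in> Ar C \<Longrightarrow> dm C g = cd C f \<Longrightarrow> cd C (g \<cdot> f) = cd C g"
  using cmp_typing by (auto simp: hom_iff)

lemma idt_r [simp]: "f \<in> Ar C \<Longrightarrow> dm C f = a \<Longrightarrow> f \<cdot> idt C a = f"
  using idt_right by (auto simp: hom_iff)
lemma idt_l [simp]: "f \<in> Ar C \<Longrightarrow> cd C f = a \<Longrightarrow> idt C a \<cdot> f = f"
  using idt_left by (auto simp: hom_iff)

lemma assoc [simp]:
  "f \<in> Ar C \<Longrightarrow> g \<in> Ar C \<Longrightarrow> h \<in> Ar C \<Longrightarrow> dm C g = cd C f \<Longrightarrow> dm C h = cd C g \<Longrightarrow>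
   (h \<cdot> g) \<cdot> f = h \<cdot> (g \<cdot> f)"
  using cmp_assoc[of f "dm C f" "cd C f" g "cd C g" h "cd C h"] by (auto simp: hom_iff)

text \<open>Composites are kept associated to the right, so an equation for
  \<open>g \<cdot> f\<close> does not match inside a longer composite. This rule supplies the
  version with a further arrow \<open>k\<close> on the right; it is applied throughout to naturality
  and coherence laws.\<close>

lemma cmp_eq_extend:
  assumes "g \<cdot> f = h" "f \<in> Ar C" "g \<in> Ar C" "dm C g = cd C f" "k \<in> Ar C" "dm C f = cd C k"
  shows "g \<cdot> (f \<cdot> k) = h \<cdot> k"
  using assms assoc by metis

lemma is_invI:
  "f \<in> Ar C \<Longrightarrow> g \<in> Ar C \<Longrightarrow> dm C g = cd C f \<Longrightarrow> cd C g = dm C f \<Longrightarrow>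
   g \<cdot> f = idt C (dm C f) \<Longrightarrow> f \<cdot> g = idt C (cd C f) \<Longrightarrow> is_inv C f g"
  by (auto simp: is_inv_def hom_iff)

lemma is_inv_unique:
  assumes "is_inv C f g" "is_inv C f h" shows "g = h"
proof -
  have t: "f \<in> Ar C" "g \<in> Ar C" "h \<in> Ar C" "dm C g = cd C f" "cd C g = dm C f" "dm C h = cd C f" "cd C h = dm C f"
    using assms by (auto simp: is_inv_def hom_iff)
  have "g = g \<cdot> (f \<cdot> h)" using assms(2) t by (simp add: is_inv_def)
  also have "\<dots> = (g \<cdot> f) \<cdot> h" using t by simp
  also have "\<dots> = h" using assms(1) t by (simp add: is_inv_def)
  finally show ?thesis .
qed

lemma inverse_of_eq: "is_inv C f g \<Longrightarrow> inverse_of C f = g"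
  unfolding inverse_of_def using is_inv_unique by blast

lemma is_inv_inverse: "iso C f \<Longrightarrow> is_inv C f (inverse_of C f)"
  using inverse_of_eq unfolding iso_def by metis

lemma is_inv_sym: "is_inv C f g \<Longrightarrow> is_inv C g f"
  by (auto simp: is_inv_def hom_iff)

lemma iso_Ar: "iso C f \<Longrightarrow> f \<in> Ar C"
  by (auto simp: iso_def is_inv_def)

lemma inverse_Ar [simp]: "iso C f \<Longrightarrow> inverse_of C f \<in> Ar C"
  and dm_inverse [simp]: "iso C f \<Longrightarrow> dm C (inverse_of C f) = cd C f"
  and cd_inverse [simp]: "iso C f \<Longrightarrow> cd C (inverse_of C f) = dm C f"
  and inverse_cmp [simp]: "iso C f \<Longrightarrow> inverse_of C f \<cdot> f = idt C (dm C f)"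
  and cmp_inverse [simp]: "iso C f \<Longrightarrow> f \<cdot> inverse_of C f = idt C (cd C f)"
  using is_inv_inverse[of f] by (auto simp: is_inv_def hom_iff)

lemma iso_inverse [simp]: "iso C f \<Longrightarrow> iso C (inverse_of C f)"
  using is_inv_inverse is_inv_sym by (auto simp: iso_def)

lemma inverse_cmp_cancel [simp]:
  "iso C f \<Longrightarrow> h \<in> Ar C \<Longrightarrow> cd C h = dm C f \<Longrightarrow> inverse_of C f \<cdot> (f \<cdot> h) = h"
  by (simp add: iso_Ar assoc[symmetric] del: assoc)
lemma cmp_inverse_cancel [simp]:
  "iso C f \<Longrightarrow> h \<in> Ar C \<Longrightarrow> cd C h = cd C f \<Longrightarrow> f \<cdot> (inverse_of C f \<cdot> h) = h"
  by (simp add: iso_Ar assoc[symmetric] del: assoc)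

lemma iso_idt [simp]: "a \<in> Ob C \<Longrightarrow> iso C (idt C a)"
  unfolding iso_def by (rule exI[of _ "idt C a"], rule is_invI) auto

lemma inverse_idt [simp]: "a \<in> Ob C \<Longrightarrow> inverse_of C (idt C a) = idt C a"
  by (rule inverse_of_eq, rule is_invI) auto

lemma is_inv_cmp:
  assumes "iso C f" "iso C g" "dm C g = cd C f"
  shows "is_inv C (g \<cdot> f) (inverse_of C f \<cdot> inverse_of C g)"
  using assms by (intro is_invI) (auto simp: iso_Ar)

lemma iso_cmp [simp]: "iso C f \<Longrightarrow> iso C g \<Longrightarrow> dm C g = cd C f \<Longrightarrow> iso C (g \<cdot> f)"
  using is_inv_cmp by (auto simp: iso_def)

lemma iso_cancel_left:
  assumes "f \<cdot> g = f \<cdot> h" "iso C f" "g \<in> Ar C" "h \<in> Ar C" "cd C g = dm C f" "cd C h = dm C f"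
  shows "g = h"
  using assms inverse_cmp_cancel by metis

lemma iso_cancel_right:
  assumes "g \<cdot> f = h \<cdot> f" "iso C f" "g \<in> Ar C" "h \<in> Ar C" "dm C g = cd C f" "dm C h = cd C f"
  shows "g = h"
proof -
  have "(g \<cdot> f) \<cdot> inverse_of C f = (h \<cdot> f) \<cdot> inverse_of C f" using assms by simp
  then show ?thesis using assms(2-) by (simp add: iso_Ar)
qed

end

section \<open>Typing and naturality in a symmetric monoidal category\<close>

context symmetric_monoidal_category begin

lemma Ob_tens [simp]: "a \<in> Ob C \<Longrightarrow> b \<in> Ob C \<Longrightarrow> a \<otimes> b \<in> Ob C" by (rule tensO_Ob)
lemma Ob_unt [simp]: "unt C \<in> Ob C" by (rule unt_Ob)

lemma tens_Ar [simp]: "f \<in> Ar C \<Longrightarrow> g \<in> Ar C \<Longrightarrow> f \<boxtimes> g \<in> Ar C"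
  and dm_tens [simp]: "f \<in> Ar C \<Longrightarrow> g \<in> Ar C \<Longrightarrow> dm C (f \<boxtimes> g) = dm C f \<otimes> dm C g"
  and cd_tens [simp]: "f \<in> Ar C \<Longrightarrow> g \<in> Ar C \<Longrightarrow> cd C (f \<boxtimes> g) = cd C f \<otimes> cd C g"
  using tensA_hom[of f "dm C f" "cd C f" g "dm C g" "cd C g"] by (auto simp: hom_iff)

lemma tens_idt [simp]: "a \<in> Ob C \<Longrightarrow> b \<in> Ob C \<Longrightarrow> idt C a \<boxtimes> idt C b = idt C (a \<otimes> b)"
  by (rule tensA_idt)

lemma tens_cmp:
  "f \<in> Ar C \<Longrightarrow> g \<in> Ar C \<Longrightarrow> f' \<in> Ar C \<Longrightarrow> g' \<in> Ar C \<Longrightarrow> dm C f' = cd C f \<Longrightarrow> dm C g' = cd C g \<Longrightarrow>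
   (f' \<boxtimes> g') \<cdot> (f \<boxtimes> g) = (f' \<cdot> f) \<boxtimes> (g' \<cdot> g)"
  using tensA_cmp[of f "dm C f" "cd C f" f' "cd C f'" g "dm C g" "cd C g" g' "cd C g'"]
  by (auto simp: hom_iff)

lemma tens_cmp_extend:
  "f \<in> Ar C \<Longrightarrow> g \<in> Ar C \<Longrightarrow> f' \<in> Ar C \<Longrightarrow> g' \<in> Ar C \<Longrightarrow> dm C f' = cd C f \<Longrightarrow> dm C g' = cd C g \<Longrightarrow>
   h \<in> Ar C \<Longrightarrow> cd C h = dm C f \<otimes> dm C g \<Longrightarrow>
   (f' \<boxtimes> g') \<cdot> ((f \<boxtimes> g) \<cdot> h) = ((f' \<cdot> f) \<boxtimes> (g' \<cdot> g)) \<cdot> h"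
  by (rule cmp_eq_extend[OF tens_cmp]) auto

lemmas tens_simps = tens_cmp tens_cmp_extend

lemma is_inv_tens:
  assumes "iso C f" "iso C g"
  shows "is_inv C (f \<boxtimes> g) (inverse_of C f \<boxtimes> inverse_of C g)"
  using assms by (intro is_invI) (auto simp: iso_Ar tens_cmp)

lemma iso_tens [simp]: "iso C f \<Longrightarrow> iso C g \<Longrightarrow> iso C (f \<boxtimes> g)"
  using is_inv_tens by (auto simp: iso_def)

lemma ass_Ar [simp]: "a \<in> Ob C \<Longrightarrow> b \<in> Ob C \<Longrightarrow> c \<in> Ob C \<Longrightarrow> ass C a b c \<in> Ar C"
  and dm_ass [simp]: "a \<in> Ob C \<Longrightarrow> b \<in> Ob C \<Longrightarrow> c \<in> Ob C \<Longrightarrow> dm C (ass C a b c) = a \<otimes> (b \<otimes> c)"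
  and cd_ass [simp]: "a \<in> Ob C \<Longrightarrow> b \<in> Ob C \<Longrightarrow> c \<in> Ob C \<Longrightarrow> cd C (ass C a b c) = (a \<otimes> b) \<otimes> c"
  using ass_hom[of a b c] by (auto simp: hom_iff)

lemma runit_Ar [simp]: "a \<in> Ob C \<Longrightarrow> runit C a \<in> Ar C"
  and dm_runit [simp]: "a \<in> Ob C \<Longrightarrow> dm C (runit C a) = a \<otimes> unt C"
  and cd_runit [simp]: "a \<in> Ob C \<Longrightarrow> cd C (runit C a) = a"
  using runit_hom[of a] by (auto simp: hom_iff)

lemma lunit_Ar [simp]: "a \<in> Ob C \<Longrightarrow> lunit C a \<in> Ar C"
  and dm_lunit [simp]: "a \<in> Ob C \<Longrightarrow> dm C (lunit C a) = unt C \<otimes> a"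
  and cd_lunit [simp]: "a \<in> Ob C \<Longrightarrow> cd C (lunit C a) = a"
  using lunit_hom[of a] by (auto simp: hom_iff)

lemma symm_Ar [simp]: "a \<in> Ob C \<Longrightarrow> b \<in> Ob C \<Longrightarrow> symm C a b \<in> Ar C"
  and dm_symm [simp]: "a \<in> Ob C \<Longrightarrow> b \<in> Ob C \<Longrightarrow> dm C (symm C a b) = a \<otimes> b"
  and cd_symm [simp]: "a \<in> Ob C \<Longrightarrow> b \<in> Ob C \<Longrightarrow> cd C (symm C a b) = b \<otimes> a"
  using symm_hom[of a b] by (auto simp: hom_iff)

declare ass_iso [simp] runit_iso [simp] lunit_iso [simp] symm_symm [simp]

lemma is_inv_symm: "a \<in> Ob C \<Longrightarrow> b \<in> Ob C \<Longrightarrow> is_inv C (symm C a b) (symm C b a)"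
  by (rule is_invI) auto

lemma iso_symm [simp]: "a \<in> Ob C \<Longrightarrow> b \<in> Ob C \<Longrightarrow> iso C (symm C a b)"
  using is_inv_symm by (auto simp: iso_def)

lemma ass_natural:
  "f \<in> Ar C \<Longrightarrow> g \<in> Ar C \<Longrightarrow> h \<in> Ar C \<Longrightarrow> cd C f = a \<Longrightarrow> cd C g = b \<Longrightarrow> cd C h = c \<Longrightarrow>
   ass C a b c \<cdot> (f \<boxtimes> (g \<boxtimes> h)) = ((f \<boxtimes> g) \<boxtimes> h) \<cdot> ass C (dm C f) (dm C g) (dm C h)"
  using ass_nat[of f "dm C f" a g "dm C g" b h "dm C h" c] by (auto simp: hom_iff)

lemma ass_natural_extend:
  "f \<in> Ar C \<Longrightarrow> g \<in> Ar C \<Longrightarrow> h \<in> Ar C \<Longrightarrow> cd C f = a \<Longrightarrow> cd C g = b \<Longrightarrow> cd C h = c \<Longrightarrow>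
   k \<in> Ar C \<Longrightarrow> cd C k = dm C f \<otimes> dm C g \<otimes> dm C h \<Longrightarrow>
   ass C a b c \<cdot> ((f \<boxtimes> (g \<boxtimes> h)) \<cdot> k) = ((f \<boxtimes> g) \<boxtimes> h) \<cdot> (ass C (dm C f) (dm C g) (dm C h) \<cdot> k)"
  by (subst cmp_eq_extend[OF ass_natural]) auto

lemma runit_natural:
  "f \<in> Ar C \<Longrightarrow> cd C f = a \<Longrightarrow> runit C a \<cdot> (f \<boxtimes> idt C (unt C)) = f \<cdot> runit C (dm C f)"
  using runit_nat[of f "dm C f" a] by (auto simp: hom_iff)
lemma lunit_natural:
  "f \<in> Ar C \<Longrightarrow> cd C f = a \<Longrightarrow> lunit C a \<cdot> (idt C (unt C) \<boxtimes> f) = f \<cdot> lunit C (dm C f)"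
  using lunit_nat[of f "dm C f" a] by (auto simp: hom_iff)
lemma symm_natural:
  "f \<in> Ar C \<Longrightarrow> g \<in> Ar C \<Longrightarrow> cd C f = a \<Longrightarrow> cd C g = b \<Longrightarrow>
   symm C a b \<cdot> (f \<boxtimes> g) = (g \<boxtimes> f) \<cdot> symm C (dm C f) (dm C g)"
  using symm_nat[of f "dm C f" a g "dm C g" b] by (auto simp: hom_iff)
lemma symm_natural_extend:
  "f \<in> Ar C \<Longrightarrow> g \<in> Ar C \<Longrightarrow> cd C f = a \<Longrightarrow> cd C g = b \<Longrightarrow> k \<in> Ar C \<Longrightarrow> cd C k = dm C f \<otimes> dm C g \<Longrightarrow>
   symm C a b \<cdot> ((f \<boxtimes> g) \<cdot> k) = (g \<boxtimes> f) \<cdot> (symm C (dm C f) (dm C g) \<cdot> k)"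
  by (subst cmp_eq_extend[OF symm_natural]) auto

text \<open>Tensoring with the unit is naturally isomorphic, via \<open>lunit\<close>, to the
  identity functor, hence faithful. Unit coherences can therefore be proved by Kelly's method:
  tensor the equation with the unit, where pentagon and triangle can act, then remove the unit
  again.\<close>

lemma unt_tens_faithful:
  assumes "idt C (unt C) \<boxtimes> f = idt C (unt C) \<boxtimes> g" "f \<in> Ar C" "g \<in> Ar C"
    "dm C f = dm C g" "cd C f = cd C g"
  shows "f = g"
proof -
  have "f \<cdot> lunit C (dm C f) = g \<cdot> lunit C (dm C f)"
    using assms lunit_natural[of f] lunit_natural[of g] by simp
  then show ?thesis by (rule iso_cancel_right) (use assms in auto)
qed

lemma tens_unt_faithful:
  assumes "f \<boxtimes> idt C (unt C) = g \<boxtimes> idt C (unt C)" "f \<in> Ar C" "g \<in> Ar C"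
    "dm C f = dm C g" "cd C f = cd C g"
  shows "f = g"
proof -
  have "f \<cdot> runit C (dm C f) = g \<cdot> runit C (dm C f)"
    using assms runit_natural[of f] runit_natural[of g] by simp
  then show ?thesis by (rule iso_cancel_right) (use assms in auto)
qed

lemma pentagon_extend:
  assumes "a \<in> Ob C" "b \<in> Ob C" "c \<in> Ob C" "d \<in> Ob C" "k \<in> Ar C" "cd C k = a \<otimes> b \<otimes> c \<otimes> d"
  shows "ass C (a \<otimes> b) c d \<cdot> ass C a b (c \<otimes> d) \<cdot> k =
          (ass C a b c \<boxtimes> idt C d) \<cdot> ass C a (b \<otimes> c) d \<cdot> (idt C a \<boxtimes> ass C b c d) \<cdot> k"
  using assms by (subst cmp_eq_extend[OF pentagon]) auto

text \<open>The axioms contain only the triangle with the unit in the middle. This one comes from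
  the pentagon on \<open>unt C\<close>, \<open>unt C\<close>, \<open>a\<close>, \<open>b\<close>,
  two of whose edges are rewritten by that triangle.\<close>

lemma lunit_tens:
  assumes [simp]: "a \<in> Ob C" "b \<in> Ob C"
  shows "(lunit C a \<boxtimes> idt C b) \<cdot> ass C (unt C) a b = lunit C (a \<otimes> b)"
proof (rule unt_tens_faithful)
  let ?i = "idt C (unt C)"
  have "ass C (unt C) a b \<cdot> (?i \<boxtimes> ((lunit C a \<boxtimes> idt C b) \<cdot> ass C (unt C) a b)) =
    ass C (unt C) a b \<cdot> (?i \<boxtimes> (lunit C a \<boxtimes> idt C b)) \<cdot> (?i \<boxtimes> ass C (unt C) a b)"
    by (simp add: tens_simps)
  also have "\<dots> = ((?i \<boxtimes> lunit C a) \<boxtimes> idt C b) \<cdot> ass C (unt C) (unt C \<otimes> a) b \<cdot> (?i \<boxtimes> ass C (unt C) a b)"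
    by (simp add: ass_natural_extend)
  also have "\<dots> = ((runit C (unt C) \<boxtimes> idt C a) \<boxtimes> idt C b) \<cdot> (ass C (unt C) (unt C) a \<boxtimes> idt C b) \<cdot>
      ass C (unt C) (unt C \<otimes> a) b \<cdot> (?i \<boxtimes> ass C (unt C) a b)"
    by (simp add: tens_simps triangle[symmetric])
  also have "\<dots> = ((runit C (unt C) \<boxtimes> idt C a) \<boxtimes> idt C b) \<cdot> ass C (unt C \<otimes> unt C) a b \<cdot> ass C (unt C) (unt C) (a \<otimes> b)"
    by (simp add: pentagon)
  also have "\<dots> = ass C (unt C) a b \<cdot> (runit C (unt C) \<boxtimes> idt C (a \<otimes> b)) \<cdot> ass C (unt C) (unt C) (a \<otimes> b)"
    using ass_natural_extend[of "runit C (unt C)" "idt C a" "idt C b" "unt C" a b "ass C (unt C) (unt C) (a \<otimes> b)"]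
    by simp
  also have "\<dots> = ass C (unt C) a b \<cdot> (?i \<boxtimes> lunit C (a \<otimes> b))"
    by (simp add: triangle)
  finally show "?i \<boxtimes> ((lunit C a \<boxtimes> idt C b) \<cdot> ass C (unt C) a b) = ?i \<boxtimes> lunit C (a \<otimes> b)"
    by (rule iso_cancel_left) auto
qed auto

text \<open>Mirror image of \<open>lunit_tens\<close>, from the pentagon on \<open>a\<close>,
  \<open>b\<close> and two units.\<close>

lemma runit_tens:
  assumes [simp]: "a \<in> Ob C" "b \<in> Ob C"
  shows "runit C (a \<otimes> b) \<cdot> ass C a b (unt C) = idt C a \<boxtimes> runit C b"
proof (rule tens_unt_faithful)
  let ?I = "unt C"
  let ?i = "idt C ?I"
  let ?e = "ass C a (b \<otimes> ?I) ?I \<cdot> (idt C a \<boxtimes> ass C b ?I ?I)"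
  have "((runit C (a \<otimes> b) \<cdot> ass C a b ?I) \<boxtimes> ?i) \<cdot> ?e =
     (runit C (a \<otimes> b) \<boxtimes> ?i) \<cdot> (ass C a b ?I \<boxtimes> ?i) \<cdot> ?e"
    by (simp add: tens_cmp_extend)
  also have "\<dots> = (runit C (a \<otimes> b) \<boxtimes> ?i) \<cdot> ass C (a \<otimes> b) ?I ?I \<cdot> ass C a b (?I \<otimes> ?I)"
    by (simp add: pentagon)
  also have "\<dots> = (idt C (a \<otimes> b) \<boxtimes> lunit C ?I) \<cdot> ass C a b (?I \<otimes> ?I)"
    using cmp_eq_extend[OF triangle[of "a \<otimes> b" ?I]] by simp
  also have "\<dots> = ass C a b ?I \<cdot> (idt C a \<boxtimes> (idt C b \<boxtimes> lunit C ?I))"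
    by (simp add: ass_natural)
  also have "\<dots> = ass C a b ?I \<cdot> (idt C a \<boxtimes> (runit C b \<boxtimes> ?i)) \<cdot> (idt C a \<boxtimes> ass C b ?I ?I)"
    by (simp add: tens_cmp triangle)
  also have "\<dots> = ((idt C a \<boxtimes> runit C b) \<boxtimes> ?i) \<cdot> ?e"
    by (simp add: ass_natural_extend)
  finally show "(runit C (a \<otimes> b) \<cdot> ass C a b ?I) \<boxtimes> ?i = (idt C a \<boxtimes> runit C b) \<boxtimes> ?i"
    by (rule iso_cancel_right) auto
qed auto

text \<open>Naturality of \<open>lunit\<close> at the arrow \<open>lunit C (unt C)\<close> itself
  determines \<open>lunit\<close> at \<open>unt C \<otimes> unt C\<close>; comparing
  \<open>lunit_tens\<close> with the triangle then equates the two unit arrows after tensoring with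
  the unit.\<close>

lemma lunit_unt: "lunit C (unt C) = runit C (unt C)"
proof (rule tens_unt_faithful)
  let ?I = "unt C"
  let ?i = "idt C ?I"
  have "lunit C ?I \<cdot> (?i \<boxtimes> lunit C ?I) = lunit C ?I \<cdot> lunit C (?I \<otimes> ?I)"
    by (simp add: lunit_natural)
  then have "?i \<boxtimes> lunit C ?I = lunit C (?I \<otimes> ?I)"
    by (rule iso_cancel_left) auto
  then have "(lunit C ?I \<boxtimes> ?i) \<cdot> ass C ?I ?I ?I = (runit C ?I \<boxtimes> ?i) \<cdot> ass C ?I ?I ?I"
    by (simp add: lunit_tens triangle)
  then show "lunit C ?I \<boxtimes> ?i = runit C ?I \<boxtimes> ?i"
    by (rule iso_cancel_right) auto
qed auto

lemma runit_symm: "a \<in> Ob C \<Longrightarrow> runit C a \<cdot> symm C (unt C) a = lunit C a"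
  by (simp add: symm_unit[symmetric])

text \<open>The elementary move of sorting: the factor \<open>y\<close> passes in front of
  \<open>a\<close> while the tail \<open>b\<close> stays. With \<open>a\<close> the product of a
  whole list, it extracts the head of the second list of a merge.\<close>

definition swap :: "'o \<Rightarrow> 'o \<Rightarrow> 'o \<Rightarrow> 'm" where
  "swap a y b = inverse_of C (ass C y a b) \<cdot> (symm C a y \<boxtimes> idt C b) \<cdot> ass C a y b"

lemma swap_Ar [simp]: "a \<in> Ob C \<Longrightarrow> b \<in> Ob C \<Longrightarrow> c \<in> Ob C \<Longrightarrow> swap a b c \<in> Ar C"
  and dm_swap [simp]: "a \<in> Ob C \<Longrightarrow> b \<in> Ob C \<Longrightarrow> c \<in> Ob C \<Longrightarrow> dm C (swap a b c) = a \<otimes> (b \<otimes> c)"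
  and cd_swap [simp]: "a \<in> Ob C \<Longrightarrow> b \<in> Ob C \<Longrightarrow> c \<in> Ob C \<Longrightarrow> cd C (swap a b c) = b \<otimes> (a \<otimes> c)"
  and iso_swap [simp]: "a \<in> Ob C \<Longrightarrow> b \<in> Ob C \<Longrightarrow> c \<in> Ob C \<Longrightarrow> iso C (swap a b c)"
  by (auto simp: swap_def)

lemma ass_swap:
  "a \<in> Ob C \<Longrightarrow> b \<in> Ob C \<Longrightarrow> c \<in> Ob C \<Longrightarrow> ass C b a c \<cdot> swap a b c = (symm C a b \<boxtimes> idt C c) \<cdot> ass C a b c"
  by (simp add: swap_def)

lemma ass_inverse_natural:
  assumes "f \<in> Ar C" "g \<in> Ar C" "h \<in> Ar C" "cd C f = a" "cd C g = b" "cd C h = c"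
  shows "inverse_of C (ass C a b c) \<cdot> ((f \<boxtimes> g) \<boxtimes> h) =
    (f \<boxtimes> (g \<boxtimes> h)) \<cdot> inverse_of C (ass C (dm C f) (dm C g) (dm C h))"
proof -
  have [simp]: "a \<in> Ob C" "b \<in> Ob C" "c \<in> Ob C" using assms by auto
  have "(f \<boxtimes> (g \<boxtimes> h)) \<cdot> inverse_of C (ass C (dm C f) (dm C g) (dm C h)) = 
    inverse_of C (ass C a b c) \<cdot> ((ass C a b c \<cdot> (f \<boxtimes> (g \<boxtimes> h))) \<cdot> inverse_of C (ass C (dm C f) (dm C g) (dm C h)))"
    using assms by simp
  also have "\<dots> = inverse_of C (ass C a b c) \<cdot> ((f \<boxtimes> g) \<boxtimes> h)"
    using assms by (subst ass_natural) simp_all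
  finally show ?thesis by simp
qed

lemma swap_natural:
  assumes "f \<in> Ar C" "g \<in> Ar C" "h \<in> Ar C" "cd C f = a" "cd C g = b" "cd C h = c"
  shows "swap a b c \<cdot> (f \<boxtimes> (g \<boxtimes> h)) = (g \<boxtimes> (f \<boxtimes> h)) \<cdot> swap (dm C f) (dm C g) (dm C h)"
proof (rule iso_cancel_left[of "ass C b a c"])
  have [simp]: "a \<in> Ob C" "b \<in> Ob C" "c \<in> Ob C" using assms by auto
  have "ass C b a c \<cdot> swap a b c \<cdot> (f \<boxtimes> (g \<boxtimes> h)) =
     (symm C a b \<boxtimes> idt C c) \<cdot> ass C a b c \<cdot> (f \<boxtimes> (g \<boxtimes> h))"
    using cmp_eq_extend[OF ass_swap] assms by simp
  also have "\<dots> = ((symm C a b \<cdot> (f \<boxtimes> g)) \<boxtimes> h) \<cdot> ass C (dm C f) (dm C g) (dm C h)"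
    using assms by (simp add: ass_natural tens_simps)
  also have "\<dots> = ((g \<boxtimes> f) \<boxtimes> h) \<cdot> ((symm C (dm C f) (dm C g) \<boxtimes> idt C (dm C h)) \<cdot> ass C (dm C f) (dm C g) (dm C h))"
    using assms by (simp add: symm_natural tens_simps)
  also have "\<dots> = ((g \<boxtimes> f) \<boxtimes> h) \<cdot> (ass C (dm C g) (dm C f) (dm C h) \<cdot> swap (dm C f) (dm C g) (dm C h))"
    using assms by (simp add: ass_swap)
  also have "\<dots> = ass C b a c \<cdot> (g \<boxtimes> (f \<boxtimes> h)) \<cdot> swap (dm C f) (dm C g) (dm C h)"
    using assms by (simp add: ass_natural_extend)
  finally show "ass C b a c \<cdot> swap a b c \<cdot> (f \<boxtimes> (g \<boxtimes> h)) = ass C b a c \<cdot> (g \<boxtimes> (f \<boxtimes> h)) \<cdot> swap (dm C f) (dm C g) (dm C h)" .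
qed (use assms in auto)

end

section \<open>Compatibility of the exchange of adjacent factors with associativity and
  symmetry\<close>

context symmetric_monoidal_category begin

text \<open>This, \<open>swap_ass_middle\<close> and \<open>swap_ass_right\<close> are one statement
  in three cases: extracting a head from a product of three lists is compatible with reassociation,
  for a head in the first, second or third list.\<close>

lemma ass_inverse_pentagon:
  assumes [simp]: "a \<in> Ob C" "b \<in> Ob C" "c \<in> Ob C" "d \<in> Ob C"
  shows "inverse_of C (ass C a (b \<otimes> c) d) \<cdot> (inverse_of C (ass C a b c) \<boxtimes> idt C d) \<cdot> ass C (a \<otimes> b) c d =
    (idt C a \<boxtimes> ass C b c d) \<cdot> inverse_of C (ass C a b (c \<otimes> d))" (is "?l = ?r")
proof (rule iso_cancel_left[of "(ass C a b c \<boxtimes> idt C d) \<cdot> ass C a (b \<otimes> c) d"])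
  show "((ass C a b c \<boxtimes> idt C d) \<cdot> ass C a (b \<otimes> c) d) \<cdot> ?l = ((ass C a b c \<boxtimes> idt C d) \<cdot> ass C a (b \<otimes> c) d) \<cdot> ?r"
    by (simp add: tens_simps pentagon_extend[symmetric])
qed auto

lemma swap_ass_middle:
  assumes [simp]: "x \<in> Ob C" "y \<in> Ob C" "b \<in> Ob C" "c \<in> Ob C"
  shows "inverse_of C (ass C y (x \<otimes> b) c) \<cdot> (swap x y b \<boxtimes> idt C c) \<cdot> ass C x (y \<otimes> b) c =
    (idt C y \<boxtimes> ass C x b c) \<cdot> swap x y (b \<otimes> c) \<cdot> (idt C x \<boxtimes> inverse_of C (ass C y b c))" (is "?l = ?r")
proof (rule iso_cancel_left[of "(ass C y x b \<boxtimes> idt C c) \<cdot> ass C y (x \<otimes> b) c"])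
  let ?e = "(ass C y x b \<boxtimes> idt C c) \<cdot> ass C y (x \<otimes> b) c"
  let ?j = "idt C x \<boxtimes> inverse_of C (ass C y b c)"
  have "?e \<cdot> ?l = (((symm C x y \<boxtimes> idt C b) \<cdot> ass C x y b) \<boxtimes> idt C c) \<cdot> ass C x (y \<otimes> b) c"
    by (simp add: tens_cmp_extend ass_swap)
  also have "((symm C x y \<boxtimes> idt C b) \<cdot> ass C x y b) \<boxtimes> idt C c =
      ((symm C x y \<boxtimes> idt C b) \<boxtimes> idt C c) \<cdot> (ass C x y b \<boxtimes> idt C c)"
    by (simp add: tens_cmp)
  also have "\<dots> \<cdot> ass C x (y \<otimes> b) c = ((symm C x y \<boxtimes> idt C b) \<boxtimes> idt C c) \<cdot> (ass C x y b \<boxtimes> idt C c) \<cdot> ass C x (y \<otimes> b) c"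
    by simp
  also have "\<dots> = ((symm C x y \<boxtimes> idt C b) \<boxtimes> idt C c) \<cdot>
      ((ass C x y b \<boxtimes> idt C c) \<cdot> ass C x (y \<otimes> b) c \<cdot> (idt C x \<boxtimes> ass C y b c) \<cdot> ?j)"
    by (simp add: tens_cmp)
  also have "\<dots> = ((symm C x y \<boxtimes> idt C b) \<boxtimes> idt C c) \<cdot> ass C (x \<otimes> y) b c \<cdot> ass C x y (b \<otimes> c) \<cdot> ?j"
    by (subst pentagon_extend) simp_all
  also have "\<dots> = ass C (y \<otimes> x) b c \<cdot> (symm C x y \<boxtimes> idt C (b \<otimes> c)) \<cdot> ass C x y (b \<otimes> c) \<cdot> ?j"
    using ass_natural_extend[of "symm C x y" "idt C b" "idt C c" "y \<otimes> x" b c "ass C x y (b \<otimes> c) \<cdot> ?j"] by simp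
  also have "\<dots> = ass C (y \<otimes> x) b c \<cdot> ass C y x (b \<otimes> c) \<cdot> swap x y (b \<otimes> c) \<cdot> ?j"
    using cmp_eq_extend[OF ass_swap[of x y "b \<otimes> c"], of ?j] by simp
  also have "\<dots> = ?e \<cdot> ?r"
    by (simp add: pentagon_extend)
  finally show "?e \<cdot> ?l = ?e \<cdot> ?r" .
qed auto

text \<open>The hexagon enters here: moving \<open>z\<close> in front of
  \<open>x \<otimes> y\<close> at once is the same as moving it past \<open>y\<close> and then past
  \<open>x\<close>.\<close>

lemma swap_ass_right:
  assumes [simp]: "x \<in> Ob C" "y \<in> Ob C" "z \<in> Ob C" "c \<in> Ob C"
  shows "swap (x \<otimes> y) z c \<cdot> ass C x y (z \<otimes> c) =
    (idt C z \<boxtimes> ass C x y c) \<cdot> swap x z (y \<otimes> c) \<cdot> (idt C x \<boxtimes> swap y z c)" (is "?l = ?r")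
proof (rule iso_cancel_left[of "(ass C z x y \<boxtimes> idt C c) \<cdot> ass C z (x \<otimes> y) c"])
  let ?e = "(ass C z x y \<boxtimes> idt C c) \<cdot> ass C z (x \<otimes> y) c"
  have "?e \<cdot> ?l = (ass C z x y \<boxtimes> idt C c) \<cdot> (symm C (x \<otimes> y) z \<boxtimes> idt C c) \<cdot> ass C (x \<otimes> y) z c \<cdot> ass C x y (z \<otimes> c)"
    using cmp_eq_extend[OF ass_swap[of "x \<otimes> y" z c], of "ass C x y (z \<otimes> c)"] by simp
  also have "\<dots> = ((ass C z x y \<cdot> symm C (x \<otimes> y) z \<cdot> ass C x y z) \<boxtimes> idt C c) \<cdot> ass C x (y \<otimes> z) c \<cdot> (idt C x \<boxtimes> ass C y z c)"
    by (simp add: pentagon tens_simps)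
  also have "\<dots> = ((symm C x z \<boxtimes> idt C y) \<boxtimes> idt C c) \<cdot> (ass C x z y \<boxtimes> idt C c) \<cdot>
     (((idt C x \<boxtimes> symm C y z) \<boxtimes> idt C c) \<cdot> ass C x (y \<otimes> z) c) \<cdot> (idt C x \<boxtimes> ass C y z c)"
    by (simp add: hexagon tens_simps)
  also have "((idt C x \<boxtimes> symm C y z) \<boxtimes> idt C c) \<cdot> ass C x (y \<otimes> z) c = 
      ass C x (z \<otimes> y) c \<cdot> (idt C x \<boxtimes> (symm C y z \<boxtimes> idt C c))"
    by (simp add: ass_natural)
  also have "((symm C x z \<boxtimes> idt C y) \<boxtimes> idt C c) \<cdot> (ass C x z y \<boxtimes> idt C c) \<cdot>
     (ass C x (z \<otimes> y) c \<cdot> (idt C x \<boxtimes> (symm C y z \<boxtimes> idt C c))) \<cdot> (idt C x \<boxtimes> ass C y z c) =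
     ((symm C x z \<boxtimes> idt C y) \<boxtimes> idt C c) \<cdot> (ass C x z y \<boxtimes> idt C c) \<cdot>
     ass C x (z \<otimes> y) c \<cdot> (idt C x \<boxtimes> ass C z y c) \<cdot> (idt C x \<boxtimes> swap y z c)"
    by (simp add: tens_cmp ass_swap)
  also have "\<dots> = ((symm C x z \<boxtimes> idt C y) \<boxtimes> idt C c) \<cdot> ass C (x \<otimes> z) y c \<cdot> ass C x z (y \<otimes> c) \<cdot> (idt C x \<boxtimes> swap y z c)"
    by (simp add: pentagon_extend)
  also have "\<dots> = ass C (z \<otimes> x) y c \<cdot> (symm C x z \<boxtimes> idt C (y \<otimes> c)) \<cdot> ass C x z (y \<otimes> c) \<cdot> (idt C x \<boxtimes> swap y z c)"
    using ass_natural_extend[of "symm C x z" "idt C y" "idt C c" "z \<otimes> x" y c "ass C x z (y \<otimes> c) \<cdot> (idt C x \<boxtimes> swap y z c)"]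
    by simp
  also have "\<dots> = ass C (z \<otimes> x) y c \<cdot> ass C z x (y \<otimes> c) \<cdot> swap x z (y \<otimes> c) \<cdot> (idt C x \<boxtimes> swap y z c)"
    using cmp_eq_extend[OF ass_swap[of x z "y \<otimes> c"], of "idt C x \<boxtimes> swap y z c"] by simp
  also have "\<dots> = ?e \<cdot> ?r"
    by (simp add: pentagon_extend)
  finally show "?e \<cdot> ?l = ?e \<cdot> ?r" .
qed auto

text \<open>Second form of the hexagon: once two lists are exchanged, extracting the head of what is
  now the second list amounts to a reassociation before the exchange. This drives the induction in
  \<open>mrg_arr_symm\<close>.\<close>

lemma swap_symm:
  assumes [simp]: "x \<in> Ob C" "y \<in> Ob C" "z \<in> Ob C"
  shows "swap z x y \<cdot> symm C (x \<otimes> y) z = (idt C x \<boxtimes> symm C y z) \<cdot> inverse_of C (ass C x y z)" (is "?l = ?r")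
proof (rule iso_cancel_left[of "ass C x z y"])
  have "ass C x z y \<cdot> ?l = (symm C z x \<boxtimes> idt C y) \<cdot> (ass C z x y \<cdot> symm C (x \<otimes> y) z \<cdot> ass C x y z) \<cdot> inverse_of C (ass C x y z)"
    using cmp_eq_extend[OF ass_swap[of z x y], of "symm C (x \<otimes> y) z"] by simp
  also have "\<dots> = (symm C z x \<boxtimes> idt C y) \<cdot> (symm C x z \<boxtimes> idt C y) \<cdot> ass C x z y \<cdot> (idt C x \<boxtimes> symm C y z) \<cdot> inverse_of C (ass C x y z)"
    by (subst hexagon) simp_all
  also have "\<dots> = ass C x z y \<cdot> ?r"
    by (simp add: tens_cmp_extend)
  finally show "ass C x z y \<cdot> ?l = ass C x z y \<cdot> ?r" .
qed auto

end

section \<open>Coherence\<close>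

text \<open>
  Coherence by merge sort. Over linearly ordered variables, \<open>leaves X\<close> is the sorted list of the
  variables of a word \<open>X\<close>, and \<open>sort_arr u X\<close> is an isomorphism from \<open>X\<close> to the right-nested product over
  this list, composed of the merging isomorphisms \<open>mrg_arr\<close>. All structure arrows commute with these
  isomorphisms, so an arrow without generators is determined by its source and target if no variable
  is repeated in them.
\<close>

fun mrg :: "'g::linorder list \<Rightarrow> 'g list \<Rightarrow> 'g list" where
  "mrg [] ys = ys"
| "mrg (x # xs) [] = x # xs"
| "mrg (x # xs) (y # ys) = (if x \<le> y then x # mrg xs (y # ys) else y # mrg (x # xs) ys)"

lemma set_mrg [simp]: "set (mrg xs ys) = set xs \<union> set ys"
  by (induction xs ys rule: mrg.induct) auto

lemma mrg_Nil_right [simp]: "mrg xs [] = xs"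
  by (cases xs) auto

lemma mrg_commute: "set xs \<inter> set ys = {} \<Longrightarrow> mrg xs ys = mrg ys xs"
  by (induction xs ys rule: mrg.induct) auto

lemma mrg_assoc: "mrg (mrg xs ys) zs = mrg xs (mrg ys zs)"
proof (induction xs ys arbitrary: zs rule: mrg.induct)
  case (3 x xs y ys)
  show ?case
  proof (induction zs)
    case (Cons z zs)
    then show ?case using 3[of "z # zs"] by (auto split: if_splits)
  qed simp
qed auto

context symmetric_monoidal_category begin

primrec list_ob :: "('g \<Rightarrow> 'o) \<Rightarrow> 'g list \<Rightarrow> 'o" where
  "list_ob u [] = unt C"
| "list_ob u (x # xs) = u x \<otimes> list_ob u xs"

text \<open>The cases follow \<open>mrg\<close>. A head taken from the left list needs a
  reassociation only; a head taken from the right list has to cross the whole left list, which is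
  \<open>swap\<close>.\<close>

fun mrg_arr :: "('g::linorder \<Rightarrow> 'o) \<Rightarrow> 'g list \<Rightarrow> 'g list \<Rightarrow> 'm" where
  "mrg_arr u [] ys = lunit C (list_ob u ys)"
| "mrg_arr u (x # xs) [] = runit C (list_ob u (x # xs))"
| "mrg_arr u (x # xs) (y # ys) = (if x \<le> y
     then (idt C (u x) \<boxtimes> mrg_arr u xs (y # ys)) \<cdot> inverse_of C (ass C (u x) (list_ob u xs) (list_ob u (y # ys)))
     else (idt C (u y) \<boxtimes> mrg_arr u (x # xs) ys) \<cdot> swap (list_ob u (x # xs)) (u y) (list_ob u ys))"

lemma list_ob_Ob: "(\<And>g. u g \<in> Ob C) \<Longrightarrow> list_ob u xs \<in> Ob C"
  by (induction xs) auto

lemma mrg_arr_iso: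
  assumes "\<And>g. u g \<in> Ob C"
  shows "iso C (mrg_arr u xs ys) \<and> dm C (mrg_arr u xs ys) = list_ob u xs \<otimes> list_ob u ys \<and>
    cd C (mrg_arr u xs ys) = list_ob u (mrg xs ys)"
  using assms by (induction u xs ys rule: mrg_arr.induct) (auto simp: list_ob_Ob iso_Ar)

text \<open>Induction step of \<open>mrg_arr_assoc\<close> when the extracted head \<open>a\<close>
  sits in the first list. The four merges of the remaining lists are replaced by arbitrary arrows
  \<open>m1\<close> to \<open>m4\<close>, tied together only by the induction hypothesis
  \<open>e\<close>. The next two lemmas treat a head in the second and in the third list.\<close>

lemma mrg_arr_assoc_left:
  assumes [simp]: "a \<in> Ob C" "x \<in> Ob C" "y \<in> Ob C" "z \<in> Ob C" "m1 \<in> Ar C" "m2 \<in> Ar C" "m3 \<in> Ar C" "m4 \<in> Ar C"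
    and [simp]: "dm C m1 = x \<otimes> y" "dm C m2 = cd C m1 \<otimes> z" "dm C m3 = y \<otimes> z" "dm C m4 = x \<otimes> cd C m3"
    and e: "m2 \<cdot> (m1 \<boxtimes> idt C z) \<cdot> ass C x y z = m4 \<cdot> (idt C x \<boxtimes> m3)"
  shows "((idt C a \<boxtimes> m2) \<cdot> inverse_of C (ass C a (cd C m1) z)) \<cdot>
     (((idt C a \<boxtimes> m1) \<cdot> inverse_of C (ass C a x y)) \<boxtimes> idt C z) \<cdot> ass C (a \<otimes> x) y z =
     ((idt C a \<boxtimes> m4) \<cdot> inverse_of C (ass C a x (cd C m3))) \<cdot> (idt C (a \<otimes> x) \<boxtimes> m3)" (is "?l = ?r")
proof -
  have "?l = (idt C a \<boxtimes> m2) \<cdot> (inverse_of C (ass C a (cd C m1) z) \<cdot> ((idt C a \<boxtimes> m1) \<boxtimes> idt C z)) \<cdot>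
      (inverse_of C (ass C a x y) \<boxtimes> idt C z) \<cdot> ass C (a \<otimes> x) y z"
    by (simp add: tens_cmp_extend)
  also have "\<dots> = (idt C a \<boxtimes> m2) \<cdot> (idt C a \<boxtimes> (m1 \<boxtimes> idt C z)) \<cdot> (idt C a \<boxtimes> ass C x y z) \<cdot>
      inverse_of C (ass C a x (y \<otimes> z))"
    by (subst ass_inverse_natural) (simp_all add: ass_inverse_pentagon)
  also have "\<dots> = (idt C a \<boxtimes> m4) \<cdot> (idt C a \<boxtimes> (idt C x \<boxtimes> m3)) \<cdot> inverse_of C (ass C a x (y \<otimes> z))"
    by (simp add: tens_cmp_extend e)
  also have "\<dots> = ?r"
    using ass_inverse_natural[of "idt C a" "idt C x" m3 a x "cd C m3"] by simp
  finally show ?thesis .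
qed

lemma mrg_arr_assoc_middle:
  assumes [simp]: "a \<in> Ob C" "x \<in> Ob C" "y \<in> Ob C" "z \<in> Ob C" "m1 \<in> Ar C" "m2 \<in> Ar C" "m3 \<in> Ar C" "m4 \<in> Ar C"
    and [simp]: "dm C m1 = x \<otimes> y" "dm C m2 = cd C m1 \<otimes> z" "dm C m3 = y \<otimes> z" "dm C m4 = x \<otimes> cd C m3"
    and e: "m2 \<cdot> (m1 \<boxtimes> idt C z) \<cdot> ass C x y z = m4 \<cdot> (idt C x \<boxtimes> m3)"
  shows "((idt C a \<boxtimes> m2) \<cdot> inverse_of C (ass C a (cd C m1) z)) \<cdot>
     (((idt C a \<boxtimes> m1) \<cdot> swap x a y) \<boxtimes> idt C z) \<cdot> ass C x (a \<otimes> y) z =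
     ((idt C a \<boxtimes> m4) \<cdot> swap x a (cd C m3)) \<cdot> (idt C x \<boxtimes> ((idt C a \<boxtimes> m3) \<cdot> inverse_of C (ass C a y z)))" (is "?l = ?r")
proof -
  have "?l = (idt C a \<boxtimes> m2) \<cdot> (inverse_of C (ass C a (cd C m1) z) \<cdot> ((idt C a \<boxtimes> m1) \<boxtimes> idt C z)) \<cdot>
      (swap x a y \<boxtimes> idt C z) \<cdot> ass C x (a \<otimes> y) z"
    by (simp add: tens_cmp_extend)
  also have "\<dots> = (idt C a \<boxtimes> m2) \<cdot> (idt C a \<boxtimes> (m1 \<boxtimes> idt C z)) \<cdot> (idt C a \<boxtimes> ass C x y z) \<cdot>
      swap x a (y \<otimes> z) \<cdot> (idt C x \<boxtimes> inverse_of C (ass C a y z))"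
    by (subst ass_inverse_natural) (simp_all add: swap_ass_middle)
  also have "\<dots> = (idt C a \<boxtimes> m4) \<cdot> ((idt C a \<boxtimes> (idt C x \<boxtimes> m3)) \<cdot> swap x a (y \<otimes> z)) \<cdot> (idt C x \<boxtimes> inverse_of C (ass C a y z))"
    by (simp add: tens_cmp_extend e)
  also have "(idt C a \<boxtimes> (idt C x \<boxtimes> m3)) \<cdot> swap x a (y \<otimes> z) = swap x a (cd C m3) \<cdot> (idt C x \<boxtimes> (idt C a \<boxtimes> m3))"
    by (simp add: swap_natural)
  also have "(idt C a \<boxtimes> m4) \<cdot> (swap x a (cd C m3) \<cdot> (idt C x \<boxtimes> (idt C a \<boxtimes> m3))) \<cdot> (idt C x \<boxtimes> inverse_of C (ass C a y z)) = ?r"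
    by (simp add: tens_cmp)
  finally show ?thesis .
qed

lemma mrg_arr_assoc_right:
  assumes [simp]: "a \<in> Ob C" "x \<in> Ob C" "y \<in> Ob C" "z \<in> Ob C" "m1 \<in> Ar C" "m2 \<in> Ar C" "m3 \<in> Ar C" "m4 \<in> Ar C"
    and [simp]: "dm C m1 = x \<otimes> y" "dm C m2 = cd C m1 \<otimes> z" "dm C m3 = y \<otimes> z" "dm C m4 = x \<otimes> cd C m3"
    and e: "m2 \<cdot> (m1 \<boxtimes> idt C z) \<cdot> ass C x y z = m4 \<cdot> (idt C x \<boxtimes> m3)"
  shows "((idt C a \<boxtimes> m2) \<cdot> swap (cd C m1) a z) \<cdot> (m1 \<boxtimes> idt C (a \<otimes> z)) \<cdot> ass C x y (a \<otimes> z) =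
     ((idt C a \<boxtimes> m4) \<cdot> swap x a (cd C m3)) \<cdot> (idt C x \<boxtimes> ((idt C a \<boxtimes> m3) \<cdot> swap y a z))" (is "?l = ?r")
proof -
  have "?l = (idt C a \<boxtimes> m2) \<cdot> (swap (cd C m1) a z \<cdot> (m1 \<boxtimes> (idt C a \<boxtimes> idt C z))) \<cdot> ass C x y (a \<otimes> z)"
    by simp
  also have "\<dots> = (idt C a \<boxtimes> m2) \<cdot> (idt C a \<boxtimes> (m1 \<boxtimes> idt C z)) \<cdot> (idt C a \<boxtimes> ass C x y z) \<cdot>
      swap x a (y \<otimes> z) \<cdot> (idt C x \<boxtimes> swap y a z)"
    by (subst swap_natural) (simp_all add: swap_ass_right)
  also have "\<dots> = (idt C a \<boxtimes> m4) \<cdot> ((idt C a \<boxtimes> (idt C x \<boxtimes> m3)) \<cdot> swap x a (y \<otimes> z)) \<cdot> (idt C x \<boxtimes> swap y a z)"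
    by (simp add: tens_cmp_extend e)
  also have "(idt C a \<boxtimes> (idt C x \<boxtimes> m3)) \<cdot> swap x a (y \<otimes> z) = swap x a (cd C m3) \<cdot> (idt C x \<boxtimes> (idt C a \<boxtimes> m3))"
    by (simp add: swap_natural)
  also have "(idt C a \<boxtimes> m4) \<cdot> (swap x a (cd C m3) \<cdot> (idt C x \<boxtimes> (idt C a \<boxtimes> m3))) \<cdot> (idt C x \<boxtimes> swap y a z) = ?r"
    by (simp add: tens_cmp)
  finally show ?thesis .
qed

context
  fixes u :: "'g::linorder \<Rightarrow> 'o"
  assumes u [simp]: "\<And>g. u g \<in> Ob C"
begin

lemma list_ob_in [simp]: "list_ob u xs \<in> Ob C"
  by (rule list_ob_Ob) simp

lemma mrg_arr_typing [simp]:
  "iso C (mrg_arr u xs ys)" "mrg_arr u xs ys \<in> Ar C"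
  "dm C (mrg_arr u xs ys) = list_ob u xs \<otimes> list_ob u ys"
  "cd C (mrg_arr u xs ys) = list_ob u (mrg xs ys)"
  using mrg_arr_iso[of u xs ys] by (auto simp: iso_Ar)

lemma mrg_arr_Nil_right: "mrg_arr u xs [] = runit C (list_ob u xs)"
  by (cases xs) (auto simp: lunit_unt)

text \<open>Disjointness is where linearity of words is used: on a tie the merge prefers its left
  argument, so exchanging two lists with a common variable would exchange the two copies.\<close>

lemma mrg_arr_symm:
  "set xs \<inter> set ys = {} \<Longrightarrow> mrg_arr u ys xs \<cdot> symm C (list_ob u xs) (list_ob u ys) = mrg_arr u xs ys"
proof (induction xs ys rule: mrg.induct)
  case (1 ys)
  then show ?case by (simp add: mrg_arr_Nil_right runit_symm)
next
  case (2 x xs)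
  then show ?case by (simp add: symm_unit)
next
  case (3 x xs y ys)
  show ?case
  proof (cases "x \<le> y")
    case True
    with 3 have n: "\<not> y \<le> x" by auto
    have IH: "mrg_arr u (y # ys) xs \<cdot> symm C (list_ob u xs) (list_ob u (y # ys)) = mrg_arr u xs (y # ys)"
      using 3 True by auto
    show ?thesis using True n IH swap_symm[of "u x" "list_ob u xs" "list_ob u (y # ys)"]
      by (simp add: tens_cmp_extend)
  next
    case False
    then have n: "y \<le> x" by auto
    have IH: "mrg_arr u ys (x # xs) \<cdot> symm C (list_ob u (x # xs)) (list_ob u ys) = mrg_arr u (x # xs) ys"
      using 3 False by auto
    have IH': "mrg_arr u (x # xs) ys \<cdot> symm C (list_ob u ys) (list_ob u (x # xs)) = mrg_arr u ys (x # xs)"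
      unfolding IH[symmetric] by simp
    \<comment> \<open>With the head in \<open>ys\<close>, \<open>swap_symm\<close> computes the
      composite with the symmetry in the opposite direction; the goal follows since the two
      symmetries are inverse to each other.\<close>
    have "mrg_arr u (x # xs) (y # ys) \<cdot> symm C (list_ob u (y # ys)) (list_ob u (x # xs)) = mrg_arr u (y # ys) (x # xs)"
      using False n IH' swap_symm[of "u y" "list_ob u ys" "list_ob u (x # xs)"]
      by (simp add: tens_cmp_extend)
    from this[symmetric] show ?thesis by simp
  qed
qed

text \<open>The head may be extracted from any of the three lists, so the induction runs over the
  total length. If one list is empty, the statement is one of the three unit triangles.\<close>

lemma mrg_arr_assoc:
  "mrg_arr u (mrg xs ys) zs \<cdot> (mrg_arr u xs ys \<boxtimes> idt C (list_ob u zs)) \<cdot> ass C (list_ob u xs) (list_ob u ys) (list_ob u zs) =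
   mrg_arr u xs (mrg ys zs) \<cdot> (idt C (list_ob u xs) \<boxtimes> mrg_arr u ys zs)"
proof (induction "length xs + length ys + length zs" arbitrary: xs ys zs rule: less_induct)
  case less
  consider "xs = []" | "ys = []" | "zs = []" | x xs' y ys' z zs' where "xs = x # xs'" "ys = y # ys'" "zs = z # zs'"
    by (metis list.exhaust)
  then show ?case
  proof cases
    case 1
    then show ?thesis by (simp add: lunit_tens lunit_natural)
  next
    case 2
    then show ?thesis by (simp add: mrg_arr_Nil_right triangle)
  next
    case 3
    then show ?thesis by (simp add: mrg_arr_Nil_right cmp_eq_extend[OF runit_natural] runit_tens)
  next
    case 4
    \<comment> \<open>The alternatives say which list provides the first element of the full merge,
      ties being decided in favour of the earlier list.\<close>
    have cases: "x \<le> y \<and> x \<le> z \<or> \<not> x \<le> y \<and> y \<le> z \<or> \<not> x \<le> z \<and> \<not> y \<le> z"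
      by fastforce
    note xs = 4(1) and ys = 4(2) and zs = 4(3)
    let ?O = "list_ob u" and ?m = "mrg_arr u" and ?a = "\<lambda>x y z. inverse_of C (ass C x y z)"
    show ?thesis
      using cases
    proof (elim disjE conjE)
      assume c: "x \<le> y" "x \<le> z"
      have m: "mrg xs ys = x # mrg xs' ys" and o: "?O xs = u x \<otimes> ?O xs'" using c by (simp_all add: xs ys)
      have "\<exists>h hs. mrg ys zs = h # hs \<and> x \<le> h" using c by (auto simp: ys zs)
      then obtain h hs where h: "mrg ys zs = h # hs" "x \<le> h" by blast
      have 1: "?m xs ys = (idt C (u x) \<boxtimes> ?m xs' ys) \<cdot> ?a (u x) (?O xs') (?O ys)" using c by (simp add: xs ys)
      have 2: "?m (x # mrg xs' ys) zs = (idt C (u x) \<boxtimes> ?m (mrg xs' ys) zs) \<cdot> ?a (u x) (?O (mrg xs' ys)) (?O zs)"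
        using c by (simp add: zs)
      have 4: "?m xs (mrg ys zs) = (idt C (u x) \<boxtimes> ?m xs' (mrg ys zs)) \<cdot> ?a (u x) (?O xs') (?O (mrg ys zs))"
        using h by (simp add: xs)
      have "?m (mrg xs' ys) zs \<cdot> (?m xs' ys \<boxtimes> idt C (?O zs)) \<cdot> ass C (?O xs') (?O ys) (?O zs) =
        ?m xs' (mrg ys zs) \<cdot> (idt C (?O xs') \<boxtimes> ?m ys zs)"
        by (rule less) (simp add: xs)
      from mrg_arr_assoc_left[OF _ _ _ _ _ _ _ _ _ _ _ _ this, of "u x"]
      show ?thesis unfolding m o 1 2 4 by (simp del: assoc list_ob.simps)
    next
      assume c: "\<not> x \<le> y" "y \<le> z"
      have m: "mrg xs ys = y # mrg xs ys'" and m': "mrg ys zs = y # mrg ys' zs" and o: "?O ys = u y \<otimes> ?O ys'"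
        using c by (simp_all add: xs ys zs)
      have 1: "?m xs ys = (idt C (u y) \<boxtimes> ?m xs ys') \<cdot> swap (?O xs) (u y) (?O ys')" using c by (simp add: xs ys)
      have 2: "?m (y # mrg xs ys') zs = (idt C (u y) \<boxtimes> ?m (mrg xs ys') zs) \<cdot> ?a (u y) (?O (mrg xs ys')) (?O zs)"
        using c by (simp add: zs)
      have 3: "?m ys zs = (idt C (u y) \<boxtimes> ?m ys' zs) \<cdot> ?a (u y) (?O ys') (?O zs)" using c by (simp add: ys zs)
      have 4: "?m xs (y # mrg ys' zs) = (idt C (u y) \<boxtimes> ?m xs (mrg ys' zs)) \<cdot> swap (?O xs) (u y) (?O (mrg ys' zs))"
        using c by (simp add: xs)
      have "?m (mrg xs ys') zs \<cdot> (?m xs ys' \<boxtimes> idt C (?O zs)) \<cdot> ass C (?O xs) (?O ys') (?O zs) =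
        ?m xs (mrg ys' zs) \<cdot> (idt C (?O xs) \<boxtimes> ?m ys' zs)"
        by (rule less) (simp add: ys)
      from mrg_arr_assoc_middle[OF _ _ _ _ _ _ _ _ _ _ _ _ this, of "u y"]
      show ?thesis unfolding m m' o 1 2 3 4 by (simp del: assoc list_ob.simps)
    next
      assume c: "\<not> x \<le> z" "\<not> y \<le> z"
      have m: "mrg ys zs = z # mrg ys zs'" and o: "?O zs = u z \<otimes> ?O zs'" using c by (simp_all add: ys zs)
      have "\<exists>h hs. mrg xs ys = h # hs \<and> \<not> h \<le> z" using c by (auto simp: xs ys)
      then obtain h hs where h: "mrg xs ys = h # hs" "\<not> h \<le> z" by blast
      have 2: "?m (mrg xs ys) zs = (idt C (u z) \<boxtimes> ?m (mrg xs ys) zs') \<cdot> swap (?O (mrg xs ys)) (u z) (?O zs')"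
        using h by (simp add: zs)
      have 3: "?m ys zs = (idt C (u z) \<boxtimes> ?m ys zs') \<cdot> swap (?O ys) (u z) (?O zs')" using c by (simp add: ys zs)
      have 4: "?m xs (z # mrg ys zs') = (idt C (u z) \<boxtimes> ?m xs (mrg ys zs')) \<cdot> swap (?O xs) (u z) (?O (mrg ys zs'))"
        using c by (simp add: xs)
      have "?m (mrg xs ys) zs' \<cdot> (?m xs ys \<boxtimes> idt C (?O zs')) \<cdot> ass C (?O xs) (?O ys) (?O zs') =
        ?m xs (mrg ys zs') \<cdot> (idt C (?O xs) \<boxtimes> ?m ys zs')"
        by (rule less) (simp add: zs)
      from mrg_arr_assoc_right[OF _ _ _ _ _ _ _ _ _ _ _ _ this, of "u z"]
      show ?thesis unfolding m o 2 3 4 by (simp del: assoc list_ob.simps)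
    qed
  qed
qed

end
end

section \<open>Evaluation of formal terms in a symmetric monoidal category\<close>

definition free_pres :: "('g, 'k) presentation" where
  "free_pres = \<lparr>ogens = UNIV, agens = {}, adom = (\<lambda>_. UnitW), acod = (\<lambda>_. UnitW), rels = (\<lambda>_ _. False)\<rparr>"

lemma free_pres_simps [simp]:
  "ogens free_pres = UNIV" "agens free_pres = {}" "adom free_pres = (\<lambda>_. UnitW)" "acod free_pres = (\<lambda>_. UnitW)"
  "rels free_pres = (\<lambda>_ _. False)" "X \<in> words free_pres"
  by (auto simp: free_pres_def words_def)

lemma words_simps [simp]:
  "UnitW \<in> words P" "GenW g \<in> words P \<longleftrightarrow> g \<in> ogens P" "TensW X Y \<in> words P \<longleftrightarrow> X \<in> words P \<and> Y \<in> words P"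
  by (auto simp: words_def)

context symmetric_monoidal_category begin

definition assignment :: "('g, 'k) presentation \<Rightarrow> ('g \<Rightarrow> 'o) \<Rightarrow> ('k \<Rightarrow> 'm) \<Rightarrow> bool" where
  "assignment P u w \<longleftrightarrow> (\<forall>g\<in>ogens P. u g \<in> Ob C) \<and>
     (\<forall>k\<in>agens P. w k \<in> hom C (eval_word C u (adom P k)) (eval_word C u (acod P k)))"

lemma eval_word_Ob: "assignment P u w \<Longrightarrow> X \<in> words P \<Longrightarrow> eval_word C u X \<in> Ob C"
  by (induction X) (auto simp: assignment_def)

lemma eval_tm_typing:
  "assignment P u w \<Longrightarrow> wf_tm P p \<Longrightarrow> eval_tm C u w p \<in> Ar C \<and>
   dm C (eval_tm C u w p) = eval_word C u (tdom (adom P) p) \<and>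
   cd C (eval_tm C u w p) = eval_word C u (tcod (acod P) p)"
  by (induction p) (auto simp: eval_word_Ob assignment_def hom_iff)

lemma eval_tm_smc_rel:
  assumes a: "assignment P u w" and r: "smc_rel (adom P) (acod P) p q" and p: "wf_tm P p" and q: "wf_tm P q"
  shows "eval_tm C u w p = eval_tm C u w q"
proof -
  note [simp] = eval_tm_typing[OF a] eval_word_Ob[OF a]
  show ?thesis using r p q
    by cases (auto simp: tensT_def tens_simps ass_natural runit_natural lunit_natural symm_natural
      pentagon triangle symm_unit hexagon)
qed

lemma eval_tm_tm_eq:
  assumes a: "assignment P u w"
    and rels: "\<And>p q. rels P p q \<Longrightarrow> wf_tm P p \<Longrightarrow> wf_tm P q \<Longrightarrow> tdom (adom P) p = tdom (adom P) q \<Longrightarrow>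
      tcod (acod P) p = tcod (acod P) q \<Longrightarrow> eval_tm C u w p = eval_tm C u w q"
    and e: "tm_eq P p q"
  shows "eval_tm C u w p = eval_tm C u w q"
  using e by induction (auto simp: rels eval_tm_smc_rel[OF a])

end

section \<open>Sorting of words and the coherence theorem\<close>

primrec linear :: "'g word \<Rightarrow> bool" where
  "linear UnitW = True"
| "linear (GenW g) = True"
| "linear (TensW X Y) = (linear X \<and> linear Y \<and> word_gens X \<inter> word_gens Y = {})"

primrec leaves :: "'g::linorder word \<Rightarrow> 'g list" where
  "leaves UnitW = []"
| "leaves (GenW g) = [g]"
| "leaves (TensW X Y) = mrg (leaves X) (leaves Y)"

lemma set_leaves [simp]: "set (leaves X) = word_gens X"
  by (induction X) auto

context symmetric_monoidal_category begin

text \<open>A single variable has to land in the product over a one-element list, which is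
  \<open>u g \<otimes> unt C\<close>; hence the inverse of the right unit arrow.\<close>

primrec sort_arr :: "('g::linorder \<Rightarrow> 'o) \<Rightarrow> 'g word \<Rightarrow> 'm" where
  "sort_arr u UnitW = idt C (unt C)"
| "sort_arr u (GenW g) = inverse_of C (runit C (u g))"
| "sort_arr u (TensW X Y) = mrg_arr u (leaves X) (leaves Y) \<cdot> (sort_arr u X \<boxtimes> sort_arr u Y)"

context
  fixes u :: "'g::linorder \<Rightarrow> 'o"
  assumes u [simp]: "\<And>g. u g \<in> Ob C"
begin

lemma eval_word_in [simp]: "eval_word C u X \<in> Ob C"
  by (rule eval_word_Ob[of free_pres]) (auto simp: assignment_def)

lemma sort_arr_iso:
  "iso C (sort_arr u X) \<and> dm C (sort_arr u X) = eval_word C u X \<and> cd C (sort_arr u X) = list_ob u (leaves X)"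
  by (induction X) (auto simp: iso_Ar)

lemma sort_arr_typing [simp]:
  "iso C (sort_arr u X)" "sort_arr u X \<in> Ar C" "dm C (sort_arr u X) = eval_word C u X"
  "cd C (sort_arr u X) = list_ob u (leaves X)"
  using sort_arr_iso[of X] by (auto simp: iso_Ar)

lemma sort_arr_ass:
  "sort_arr u (TensW (TensW X Y) Z) \<cdot> ass C (eval_word C u X) (eval_word C u Y) (eval_word C u Z) =
   sort_arr u (TensW X (TensW Y Z))"
proof -
  have "sort_arr u (TensW (TensW X Y) Z) \<cdot> ass C (eval_word C u X) (eval_word C u Y) (eval_word C u Z) =
    mrg_arr u (mrg (leaves X) (leaves Y)) (leaves Z) \<cdot> (mrg_arr u (leaves X) (leaves Y) \<boxtimes> idt C (list_ob u (leaves Z))) \<cdot>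
    (((sort_arr u X \<boxtimes> sort_arr u Y) \<boxtimes> sort_arr u Z) \<cdot> ass C (eval_word C u X) (eval_word C u Y) (eval_word C u Z))"
    by (simp add: tens_simps)
  also have "((sort_arr u X \<boxtimes> sort_arr u Y) \<boxtimes> sort_arr u Z) \<cdot> ass C (eval_word C u X) (eval_word C u Y) (eval_word C u Z) =
    ass C (list_ob u (leaves X)) (list_ob u (leaves Y)) (list_ob u (leaves Z)) \<cdot> (sort_arr u X \<boxtimes> (sort_arr u Y \<boxtimes> sort_arr u Z))"
    by (simp add: ass_natural)
  also have "mrg_arr u (mrg (leaves X) (leaves Y)) (leaves Z) \<cdot> (mrg_arr u (leaves X) (leaves Y) \<boxtimes> idt C (list_ob u (leaves Z))) \<cdot> \<dots> =
    (mrg_arr u (mrg (leaves X) (leaves Y)) (leaves Z) \<cdot> (mrg_arr u (leaves X) (leaves Y) \<boxtimes> idt C (list_ob u (leaves Z))) \<cdot>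
     ass C (list_ob u (leaves X)) (list_ob u (leaves Y)) (list_ob u (leaves Z))) \<cdot> (sort_arr u X \<boxtimes> (sort_arr u Y \<boxtimes> sort_arr u Z))"
    by (simp add: mrg_assoc)
  also have "\<dots> = sort_arr u (TensW X (TensW Y Z))"
    unfolding mrg_arr_assoc[OF u] by (simp add: tens_simps)
  finally show ?thesis .
qed

lemma sort_arr_runit: "sort_arr u (TensW X UnitW) = sort_arr u X \<cdot> runit C (eval_word C u X)"
  by (simp add: mrg_arr_Nil_right[OF u] runit_natural)

lemma sort_arr_lunit: "sort_arr u (TensW UnitW X) = sort_arr u X \<cdot> lunit C (eval_word C u X)"
  by (simp add: lunit_natural)

lemma sort_arr_symm:
  "word_gens X \<inter> word_gens Y = {} \<Longrightarrow>
   sort_arr u (TensW Y X) \<cdot> symm C (eval_word C u X) (eval_word C u Y) = sort_arr u (TensW X Y)"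
proof -
  assume d: "word_gens X \<inter> word_gens Y = {}"
  have m: "mrg (leaves X) (leaves Y) = mrg (leaves Y) (leaves X)"
    using d mrg_commute[of "leaves X" "leaves Y"] by simp
  have "sort_arr u (TensW Y X) \<cdot> symm C (eval_word C u X) (eval_word C u Y) =
    mrg_arr u (leaves Y) (leaves X) \<cdot> symm C (list_ob u (leaves X)) (list_ob u (leaves Y)) \<cdot> (sort_arr u X \<boxtimes> sort_arr u Y)"
    by (simp add: symm_natural)
  also have "\<dots> = (mrg_arr u (leaves Y) (leaves X) \<cdot> symm C (list_ob u (leaves X)) (list_ob u (leaves Y))) \<cdot> (sort_arr u X \<boxtimes> sort_arr u Y)"
    by simp
  also have "\<dots> = sort_arr u (TensW X Y)"
    using d by (subst mrg_arr_symm) simp_all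
  finally show ?thesis .
qed

text \<open>The commutation with sorting is proved together with the invariance of linearity,
  variables and leaves: composition has to pass linearity on to the second factor, and whiskering
  has to keep the variables of both sides disjoint.\<close>

lemma sort_arr_eval_tm:
  assumes "wf_tm free_pres p" "linear (tdom (\<lambda>_. UnitW) p)"
  shows "linear (tcod (\<lambda>_. UnitW) p) \<and> word_gens (tcod (\<lambda>_. UnitW) p) = word_gens (tdom (\<lambda>_. UnitW) p) \<and>
    leaves (tcod (\<lambda>_. UnitW) p) = leaves (tdom (\<lambda>_. UnitW) p) \<and>
    sort_arr u (tcod (\<lambda>_. UnitW) p) \<cdot> eval_tm C u w p = sort_arr u (tdom (\<lambda>_. UnitW) p)"
  using assms
proof (induction p)
  have a: "assignment free_pres u w" by (auto simp: assignment_def)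
  note eval_tm_typing[OF a, simp]
  {
    case (CompT q p)
    then show ?case by (auto simp: assoc[symmetric] simp del: assoc)
  next
    case (LeftT X p)
    then show ?case by (auto simp: tens_simps)
  next
    case (RightT p X)
    then show ?case by (auto simp: tens_simps)
  next
    case (AssT X Y Z)
    then show ?case using sort_arr_ass[of X Y Z] by (auto simp: mrg_assoc simp del: sort_arr.simps)
  next
    case (AssInvT X Y Z)
    have "sort_arr u (TensW X (TensW Y Z)) \<cdot> inverse_of C (ass C (eval_word C u X) (eval_word C u Y) (eval_word C u Z)) =
      sort_arr u (TensW (TensW X Y) Z)"
      unfolding sort_arr_ass[symmetric] by (simp del: sort_arr.simps add: mrg_assoc)
    then show ?case using AssInvT by (auto simp: mrg_assoc simp del: sort_arr.simps)
  next
    case (RunitT X)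
    then show ?case by (simp add: sort_arr_runit del: sort_arr.simps)
  next
    case (RunitInvT X)
    then show ?case by (simp add: sort_arr_runit del: sort_arr.simps)
  next
    case (LunitT X)
    then show ?case by (simp add: sort_arr_lunit del: sort_arr.simps)
  next
    case (LunitInvT X)
    then show ?case by (simp add: sort_arr_lunit del: sort_arr.simps)
  next
    case (SymmT X Y)
    then have "leaves (TensW Y X) = leaves (TensW X Y)"
      using mrg_commute[of "leaves X" "leaves Y"] by simp
    then show ?case using sort_arr_symm[of X Y] SymmT by (auto simp del: sort_arr.simps leaves.simps)
  }
qed auto

end

theorem coherence:
  fixes u :: "'g::linorder \<Rightarrow> 'o" and w :: "'k \<Rightarrow> 'm" and p q :: "('g, 'k) tm"
  assumes u: "\<And>g. u g \<in> Ob C"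
    and p: "wf_tm free_pres p" and q: "wf_tm free_pres q"
    and d: "tdom (\<lambda>_. UnitW) p = tdom (\<lambda>_. UnitW) q" and c: "tcod (\<lambda>_. UnitW) p = tcod (\<lambda>_. UnitW) q"
    and l: "linear (tdom (\<lambda>_. UnitW) p)"
  shows "eval_tm C u w p = eval_tm C u w q"
proof (rule iso_cancel_left)
  have a: "assignment free_pres u w" using u by (auto simp: assignment_def)
  show "sort_arr u (tcod (\<lambda>_. UnitW) p) \<cdot> eval_tm C u w p = sort_arr u (tcod (\<lambda>_. UnitW) p) \<cdot> eval_tm C u w q"
    using sort_arr_eval_tm[of u p w] sort_arr_eval_tm[of u q w] assms by simp
qed (use assms eval_tm_typing[of free_pres u w p] eval_tm_typing[of free_pres u w q] in \<open>auto simp: assignment_def\<close>)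

section \<open>Naturality and coherence of the interchange\<close>

lemma eval_tm_interchangeT:
  "eval_tm C u w (interchangeT X Y Z W) = interchange C (eval_word C u X) (eval_word C u Y) (eval_word C u Z) (eval_word C u W)"
  by (simp add: interchangeT_def interchange_def)

lemma interchange_typing [simp]:
  assumes "a \<in> Ob C" "b \<in> Ob C" "c \<in> Ob C" "d \<in> Ob C"
  shows "interchange C a b c d \<in> Ar C" "dm C (interchange C a b c d) = (a \<otimes> b) \<otimes> (c \<otimes> d)"
    "cd C (interchange C a b c d) = (a \<otimes> c) \<otimes> (b \<otimes> d)"
  using assms by (auto simp: interchange_def)

lemma interchange_natural:
  assumes t: "f \<in> Ar C" "g \<in> Ar C" "h \<in> Ar C" "k \<in> Ar C"
    and "cd C f = a" "cd C g = b" "cd C h = c" "cd C k = d"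
  shows "interchange C a b c d \<cdot> ((f \<boxtimes> g) \<boxtimes> (h \<boxtimes> k)) =
    ((f \<boxtimes> h) \<boxtimes> (g \<boxtimes> k)) \<cdot> interchange C (dm C f) (dm C g) (dm C h) (dm C k)"
proof -
  let ?a = "dm C f" and ?b = "dm C g" and ?c = "dm C h" and ?d = "dm C k"
  have [simp]: "a \<in> Ob C" "b \<in> Ob C" "c \<in> Ob C" "d \<in> Ob C" using assms by auto
  note [simp] = assms
  \<comment> \<open>\<open>m\<close> exchanges the last two of three factors. The interchange is
    \<open>m\<close> tensored with the identity of \<open>d\<close>, conjugated by associativity, so
    its naturality reduces to that of \<open>m\<close>. The coherence theorem does not apply, as the
    arrows \<open>f\<close>, \<open>g\<close>, \<open>h\<close>, \<open>k\<close> are not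
    structural.\<close>
  define m where "m = ass C a c b \<cdot> (idt C a \<boxtimes> symm C b c) \<cdot> inverse_of C (ass C a b c)"
  define m' where "m' = ass C ?a ?c ?b \<cdot> (idt C ?a \<boxtimes> symm C ?b ?c) \<cdot> inverse_of C (ass C ?a ?b ?c)"
  have [simp]: "m \<in> Ar C" "dm C m = (a \<otimes> b) \<otimes> c" "cd C m = (a \<otimes> c) \<otimes> b"
    "m' \<in> Ar C" "dm C m' = (?a \<otimes> ?b) \<otimes> ?c" "cd C m' = (?a \<otimes> ?c) \<otimes> ?b"
    by (simp_all add: m_def m'_def)
  have "m \<cdot> ((f \<boxtimes> g) \<boxtimes> h) = ass C a c b \<cdot> (f \<boxtimes> (symm C b c \<cdot> (g \<boxtimes> h))) \<cdot> inverse_of C (ass C ?a ?b ?c)"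
    by (simp add: m_def ass_inverse_natural tens_cmp_extend)
  also have "\<dots> = ass C a c b \<cdot> (f \<boxtimes> (h \<boxtimes> g)) \<cdot> (idt C ?a \<boxtimes> symm C ?b ?c) \<cdot> inverse_of C (ass C ?a ?b ?c)"
    by (simp add: symm_natural tens_cmp_extend)
  also have "\<dots> = ((f \<boxtimes> h) \<boxtimes> g) \<cdot> m'"
    by (simp add: ass_natural_extend m'_def)
  finally have m: "m \<cdot> ((f \<boxtimes> g) \<boxtimes> h) = ((f \<boxtimes> h) \<boxtimes> g) \<cdot> m'" .
  have i: "interchange C a b c d = inverse_of C (ass C (a \<otimes> c) b d) \<cdot> (m \<boxtimes> idt C d) \<cdot> ass C (a \<otimes> b) c d"
    by (simp add: interchange_def m_def tens_cmp_extend)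
  have i': "interchange C ?a ?b ?c ?d = inverse_of C (ass C (?a \<otimes> ?c) ?b ?d) \<cdot> (m' \<boxtimes> idt C ?d) \<cdot> ass C (?a \<otimes> ?b) ?c ?d"
    by (simp add: interchange_def m'_def tens_cmp_extend)
  have "interchange C a b c d \<cdot> ((f \<boxtimes> g) \<boxtimes> (h \<boxtimes> k)) =
      inverse_of C (ass C (a \<otimes> c) b d) \<cdot> ((m \<cdot> ((f \<boxtimes> g) \<boxtimes> h)) \<boxtimes> k) \<cdot> ass C (?a \<otimes> ?b) ?c ?d"
    by (simp add: i ass_natural tens_cmp_extend)
  also have "\<dots> = (inverse_of C (ass C (a \<otimes> c) b d) \<cdot> (((f \<boxtimes> h) \<boxtimes> g) \<boxtimes> k)) \<cdot> (m' \<boxtimes> idt C ?d) \<cdot> ass C (?a \<otimes> ?b) ?c ?d"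
    by (simp add: m tens_cmp_extend)
  also have "\<dots> = ((f \<boxtimes> h) \<boxtimes> (g \<boxtimes> k)) \<cdot> interchange C ?a ?b ?c ?d"
    by (subst ass_inverse_natural) (simp_all add: i')
  finally show ?thesis .
qed

lemma interchange_natural_extend:
  "f \<in> Ar C \<Longrightarrow> g \<in> Ar C \<Longrightarrow> h \<in> Ar C \<Longrightarrow> k \<in> Ar C \<Longrightarrow>
   cd C f = a \<Longrightarrow> cd C g = b \<Longrightarrow> cd C h = c \<Longrightarrow> cd C k = d \<Longrightarrow>
   z \<in> Ar C \<Longrightarrow> cd C z = (dm C f \<otimes> dm C g) \<otimes> (dm C h \<otimes> dm C k) \<Longrightarrow>
   interchange C a b c d \<cdot> (((f \<boxtimes> g) \<boxtimes> (h \<boxtimes> k)) \<cdot> z) =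
    ((f \<boxtimes> h) \<boxtimes> (g \<boxtimes> k)) \<cdot> interchange C (dm C f) (dm C g) (dm C h) (dm C k) \<cdot> z"
  by (subst cmp_eq_extend[OF interchange_natural]) auto

text \<open>To apply coherence, a diagram is read as a pair of terms in the variables \<open>0, 1, \<dots>\<close>.\<close>

definition vars :: "'o list \<Rightarrow> nat \<Rightarrow> 'o" where
  "vars xs i = (if i < length xs then xs ! i else unt C)"

lemma vars_Ob: "set xs \<subseteq> Ob C \<Longrightarrow> vars xs i \<in> Ob C"
  by (auto simp: vars_def)

lemma vars_simps [simp]:
  "vars (x # xs) 0 = x" "vars (x # xs) (Suc i) = vars xs i"
  "vars (x # xs) (numeral n) = vars xs (pred_numeral n)" "vars (x # xs) 1 = vars xs 0"
  by (simp_all add: vars_def numeral_eq_Suc)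

text \<open>This lemma with \<open>interchange_runit\<close>, \<open>interchange_lunit\<close> and
  \<open>interchange_symm\<close> says that the tensor is itself a symmetric monoidal functor of two
  variables. They are the structural remainders of the functor axioms for
  \<open>smf_box\<close>.\<close>

lemma interchange_ass:
  assumes "a \<in> Ob C" "b \<in> Ob C" "c \<in> Ob C" "d \<in> Ob C" "e \<in> Ob C" "f \<in> Ob C"
  shows "(ass C a c e \<boxtimes> ass C b d f) \<cdot> interchange C a b (c \<otimes> e) (d \<otimes> f) \<cdot> (idt C (a \<otimes> b) \<boxtimes> interchange C c d e f) =
    interchange C (a \<otimes> c) (b \<otimes> d) e f \<cdot> (interchange C a b c d \<boxtimes> idt C (e \<otimes> f)) \<cdot> ass C (a \<otimes> b) (c \<otimes> d) (e \<otimes> f)"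
proof -
  let ?V = "\<lambda>i::nat. GenW i" and ?k = "\<lambda>_::unit. UnitW" and ?w = "\<lambda>_::unit. undefined"
  have "eval_tm C (vars [a,b,c,d,e,f]) ?w
      (CompT (tensT ?k ?k (AssT (?V 0) (?V 2) (?V 4)) (AssT (?V 1) (?V 3) (?V 5)))
       (CompT (interchangeT (?V 0) (?V 1) (TensW (?V 2) (?V 4)) (TensW (?V 3) (?V 5)))
         (LeftT (TensW (?V 0) (?V 1)) (interchangeT (?V 2) (?V 3) (?V 4) (?V 5))))) =
    eval_tm C (vars [a,b,c,d,e,f]) ?w
      (CompT (interchangeT (TensW (?V 0) (?V 2)) (TensW (?V 1) (?V 3)) (?V 4) (?V 5))
       (CompT (RightT (interchangeT (?V 0) (?V 1) (?V 2) (?V 3)) (TensW (?V 4) (?V 5)))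
         (AssT (TensW (?V 0) (?V 1)) (TensW (?V 2) (?V 3)) (TensW (?V 4) (?V 5)))))"
    by (rule coherence) (use assms in \<open>auto intro!: vars_Ob simp: interchangeT_def tensT_def\<close>)
  then show ?thesis using assms by (simp add: eval_tm_interchangeT tensT_def tens_simps)
qed

text \<open>This moves an interchange to the other side of an equation, as is needed whenever the
  two variables of a functor trade places.\<close>

lemma interchange_interchange:
  assumes "a \<in> Ob C" "b \<in> Ob C" "c \<in> Ob C" "d \<in> Ob C"
  shows "interchange C a c b d \<cdot> interchange C a b c d = idt C ((a \<otimes> b) \<otimes> (c \<otimes> d))"
proof -
  let ?V = "\<lambda>i::nat. GenW i" and ?k = "\<lambda>_::unit. UnitW" and ?w = "\<lambda>_::unit. undefined"
  have "eval_tm C (vars [a,b,c,d]) ?w ((CompT (interchangeT (?V 0) (?V 2) (?V 1) (?V 3)) (interchangeT (?V 0) (?V 1) (?V 2) (?V 3)))) =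
    eval_tm C (vars [a,b,c,d]) ?w ((IdT (TensW (TensW (?V 0) (?V 1)) (TensW (?V 2) (?V 3)))))"
    by (rule coherence) (use assms in \<open>auto intro!: vars_Ob simp: interchangeT_def tensT_def\<close>)
  then show ?thesis using assms by (simp add: eval_tm_interchangeT tensT_def tens_simps)
qed

lemma interchange_runit:
  assumes "a \<in> Ob C" "b \<in> Ob C"
  shows "(runit C a \<boxtimes> runit C b) \<cdot> interchange C a b (unt C) (unt C) \<cdot> (idt C (a \<otimes> b) \<boxtimes> inverse_of C (runit C (unt C))) = runit C (a \<otimes> b)"
proof -
  let ?V = "\<lambda>i::nat. GenW i" and ?k = "\<lambda>_::unit. UnitW" and ?w = "\<lambda>_::unit. undefined"
  have "eval_tm C (vars [a,b]) ?w ((CompT (tensT ?k ?k (RunitT (?V 0)) (RunitT (?V 1))) (CompT (interchangeT (?V 0) (?V 1) UnitW UnitW) (LeftT (TensW (?V 0) (?V 1)) (RunitInvT UnitW))))) =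
    eval_tm C (vars [a,b]) ?w ((RunitT (TensW (?V 0) (?V 1))))"
    by (rule coherence) (use assms in \<open>auto intro!: vars_Ob simp: interchangeT_def tensT_def\<close>)
  then show ?thesis using assms by (simp add: eval_tm_interchangeT tensT_def tens_simps)
qed

lemma interchange_lunit:
  assumes "a \<in> Ob C" "b \<in> Ob C"
  shows "(lunit C a \<boxtimes> lunit C b) \<cdot> interchange C (unt C) (unt C) a b \<cdot> (inverse_of C (runit C (unt C)) \<boxtimes> idt C (a \<otimes> b)) = lunit C (a \<otimes> b)"
proof -
  let ?V = "\<lambda>i::nat. GenW i" and ?k = "\<lambda>_::unit. UnitW" and ?w = "\<lambda>_::unit. undefined"
  have "eval_tm C (vars [a,b]) ?w ((CompT (tensT ?k ?k (LunitT (?V 0)) (LunitT (?V 1))) (CompT (interchangeT UnitW UnitW (?V 0) (?V 1)) (RightT (RunitInvT UnitW) (TensW (?V 0) (?V 1)))))) =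
    eval_tm C (vars [a,b]) ?w ((LunitT (TensW (?V 0) (?V 1))))"
    by (rule coherence) (use assms in \<open>auto intro!: vars_Ob simp: interchangeT_def tensT_def\<close>)
  then show ?thesis using assms by (simp add: eval_tm_interchangeT tensT_def tens_simps)
qed

lemma interchange_symm:
  assumes "a \<in> Ob C" "b \<in> Ob C" "c \<in> Ob C" "d \<in> Ob C"
  shows "(symm C a c \<boxtimes> symm C b d) \<cdot> interchange C a b c d = interchange C c d a b \<cdot> symm C (a \<otimes> b) (c \<otimes> d)"
proof -
  let ?V = "\<lambda>i::nat. GenW i" and ?k = "\<lambda>_::unit. UnitW" and ?w = "\<lambda>_::unit. undefined"
  have "eval_tm C (vars [a,b,c,d]) ?w ((CompT (tensT ?k ?k (SymmT (?V 0) (?V 2)) (SymmT (?V 1) (?V 3))) (interchangeT (?V 0) (?V 1) (?V 2) (?V 3)))) =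
    eval_tm C (vars [a,b,c,d]) ?w ((CompT (interchangeT (?V 2) (?V 3) (?V 0) (?V 1)) (SymmT (TensW (?V 0) (?V 1)) (TensW (?V 2) (?V 3)))))"
    by (rule coherence) (use assms in \<open>auto intro!: vars_Ob simp: interchangeT_def tensT_def\<close>)
  then show ?thesis using assms by (simp add: eval_tm_interchangeT tensT_def tens_simps)
qed

text \<open>Here the interchange is composed with structural arrows of the other kind: this lemma,
  \<open>runit_interchange\<close>, \<open>lunit_interchange\<close> and
  \<open>symm_interchange\<close> are the tensor conditions making the pointwise structural arrows
  of \<open>[A, B]\<close> monoidal transformations.\<close>

lemma ass_interchange:
  assumes "a \<in> Ob C" "b \<in> Ob C" "c \<in> Ob C" "d \<in> Ob C" "e \<in> Ob C" "f \<in> Ob C"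
  shows "ass C (a \<otimes> b) (c \<otimes> d) (e \<otimes> f) \<cdot> (idt C (a \<otimes> b) \<boxtimes> interchange C c e d f) \<cdot> interchange C a (c \<otimes> e) b (d \<otimes> f) = (interchange C a c b d \<boxtimes> idt C (e \<otimes> f)) \<cdot> interchange C (a \<otimes> c) e (b \<otimes> d) f \<cdot> (ass C a c e \<boxtimes> ass C b d f)"
proof -
  let ?V = "\<lambda>i::nat. GenW i" and ?k = "\<lambda>_::unit. UnitW" and ?w = "\<lambda>_::unit. undefined"
  have "eval_tm C (vars [a,b,c,d,e,f]) ?w ((CompT (AssT (TensW (?V 0) (?V 1)) (TensW (?V 2) (?V 3)) (TensW (?V 4) (?V 5))) (CompT (LeftT (TensW (?V 0) (?V 1)) (interchangeT (?V 2) (?V 4) (?V 3) (?V 5))) (interchangeT (?V 0) (TensW (?V 2) (?V 4)) (?V 1) (TensW (?V 3) (?V 5)))))) =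
    eval_tm C (vars [a,b,c,d,e,f]) ?w ((CompT (RightT (interchangeT (?V 0) (?V 2) (?V 1) (?V 3)) (TensW (?V 4) (?V 5))) (CompT (interchangeT (TensW (?V 0) (?V 2)) (?V 4) (TensW (?V 1) (?V 3)) (?V 5)) (tensT ?k ?k (AssT (?V 0) (?V 2) (?V 4)) (AssT (?V 1) (?V 3) (?V 5))))))"
    by (rule coherence) (use assms in \<open>auto intro!: vars_Ob simp: interchangeT_def tensT_def\<close>)
  then show ?thesis using assms by (simp add: eval_tm_interchangeT tensT_def tens_simps)
qed

lemma runit_interchange:
  assumes "a \<in> Ob C" "b \<in> Ob C"
  shows "runit C (a \<otimes> b) \<cdot> (idt C (a \<otimes> b) \<boxtimes> runit C (unt C)) \<cdot> interchange C a (unt C) b (unt C) = runit C a \<boxtimes> runit C b"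
proof -
  let ?V = "\<lambda>i::nat. GenW i" and ?k = "\<lambda>_::unit. UnitW" and ?w = "\<lambda>_::unit. undefined"
  have "eval_tm C (vars [a,b]) ?w ((CompT (RunitT (TensW (?V 0) (?V 1))) (CompT (LeftT (TensW (?V 0) (?V 1)) (RunitT UnitW)) (interchangeT (?V 0) UnitW (?V 1) UnitW)))) =
    eval_tm C (vars [a,b]) ?w ((tensT ?k ?k (RunitT (?V 0)) (RunitT (?V 1))))"
    by (rule coherence) (use assms in \<open>auto intro!: vars_Ob simp: interchangeT_def tensT_def\<close>)
  then show ?thesis using assms by (simp add: eval_tm_interchangeT tensT_def tens_simps)
qed

lemma lunit_interchange:
  assumes "a \<in> Ob C" "b \<in> Ob C"
  shows "lunit C (a \<otimes> b) \<cdot> (runit C (unt C) \<boxtimes> idt C (a \<otimes> b)) \<cdot> interchange C (unt C) a (unt C) b = lunit C a \<boxtimes> lunit C b"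
proof -
  let ?V = "\<lambda>i::nat. GenW i" and ?k = "\<lambda>_::unit. UnitW" and ?w = "\<lambda>_::unit. undefined"
  have "eval_tm C (vars [a,b]) ?w ((CompT (LunitT (TensW (?V 0) (?V 1))) (CompT (RightT (RunitT UnitW) (TensW (?V 0) (?V 1))) (interchangeT UnitW (?V 0) UnitW (?V 1))))) =
    eval_tm C (vars [a,b]) ?w ((tensT ?k ?k (LunitT (?V 0)) (LunitT (?V 1))))"
    by (rule coherence) (use assms in \<open>auto intro!: vars_Ob simp: interchangeT_def tensT_def\<close>)
  then show ?thesis using assms by (simp add: eval_tm_interchangeT tensT_def tens_simps)
qed

lemma symm_interchange:
  assumes "a \<in> Ob C" "b \<in> Ob C" "c \<in> Ob C" "d \<in> Ob C"
  shows "symm C (a \<otimes> b) (c \<otimes> d) \<cdot> interchange C a c b d = interchange C c a d b \<cdot> (symm C a c \<boxtimes> symm C b d)"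
proof -
  let ?V = "\<lambda>i::nat. GenW i" and ?k = "\<lambda>_::unit. UnitW" and ?w = "\<lambda>_::unit. undefined"
  have "eval_tm C (vars [a,b,c,d]) ?w ((CompT (SymmT (TensW (?V 0) (?V 1)) (TensW (?V 2) (?V 3))) (interchangeT (?V 0) (?V 2) (?V 1) (?V 3)))) =
    eval_tm C (vars [a,b,c,d]) ?w ((CompT (interchangeT (?V 2) (?V 0) (?V 3) (?V 1)) (tensT ?k ?k (SymmT (?V 0) (?V 2)) (SymmT (?V 1) (?V 3)))))"
    by (rule coherence) (use assms in \<open>auto intro!: vars_Ob simp: interchangeT_def tensT_def\<close>)
  then show ?thesis using assms by (simp add: eval_tm_interchangeT tensT_def tens_simps)
qed

lemma ass_unt: "ass C (unt C) (unt C) (unt C) = (inverse_of C (runit C (unt C)) \<boxtimes> idt C (unt C)) \<cdot> (idt C (unt C) \<boxtimes> runit C (unt C))"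
proof (rule iso_cancel_left[of "runit C (unt C) \<boxtimes> idt C (unt C)"])
  have "(runit C (unt C) \<boxtimes> idt C (unt C)) \<cdot> ass C (unt C) (unt C) (unt C) = idt C (unt C) \<boxtimes> runit C (unt C)"
    using triangle[of "unt C" "unt C"] by (simp only: lunit_unt Ob_unt simp_thms)
  also have "\<dots> = (runit C (unt C) \<boxtimes> idt C (unt C)) \<cdot> (inverse_of C (runit C (unt C)) \<boxtimes> idt C (unt C)) \<cdot> (idt C (unt C) \<boxtimes> runit C (unt C))"
    by (simp add: tens_cmp_extend)
  finally show "(runit C (unt C) \<boxtimes> idt C (unt C)) \<cdot> ass C (unt C) (unt C) (unt C) =
    (runit C (unt C) \<boxtimes> idt C (unt C)) \<cdot> (inverse_of C (runit C (unt C)) \<boxtimes> idt C (unt C)) \<cdot> (idt C (unt C) \<boxtimes> runit C (unt C))" .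
qed simp_all

lemma symm_unt: "symm C (unt C) (unt C) = idt C (unt C \<otimes> unt C)"
  by (rule iso_cancel_left[of "lunit C (unt C)"]) (simp_all add: lunit_unt runit_symm)

end

section \<open>Symmetric monoidal functors and transformations\<close>

text \<open>Typing is expressed by \<open>Ar\<close>, \<open>dm\<close> and \<open>cd\<close> rather
  than by hom-sets, the form in which the simplifier computes sources and targets.\<close>

lemma smfI:
  assumes "SMC A" "SMC B"
    and "FO F \<in> extensional (Ob A)" "FA F \<in> extensional (Ar A)" "F2 F \<in> extensional (Ob A)"
    and "\<And>x. x \<in> Ob A \<Longrightarrow> F2 F x \<in> extensional (Ob A)"
    and "\<And>x. x \<in> Ob A \<Longrightarrow> FO F x \<in> Ob B"
    and "\<And>f. f \<in> Ar A \<Longrightarrow> FA F f \<in> Ar B \<and> dm B (FA F f) = FO F (dm A f) \<and> cd B (FA F f) = FO F (cd A f)"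
    and "\<And>x. x \<in> Ob A \<Longrightarrow> FA F (idt A x) = idt B (FO F x)"
    and "\<And>f g. f \<in> Ar A \<Longrightarrow> g \<in> Ar A \<Longrightarrow> dm A g = cd A f \<Longrightarrow> FA F (g \<cdot>\<^bsub>A\<^esub> f) = FA F g \<cdot>\<^bsub>B\<^esub> FA F f"
    and "F0 F \<in> Ar B \<and> dm B (F0 F) = unt B \<and> cd B (F0 F) = FO F (unt A)"
    and "\<And>x y. x \<in> Ob A \<Longrightarrow> y \<in> Ob A \<Longrightarrow> F2 F x y \<in> Ar B \<and>
      dm B (F2 F x y) = FO F x \<otimes>\<^bsub>B\<^esub> FO F y \<and> cd B (F2 F x y) = FO F (x \<otimes>\<^bsub>A\<^esub> y)"
    and "\<And>f g. f \<in> Ar A \<Longrightarrow> g \<in> Ar A \<Longrightarrow>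
      F2 F (cd A f) (cd A g) \<cdot>\<^bsub>B\<^esub> (FA F f \<boxtimes>\<^bsub>B\<^esub> FA F g) = FA F (f \<boxtimes>\<^bsub>A\<^esub> g) \<cdot>\<^bsub>B\<^esub> F2 F (dm A f) (dm A g)"
    and "\<And>x y z. x \<in> Ob A \<Longrightarrow> y \<in> Ob A \<Longrightarrow> z \<in> Ob A \<Longrightarrow>
      FA F (ass A x y z) \<cdot>\<^bsub>B\<^esub> F2 F x (y \<otimes>\<^bsub>A\<^esub> z) \<cdot>\<^bsub>B\<^esub> (idt B (FO F x) \<boxtimes>\<^bsub>B\<^esub> F2 F y z) =
      F2 F (x \<otimes>\<^bsub>A\<^esub> y) z \<cdot>\<^bsub>B\<^esub> (F2 F x y \<boxtimes>\<^bsub>B\<^esub> idt B (FO F z)) \<cdot>\<^bsub>B\<^esub> ass B (FO F x) (FO F y) (FO F z)"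
    and "\<And>x. x \<in> Ob A \<Longrightarrow>
      FA F (runit A x) \<cdot>\<^bsub>B\<^esub> F2 F x (unt A) \<cdot>\<^bsub>B\<^esub> (idt B (FO F x) \<boxtimes>\<^bsub>B\<^esub> F0 F) = runit B (FO F x)"
    and "\<And>x. x \<in> Ob A \<Longrightarrow>
      FA F (lunit A x) \<cdot>\<^bsub>B\<^esub> F2 F (unt A) x \<cdot>\<^bsub>B\<^esub> (F0 F \<boxtimes>\<^bsub>B\<^esub> idt B (FO F x)) = lunit B (FO F x)"
    and "\<And>x y. x \<in> Ob A \<Longrightarrow> y \<in> Ob A \<Longrightarrow>
      FA F (symm A x y) \<cdot>\<^bsub>B\<^esub> F2 F x y = F2 F y x \<cdot>\<^bsub>B\<^esub> symm B (FO F x) (FO F y)"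
  shows "SMF A B F"
  unfolding symmetric_monoidal_functor_def symmetric_monoidal_functor_axioms_def
  using assms by (auto simp: hom_iff)

context symmetric_monoidal_functor begin

lemma FO_in [simp]: "x \<in> Ob A \<Longrightarrow> FO F x \<in> Ob B" by (rule FO_Ob)

lemma FA_typing [simp]:
  assumes "f \<in> Ar A"
  shows "FA F f \<in> Ar B" "dm B (FA F f) = FO F (dm A f)" "cd B (FA F f) = FO F (cd A f)"
  using FA_hom[of f "dm A f" "cd A f"] assms by (auto simp: hom_iff)

lemma FA_cmp' [simp]:
  "f \<in> Ar A \<Longrightarrow> g \<in> Ar A \<Longrightarrow> dm A g = cd A f \<Longrightarrow> FA F (g \<cdot>\<^bsub>A\<^esub> f) = FA F g \<cdot>\<^bsub>B\<^esub> FA F f"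
  using FA_cmp[of f "dm A f" "cd A f" g "cd A g"] by (auto simp: hom_iff)

declare FA_idt [simp]

lemma F0_typing [simp]: "F0 F \<in> Ar B" "dm B (F0 F) = unt B" "cd B (F0 F) = FO F (unt A)"
  using F0_hom by (auto simp: hom_iff)

lemma F2_typing [simp]:
  assumes "x \<in> Ob A" "y \<in> Ob A"
  shows "F2 F x y \<in> Ar B" "dm B (F2 F x y) = FO F x \<otimes>\<^bsub>B\<^esub> FO F y" "cd B (F2 F x y) = FO F (x \<otimes>\<^bsub>A\<^esub> y)"
  using F2_hom[OF assms] by (auto simp: hom_iff)

lemma F2_natural:
  "f \<in> Ar A \<Longrightarrow> g \<in> Ar A \<Longrightarrow> cd A f = x \<Longrightarrow> cd A g = y \<Longrightarrow>
   F2 F x y \<cdot>\<^bsub>B\<^esub> (FA F f \<boxtimes>\<^bsub>B\<^esub> FA F g) = FA F (f \<boxtimes>\<^bsub>A\<^esub> g) \<cdot>\<^bsub>B\<^esub> F2 F (dm A f) (dm A g)"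
  using F2_nat[of f "dm A f" x g "dm A g" y] by (auto simp: hom_iff)

lemma F2_natural_extend:
  "f \<in> Ar A \<Longrightarrow> g \<in> Ar A \<Longrightarrow> cd A f = x \<Longrightarrow> cd A g = y \<Longrightarrow> k \<in> Ar B \<Longrightarrow>
   cd B k = FO F (dm A f) \<otimes>\<^bsub>B\<^esub> FO F (dm A g) \<Longrightarrow>
   F2 F x y \<cdot>\<^bsub>B\<^esub> ((FA F f \<boxtimes>\<^bsub>B\<^esub> FA F g) \<cdot>\<^bsub>B\<^esub> k) = FA F (f \<boxtimes>\<^bsub>A\<^esub> g) \<cdot>\<^bsub>B\<^esub> (F2 F (dm A f) (dm A g) \<cdot>\<^bsub>B\<^esub> k)"
  by (subst target.cmp_eq_extend[OF F2_natural]) auto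

lemma is_inv_FA: "iso A f \<Longrightarrow> is_inv B (FA F f) (FA F (inverse_of A f))"
  by (rule target.is_invI) (simp_all add: source.iso_Ar FA_cmp'[symmetric] del: FA_cmp')

lemma iso_FA [simp]: "iso A f \<Longrightarrow> iso B (FA F f)"
  using is_inv_FA by (auto simp: iso_def)

lemma FA_inverse: "iso A f \<Longrightarrow> FA F (inverse_of A f) = inverse_of B (FA F f)"
  using target.inverse_of_eq[OF is_inv_FA] by simp

text \<open>A family \<open>t g : u' g \<rightarrow> F (u g)\<close> extends to words: \<open>u' X \<rightarrow> F (u X)\<close>.\<close>

primrec lax_comp :: "('g \<Rightarrow> 'o) \<Rightarrow> ('g \<Rightarrow> 'n) \<Rightarrow> 'g word \<Rightarrow> 'n" where
  "lax_comp u t UnitW = F0 F"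
| "lax_comp u t (GenW g) = t g"
| "lax_comp u t (TensW X Y) =
     F2 F (eval_word A u X) (eval_word A u Y) \<cdot>\<^bsub>B\<^esub> (lax_comp u t X \<boxtimes>\<^bsub>B\<^esub> lax_comp u t Y)"

lemma lax_comp_typing:
  assumes a: "source.assignment P u w"
    and t: "\<And>g. g \<in> ogens P \<Longrightarrow> t g \<in> Ar B \<and> dm B (t g) = u' g \<and> cd B (t g) = FO F (u g)"
  shows "X \<in> words P \<Longrightarrow> lax_comp u t X \<in> Ar B \<and> dm B (lax_comp u t X) = eval_word B u' X \<and>
    cd B (lax_comp u t X) = FO F (eval_word A u X)"
  by (induction X) (auto simp: t source.eval_word_Ob[OF a])

text \<open>Naturality needs checking on arrow generators only: on structural arrows it is the
  corresponding axiom of \<open>F\<close>, and the property is stable under composition and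
  whiskering. All 2-cells out of presented categories arise from this lemma.\<close>

lemma lax_comp_natural:
  assumes a: "source.assignment P u w" and a': "target.assignment P u' w'"
    and t: "\<And>g. g \<in> ogens P \<Longrightarrow> t g \<in> Ar B \<and> dm B (t g) = u' g \<and> cd B (t g) = FO F (u g)"
    and gens: "\<And>k. k \<in> agens P \<Longrightarrow> adom P k \<in> words P \<and> acod P k \<in> words P"
    and nat: "\<And>k. k \<in> agens P \<Longrightarrow> lax_comp u t (acod P k) \<cdot>\<^bsub>B\<^esub> w' k = FA F (w k) \<cdot>\<^bsub>B\<^esub> lax_comp u t (adom P k)"
  shows "wf_tm P p \<Longrightarrow> tdom (adom P) p \<in> words P \<and> tcod (acod P) p \<in> words P \<and>
    lax_comp u t (tcod (acod P) p) \<cdot>\<^bsub>B\<^esub> eval_tm B u' w' p = FA F (eval_tm A u w p) \<cdot>\<^bsub>B\<^esub> lax_comp u t (tdom (adom P) p)"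
proof -
  note [simp] = source.eval_word_Ob[OF a] target.eval_word_Ob[OF a'] source.eval_tm_typing[OF a]
    target.eval_tm_typing[OF a'] lax_comp_typing[OF a t]
  have ass: "lax_comp u t (TensW (TensW X Y) Z) \<cdot>\<^bsub>B\<^esub> ass B (eval_word B u' X) (eval_word B u' Y) (eval_word B u' Z) =
      FA F (ass A (eval_word A u X) (eval_word A u Y) (eval_word A u Z)) \<cdot>\<^bsub>B\<^esub> lax_comp u t (TensW X (TensW Y Z))"
    if [simp]: "X \<in> words P" "Y \<in> words P" "Z \<in> words P" for X Y Z
  proof -
    let ?u = "eval_word A u" and ?l = "lax_comp u t"
    have "?l (TensW (TensW X Y) Z) \<cdot>\<^bsub>B\<^esub> ass B (eval_word B u' X) (eval_word B u' Y) (eval_word B u' Z) =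
      F2 F (?u X \<otimes>\<^bsub>A\<^esub> ?u Y) (?u Z) \<cdot>\<^bsub>B\<^esub> (F2 F (?u X) (?u Y) \<boxtimes>\<^bsub>B\<^esub> idt B (FO F (?u Z))) \<cdot>\<^bsub>B\<^esub>
        (((?l X \<boxtimes>\<^bsub>B\<^esub> ?l Y) \<boxtimes>\<^bsub>B\<^esub> ?l Z) \<cdot>\<^bsub>B\<^esub> ass B (eval_word B u' X) (eval_word B u' Y) (eval_word B u' Z))"
      by (simp add: target.tens_simps)
    also have "((?l X \<boxtimes>\<^bsub>B\<^esub> ?l Y) \<boxtimes>\<^bsub>B\<^esub> ?l Z) \<cdot>\<^bsub>B\<^esub> ass B (eval_word B u' X) (eval_word B u' Y) (eval_word B u' Z) =
        ass B (FO F (?u X)) (FO F (?u Y)) (FO F (?u Z)) \<cdot>\<^bsub>B\<^esub> (?l X \<boxtimes>\<^bsub>B\<^esub> (?l Y \<boxtimes>\<^bsub>B\<^esub> ?l Z))"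
      by (simp add: target.ass_natural)
    also have "F2 F (?u X \<otimes>\<^bsub>A\<^esub> ?u Y) (?u Z) \<cdot>\<^bsub>B\<^esub> (F2 F (?u X) (?u Y) \<boxtimes>\<^bsub>B\<^esub> idt B (FO F (?u Z))) \<cdot>\<^bsub>B\<^esub> \<dots> =
      (F2 F (?u X \<otimes>\<^bsub>A\<^esub> ?u Y) (?u Z) \<cdot>\<^bsub>B\<^esub> (F2 F (?u X) (?u Y) \<boxtimes>\<^bsub>B\<^esub> idt B (FO F (?u Z))) \<cdot>\<^bsub>B\<^esub>
        ass B (FO F (?u X)) (FO F (?u Y)) (FO F (?u Z))) \<cdot>\<^bsub>B\<^esub> (?l X \<boxtimes>\<^bsub>B\<^esub> (?l Y \<boxtimes>\<^bsub>B\<^esub> ?l Z))"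
      by simp
    also have "\<dots> = FA F (ass A (?u X) (?u Y) (?u Z)) \<cdot>\<^bsub>B\<^esub> ?l (TensW X (TensW Y Z))"
      by (subst F2_ass[symmetric]) (simp_all add: target.tens_simps)
    finally show ?thesis .
  qed
  have runit: "lax_comp u t X \<cdot>\<^bsub>B\<^esub> runit B (eval_word B u' X) = FA F (runit A (eval_word A u X)) \<cdot>\<^bsub>B\<^esub> lax_comp u t (TensW X UnitW)"
    if [simp]: "X \<in> words P" for X
  proof -
    have "lax_comp u t X \<cdot>\<^bsub>B\<^esub> runit B (eval_word B u' X) = runit B (FO F (eval_word A u X)) \<cdot>\<^bsub>B\<^esub> (lax_comp u t X \<boxtimes>\<^bsub>B\<^esub> idt B (unt B))"
      by (simp add: target.runit_natural)
    then show ?thesis by (simp add: F2_runit[symmetric] target.tens_simps)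
  qed
  have lunit: "lax_comp u t X \<cdot>\<^bsub>B\<^esub> lunit B (eval_word B u' X) = FA F (lunit A (eval_word A u X)) \<cdot>\<^bsub>B\<^esub> lax_comp u t (TensW UnitW X)"
    if [simp]: "X \<in> words P" for X
  proof -
    have "lax_comp u t X \<cdot>\<^bsub>B\<^esub> lunit B (eval_word B u' X) = lunit B (FO F (eval_word A u X)) \<cdot>\<^bsub>B\<^esub> (idt B (unt B) \<boxtimes>\<^bsub>B\<^esub> lax_comp u t X)"
      by (simp add: target.lunit_natural)
    then show ?thesis by (simp add: F2_lunit[symmetric] target.tens_simps)
  qed
  have symm: "lax_comp u t (TensW Y X) \<cdot>\<^bsub>B\<^esub> symm B (eval_word B u' X) (eval_word B u' Y) =
      FA F (symm A (eval_word A u X) (eval_word A u Y)) \<cdot>\<^bsub>B\<^esub> lax_comp u t (TensW X Y)"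
    if [simp]: "X \<in> words P" "Y \<in> words P" for X Y
    using target.cmp_eq_extend[OF F2_symm[of "eval_word A u X" "eval_word A u Y"], of "lax_comp u t X \<boxtimes>\<^bsub>B\<^esub> lax_comp u t Y"]
    by (simp add: target.symm_natural)
  \<comment> \<open>The formal inverses of structural arrows are treated uniformly: a commuting
    square with two invertible parallel sides may be read backwards.\<close>
  have inv: "l' \<cdot>\<^bsub>B\<^esub> inverse_of B e = FA F (inverse_of A f) \<cdot>\<^bsub>B\<^esub> l"
    if h: "l \<cdot>\<^bsub>B\<^esub> e = FA F f \<cdot>\<^bsub>B\<^esub> l'" "iso A f" "iso B e" "l \<in> Ar B" "l' \<in> Ar B"
      "dm B l = cd B e" "cd B l = FO F (cd A f)" "dm B l' = dm B e" "cd B l' = FO F (dm A f)" for l l' e f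
  proof (rule target.iso_cancel_left[of "FA F f"])
    note [simp] = that(2-) source.iso_Ar[OF that(2)] target.iso_Ar[OF that(3)]
    have "FA F f \<cdot>\<^bsub>B\<^esub> l' \<cdot>\<^bsub>B\<^esub> inverse_of B e = (FA F f \<cdot>\<^bsub>B\<^esub> l') \<cdot>\<^bsub>B\<^esub> inverse_of B e" by simp
    also have "\<dots> = l" unfolding h(1)[symmetric] by simp
    also have "\<dots> = FA F f \<cdot>\<^bsub>B\<^esub> FA F (inverse_of A f) \<cdot>\<^bsub>B\<^esub> l"
      by (simp add: FA_inverse)
    finally show "FA F f \<cdot>\<^bsub>B\<^esub> l' \<cdot>\<^bsub>B\<^esub> inverse_of B e = FA F f \<cdot>\<^bsub>B\<^esub> FA F (inverse_of A f) \<cdot>\<^bsub>B\<^esub> l" .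
  qed (use that in \<open>auto simp: source.iso_Ar target.iso_Ar\<close>)
  show "wf_tm P p \<Longrightarrow> ?thesis"
  proof (induction p)
    case (CompT q p)
    then have [simp]: "wf_tm P q" "wf_tm P p" "tcod (acod P) p = tdom (adom P) q" by auto
    have q: "lax_comp u t (tcod (acod P) q) \<cdot>\<^bsub>B\<^esub> eval_tm B u' w' q = FA F (eval_tm A u w q) \<cdot>\<^bsub>B\<^esub> lax_comp u t (tdom (adom P) q)"
     and p: "lax_comp u t (tcod (acod P) p) \<cdot>\<^bsub>B\<^esub> eval_tm B u' w' p = FA F (eval_tm A u w p) \<cdot>\<^bsub>B\<^esub> lax_comp u t (tdom (adom P) p)"
     and [simp]: "tdom (adom P) p \<in> words P" "tdom (adom P) q \<in> words P" "tcod (acod P) q \<in> words P"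
      using CompT by auto
    have "lax_comp u t (tcod (acod P) q) \<cdot>\<^bsub>B\<^esub> eval_tm B u' w' q \<cdot>\<^bsub>B\<^esub> eval_tm B u' w' p =
       (lax_comp u t (tcod (acod P) q) \<cdot>\<^bsub>B\<^esub> eval_tm B u' w' q) \<cdot>\<^bsub>B\<^esub> eval_tm B u' w' p" by simp
    also have "\<dots> = FA F (eval_tm A u w q) \<cdot>\<^bsub>B\<^esub> (lax_comp u t (tcod (acod P) p) \<cdot>\<^bsub>B\<^esub> eval_tm B u' w' p)"
      unfolding q by simp
    finally show ?case using CompT p by simp
  next
    case (LeftT X p)
    let ?i = "idt A (eval_word A u X)"
    have [simp]: "wf_tm P p" "X \<in> words P" "tdom (adom P) p \<in> words P" "tcod (acod P) p \<in> words P"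
      using LeftT by auto
    show ?case using LeftT F2_natural_extend[of ?i "eval_tm A u w p" "eval_word A u X" _ "lax_comp u t X \<boxtimes>\<^bsub>B\<^esub> lax_comp u t (tdom (adom P) p)"]
      by (simp add: target.tens_simps)
  next
    case (RightT p X)
    let ?i = "idt A (eval_word A u X)"
    have [simp]: "wf_tm P p" "X \<in> words P" "tdom (adom P) p \<in> words P" "tcod (acod P) p \<in> words P"
      using RightT by auto
    show ?case using RightT F2_natural_extend[of "eval_tm A u w p" ?i _ "eval_word A u X" "lax_comp u t (tdom (adom P) p) \<boxtimes>\<^bsub>B\<^esub> lax_comp u t X"]
      by (simp add: target.tens_simps)
  next
    case (AssT X Y Z)
    then show ?case using ass by (simp del: lax_comp.simps)
  next
    case (AssInvT X Y Z)
    then show ?case using inv[OF ass] by (simp del: lax_comp.simps)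
  next
    case (RunitT X)
    then show ?case using runit by (simp del: lax_comp.simps)
  next
    case (RunitInvT X)
    then show ?case using inv[OF runit] by (simp del: lax_comp.simps)
  next
    case (LunitT X)
    then show ?case using lunit by (simp del: lax_comp.simps)
  next
    case (LunitInvT X)
    then show ?case using inv[OF lunit] by (simp del: lax_comp.simps)
  next
    case (SymmT X Y)
    then show ?case using symm by (simp del: lax_comp.simps)
  qed (auto simp: gens nat)
qed

text \<open>The interchange is a term without generators, so this is \<open>lax_comp_natural\<close>
  for the free presentation on four variables, the starting family being identities.\<close>

lemma F2_interchange:
  assumes [simp]: "a \<in> Ob A" "b \<in> Ob A" "c \<in> Ob A" "d \<in> Ob A"
  shows "FA F (interchange A a b c d) \<cdot>\<^bsub>B\<^esub> F2 F (a \<otimes>\<^bsub>A\<^esub> b) (c \<otimes>\<^bsub>A\<^esub> d) \<cdot>\<^bsub>B\<^esub> (F2 F a b \<boxtimes>\<^bsub>B\<^esub> F2 F c d) =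
    F2 F (a \<otimes>\<^bsub>A\<^esub> c) (b \<otimes>\<^bsub>A\<^esub> d) \<cdot>\<^bsub>B\<^esub> (F2 F a c \<boxtimes>\<^bsub>B\<^esub> F2 F b d) \<cdot>\<^bsub>B\<^esub>
      interchange B (FO F a) (FO F b) (FO F c) (FO F d)"
proof -
  let ?u = "source.vars [a, b, c, d]" let ?u' = "\<lambda>i. FO F (?u i)" let ?w = "\<lambda>_::unit. undefined"
  let ?p = "interchangeT (GenW 0) (GenW 1) (GenW 2) (GenW 3)"
  let ?t = "\<lambda>i. idt B (?u' i)"
  have u: "\<And>i. ?u i \<in> Ob A" by (auto intro!: source.vars_Ob)
  have "lax_comp ?u ?t (tcod (acod free_pres) ?p) \<cdot>\<^bsub>B\<^esub> eval_tm B ?u' ?w ?p =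
      FA F (eval_tm A ?u ?w ?p) \<cdot>\<^bsub>B\<^esub> lax_comp ?u ?t (tdom (adom free_pres) ?p)"
    using lax_comp_natural[of free_pres ?u ?w ?u' ?w ?t ?p] u
    by (auto simp: source.assignment_def target.assignment_def interchangeT_def)
  then have e: "lax_comp ?u ?t (TensW (TensW (GenW 0) (GenW 2)) (TensW (GenW 1) (GenW 3))) \<cdot>\<^bsub>B\<^esub> eval_tm B ?u' ?w ?p =
      FA F (eval_tm A ?u ?w ?p) \<cdot>\<^bsub>B\<^esub> lax_comp ?u ?t (TensW (TensW (GenW 0) (GenW 1)) (TensW (GenW 2) (GenW 3)))"
    by (simp only: interchangeT_def tdom.simps tcod.simps)
  show ?thesis using e
    by (simp add: source.eval_tm_interchangeT target.eval_tm_interchangeT target.tens_simps)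
qed

end

lemma smf_eqI:
  assumes "SMF A B F" "SMF A B G"
    and "\<And>x. x \<in> Ob A \<Longrightarrow> FO F x = FO G x" "\<And>f. f \<in> Ar A \<Longrightarrow> FA F f = FA G f"
    and "F0 F = F0 G" "\<And>x y. x \<in> Ob A \<Longrightarrow> y \<in> Ob A \<Longrightarrow> F2 F x y = F2 G x y"
  shows "F = G"
proof -
  interpret F: symmetric_monoidal_functor A B F by fact
  interpret G: symmetric_monoidal_functor A B G by fact
  have "FO F = FO G" by (rule extensionalityI[OF F.FO_ext G.FO_ext]) (rule assms)
  moreover have "FA F = FA G" by (rule extensionalityI[OF F.FA_ext G.FA_ext]) (rule assms)
  moreover have "F2 F x = F2 G x" if "x \<in> Ob A" for x
    by (rule extensionalityI[OF F.F2_ext(2) G.F2_ext(2)]) (use that assms in auto)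
  then have "F2 F = F2 G" by (intro extensionalityI[OF F.F2_ext(1) G.F2_ext(1)])
  ultimately show ?thesis using assms(5) by (cases F; cases G) auto
qed

lemma smf_id: "SMC A \<Longrightarrow> SMF A A (smf_id A)"
proof -
  assume "SMC A"
  then interpret symmetric_monoidal_category A .
  show ?thesis
    by (rule smfI) (unfold_locales, auto simp: smf_id_def pentagon triangle)
qed

lemma smf_comp:
  assumes "SMF A B F" "SMF B C G"
  shows "SMF A C (smf_comp A C G F)"
proof -
  interpret F: symmetric_monoidal_functor A B F by fact
  interpret G: symmetric_monoidal_functor B C G by fact
  note GF = G.FA_cmp'[symmetric]
  show ?thesis
  proof (rule smfI)
    fix f g assume [simp]: "f \<in> Ar A" "g \<in> Ar A"
    have "FA G (F2 F (cd A f) (cd A g)) \<cdot>\<^bsub>C\<^esub> (F2 G (FO F (cd A f)) (FO F (cd A g)) \<cdot>\<^bsub>C\<^esub> (FA G (FA F f) \<boxtimes>\<^bsub>C\<^esub> FA G (FA F g))) =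
      FA G (F2 F (cd A f) (cd A g) \<cdot>\<^bsub>B\<^esub> (FA F f \<boxtimes>\<^bsub>B\<^esub> FA F g)) \<cdot>\<^bsub>C\<^esub> F2 G (FO F (dm A f)) (FO F (dm A g))"
      by (simp add: G.F2_natural)
    then show "F2 (smf_comp A C G F) (cd A f) (cd A g) \<cdot>\<^bsub>C\<^esub> (FA (smf_comp A C G F) f \<boxtimes>\<^bsub>C\<^esub> FA (smf_comp A C G F) g) =
        FA (smf_comp A C G F) (f \<boxtimes>\<^bsub>A\<^esub> g) \<cdot>\<^bsub>C\<^esub> F2 (smf_comp A C G F) (dm A f) (dm A g)"
      by (simp add: smf_comp_def F.F2_natural)
  next
    fix x y z assume [simp]: "x \<in> Ob A" "y \<in> Ob A" "z \<in> Ob A"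
    let ?x = "FO F x" and ?y = "FO F y" and ?z = "FO F z"
    have "FA G (FA F (ass A x y z)) \<cdot>\<^bsub>C\<^esub> (FA G (F2 F x (y \<otimes>\<^bsub>A\<^esub> z)) \<cdot>\<^bsub>C\<^esub> F2 G ?x (FO F (y \<otimes>\<^bsub>A\<^esub> z))) \<cdot>\<^bsub>C\<^esub>
         (idt C (FO G ?x) \<boxtimes>\<^bsub>C\<^esub> (FA G (F2 F y z) \<cdot>\<^bsub>C\<^esub> F2 G ?y ?z)) =
       FA G (FA F (ass A x y z)) \<cdot>\<^bsub>C\<^esub> FA G (F2 F x (y \<otimes>\<^bsub>A\<^esub> z)) \<cdot>\<^bsub>C\<^esub> (F2 G ?x (FO F (y \<otimes>\<^bsub>A\<^esub> z)) \<cdot>\<^bsub>C\<^esub>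
         (FA G (idt B ?x) \<boxtimes>\<^bsub>C\<^esub> FA G (F2 F y z))) \<cdot>\<^bsub>C\<^esub> (idt C (FO G ?x) \<boxtimes>\<^bsub>C\<^esub> F2 G ?y ?z)"
      by (simp add: G.target.tens_simps)
    also have "\<dots> = FA G (FA F (ass A x y z) \<cdot>\<^bsub>B\<^esub> F2 F x (y \<otimes>\<^bsub>A\<^esub> z) \<cdot>\<^bsub>B\<^esub> (idt B ?x \<boxtimes>\<^bsub>B\<^esub> F2 F y z)) \<cdot>\<^bsub>C\<^esub>
        F2 G ?x (?y \<otimes>\<^bsub>B\<^esub> ?z) \<cdot>\<^bsub>C\<^esub> (idt C (FO G ?x) \<boxtimes>\<^bsub>C\<^esub> F2 G ?y ?z)"
      by (subst G.F2_natural) simp_all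
    also have "\<dots> = FA G (F2 F (x \<otimes>\<^bsub>A\<^esub> y) z) \<cdot>\<^bsub>C\<^esub> FA G (F2 F x y \<boxtimes>\<^bsub>B\<^esub> idt B ?z) \<cdot>\<^bsub>C\<^esub> (FA G (ass B ?x ?y ?z) \<cdot>\<^bsub>C\<^esub>
        F2 G ?x (?y \<otimes>\<^bsub>B\<^esub> ?z) \<cdot>\<^bsub>C\<^esub> (idt C (FO G ?x) \<boxtimes>\<^bsub>C\<^esub> F2 G ?y ?z))"
      by (subst F.F2_ass) simp_all
    also have "\<dots> = FA G (F2 F (x \<otimes>\<^bsub>A\<^esub> y) z) \<cdot>\<^bsub>C\<^esub> (FA G (F2 F x y \<boxtimes>\<^bsub>B\<^esub> idt B ?z) \<cdot>\<^bsub>C\<^esub> F2 G (?x \<otimes>\<^bsub>B\<^esub> ?y) ?z) \<cdot>\<^bsub>C\<^esub>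
        (F2 G ?x ?y \<boxtimes>\<^bsub>C\<^esub> idt C (FO G ?z)) \<cdot>\<^bsub>C\<^esub> ass C (FO G ?x) (FO G ?y) (FO G ?z)"
      by (subst G.F2_ass) simp_all
    also have "\<dots> = FA G (F2 F (x \<otimes>\<^bsub>A\<^esub> y) z) \<cdot>\<^bsub>C\<^esub> (F2 G (FO F (x \<otimes>\<^bsub>A\<^esub> y)) ?z \<cdot>\<^bsub>C\<^esub> (FA G (F2 F x y) \<boxtimes>\<^bsub>C\<^esub> FA G (idt B ?z))) \<cdot>\<^bsub>C\<^esub>
        (F2 G ?x ?y \<boxtimes>\<^bsub>C\<^esub> idt C (FO G ?z)) \<cdot>\<^bsub>C\<^esub> ass C (FO G ?x) (FO G ?y) (FO G ?z)"
      by (subst G.F2_natural) simp_all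
    also have "\<dots> = (FA G (F2 F (x \<otimes>\<^bsub>A\<^esub> y) z) \<cdot>\<^bsub>C\<^esub> F2 G (FO F (x \<otimes>\<^bsub>A\<^esub> y)) ?z) \<cdot>\<^bsub>C\<^esub> ((FA G (F2 F x y) \<cdot>\<^bsub>C\<^esub> F2 G ?x ?y) \<boxtimes>\<^bsub>C\<^esub> idt C (FO G ?z)) \<cdot>\<^bsub>C\<^esub> ass C (FO G ?x) (FO G ?y) (FO G ?z)"
      by (simp add: G.target.tens_simps)
    finally show "FA (smf_comp A C G F) (ass A x y z) \<cdot>\<^bsub>C\<^esub> F2 (smf_comp A C G F) x (y \<otimes>\<^bsub>A\<^esub> z) \<cdot>\<^bsub>C\<^esub>
         (idt C (FO (smf_comp A C G F) x) \<boxtimes>\<^bsub>C\<^esub> F2 (smf_comp A C G F) y z) =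
       F2 (smf_comp A C G F) (x \<otimes>\<^bsub>A\<^esub> y) z \<cdot>\<^bsub>C\<^esub> (F2 (smf_comp A C G F) x y \<boxtimes>\<^bsub>C\<^esub> idt C (FO (smf_comp A C G F) z)) \<cdot>\<^bsub>C\<^esub>
         ass C (FO (smf_comp A C G F) x) (FO (smf_comp A C G F) y) (FO (smf_comp A C G F) z)"
      by (simp add: smf_comp_def)
  next
    fix x assume [simp]: "x \<in> Ob A"
    let ?x = "FO F x"
    have "FA G (FA F (runit A x)) \<cdot>\<^bsub>C\<^esub> (FA G (F2 F x (unt A)) \<cdot>\<^bsub>C\<^esub> F2 G ?x (FO F (unt A))) \<cdot>\<^bsub>C\<^esub>
         (idt C (FO G ?x) \<boxtimes>\<^bsub>C\<^esub> (FA G (F0 F) \<cdot>\<^bsub>C\<^esub> F0 G)) =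
       FA G (FA F (runit A x)) \<cdot>\<^bsub>C\<^esub> FA G (F2 F x (unt A)) \<cdot>\<^bsub>C\<^esub> (F2 G ?x (FO F (unt A)) \<cdot>\<^bsub>C\<^esub>
         (FA G (idt B ?x) \<boxtimes>\<^bsub>C\<^esub> FA G (F0 F))) \<cdot>\<^bsub>C\<^esub> (idt C (FO G ?x) \<boxtimes>\<^bsub>C\<^esub> F0 G)"
      by (simp add: G.target.tens_simps)
    also have "\<dots> = FA G (FA F (runit A x) \<cdot>\<^bsub>B\<^esub> F2 F x (unt A) \<cdot>\<^bsub>B\<^esub> (idt B ?x \<boxtimes>\<^bsub>B\<^esub> F0 F)) \<cdot>\<^bsub>C\<^esub>
        F2 G ?x (unt B) \<cdot>\<^bsub>C\<^esub> (idt C (FO G ?x) \<boxtimes>\<^bsub>C\<^esub> F0 G)"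
      by (subst G.F2_natural) simp_all
    also have "\<dots> = runit C (FO G ?x)"
      by (subst F.F2_runit) (simp_all add: G.F2_runit)
    finally show "FA (smf_comp A C G F) (runit A x) \<cdot>\<^bsub>C\<^esub> F2 (smf_comp A C G F) x (unt A) \<cdot>\<^bsub>C\<^esub>
        (idt C (FO (smf_comp A C G F) x) \<boxtimes>\<^bsub>C\<^esub> F0 (smf_comp A C G F)) = runit C (FO (smf_comp A C G F) x)"
      by (simp add: smf_comp_def)
  next
    fix x assume [simp]: "x \<in> Ob A"
    let ?x = "FO F x"
    have "FA G (FA F (lunit A x)) \<cdot>\<^bsub>C\<^esub> (FA G (F2 F (unt A) x) \<cdot>\<^bsub>C\<^esub> F2 G (FO F (unt A)) ?x) \<cdot>\<^bsub>C\<^esub>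
         ((FA G (F0 F) \<cdot>\<^bsub>C\<^esub> F0 G) \<boxtimes>\<^bsub>C\<^esub> idt C (FO G ?x)) =
       FA G (FA F (lunit A x)) \<cdot>\<^bsub>C\<^esub> FA G (F2 F (unt A) x) \<cdot>\<^bsub>C\<^esub> (F2 G (FO F (unt A)) ?x \<cdot>\<^bsub>C\<^esub>
         (FA G (F0 F) \<boxtimes>\<^bsub>C\<^esub> FA G (idt B ?x))) \<cdot>\<^bsub>C\<^esub> (F0 G \<boxtimes>\<^bsub>C\<^esub> idt C (FO G ?x))"
      by (simp add: G.target.tens_simps)
    also have "\<dots> = FA G (FA F (lunit A x) \<cdot>\<^bsub>B\<^esub> F2 F (unt A) x \<cdot>\<^bsub>B\<^esub> (F0 F \<boxtimes>\<^bsub>B\<^esub> idt B ?x)) \<cdot>\<^bsub>C\<^esub>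
        F2 G (unt B) ?x \<cdot>\<^bsub>C\<^esub> (F0 G \<boxtimes>\<^bsub>C\<^esub> idt C (FO G ?x))"
      by (subst G.F2_natural) simp_all
    also have "\<dots> = lunit C (FO G ?x)"
      by (subst F.F2_lunit) (simp_all add: G.F2_lunit)
    finally show "FA (smf_comp A C G F) (lunit A x) \<cdot>\<^bsub>C\<^esub> F2 (smf_comp A C G F) (unt A) x \<cdot>\<^bsub>C\<^esub>
        (F0 (smf_comp A C G F) \<boxtimes>\<^bsub>C\<^esub> idt C (FO (smf_comp A C G F) x)) = lunit C (FO (smf_comp A C G F) x)"
      by (simp add: smf_comp_def)
  next
    fix x y assume [simp]: "x \<in> Ob A" "y \<in> Ob A"
    have "FA G (FA F (symm A x y)) \<cdot>\<^bsub>C\<^esub> FA G (F2 F x y) \<cdot>\<^bsub>C\<^esub> F2 G (FO F x) (FO F y) =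
      FA G (FA F (symm A x y) \<cdot>\<^bsub>B\<^esub> F2 F x y) \<cdot>\<^bsub>C\<^esub> F2 G (FO F x) (FO F y)" by simp
    also have "\<dots> = (FA G (F2 F y x) \<cdot>\<^bsub>C\<^esub> F2 G (FO F y) (FO F x)) \<cdot>\<^bsub>C\<^esub> symm C (FO G (FO F x)) (FO G (FO F y))"
      by (subst F.F2_symm) (simp_all add: G.F2_symm)
    finally show "FA (smf_comp A C G F) (symm A x y) \<cdot>\<^bsub>C\<^esub> F2 (smf_comp A C G F) x y =
       F2 (smf_comp A C G F) y x \<cdot>\<^bsub>C\<^esub> symm C (FO (smf_comp A C G F) x) (FO (smf_comp A C G F) y)"
      by (simp add: smf_comp_def)
  qed (unfold_locales, auto simp: smf_comp_def)
qed

section \<open>Monoidal transformations: composition and whiskering\<close>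

lemma mtI:
  assumes "SMF A B F" "SMF A B G" "\<sigma> \<in> extensional (Ob A)"
    and "\<And>x. x \<in> Ob A \<Longrightarrow> \<sigma> x \<in> Ar B \<and> dm B (\<sigma> x) = FO F x \<and> cd B (\<sigma> x) = FO G x"
    and "\<And>f. f \<in> Ar A \<Longrightarrow> \<sigma> (cd A f) \<cdot>\<^bsub>B\<^esub> FA F f = FA G f \<cdot>\<^bsub>B\<^esub> \<sigma> (dm A f)"
    and "\<sigma> (unt A) \<cdot>\<^bsub>B\<^esub> F0 F = F0 G"
    and "\<And>x y. x \<in> Ob A \<Longrightarrow> y \<in> Ob A \<Longrightarrow> \<sigma> (x \<otimes>\<^bsub>A\<^esub> y) \<cdot>\<^bsub>B\<^esub> F2 F x y = F2 G x y \<cdot>\<^bsub>B\<^esub> (\<sigma> x \<boxtimes>\<^bsub>B\<^esub> \<sigma> y)"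
  shows "MT A B F G \<sigma>"
  unfolding monoidal_transformation_def monoidal_transformation_axioms_def
  using assms by (auto simp: hom_iff)

context monoidal_transformation begin

lemma tr_typing [simp]:
  assumes "x \<in> Ob A"
  shows "\<sigma> x \<in> Ar B" "dm B (\<sigma> x) = FO F x" "cd B (\<sigma> x) = FO G x"
  using tr_hom[OF assms] by (auto simp: hom_iff)

lemma tr_natural: "f \<in> Ar A \<Longrightarrow> cd A f = y \<Longrightarrow> \<sigma> y \<cdot>\<^bsub>B\<^esub> FA F f = FA G f \<cdot>\<^bsub>B\<^esub> \<sigma> (dm A f)"
  using tr_nat[of f "dm A f" y] by (auto simp: hom_iff)

end

lemma mt_id: assumes "SMF A B F" shows "MT A B F F (\<lambda>a\<in>Ob A. idt B (FO F a))"
proof -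
  interpret F: symmetric_monoidal_functor A B F by fact
  show ?thesis by (rule mtI) (use assms in auto)
qed

lemma mt_comp:
  assumes "MT A B F G \<sigma>" "MT A B G H \<tau>"
  shows "MT A B F H (\<lambda>a\<in>Ob A. \<tau> a \<cdot>\<^bsub>B\<^esub> \<sigma> a)"
proof -
  interpret s: monoidal_transformation A B F G \<sigma> by fact
  interpret t: monoidal_transformation A B G H \<tau> by fact
  show ?thesis
  proof (rule mtI)
    fix f assume [simp]: "f \<in> Ar A"
    show "(\<lambda>a\<in>Ob A. \<tau> a \<cdot>\<^bsub>B\<^esub> \<sigma> a) (cd A f) \<cdot>\<^bsub>B\<^esub> FA F f = FA H f \<cdot>\<^bsub>B\<^esub> (\<lambda>a\<in>Ob A. \<tau> a \<cdot>\<^bsub>B\<^esub> \<sigma> a) (dm A f)"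
      by (simp add: s.tr_natural s.source.target.cmp_eq_extend[OF t.tr_natural])
  next
    fix x y assume [simp]: "x \<in> Ob A" "y \<in> Ob A"
    show "(\<lambda>a\<in>Ob A. \<tau> a \<cdot>\<^bsub>B\<^esub> \<sigma> a) (x \<otimes>\<^bsub>A\<^esub> y) \<cdot>\<^bsub>B\<^esub> F2 F x y =
        F2 H x y \<cdot>\<^bsub>B\<^esub> ((\<lambda>a\<in>Ob A. \<tau> a \<cdot>\<^bsub>B\<^esub> \<sigma> a) x \<boxtimes>\<^bsub>B\<^esub> (\<lambda>a\<in>Ob A. \<tau> a \<cdot>\<^bsub>B\<^esub> \<sigma> a) y)"
      by (simp add: s.tr_tens s.source.target.cmp_eq_extend[OF t.tr_tens] s.source.target.tens_simps)
  qed (use s.source.symmetric_monoidal_functor_axioms t.target.symmetric_monoidal_functor_axioms in \<open>auto simp: s.tr_unit t.tr_unit\<close>)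
qed

lemma mt_whisker_left:
  assumes "MT A B F G \<sigma>" "SMF B C H"
  shows "MT A C (smf_comp A C H F) (smf_comp A C H G) (\<lambda>a\<in>Ob A. FA H (\<sigma> a))"
proof -
  interpret s: monoidal_transformation A B F G \<sigma> by fact
  interpret H: symmetric_monoidal_functor B C H by fact
  note c = H.FA_cmp'[symmetric]
  show ?thesis
  proof (rule mtI)
    fix f assume [simp]: "f \<in> Ar A"
    show "(\<lambda>a\<in>Ob A. FA H (\<sigma> a)) (cd A f) \<cdot>\<^bsub>C\<^esub> FA (smf_comp A C H F) f =
        FA (smf_comp A C H G) f \<cdot>\<^bsub>C\<^esub> (\<lambda>a\<in>Ob A. FA H (\<sigma> a)) (dm A f)"
      by (simp add: smf_comp_def c s.tr_natural del: H.FA_cmp')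
  next
    have "FA H (\<sigma> (unt A)) \<cdot>\<^bsub>C\<^esub> FA H (F0 F) \<cdot>\<^bsub>C\<^esub> F0 H = FA H (\<sigma> (unt A) \<cdot>\<^bsub>B\<^esub> F0 F) \<cdot>\<^bsub>C\<^esub> F0 H" by simp
    then show "(\<lambda>a\<in>Ob A. FA H (\<sigma> a)) (unt A) \<cdot>\<^bsub>C\<^esub> F0 (smf_comp A C H F) = F0 (smf_comp A C H G)"
      by (simp add: smf_comp_def s.tr_unit)
  next
    fix x y assume [simp]: "x \<in> Ob A" "y \<in> Ob A"
    have "FA H (\<sigma> (x \<otimes>\<^bsub>A\<^esub> y)) \<cdot>\<^bsub>C\<^esub> FA H (F2 F x y) \<cdot>\<^bsub>C\<^esub> F2 H (FO F x) (FO F y) =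
        FA H (\<sigma> (x \<otimes>\<^bsub>A\<^esub> y) \<cdot>\<^bsub>B\<^esub> F2 F x y) \<cdot>\<^bsub>C\<^esub> F2 H (FO F x) (FO F y)" by simp
    also have "\<dots> = FA H (F2 G x y) \<cdot>\<^bsub>C\<^esub> F2 H (FO G x) (FO G y) \<cdot>\<^bsub>C\<^esub> (FA H (\<sigma> x) \<boxtimes>\<^bsub>C\<^esub> FA H (\<sigma> y))"
      by (subst s.tr_tens) (simp_all add: H.F2_natural)
    finally show "(\<lambda>a\<in>Ob A. FA H (\<sigma> a)) (x \<otimes>\<^bsub>A\<^esub> y) \<cdot>\<^bsub>C\<^esub> F2 (smf_comp A C H F) x y =
        F2 (smf_comp A C H G) x y \<cdot>\<^bsub>C\<^esub> ((\<lambda>a\<in>Ob A. FA H (\<sigma> a)) x \<boxtimes>\<^bsub>C\<^esub> (\<lambda>a\<in>Ob A. FA H (\<sigma> a)) y)"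
      by (simp add: smf_comp_def)
  qed (use smf_comp[OF _ assms(2)] s.source.symmetric_monoidal_functor_axioms s.target.symmetric_monoidal_functor_axioms in \<open>auto simp: smf_comp_def\<close>)
qed

lemma mt_whisker_right:
  assumes "MT A B F G \<sigma>" "SMF Z A K"
  shows "MT Z B (smf_comp Z B F K) (smf_comp Z B G K) (\<lambda>z\<in>Ob Z. \<sigma> (FO K z))"
proof -
  interpret s: monoidal_transformation A B F G \<sigma> by fact
  interpret K: symmetric_monoidal_functor Z A K by fact
  show ?thesis
  proof (rule mtI)
    fix f assume [simp]: "f \<in> Ar Z"
    show "(\<lambda>z\<in>Ob Z. \<sigma> (FO K z)) (cd Z f) \<cdot>\<^bsub>B\<^esub> FA (smf_comp Z B F K) f =
        FA (smf_comp Z B G K) f \<cdot>\<^bsub>B\<^esub> (\<lambda>z\<in>Ob Z. \<sigma> (FO K z)) (dm Z f)"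
      by (simp add: smf_comp_def s.tr_natural)
  next
    show "(\<lambda>z\<in>Ob Z. \<sigma> (FO K z)) (unt Z) \<cdot>\<^bsub>B\<^esub> F0 (smf_comp Z B F K) = F0 (smf_comp Z B G K)"
      by (simp add: smf_comp_def s.source.target.cmp_eq_extend[OF s.tr_natural] s.tr_unit)
  next
    fix x y assume [simp]: "x \<in> Ob Z" "y \<in> Ob Z"
    show "(\<lambda>z\<in>Ob Z. \<sigma> (FO K z)) (x \<otimes>\<^bsub>Z\<^esub> y) \<cdot>\<^bsub>B\<^esub> F2 (smf_comp Z B F K) x y =
        F2 (smf_comp Z B G K) x y \<cdot>\<^bsub>B\<^esub> ((\<lambda>z\<in>Ob Z. \<sigma> (FO K z)) x \<boxtimes>\<^bsub>B\<^esub> (\<lambda>z\<in>Ob Z. \<sigma> (FO K z)) y)"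
      by (simp add: smf_comp_def s.source.target.cmp_eq_extend[OF s.tr_natural] s.tr_tens)
  qed (use smf_comp[OF assms(2)] s.source.symmetric_monoidal_functor_axioms s.target.symmetric_monoidal_functor_axioms in \<open>auto simp: smf_comp_def\<close>)
qed

text \<open>Each axiom follows one pattern: naturality of the interchange gathers the structure
  arrows of \<open>F\<close> and of \<open>G\<close> into one tensor, the axiom is applied to both
  factors, and the remaining structural diagram is one of the interchange lemmas.\<close>

lemma smf_box:
  assumes "SMF A B F" "SMF A B G"
  shows "SMF A B (smf_box A B F G)"
proof -
  interpret F: symmetric_monoidal_functor A B F by fact
  interpret G: symmetric_monoidal_functor A B G by fact
  note tens_cmp = F.target.tens_cmp and tens_cmp_extend = F.target.tens_cmp_extend and tens_simps = F.target.tens_simps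
  show ?thesis
  proof (rule smfI)
    fix f g assume [simp]: "f \<in> Ar A" "g \<in> Ar A"
    let ?m = "\<lambda>x y. interchange B (FO F x) (FO G x) (FO F y) (FO G y)"
    show "F2 (smf_box A B F G) (cd A f) (cd A g) \<cdot>\<^bsub>B\<^esub> (FA (smf_box A B F G) f \<boxtimes>\<^bsub>B\<^esub> FA (smf_box A B F G) g) =
        FA (smf_box A B F G) (f \<boxtimes>\<^bsub>A\<^esub> g) \<cdot>\<^bsub>B\<^esub> F2 (smf_box A B F G) (dm A f) (dm A g)"
      by (simp add: smf_box_def F.target.interchange_natural tens_simps F.F2_natural G.F2_natural)
  next
    fix x y z assume [simp]: "x \<in> Ob A" "y \<in> Ob A" "z \<in> Ob A"
    let ?x = "FO F x" and ?y = "FO F y" and ?z = "FO F z"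
    let ?x' = "FO G x" and ?y' = "FO G y" and ?z' = "FO G z"
    let ?m = "interchange B"
    let ?i = "idt B"
    let ?b = "smf_box A B F G"
    have "(FA F (ass A x y z) \<boxtimes>\<^bsub>B\<^esub> FA G (ass A x y z)) \<cdot>\<^bsub>B\<^esub> ((F2 F x (y \<otimes>\<^bsub>A\<^esub> z) \<boxtimes>\<^bsub>B\<^esub> F2 G x (y \<otimes>\<^bsub>A\<^esub> z)) \<cdot>\<^bsub>B\<^esub>
         ?m ?x ?x' (FO F (y \<otimes>\<^bsub>A\<^esub> z)) (FO G (y \<otimes>\<^bsub>A\<^esub> z))) \<cdot>\<^bsub>B\<^esub> (?i (?x \<otimes>\<^bsub>B\<^esub> ?x') \<boxtimes>\<^bsub>B\<^esub> ((F2 F y z \<boxtimes>\<^bsub>B\<^esub> F2 G y z) \<cdot>\<^bsub>B\<^esub> ?m ?y ?y' ?z ?z')) =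
      (FA F (ass A x y z) \<boxtimes>\<^bsub>B\<^esub> FA G (ass A x y z)) \<cdot>\<^bsub>B\<^esub> (F2 F x (y \<otimes>\<^bsub>A\<^esub> z) \<boxtimes>\<^bsub>B\<^esub> F2 G x (y \<otimes>\<^bsub>A\<^esub> z)) \<cdot>\<^bsub>B\<^esub>
         (?m ?x ?x' (FO F (y \<otimes>\<^bsub>A\<^esub> z)) (FO G (y \<otimes>\<^bsub>A\<^esub> z)) \<cdot>\<^bsub>B\<^esub> ((?i ?x \<boxtimes>\<^bsub>B\<^esub> ?i ?x') \<boxtimes>\<^bsub>B\<^esub> (F2 F y z \<boxtimes>\<^bsub>B\<^esub> F2 G y z))) \<cdot>\<^bsub>B\<^esub>
         (?i (?x \<otimes>\<^bsub>B\<^esub> ?x') \<boxtimes>\<^bsub>B\<^esub> ?m ?y ?y' ?z ?z')"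
      by (simp add: tens_cmp)
    also have "\<dots> = ((FA F (ass A x y z) \<cdot>\<^bsub>B\<^esub> F2 F x (y \<otimes>\<^bsub>A\<^esub> z) \<cdot>\<^bsub>B\<^esub> (?i ?x \<boxtimes>\<^bsub>B\<^esub> F2 F y z)) \<boxtimes>\<^bsub>B\<^esub>
         (FA G (ass A x y z) \<cdot>\<^bsub>B\<^esub> F2 G x (y \<otimes>\<^bsub>A\<^esub> z) \<cdot>\<^bsub>B\<^esub> (?i ?x' \<boxtimes>\<^bsub>B\<^esub> F2 G y z))) \<cdot>\<^bsub>B\<^esub>
        ?m ?x ?x' (?y \<otimes>\<^bsub>B\<^esub> ?z) (?y' \<otimes>\<^bsub>B\<^esub> ?z') \<cdot>\<^bsub>B\<^esub> (?i (?x \<otimes>\<^bsub>B\<^esub> ?x') \<boxtimes>\<^bsub>B\<^esub> ?m ?y ?y' ?z ?z')"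
      by (subst F.target.interchange_natural) (simp_all add: tens_cmp_extend)
    also have "\<dots> = ((F2 F (x \<otimes>\<^bsub>A\<^esub> y) z \<cdot>\<^bsub>B\<^esub> (F2 F x y \<boxtimes>\<^bsub>B\<^esub> ?i ?z)) \<boxtimes>\<^bsub>B\<^esub> (F2 G (x \<otimes>\<^bsub>A\<^esub> y) z \<cdot>\<^bsub>B\<^esub> (F2 G x y \<boxtimes>\<^bsub>B\<^esub> ?i ?z'))) \<cdot>\<^bsub>B\<^esub>
        ((ass B ?x ?y ?z \<boxtimes>\<^bsub>B\<^esub> ass B ?x' ?y' ?z') \<cdot>\<^bsub>B\<^esub> ?m ?x ?x' (?y \<otimes>\<^bsub>B\<^esub> ?z) (?y' \<otimes>\<^bsub>B\<^esub> ?z') \<cdot>\<^bsub>B\<^esub> (?i (?x \<otimes>\<^bsub>B\<^esub> ?x') \<boxtimes>\<^bsub>B\<^esub> ?m ?y ?y' ?z ?z'))"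
      by (simp add: F.F2_ass G.F2_ass tens_cmp_extend)
    also have "\<dots> = ((F2 F (x \<otimes>\<^bsub>A\<^esub> y) z \<boxtimes>\<^bsub>B\<^esub> F2 G (x \<otimes>\<^bsub>A\<^esub> y) z) \<cdot>\<^bsub>B\<^esub> ((F2 F x y \<boxtimes>\<^bsub>B\<^esub> ?i ?z) \<boxtimes>\<^bsub>B\<^esub> (F2 G x y \<boxtimes>\<^bsub>B\<^esub> ?i ?z'))) \<cdot>\<^bsub>B\<^esub>
        ?m (?x \<otimes>\<^bsub>B\<^esub> ?y) (?x' \<otimes>\<^bsub>B\<^esub> ?y') ?z ?z' \<cdot>\<^bsub>B\<^esub> (?m ?x ?x' ?y ?y' \<boxtimes>\<^bsub>B\<^esub> ?i (?z \<otimes>\<^bsub>B\<^esub> ?z')) \<cdot>\<^bsub>B\<^esub> ass B (?x \<otimes>\<^bsub>B\<^esub> ?x') (?y \<otimes>\<^bsub>B\<^esub> ?y') (?z \<otimes>\<^bsub>B\<^esub> ?z')"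
      by (simp add: F.target.interchange_ass tens_cmp)
    also have "\<dots> = (F2 F (x \<otimes>\<^bsub>A\<^esub> y) z \<boxtimes>\<^bsub>B\<^esub> F2 G (x \<otimes>\<^bsub>A\<^esub> y) z) \<cdot>\<^bsub>B\<^esub> ?m (FO F (x \<otimes>\<^bsub>A\<^esub> y)) (FO G (x \<otimes>\<^bsub>A\<^esub> y)) ?z ?z' \<cdot>\<^bsub>B\<^esub>
       ((F2 F x y \<boxtimes>\<^bsub>B\<^esub> F2 G x y) \<boxtimes>\<^bsub>B\<^esub> (?i ?z \<boxtimes>\<^bsub>B\<^esub> ?i ?z')) \<cdot>\<^bsub>B\<^esub> (?m ?x ?x' ?y ?y' \<boxtimes>\<^bsub>B\<^esub> ?i (?z \<otimes>\<^bsub>B\<^esub> ?z')) \<cdot>\<^bsub>B\<^esub> ass B (?x \<otimes>\<^bsub>B\<^esub> ?x') (?y \<otimes>\<^bsub>B\<^esub> ?y') (?z \<otimes>\<^bsub>B\<^esub> ?z')"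
      by (subst F.target.interchange_natural_extend) simp_all
    finally show "FA ?b (ass A x y z) \<cdot>\<^bsub>B\<^esub> F2 ?b x (y \<otimes>\<^bsub>A\<^esub> z) \<cdot>\<^bsub>B\<^esub> (idt B (FO ?b x) \<boxtimes>\<^bsub>B\<^esub> F2 ?b y z) =
       F2 ?b (x \<otimes>\<^bsub>A\<^esub> y) z \<cdot>\<^bsub>B\<^esub> (F2 ?b x y \<boxtimes>\<^bsub>B\<^esub> idt B (FO ?b z)) \<cdot>\<^bsub>B\<^esub> ass B (FO ?b x) (FO ?b y) (FO ?b z)"
      by (simp add: smf_box_def tens_cmp_extend)
  next
    fix x assume [simp]: "x \<in> Ob A"
    let ?x = "FO F x" and ?x' = "FO G x" and ?I = "unt B" and ?m = "interchange B" and ?i = "idt B" and ?b = "smf_box A B F G"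
    let ?j = "inverse_of B (runit B (unt B))"
    have "(FA F (runit A x) \<boxtimes>\<^bsub>B\<^esub> FA G (runit A x)) \<cdot>\<^bsub>B\<^esub> ((F2 F x (unt A) \<boxtimes>\<^bsub>B\<^esub> F2 G x (unt A)) \<cdot>\<^bsub>B\<^esub>
         ?m ?x ?x' (FO F (unt A)) (FO G (unt A))) \<cdot>\<^bsub>B\<^esub> (?i (?x \<otimes>\<^bsub>B\<^esub> ?x') \<boxtimes>\<^bsub>B\<^esub> ((F0 F \<boxtimes>\<^bsub>B\<^esub> F0 G) \<cdot>\<^bsub>B\<^esub> ?j)) =
      (FA F (runit A x) \<boxtimes>\<^bsub>B\<^esub> FA G (runit A x)) \<cdot>\<^bsub>B\<^esub> (F2 F x (unt A) \<boxtimes>\<^bsub>B\<^esub> F2 G x (unt A)) \<cdot>\<^bsub>B\<^esub>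
         (?m ?x ?x' (FO F (unt A)) (FO G (unt A)) \<cdot>\<^bsub>B\<^esub> ((?i ?x \<boxtimes>\<^bsub>B\<^esub> ?i ?x') \<boxtimes>\<^bsub>B\<^esub> (F0 F \<boxtimes>\<^bsub>B\<^esub> F0 G))) \<cdot>\<^bsub>B\<^esub> (?i (?x \<otimes>\<^bsub>B\<^esub> ?x') \<boxtimes>\<^bsub>B\<^esub> ?j)"
      by (simp add: tens_cmp)
    also have "\<dots> = ((FA F (runit A x) \<cdot>\<^bsub>B\<^esub> F2 F x (unt A) \<cdot>\<^bsub>B\<^esub> (?i ?x \<boxtimes>\<^bsub>B\<^esub> F0 F)) \<boxtimes>\<^bsub>B\<^esub> (FA G (runit A x) \<cdot>\<^bsub>B\<^esub> F2 G x (unt A) \<cdot>\<^bsub>B\<^esub> (?i ?x' \<boxtimes>\<^bsub>B\<^esub> F0 G))) \<cdot>\<^bsub>B\<^esub>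
        ?m ?x ?x' ?I ?I \<cdot>\<^bsub>B\<^esub> (?i (?x \<otimes>\<^bsub>B\<^esub> ?x') \<boxtimes>\<^bsub>B\<^esub> ?j)"
      by (subst F.target.interchange_natural) (simp_all add: tens_cmp_extend)
    also have "\<dots> = runit B (?x \<otimes>\<^bsub>B\<^esub> ?x')"
      by (simp add: F.F2_runit G.F2_runit F.target.interchange_runit)
    finally show "FA ?b (runit A x) \<cdot>\<^bsub>B\<^esub> F2 ?b x (unt A) \<cdot>\<^bsub>B\<^esub> (idt B (FO ?b x) \<boxtimes>\<^bsub>B\<^esub> F0 ?b) = runit B (FO ?b x)"
      by (simp add: smf_box_def tens_cmp_extend)
  next
    fix x assume [simp]: "x \<in> Ob A"
    let ?x = "FO F x" and ?x' = "FO G x" and ?I = "unt B" and ?m = "interchange B" and ?i = "idt B" and ?b = "smf_box A B F G"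
    let ?j = "inverse_of B (runit B (unt B))"
    have "(FA F (lunit A x) \<boxtimes>\<^bsub>B\<^esub> FA G (lunit A x)) \<cdot>\<^bsub>B\<^esub> ((F2 F (unt A) x \<boxtimes>\<^bsub>B\<^esub> F2 G (unt A) x) \<cdot>\<^bsub>B\<^esub>
         ?m (FO F (unt A)) (FO G (unt A)) ?x ?x') \<cdot>\<^bsub>B\<^esub> (((F0 F \<boxtimes>\<^bsub>B\<^esub> F0 G) \<cdot>\<^bsub>B\<^esub> ?j) \<boxtimes>\<^bsub>B\<^esub> ?i (?x \<otimes>\<^bsub>B\<^esub> ?x')) =
      (FA F (lunit A x) \<boxtimes>\<^bsub>B\<^esub> FA G (lunit A x)) \<cdot>\<^bsub>B\<^esub> (F2 F (unt A) x \<boxtimes>\<^bsub>B\<^esub> F2 G (unt A) x) \<cdot>\<^bsub>B\<^esub>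
         (?m (FO F (unt A)) (FO G (unt A)) ?x ?x' \<cdot>\<^bsub>B\<^esub> ((F0 F \<boxtimes>\<^bsub>B\<^esub> F0 G) \<boxtimes>\<^bsub>B\<^esub> (?i ?x \<boxtimes>\<^bsub>B\<^esub> ?i ?x'))) \<cdot>\<^bsub>B\<^esub> (?j \<boxtimes>\<^bsub>B\<^esub> ?i (?x \<otimes>\<^bsub>B\<^esub> ?x'))"
      by (simp add: tens_cmp)
    also have "\<dots> = ((FA F (lunit A x) \<cdot>\<^bsub>B\<^esub> F2 F (unt A) x \<cdot>\<^bsub>B\<^esub> (F0 F \<boxtimes>\<^bsub>B\<^esub> ?i ?x)) \<boxtimes>\<^bsub>B\<^esub> (FA G (lunit A x) \<cdot>\<^bsub>B\<^esub> F2 G (unt A) x \<cdot>\<^bsub>B\<^esub> (F0 G \<boxtimes>\<^bsub>B\<^esub> ?i ?x'))) \<cdot>\<^bsub>B\<^esub>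
        ?m ?I ?I ?x ?x' \<cdot>\<^bsub>B\<^esub> (?j \<boxtimes>\<^bsub>B\<^esub> ?i (?x \<otimes>\<^bsub>B\<^esub> ?x'))"
      by (subst F.target.interchange_natural) (simp_all add: tens_cmp_extend)
    also have "\<dots> = lunit B (?x \<otimes>\<^bsub>B\<^esub> ?x')"
      by (simp add: F.F2_lunit G.F2_lunit F.target.interchange_lunit)
    finally show "FA ?b (lunit A x) \<cdot>\<^bsub>B\<^esub> F2 ?b (unt A) x \<cdot>\<^bsub>B\<^esub> (F0 ?b \<boxtimes>\<^bsub>B\<^esub> idt B (FO ?b x)) = lunit B (FO ?b x)"
      by (simp add: smf_box_def tens_cmp_extend)
  next
    fix x y assume [simp]: "x \<in> Ob A" "y \<in> Ob A"
    show "FA (smf_box A B F G) (symm A x y) \<cdot>\<^bsub>B\<^esub> F2 (smf_box A B F G) x y =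
       F2 (smf_box A B F G) y x \<cdot>\<^bsub>B\<^esub> symm B (FO (smf_box A B F G) x) (FO (smf_box A B F G) y)"
      by (simp add: smf_box_def tens_cmp_extend F.F2_symm G.F2_symm)
       (simp add: tens_simps[symmetric] F.target.interchange_symm)
  qed (unfold_locales, auto simp: smf_box_def tens_cmp)
qed

lemma smf_const:
  assumes "SMC A" "SMC B"
  shows "SMF A B (smf_const A B)"
proof -
  interpret A: symmetric_monoidal_category A by fact
  interpret B: symmetric_monoidal_category B by fact
  show ?thesis
    by (rule smfI) (unfold_locales, auto simp: smf_const_def B.runit_natural B.ass_unt B.tens_simps B.lunit_unt B.symm_unt)
qed

lemma smf_comp_simps [simp]:
  "x \<in> Ob A \<Longrightarrow> FO (smf_comp A C G F) x = FO G (FO F x)"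
  "f \<in> Ar A \<Longrightarrow> FA (smf_comp A C G F) f = FA G (FA F f)"
  "F0 (smf_comp A C G F) = FA G (F0 F) \<cdot>\<^bsub>C\<^esub> F0 G"
  "x \<in> Ob A \<Longrightarrow> y \<in> Ob A \<Longrightarrow> F2 (smf_comp A C G F) x y = FA G (F2 F x y) \<cdot>\<^bsub>C\<^esub> F2 G (FO F x) (FO F y)"
  by (simp_all add: smf_comp_def)

lemma smf_id_simps [simp]:
  "x \<in> Ob A \<Longrightarrow> FO (smf_id A) x = x" "f \<in> Ar A \<Longrightarrow> FA (smf_id A) f = f"
  "F0 (smf_id A) = idt A (unt A)" "x \<in> Ob A \<Longrightarrow> y \<in> Ob A \<Longrightarrow> F2 (smf_id A) x y = idt A (x \<otimes>\<^bsub>A\<^esub> y)"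
  by (simp_all add: smf_id_def)

lemma smf_box_simps [simp]:
  "x \<in> Ob A \<Longrightarrow> FO (smf_box A B F G) x = FO F x \<otimes>\<^bsub>B\<^esub> FO G x"
  "f \<in> Ar A \<Longrightarrow> FA (smf_box A B F G) f = FA F f \<boxtimes>\<^bsub>B\<^esub> FA G f"
  "F0 (smf_box A B F G) = (F0 F \<boxtimes>\<^bsub>B\<^esub> F0 G) \<cdot>\<^bsub>B\<^esub> inverse_of B (runit B (unt B))"
  "x \<in> Ob A \<Longrightarrow> y \<in> Ob A \<Longrightarrow> F2 (smf_box A B F G) x y =
    (F2 F x y \<boxtimes>\<^bsub>B\<^esub> F2 G x y) \<cdot>\<^bsub>B\<^esub> interchange B (FO F x) (FO G x) (FO F y) (FO G y)"
  by (simp_all add: smf_box_def)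

lemma smf_const_simps [simp]:
  "x \<in> Ob A \<Longrightarrow> FO (smf_const A B) x = unt B" "f \<in> Ar A \<Longrightarrow> FA (smf_const A B) f = idt B (unt B)"
  "F0 (smf_const A B) = idt B (unt B)" "x \<in> Ob A \<Longrightarrow> y \<in> Ob A \<Longrightarrow> F2 (smf_const A B) x y = runit B (unt B)"
  by (simp_all add: smf_const_def)

lemma mt_box:
  assumes "MT A B F G \<sigma>" "MT A B F' G' \<tau>"
  shows "MT A B (smf_box A B F F') (smf_box A B G G') (\<lambda>a\<in>Ob A. \<sigma> a \<boxtimes>\<^bsub>B\<^esub> \<tau> a)"
proof -
  interpret s: monoidal_transformation A B F G \<sigma> by fact
  interpret t: monoidal_transformation A B F' G' \<tau> by fact
  show ?thesis
    by (rule mtI) (auto intro!: smf_box s.source.symmetric_monoidal_functor_axioms t.source.symmetric_monoidal_functor_axioms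
      s.target.symmetric_monoidal_functor_axioms t.target.symmetric_monoidal_functor_axioms
      simp: s.source.target.tens_simps s.tr_natural t.tr_natural s.tr_unit t.tr_unit s.tr_tens t.tr_tens
      s.source.target.interchange_natural)
qed

lemma mt_ass:
  assumes "SMF A B F" "SMF A B G" "SMF A B H"
  shows "MT A B (smf_box A B F (smf_box A B G H)) (smf_box A B (smf_box A B F G) H)
    (\<lambda>a\<in>Ob A. ass B (FO F a) (FO G a) (FO H a))"
proof -
  interpret F: symmetric_monoidal_functor A B F by fact
  interpret G: symmetric_monoidal_functor A B G by fact
  interpret H: symmetric_monoidal_functor A B H by fact
  let ?m = "interchange B" and ?i = "idt B" and ?j = "inverse_of B (runit B (unt B))" and ?I = "unt B"
  show ?thesis
  proof (rule mtI)
    have "ass B (FO F (unt A)) (FO G (unt A)) (FO H (unt A)) \<cdot>\<^bsub>B\<^esub> (F0 F \<boxtimes>\<^bsub>B\<^esub> ((F0 G \<boxtimes>\<^bsub>B\<^esub> F0 H) \<cdot>\<^bsub>B\<^esub> ?j)) \<cdot>\<^bsub>B\<^esub> ?j =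
      ass B (FO F (unt A)) (FO G (unt A)) (FO H (unt A)) \<cdot>\<^bsub>B\<^esub> (F0 F \<boxtimes>\<^bsub>B\<^esub> (F0 G \<boxtimes>\<^bsub>B\<^esub> F0 H)) \<cdot>\<^bsub>B\<^esub> (?i ?I \<boxtimes>\<^bsub>B\<^esub> ?j) \<cdot>\<^bsub>B\<^esub> ?j"
      by (simp add: F.target.tens_cmp_extend)
    also have "\<dots> = ((F0 F \<boxtimes>\<^bsub>B\<^esub> F0 G) \<boxtimes>\<^bsub>B\<^esub> F0 H) \<cdot>\<^bsub>B\<^esub> (?j \<boxtimes>\<^bsub>B\<^esub> ?i ?I) \<cdot>\<^bsub>B\<^esub> (?i ?I \<boxtimes>\<^bsub>B\<^esub> runit B ?I) \<cdot>\<^bsub>B\<^esub> (?i ?I \<boxtimes>\<^bsub>B\<^esub> ?j) \<cdot>\<^bsub>B\<^esub> ?j"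
      by (simp add: F.target.ass_natural_extend F.target.ass_unt)
    also have "\<dots> = (((F0 F \<boxtimes>\<^bsub>B\<^esub> F0 G) \<cdot>\<^bsub>B\<^esub> ?j) \<boxtimes>\<^bsub>B\<^esub> F0 H) \<cdot>\<^bsub>B\<^esub> ?j"
      by (simp add: F.target.tens_cmp_extend)
    finally show "(\<lambda>a\<in>Ob A. ass B (FO F a) (FO G a) (FO H a)) (unt A) \<cdot>\<^bsub>B\<^esub> F0 (smf_box A B F (smf_box A B G H)) =
        F0 (smf_box A B (smf_box A B F G) H)"
      by simp
  next
    fix x y assume [simp]: "x \<in> Ob A" "y \<in> Ob A"
    have "ass B (FO F (x \<otimes>\<^bsub>A\<^esub> y)) (FO G (x \<otimes>\<^bsub>A\<^esub> y)) (FO H (x \<otimes>\<^bsub>A\<^esub> y)) \<cdot>\<^bsub>B\<^esub>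
      (F2 F x y \<boxtimes>\<^bsub>B\<^esub> ((F2 G x y \<boxtimes>\<^bsub>B\<^esub> F2 H x y) \<cdot>\<^bsub>B\<^esub> ?m (FO G x) (FO H x) (FO G y) (FO H y))) \<cdot>\<^bsub>B\<^esub>
      ?m (FO F x) (FO G x \<otimes>\<^bsub>B\<^esub> FO H x) (FO F y) (FO G y \<otimes>\<^bsub>B\<^esub> FO H y) =
      ass B (FO F (x \<otimes>\<^bsub>A\<^esub> y)) (FO G (x \<otimes>\<^bsub>A\<^esub> y)) (FO H (x \<otimes>\<^bsub>A\<^esub> y)) \<cdot>\<^bsub>B\<^esub>
      (F2 F x y \<boxtimes>\<^bsub>B\<^esub> (F2 G x y \<boxtimes>\<^bsub>B\<^esub> F2 H x y)) \<cdot>\<^bsub>B\<^esub> (?i (FO F x \<otimes>\<^bsub>B\<^esub> FO F y) \<boxtimes>\<^bsub>B\<^esub> ?m (FO G x) (FO H x) (FO G y) (FO H y)) \<cdot>\<^bsub>B\<^esub>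
      ?m (FO F x) (FO G x \<otimes>\<^bsub>B\<^esub> FO H x) (FO F y) (FO G y \<otimes>\<^bsub>B\<^esub> FO H y)"
      by (simp add: F.target.tens_cmp_extend)
    also have "\<dots> = ((F2 F x y \<boxtimes>\<^bsub>B\<^esub> F2 G x y) \<boxtimes>\<^bsub>B\<^esub> F2 H x y) \<cdot>\<^bsub>B\<^esub> (?m (FO F x) (FO G x) (FO F y) (FO G y) \<boxtimes>\<^bsub>B\<^esub> ?i (FO H x \<otimes>\<^bsub>B\<^esub> FO H y)) \<cdot>\<^bsub>B\<^esub>
      ?m (FO F x \<otimes>\<^bsub>B\<^esub> FO G x) (FO H x) (FO F y \<otimes>\<^bsub>B\<^esub> FO G y) (FO H y) \<cdot>\<^bsub>B\<^esub>
      (ass B (FO F x) (FO G x) (FO H x) \<boxtimes>\<^bsub>B\<^esub> ass B (FO F y) (FO G y) (FO H y))"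
      by (simp add: F.target.ass_natural_extend F.target.ass_interchange)
    finally show "(\<lambda>a\<in>Ob A. ass B (FO F a) (FO G a) (FO H a)) (x \<otimes>\<^bsub>A\<^esub> y) \<cdot>\<^bsub>B\<^esub> F2 (smf_box A B F (smf_box A B G H)) x y =
        F2 (smf_box A B (smf_box A B F G) H) x y \<cdot>\<^bsub>B\<^esub>
        ((\<lambda>a\<in>Ob A. ass B (FO F a) (FO G a) (FO H a)) x \<boxtimes>\<^bsub>B\<^esub> (\<lambda>a\<in>Ob A. ass B (FO F a) (FO G a) (FO H a)) y)"
      by (simp add: F.target.tens_cmp_extend)
  qed (auto intro!: smf_box assms simp: F.target.ass_natural)
qed

lemma mt_runit:
  assumes "SMF A B F"
  shows "MT A B (smf_box A B F (smf_const A B)) F (\<lambda>a\<in>Ob A. runit B (FO F a))"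
proof -
  interpret F: symmetric_monoidal_functor A B F by fact
  show ?thesis
  proof (rule mtI)
    have "runit B (FO F (unt A)) \<cdot>\<^bsub>B\<^esub> (F0 F \<boxtimes>\<^bsub>B\<^esub> idt B (unt B)) \<cdot>\<^bsub>B\<^esub> inverse_of B (runit B (unt B)) = F0 F"
      by (simp add: F.target.cmp_eq_extend[OF F.target.runit_natural])
    then show "(\<lambda>a\<in>Ob A. runit B (FO F a)) (unt A) \<cdot>\<^bsub>B\<^esub> F0 (smf_box A B F (smf_const A B)) = F0 F"
      by (simp add: smf_const_def)
  next
    fix x y assume [simp]: "x \<in> Ob A" "y \<in> Ob A"
    have "runit B (FO F (x \<otimes>\<^bsub>A\<^esub> y)) \<cdot>\<^bsub>B\<^esub> (F2 F x y \<boxtimes>\<^bsub>B\<^esub> runit B (unt B)) \<cdot>\<^bsub>B\<^esub> interchange B (FO F x) (unt B) (FO F y) (unt B) =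
      runit B (FO F (x \<otimes>\<^bsub>A\<^esub> y)) \<cdot>\<^bsub>B\<^esub> (F2 F x y \<boxtimes>\<^bsub>B\<^esub> idt B (unt B)) \<cdot>\<^bsub>B\<^esub> (idt B (FO F x \<otimes>\<^bsub>B\<^esub> FO F y) \<boxtimes>\<^bsub>B\<^esub> runit B (unt B)) \<cdot>\<^bsub>B\<^esub> interchange B (FO F x) (unt B) (FO F y) (unt B)"
      by (simp add: F.target.tens_cmp_extend)
    also have "\<dots> = F2 F x y \<cdot>\<^bsub>B\<^esub> (runit B (FO F x) \<boxtimes>\<^bsub>B\<^esub> runit B (FO F y))"
      by (simp add: F.target.cmp_eq_extend[OF F.target.runit_natural] F.target.runit_interchange)
    finally show "(\<lambda>a\<in>Ob A. runit B (FO F a)) (x \<otimes>\<^bsub>A\<^esub> y) \<cdot>\<^bsub>B\<^esub> F2 (smf_box A B F (smf_const A B)) x y =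
      F2 F x y \<cdot>\<^bsub>B\<^esub> ((\<lambda>a\<in>Ob A. runit B (FO F a)) x \<boxtimes>\<^bsub>B\<^esub> (\<lambda>a\<in>Ob A. runit B (FO F a)) y)"
      by (simp add: smf_const_def)
  qed (use F.source.symmetric_monoidal_category_axioms F.target.symmetric_monoidal_category_axioms in
    \<open>auto intro!: smf_box assms smf_const simp: F.target.runit_natural\<close>)
qed

lemma mt_lunit:
  assumes "SMF A B F"
  shows "MT A B (smf_box A B (smf_const A B) F) F (\<lambda>a\<in>Ob A. lunit B (FO F a))"
proof -
  interpret F: symmetric_monoidal_functor A B F by fact
  show ?thesis
  proof (rule mtI)
    have "lunit B (FO F (unt A)) \<cdot>\<^bsub>B\<^esub> (idt B (unt B) \<boxtimes>\<^bsub>B\<^esub> F0 F) \<cdot>\<^bsub>B\<^esub> inverse_of B (runit B (unt B)) = F0 F"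
      by (simp add: F.target.cmp_eq_extend[OF F.target.lunit_natural] F.target.lunit_unt)
    then show "(\<lambda>a\<in>Ob A. lunit B (FO F a)) (unt A) \<cdot>\<^bsub>B\<^esub> F0 (smf_box A B (smf_const A B) F) = F0 F"
      by (simp add: smf_const_def)
  next
    fix x y assume [simp]: "x \<in> Ob A" "y \<in> Ob A"
    have "lunit B (FO F (x \<otimes>\<^bsub>A\<^esub> y)) \<cdot>\<^bsub>B\<^esub> (runit B (unt B) \<boxtimes>\<^bsub>B\<^esub> F2 F x y) \<cdot>\<^bsub>B\<^esub> interchange B (unt B) (FO F x) (unt B) (FO F y) =
      lunit B (FO F (x \<otimes>\<^bsub>A\<^esub> y)) \<cdot>\<^bsub>B\<^esub> (idt B (unt B) \<boxtimes>\<^bsub>B\<^esub> F2 F x y) \<cdot>\<^bsub>B\<^esub> (runit B (unt B) \<boxtimes>\<^bsub>B\<^esub> idt B (FO F x \<otimes>\<^bsub>B\<^esub> FO F y)) \<cdot>\<^bsub>B\<^esub> interchange B (unt B) (FO F x) (unt B) (FO F y)"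
      by (simp add: F.target.tens_cmp_extend)
    also have "\<dots> = F2 F x y \<cdot>\<^bsub>B\<^esub> (lunit B (FO F x) \<boxtimes>\<^bsub>B\<^esub> lunit B (FO F y))"
      by (simp add: F.target.cmp_eq_extend[OF F.target.lunit_natural] F.target.lunit_interchange)
    finally show "(\<lambda>a\<in>Ob A. lunit B (FO F a)) (x \<otimes>\<^bsub>A\<^esub> y) \<cdot>\<^bsub>B\<^esub> F2 (smf_box A B (smf_const A B) F) x y =
      F2 F x y \<cdot>\<^bsub>B\<^esub> ((\<lambda>a\<in>Ob A. lunit B (FO F a)) x \<boxtimes>\<^bsub>B\<^esub> (\<lambda>a\<in>Ob A. lunit B (FO F a)) y)"
      by (simp add: smf_const_def)
  qed (use F.source.symmetric_monoidal_category_axioms F.target.symmetric_monoidal_category_axioms in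
    \<open>auto intro!: smf_box assms smf_const simp: F.target.lunit_natural\<close>)
qed

lemma mt_symm:
  assumes "SMF A B F" "SMF A B G"
  shows "MT A B (smf_box A B F G) (smf_box A B G F) (\<lambda>a\<in>Ob A. symm B (FO F a) (FO G a))"
proof -
  interpret F: symmetric_monoidal_functor A B F by fact
  interpret G: symmetric_monoidal_functor A B G by fact
  show ?thesis
    by (rule mtI) (auto intro!: smf_box assms simp: F.target.symm_natural F.target.symm_natural_extend
      F.target.symm_unt F.target.symm_interchange)
qed

lemma mt_inverse:
  assumes "MT A B F G \<sigma>" and i: "\<And>a. a \<in> Ob A \<Longrightarrow> iso B (\<sigma> a)"
  shows "MT A B G F (\<lambda>a\<in>Ob A. inverse_of B (\<sigma> a))"
proof -
  interpret s: monoidal_transformation A B F G \<sigma> by fact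
  note [simp] = i
  let ?i = "inverse_of B"
  show ?thesis
  proof (rule mtI)
    fix f assume [simp]: "f \<in> Ar A"
    have "?i (\<sigma> (cd A f)) \<cdot>\<^bsub>B\<^esub> FA G f = ?i (\<sigma> (cd A f)) \<cdot>\<^bsub>B\<^esub> (FA G f \<cdot>\<^bsub>B\<^esub> \<sigma> (dm A f)) \<cdot>\<^bsub>B\<^esub> ?i (\<sigma> (dm A f))"
      by simp
    also have "\<dots> = FA F f \<cdot>\<^bsub>B\<^esub> ?i (\<sigma> (dm A f))"
      by (subst s.tr_natural[OF _ HOL.refl, symmetric]) simp_all
    finally show "(\<lambda>a\<in>Ob A. ?i (\<sigma> a)) (cd A f) \<cdot>\<^bsub>B\<^esub> FA G f = FA F f \<cdot>\<^bsub>B\<^esub> (\<lambda>a\<in>Ob A. ?i (\<sigma> a)) (dm A f)"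
      by simp
  next
    show "(\<lambda>a\<in>Ob A. ?i (\<sigma> a)) (unt A) \<cdot>\<^bsub>B\<^esub> F0 G = F0 F"
      by (simp add: s.tr_unit[symmetric])
  next
    fix x y assume [simp]: "x \<in> Ob A" "y \<in> Ob A"
    have "?i (\<sigma> (x \<otimes>\<^bsub>A\<^esub> y)) \<cdot>\<^bsub>B\<^esub> F2 G x y = ?i (\<sigma> (x \<otimes>\<^bsub>A\<^esub> y)) \<cdot>\<^bsub>B\<^esub> (F2 G x y \<cdot>\<^bsub>B\<^esub> (\<sigma> x \<boxtimes>\<^bsub>B\<^esub> \<sigma> y)) \<cdot>\<^bsub>B\<^esub> (?i (\<sigma> x) \<boxtimes>\<^bsub>B\<^esub> ?i (\<sigma> y))"
      by (simp add: s.source.target.tens_cmp)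
    also have "\<dots> = F2 F x y \<cdot>\<^bsub>B\<^esub> (?i (\<sigma> x) \<boxtimes>\<^bsub>B\<^esub> ?i (\<sigma> y))"
      by (subst s.tr_tens[symmetric]) simp_all
    finally show "(\<lambda>a\<in>Ob A. ?i (\<sigma> a)) (x \<otimes>\<^bsub>A\<^esub> y) \<cdot>\<^bsub>B\<^esub> F2 G x y = F2 F x y \<cdot>\<^bsub>B\<^esub> ((\<lambda>a\<in>Ob A. ?i (\<sigma> a)) x \<boxtimes>\<^bsub>B\<^esub> (\<lambda>a\<in>Ob A. ?i (\<sigma> a)) y)"
      by simp
  qed (auto intro: s.source.symmetric_monoidal_functor_axioms s.target.symmetric_monoidal_functor_axioms)
qed

section \<open>The internal hom and componentwise reasoning in it\<close>

lemma comp_at_simp [simp]: "comp_at (F, G, \<sigma>) = \<sigma>"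
  by (rule ext) (simp add: comp_at_def)

lemma Ob_ihom: "Ob (ihom A B) = {F. SMF A B F}"
  by (simp add: ihom_def)

lemma dm_ihom_simp [simp]: "dm (ihom A B) (F, G, \<sigma>) = F"
  and cd_ihom_simp [simp]: "cd (ihom A B) (F, G, \<sigma>) = G"
  by (simp_all add: ihom_def)

lemma Ar_ihom: "\<theta> \<in> Ar (ihom A B) \<longleftrightarrow> MT A B (dm (ihom A B) \<theta>) (cd (ihom A B) \<theta>) (comp_at \<theta>)"
  by (cases \<theta>) (auto simp: ihom_def)

lemma Ar_ihom_triple: "(F, G, \<sigma>) \<in> Ar (ihom A B) \<longleftrightarrow> MT A B F G \<sigma>"
  by (simp add: Ar_ihom)

lemma ihom_triple: "\<theta> = (dm (ihom A B) \<theta>, cd (ihom A B) \<theta>, comp_at \<theta>)"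
  by (cases \<theta>) (simp add: ihom_def)

lemma ihom_eqI:
  assumes "\<theta> \<in> Ar (ihom A B)" "\<theta>' \<in> Ar (ihom A B)"
    and "dm (ihom A B) \<theta> = dm (ihom A B) \<theta>'" "cd (ihom A B) \<theta> = cd (ihom A B) \<theta>'"
    and "\<And>a. a \<in> Ob A \<Longrightarrow> comp_at \<theta> a = comp_at \<theta>' a"
  shows "\<theta> = \<theta>'"
proof -
  have "comp_at \<theta> = comp_at \<theta>'"
    using assms(1,2,5) unfolding Ar_ihom
    by (intro extensionalityI[of _ "Ob A"]) (auto dest: monoidal_transformation.tr_ext)
  then show ?thesis using ihom_triple[of \<theta> A B] ihom_triple[of \<theta>' A B] assms(3,4) by simp
qed

text \<open>The equations hold because all structure is computed componentwise in \<open>B\<close>.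
  Structural arrows are invertible because the pointwise inverses of a monoidal transformation form
  a monoidal transformation again, by \<open>mt_inverse\<close>.\<close>

lemma smc_ihom:
  assumes "SMC A" "SMC B"
  shows "SMC (ihom A B)"
proof -
  interpret A: symmetric_monoidal_category A by fact
  interpret B: symmetric_monoidal_category B by fact
  have tp: "\<And>x. x \<in> Ob A \<Longrightarrow> \<sigma> x \<in> Ar B \<and> dm B (\<sigma> x) = FO F x \<and> cd B (\<sigma> x) = FO G x \<and> FO F x \<in> Ob B \<and> FO G x \<in> Ob B"
    if "MT A B F G \<sigma>" for F G \<sigma>
  proof -
    interpret s: monoidal_transformation A B F G \<sigma> by fact
    show "\<And>x. x \<in> Ob A \<Longrightarrow> \<sigma> x \<in> Ar B \<and> dm B (\<sigma> x) = FO F x \<and> cd B (\<sigma> x) = FO G x \<and> FO F x \<in> Ob B \<and> FO G x \<in> Ob B" by simp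
  qed
  have obj: "\<And>x. x \<in> Ob A \<Longrightarrow> FO F x \<in> Ob B" if "SMF A B F" for F
    using that by (rule symmetric_monoidal_functor.FO_Ob)
  have ext: "\<sigma> \<in> extensional (Ob A)" if "MT A B F G \<sigma>" for F G \<sigma>
    using that by (rule monoidal_transformation.tr_ext)
  have src: "SMF A B F" "SMF A B G" if "MT A B F G \<sigma>" for F G \<sigma>
    using that by (auto simp: monoidal_transformation_def)
  have isoI: "iso (ihom A B) (F, G, \<lambda>a\<in>Ob A. \<sigma> a)" if "MT A B F G (\<lambda>a\<in>Ob A. \<sigma> a)" "\<And>a. a \<in> Ob A \<Longrightarrow> iso B (\<sigma> a)" for F G \<sigma>
  proof -
    have "MT A B G F (\<lambda>a\<in>Ob A. inverse_of B (\<sigma> a))"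
      using mt_inverse[OF that(1)] that(2) by (simp cong: restrict_cong)
    then have "is_inv (ihom A B) (F, G, \<lambda>a\<in>Ob A. \<sigma> a) (G, F, \<lambda>a\<in>Ob A. inverse_of B (\<sigma> a))"
      using that tp[OF that(1)] by (auto simp: is_inv_def hom_def ihom_def intro!: restrict_ext)
    then show ?thesis unfolding iso_def by blast
  qed
  have ex: "(\<lambda>a\<in>Ob A. f a) = g" if "\<And>a. a \<in> Ob A \<Longrightarrow> f a = g a" "g \<in> extensional (Ob A)" for f g
    using that by (intro extensionalityI[of _ "Ob A"]) auto
  show ?thesis
  proof unfold_locales
    fix F G H
    assume o: "F \<in> Ob (ihom A B)" "G \<in> Ob (ihom A B)" "H \<in> Ob (ihom A B)"
    show "iso (ihom A B) (ass (ihom A B) F G H)"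
      using o mt_ass[of A B F G H] obj by (auto simp: Ob_ihom) (auto simp: ihom_def intro!: isoI[unfolded ihom_def])
  next
    fix F assume o: "F \<in> Ob (ihom A B)"
    show "iso (ihom A B) (runit (ihom A B) F)"
      using o mt_runit[of A B F] obj by (auto simp: Ob_ihom) (auto simp: ihom_def intro!: isoI[unfolded ihom_def])
    show "iso (ihom A B) (lunit (ihom A B) F)"
      using o mt_lunit[of A B F] obj by (auto simp: Ob_ihom) (auto simp: ihom_def intro!: isoI[unfolded ihom_def])
  qed (auto simp: ihom_def hom_def monoidal_transformation.tr_typing obj B.tens_cmp B.ass_natural B.runit_natural
      B.lunit_natural B.symm_natural B.pentagon B.triangle B.symm_unit B.hexagon dest: src intro!: mt_id mt_comp smf_box smf_const mt_box mt_ass mt_runit mt_lunit mt_symm assms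
      ext ex restrict_ext)
qed

lemma smf_source: "SMF A B F \<Longrightarrow> SMC A" and smf_target: "SMF A B F \<Longrightarrow> SMC B"
  by (simp_all add: symmetric_monoidal_functor_def)

lemma smf_FO_Ob [simp]: "SMF A B F \<Longrightarrow> x \<in> Ob A \<Longrightarrow> FO F x \<in> Ob B"
  by (rule symmetric_monoidal_functor.FO_Ob)

lemma mt_smf: "MT A B F G \<sigma> \<Longrightarrow> SMF A B F" "MT A B F G \<sigma> \<Longrightarrow> SMF A B G"
  by (simp_all add: monoidal_transformation_def)

declare smf_box [simp] smf_const [simp] smc_ihom [simp]

lemma ihom_simps [simp]:
  "F \<in> Ob (ihom A B) \<longleftrightarrow> SMF A B F"
  "F \<otimes>\<^bsub>ihom A B\<^esub> G = smf_box A B F G"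
  "unt (ihom A B) = smf_const A B"
  by (simp_all add: ihom_def)

lemma comp_at_ihom [simp]:
  assumes "a \<in> Ob A"
  shows "comp_at (idt (ihom A B) F) a = idt B (FO F a)"
    "comp_at (\<theta>' \<cdot>\<^bsub>ihom A B\<^esub> \<theta>) a = comp_at \<theta>' a \<cdot>\<^bsub>B\<^esub> comp_at \<theta> a"
    "comp_at (\<theta> \<boxtimes>\<^bsub>ihom A B\<^esub> \<theta>') a = comp_at \<theta> a \<boxtimes>\<^bsub>B\<^esub> comp_at \<theta>' a"
    "comp_at (ass (ihom A B) F G H) a = ass B (FO F a) (FO G a) (FO H a)"
    "comp_at (runit (ihom A B) F) a = runit B (FO F a)"
    "comp_at (lunit (ihom A B) F) a = lunit B (FO F a)"
    "comp_at (symm (ihom A B) F G) a = symm B (FO F a) (FO G a)"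
  using assms by (cases \<theta>; cases \<theta>'; simp add: ihom_def)+

lemma ihom_arrow [simp]:
  assumes "\<theta> \<in> Ar (ihom A B)"
  shows "SMF A B (dm (ihom A B) \<theta>)" "SMF A B (cd (ihom A B) \<theta>)"
    and "a \<in> Ob A \<Longrightarrow> comp_at \<theta> a \<in> Ar B"
    and "a \<in> Ob A \<Longrightarrow> dm B (comp_at \<theta> a) = FO (dm (ihom A B) \<theta>) a"
    and "a \<in> Ob A \<Longrightarrow> cd B (comp_at \<theta> a) = FO (cd (ihom A B) \<theta>) a"
  using assms unfolding Ar_ihom
  by (auto dest: mt_smf monoidal_transformation.tr_typing)

lemma is_inv_comp_at:
  assumes "is_inv (ihom A B) \<theta> \<theta>'" "a \<in> Ob A"
  shows "is_inv B (comp_at \<theta> a) (comp_at \<theta>' a)"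
proof -
  have t: "\<theta> \<in> Ar (ihom A B)" "\<theta>' \<in> Ar (ihom A B)" "dm (ihom A B) \<theta>' = cd (ihom A B) \<theta>" "cd (ihom A B) \<theta>' = dm (ihom A B) \<theta>"
    and e: "\<theta>' \<cdot>\<^bsub>ihom A B\<^esub> \<theta> = idt (ihom A B) (dm (ihom A B) \<theta>)" "\<theta> \<cdot>\<^bsub>ihom A B\<^esub> \<theta>' = idt (ihom A B) (cd (ihom A B) \<theta>)"
    using assms(1) by (auto simp: is_inv_def hom_iff)
  have "category B" using smf_target[OF ihom_arrow(1)[OF t(1)]] by (simp add: symmetric_monoidal_category_def)
  then show ?thesis
    using t assms(2) arg_cong[OF e(1), of "\<lambda>\<theta>. comp_at \<theta> a"] arg_cong[OF e(2), of "\<lambda>\<theta>. comp_at \<theta> a"]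
    by (intro category.is_invI) simp_all
qed

lemma comp_at_inverse [simp]:
  assumes "SMC A" "SMC B" "iso (ihom A B) \<theta>" "a \<in> Ob A"
  shows "comp_at (inverse_of (ihom A B) \<theta>) a = inverse_of B (comp_at \<theta> a)"
proof -
  interpret B: symmetric_monoidal_category B by fact
  interpret H: symmetric_monoidal_category "ihom A B" by (rule smc_ihom) fact+
  show ?thesis using is_inv_comp_at[OF H.is_inv_inverse[OF assms(3)] assms(4)] B.inverse_of_eq by simp
qed

lemma iso_ihomI:
  assumes "\<theta> \<in> Ar (ihom A B)" "\<And>a. a \<in> Ob A \<Longrightarrow> iso B (comp_at \<theta> a)"
  shows "iso (ihom A B) \<theta>"
proof -
  note S = smf_source[OF ihom_arrow(1)[OF assms(1)]] smf_target[OF ihom_arrow(1)[OF assms(1)]]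
  interpret B: symmetric_monoidal_category B by (rule S)
  interpret H: symmetric_monoidal_category "ihom A B" by (rule smc_ihom) (rule S)+
  have m: "MT A B (cd (ihom A B) \<theta>) (dm (ihom A B) \<theta>) (\<lambda>a\<in>Ob A. inverse_of B (comp_at \<theta> a))"
    using mt_inverse assms Ar_ihom by blast
  then have t: "(cd (ihom A B) \<theta>, dm (ihom A B) \<theta>, \<lambda>a\<in>Ob A. inverse_of B (comp_at \<theta> a)) \<in> Ar (ihom A B)"
    by (simp add: Ar_ihom_triple)
  have "is_inv (ihom A B) \<theta> (cd (ihom A B) \<theta>, dm (ihom A B) \<theta>, \<lambda>a\<in>Ob A. inverse_of B (comp_at \<theta> a))"
    by (rule H.is_invI) (use assms t in \<open>auto intro!: ihom_eqI[where A=A and B=B]\<close>)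
  then show ?thesis by (auto simp: iso_def)
qed

lemma comp_at_interchange [simp]:
  assumes "SMF A B F" "SMF A B G" "SMF A B H" "SMF A B K" "a \<in> Ob A"
  shows "comp_at (interchange (ihom A B) F G H K) a = interchange B (FO F a) (FO G a) (FO H a) (FO K a)"
proof -
  interpret B: symmetric_monoidal_category B by (rule smf_target) fact
  interpret H: symmetric_monoidal_category "ihom A B"
    by (rule smc_ihom) (rule smf_source smf_target, fact)+
  show ?thesis
    using assms smf_source[OF assms(1)] smf_target[OF assms(1)]
    by (simp add: interchange_def)
qed

lemma smf_ihom_eqI:
  assumes "SMF X (ihom A B) P" "SMF X (ihom A B) Q"
    and "\<And>x. x \<in> Ob X \<Longrightarrow> FO P x = FO Q x"
    and "\<And>f a. f \<in> Ar X \<Longrightarrow> a \<in> Ob A \<Longrightarrow> comp_at (FA P f) a = comp_at (FA Q f) a"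
    and "\<And>a. a \<in> Ob A \<Longrightarrow> comp_at (F0 P) a = comp_at (F0 Q) a"
    and "\<And>x y a. x \<in> Ob X \<Longrightarrow> y \<in> Ob X \<Longrightarrow> a \<in> Ob A \<Longrightarrow> comp_at (F2 P x y) a = comp_at (F2 Q x y) a"
  shows "P = Q"
proof -
  interpret P: symmetric_monoidal_functor X "ihom A B" P by fact
  interpret Q: symmetric_monoidal_functor X "ihom A B" Q by fact
  show ?thesis
    by (rule smf_eqI[OF assms(1,2)]) (auto intro!: ihom_eqI[where A=A and B=B] simp: assms(3-))
qed

text \<open>The axioms for a functor into \<open>[A, B]\<close> are reduced to equations in
  \<open>B\<close>. What is left for each application is to see that the given families are monoidal
  transformations.\<close>

lemma smf_into_ihomI:
  assumes "SMC X" "SMC A" "SMC B"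
    and "FO F \<in> extensional (Ob X)" "FA F \<in> extensional (Ar X)" "F2 F \<in> extensional (Ob X)"
    and "\<And>x. x \<in> Ob X \<Longrightarrow> F2 F x \<in> extensional (Ob X)"
    and o: "\<And>x. x \<in> Ob X \<Longrightarrow> SMF A B (FO F x)"
    and f: "\<And>f. f \<in> Ar X \<Longrightarrow> FA F f \<in> Ar (ihom A B) \<and> dm (ihom A B) (FA F f) = FO F (dm X f) \<and> cd (ihom A B) (FA F f) = FO F (cd X f)"
    and i: "\<And>x a. x \<in> Ob X \<Longrightarrow> a \<in> Ob A \<Longrightarrow> comp_at (FA F (idt X x)) a = idt B (FO (FO F x) a)"
    and c: "\<And>f g a. f \<in> Ar X \<Longrightarrow> g \<in> Ar X \<Longrightarrow> dm X g = cd X f \<Longrightarrow> a \<in> Ob A \<Longrightarrow>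
      comp_at (FA F (g \<cdot>\<^bsub>X\<^esub> f)) a = comp_at (FA F g) a \<cdot>\<^bsub>B\<^esub> comp_at (FA F f) a"
    and z: "F0 F \<in> Ar (ihom A B) \<and> dm (ihom A B) (F0 F) = smf_const A B \<and> cd (ihom A B) (F0 F) = FO F (unt X)"
    and t: "\<And>x y. x \<in> Ob X \<Longrightarrow> y \<in> Ob X \<Longrightarrow> F2 F x y \<in> Ar (ihom A B) \<and>
      dm (ihom A B) (F2 F x y) = smf_box A B (FO F x) (FO F y) \<and> cd (ihom A B) (F2 F x y) = FO F (x \<otimes>\<^bsub>X\<^esub> y)"
    and "\<And>f g a. f \<in> Ar X \<Longrightarrow> g \<in> Ar X \<Longrightarrow> a \<in> Ob A \<Longrightarrow>
      comp_at (F2 F (cd X f) (cd X g)) a \<cdot>\<^bsub>B\<^esub> (comp_at (FA F f) a \<boxtimes>\<^bsub>B\<^esub> comp_at (FA F g) a) =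
      comp_at (FA F (f \<boxtimes>\<^bsub>X\<^esub> g)) a \<cdot>\<^bsub>B\<^esub> comp_at (F2 F (dm X f) (dm X g)) a"
    and "\<And>x y z a. x \<in> Ob X \<Longrightarrow> y \<in> Ob X \<Longrightarrow> z \<in> Ob X \<Longrightarrow> a \<in> Ob A \<Longrightarrow>
      comp_at (FA F (ass X x y z)) a \<cdot>\<^bsub>B\<^esub> comp_at (F2 F x (y \<otimes>\<^bsub>X\<^esub> z)) a \<cdot>\<^bsub>B\<^esub> (idt B (FO (FO F x) a) \<boxtimes>\<^bsub>B\<^esub> comp_at (F2 F y z) a) =
      comp_at (F2 F (x \<otimes>\<^bsub>X\<^esub> y) z) a \<cdot>\<^bsub>B\<^esub> (comp_at (F2 F x y) a \<boxtimes>\<^bsub>B\<^esub> idt B (FO (FO F z) a)) \<cdot>\<^bsub>B\<^esub>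
        ass B (FO (FO F x) a) (FO (FO F y) a) (FO (FO F z) a)"
    and "\<And>x a. x \<in> Ob X \<Longrightarrow> a \<in> Ob A \<Longrightarrow>
      comp_at (FA F (runit X x)) a \<cdot>\<^bsub>B\<^esub> comp_at (F2 F x (unt X)) a \<cdot>\<^bsub>B\<^esub> (idt B (FO (FO F x) a) \<boxtimes>\<^bsub>B\<^esub> comp_at (F0 F) a) = runit B (FO (FO F x) a)"
    and "\<And>x a. x \<in> Ob X \<Longrightarrow> a \<in> Ob A \<Longrightarrow>
      comp_at (FA F (lunit X x)) a \<cdot>\<^bsub>B\<^esub> comp_at (F2 F (unt X) x) a \<cdot>\<^bsub>B\<^esub> (comp_at (F0 F) a \<boxtimes>\<^bsub>B\<^esub> idt B (FO (FO F x) a)) = lunit B (FO (FO F x) a)"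
    and "\<And>x y a. x \<in> Ob X \<Longrightarrow> y \<in> Ob X \<Longrightarrow> a \<in> Ob A \<Longrightarrow>
      comp_at (FA F (symm X x y)) a \<cdot>\<^bsub>B\<^esub> comp_at (F2 F x y) a = comp_at (F2 F y x) a \<cdot>\<^bsub>B\<^esub> symm B (FO (FO F x) a) (FO (FO F y) a)"
  shows "SMF X (ihom A B) F"
proof -
  interpret X: symmetric_monoidal_category X by fact
  interpret H: symmetric_monoidal_category "ihom A B" by (rule smc_ihom) fact+
  note [simp] = o f z t
  show ?thesis
    by (rule smfI) (auto intro!: ihom_eqI[where A=A and B=B] simp: assms)
qed

text \<open>That \<open>F\<close> preserves unit and tensor of objects is not part of the
  definition: it follows from the targets of \<open>F0\<close> and \<open>F2\<close>, once these
  arrows are identities.\<close>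

definition strict :: "('o, 'm) smc \<Rightarrow> ('p, 'n) smc \<Rightarrow> ('o, 'm, 'p, 'n) smf \<Rightarrow> bool" where
  "strict A B F \<longleftrightarrow> F0 F = idt B (unt B) \<and>
     (\<forall>x\<in>Ob A. \<forall>y\<in>Ob A. F2 F x y = idt B (FO F x \<otimes>\<^bsub>B\<^esub> FO F y))"

lemma strictD:
  "strict A B F \<Longrightarrow> F0 F = idt B (unt B)"
  "strict A B F \<Longrightarrow> x \<in> Ob A \<Longrightarrow> y \<in> Ob A \<Longrightarrow> F2 F x y = idt B (FO F x \<otimes>\<^bsub>B\<^esub> FO F y)"
  by (simp_all add: strict_def)

lemma strict_comp:
  assumes "SMF A B F" "SMF B C G" "strict A B F" "strict B C G"
  shows "strict A C (smf_comp A C G F)"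
proof -
  interpret F: symmetric_monoidal_functor A B F by fact
  interpret G: symmetric_monoidal_functor B C G by fact
  have "FO G (unt B) = unt C" "FO F (unt A) = unt B" using G.F0_typing(3) F.F0_typing(3) strictD(1)[OF assms(4)] strictD(1)[OF assms(3)] by auto
  moreover have "FO G (x \<otimes>\<^bsub>B\<^esub> y) = FO G x \<otimes>\<^bsub>C\<^esub> FO G y" if "x \<in> Ob B" "y \<in> Ob B" for x y
    using that strictD(2)[OF assms(4)] G.F2_typing(3)[of x y] by simp
  ultimately show ?thesis using assms(3,4) by (simp add: strict_def)
qed

lemma strict_smfI:
  assumes "SMC A" "SMC B"
    and "FO F \<in> extensional (Ob A)" "FA F \<in> extensional (Ar A)" "F2 F \<in> extensional (Ob A)"
    and "\<And>x. x \<in> Ob A \<Longrightarrow> F2 F x \<in> extensional (Ob A)"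
    and s: "strict A B F"
    and o: "\<And>x. x \<in> Ob A \<Longrightarrow> FO F x \<in> Ob B"
    and a: "\<And>f. f \<in> Ar A \<Longrightarrow> FA F f \<in> Ar B \<and> dm B (FA F f) = FO F (dm A f) \<and> cd B (FA F f) = FO F (cd A f)"
    and i: "\<And>x. x \<in> Ob A \<Longrightarrow> FA F (idt A x) = idt B (FO F x)"
    and c: "\<And>f g. f \<in> Ar A \<Longrightarrow> g \<in> Ar A \<Longrightarrow> dm A g = cd A f \<Longrightarrow> FA F (g \<cdot>\<^bsub>A\<^esub> f) = FA F g \<cdot>\<^bsub>B\<^esub> FA F f"
    and u: "FO F (unt A) = unt B"
    and t: "\<And>x y. x \<in> Ob A \<Longrightarrow> y \<in> Ob A \<Longrightarrow> FO F (x \<otimes>\<^bsub>A\<^esub> y) = FO F x \<otimes>\<^bsub>B\<^esub> FO F y"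
    and "\<And>f g. f \<in> Ar A \<Longrightarrow> g \<in> Ar A \<Longrightarrow> FA F (f \<boxtimes>\<^bsub>A\<^esub> g) = FA F f \<boxtimes>\<^bsub>B\<^esub> FA F g"
    and "\<And>x y z. x \<in> Ob A \<Longrightarrow> y \<in> Ob A \<Longrightarrow> z \<in> Ob A \<Longrightarrow> FA F (ass A x y z) = ass B (FO F x) (FO F y) (FO F z)"
    and "\<And>x. x \<in> Ob A \<Longrightarrow> FA F (runit A x) = runit B (FO F x)"
    and "\<And>x. x \<in> Ob A \<Longrightarrow> FA F (lunit A x) = lunit B (FO F x)"
    and "\<And>x y. x \<in> Ob A \<Longrightarrow> y \<in> Ob A \<Longrightarrow> FA F (symm A x y) = symm B (FO F x) (FO F y)"
  shows "SMF A B F"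
proof -
  interpret A: symmetric_monoidal_category A by fact
  interpret B: symmetric_monoidal_category B by fact
  note [simp] = strictD[OF s] o a t u
  show ?thesis by (rule smfI) (use assms in \<open>auto simp: i c\<close>)
qed

lemma strict_into_ihomI:
  assumes "SMC X" "SMC A" "SMC B"
    and "FO F \<in> extensional (Ob X)" "FA F \<in> extensional (Ar X)" "F2 F \<in> extensional (Ob X)"
    and "\<And>x. x \<in> Ob X \<Longrightarrow> F2 F x \<in> extensional (Ob X)"
    and s: "strict X (ihom A B) F"
    and o: "\<And>x. x \<in> Ob X \<Longrightarrow> SMF A B (FO F x)"
    and f: "\<And>f. f \<in> Ar X \<Longrightarrow> FA F f \<in> Ar (ihom A B) \<and> dm (ihom A B) (FA F f) = FO F (dm X f) \<and> cd (ihom A B) (FA F f) = FO F (cd X f)"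
    and "\<And>x a. x \<in> Ob X \<Longrightarrow> a \<in> Ob A \<Longrightarrow> comp_at (FA F (idt X x)) a = idt B (FO (FO F x) a)"
    and "\<And>f g a. f \<in> Ar X \<Longrightarrow> g \<in> Ar X \<Longrightarrow> dm X g = cd X f \<Longrightarrow> a \<in> Ob A \<Longrightarrow>
      comp_at (FA F (g \<cdot>\<^bsub>X\<^esub> f)) a = comp_at (FA F g) a \<cdot>\<^bsub>B\<^esub> comp_at (FA F f) a"
    and u: "FO F (unt X) = smf_const A B"
    and t: "\<And>x y. x \<in> Ob X \<Longrightarrow> y \<in> Ob X \<Longrightarrow> FO F (x \<otimes>\<^bsub>X\<^esub> y) = smf_box A B (FO F x) (FO F y)"
    and "\<And>f g a. f \<in> Ar X \<Longrightarrow> g \<in> Ar X \<Longrightarrow> a \<in> Ob A \<Longrightarrow>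
      comp_at (FA F (f \<boxtimes>\<^bsub>X\<^esub> g)) a = comp_at (FA F f) a \<boxtimes>\<^bsub>B\<^esub> comp_at (FA F g) a"
    and "\<And>x y z a. x \<in> Ob X \<Longrightarrow> y \<in> Ob X \<Longrightarrow> z \<in> Ob X \<Longrightarrow> a \<in> Ob A \<Longrightarrow>
      comp_at (FA F (ass X x y z)) a = ass B (FO (FO F x) a) (FO (FO F y) a) (FO (FO F z) a)"
    and "\<And>x a. x \<in> Ob X \<Longrightarrow> a \<in> Ob A \<Longrightarrow> comp_at (FA F (runit X x)) a = runit B (FO (FO F x) a)"
    and "\<And>x a. x \<in> Ob X \<Longrightarrow> a \<in> Ob A \<Longrightarrow> comp_at (FA F (lunit X x)) a = lunit B (FO (FO F x) a)"
    and "\<And>x y a. x \<in> Ob X \<Longrightarrow> y \<in> Ob X \<Longrightarrow> a \<in> Ob A \<Longrightarrow>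
      comp_at (FA F (symm X x y)) a = symm B (FO (FO F x) a) (FO (FO F y) a)"
  shows "SMF X (ihom A B) F"
proof -
  interpret X: symmetric_monoidal_category X by fact
  interpret H: symmetric_monoidal_category "ihom A B" by (rule smc_ihom) fact+
  note [simp] = o f u t
  show ?thesis
    by (rule strict_smfI) (auto intro!: ihom_eqI[where A=A and B=B] simp: assms)
qed

lemma strict_eqI:
  assumes "SMF A B F" "SMF A B G" "strict A B F" "strict A B G"
    and "\<And>x. x \<in> Ob A \<Longrightarrow> FO F x = FO G x" "\<And>f. f \<in> Ar A \<Longrightarrow> FA F f = FA G f"
  shows "F = G"
  by (rule smf_eqI[OF assms(1,2)]) (use assms(3-) in \<open>auto simp: strict_def\<close>)

section \<open>Composition of functors and its compatibility with the pointwise structure\<close>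

lemma smf_comp_assoc:
  assumes "SMF A B F" "SMF B C G" "SMF C D H"
  shows "smf_comp A D H (smf_comp A C G F) = smf_comp A D (smf_comp B D H G) F"
proof -
  interpret F: symmetric_monoidal_functor A B F by fact
  interpret G: symmetric_monoidal_functor B C G by fact
  interpret H: symmetric_monoidal_functor C D H by fact
  show ?thesis
    by (rule smf_eqI[of A D]) (use smf_comp[OF smf_comp[OF assms(1,2)] assms(3)] smf_comp[OF assms(1) smf_comp[OF assms(2,3)]] in auto)
qed

lemma smf_comp_id [simp]:
  assumes "SMF A B F"
  shows "smf_comp A B F (smf_id A) = F" "smf_comp A B (smf_id B) F = F"
proof -
  interpret F: symmetric_monoidal_functor A B F by fact
  have i: "SMF A A (smf_id A)" "SMF B B (smf_id B)"
    using smf_id F.source.symmetric_monoidal_category_axioms F.target.symmetric_monoidal_category_axioms by auto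
  show "smf_comp A B F (smf_id A) = F"
    by (rule smf_eqI[of A B]) (use assms smf_comp[OF i(1) assms] in auto)
  show "smf_comp A B (smf_id B) F = F"
    by (rule smf_eqI[of A B]) (use assms smf_comp[OF assms i(2)] in auto)
qed

lemma smf_comp_box:
  assumes "SMF A B K" "SMF B C F" "SMF B C G"
  shows "smf_comp A C (smf_box B C F G) K = smf_box A C (smf_comp A C F K) (smf_comp A C G K)"
proof -
  interpret K: symmetric_monoidal_functor A B K by fact
  interpret F: symmetric_monoidal_functor B C F by fact
  interpret G: symmetric_monoidal_functor B C G by fact
  show ?thesis
    by (rule smf_eqI[of A C])
      (use smf_comp[OF assms(1) smf_box[OF assms(2,3)]] smf_comp[OF assms(1,2)] smf_comp[OF assms(1,3)] in
        \<open>auto simp: F.target.tens_cmp_extend\<close>)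
qed

lemma smf_comp_const:
  assumes "SMF A B K" "SMC C"
  shows "smf_comp A C (smf_const B C) K = smf_const A C"
proof -
  interpret K: symmetric_monoidal_functor A B K by fact
  interpret C: symmetric_monoidal_category C by fact
  have c: "SMF B C (smf_const B C)" using smf_target[OF assms(1)] assms(2) by simp
  show ?thesis
    by (rule smf_eqI[of A C]) (use smf_comp[OF assms(1) c] smf_source[OF assms(1)] assms(2) in auto)
qed

section \<open>Postcomposition as a functor between internal homs\<close>

lemma post_simps [simp]:
  "SMF A B H \<Longrightarrow> FO (post A B C F) H = smf_comp A C F H"
  "\<theta> \<in> Ar (ihom A B) \<Longrightarrow> dm (ihom A C) (FA (post A B C F) \<theta>) = smf_comp A C F (dm (ihom A B) \<theta>)"
  "\<theta> \<in> Ar (ihom A B) \<Longrightarrow> cd (ihom A C) (FA (post A B C F) \<theta>) = smf_comp A C F (cd (ihom A B) \<theta>)"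
  "\<theta> \<in> Ar (ihom A B) \<Longrightarrow> a \<in> Ob A \<Longrightarrow> comp_at (FA (post A B C F) \<theta>) a = FA F (comp_at \<theta> a)"
  "dm (ihom A C) (F0 (post A B C F)) = smf_const A C"
  "cd (ihom A C) (F0 (post A B C F)) = smf_comp A C F (smf_const A B)"
  "a \<in> Ob A \<Longrightarrow> comp_at (F0 (post A B C F)) a = F0 F"
  "SMF A B H \<Longrightarrow> SMF A B K \<Longrightarrow> dm (ihom A C) (F2 (post A B C F) H K) = smf_box A C (smf_comp A C F H) (smf_comp A C F K)"
  "SMF A B H \<Longrightarrow> SMF A B K \<Longrightarrow> cd (ihom A C) (F2 (post A B C F) H K) = smf_comp A C F (smf_box A B H K)"
  "SMF A B H \<Longrightarrow> SMF A B K \<Longrightarrow> a \<in> Ob A \<Longrightarrow> comp_at (F2 (post A B C F) H K) a = F2 F (FO H a) (FO K a)"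
  by (simp_all add: post_def)

lemma post_ext:
  "FO (post A B C F) \<in> extensional (Ob (ihom A B))" "FA (post A B C F) \<in> extensional (Ar (ihom A B))"
  "F2 (post A B C F) \<in> extensional (Ob (ihom A B))"
  "H \<in> Ob (ihom A B) \<Longrightarrow> F2 (post A B C F) H \<in> extensional (Ob (ihom A B))"
  by (simp_all add: post_def del: ihom_simps)

context symmetric_monoidal_functor begin

text \<open>A consequence of the right unit axiom at the unit object. It is the tensor condition for
  the constant family \<open>F0 F\<close>, and the unit condition for the family
  \<open>F2 F\<close>, in the structure of \<open>post\<close>.\<close>

lemma F2_unt: "F2 F (unt A) (unt A) \<cdot>\<^bsub>B\<^esub> (F0 F \<boxtimes>\<^bsub>B\<^esub> F0 F) = FA F (inverse_of A (runit A (unt A))) \<cdot>\<^bsub>B\<^esub> F0 F \<cdot>\<^bsub>B\<^esub> runit B (unt B)"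
proof (rule target.iso_cancel_left[of "FA F (runit A (unt A))"])
  have "FA F (runit A (unt A)) \<cdot>\<^bsub>B\<^esub> F2 F (unt A) (unt A) \<cdot>\<^bsub>B\<^esub> (F0 F \<boxtimes>\<^bsub>B\<^esub> F0 F) =
    (FA F (runit A (unt A)) \<cdot>\<^bsub>B\<^esub> F2 F (unt A) (unt A) \<cdot>\<^bsub>B\<^esub> (idt B (FO F (unt A)) \<boxtimes>\<^bsub>B\<^esub> F0 F)) \<cdot>\<^bsub>B\<^esub> (F0 F \<boxtimes>\<^bsub>B\<^esub> idt B (unt B))"
    by (simp add: target.tens_cmp)
  also have "\<dots> = F0 F \<cdot>\<^bsub>B\<^esub> runit B (unt B)"
    by (simp only: F2_runit source.Ob_unt) (simp add: target.runit_natural)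
  finally show "FA F (runit A (unt A)) \<cdot>\<^bsub>B\<^esub> F2 F (unt A) (unt A) \<cdot>\<^bsub>B\<^esub> (F0 F \<boxtimes>\<^bsub>B\<^esub> F0 F) =
    FA F (runit A (unt A)) \<cdot>\<^bsub>B\<^esub> FA F (inverse_of A (runit A (unt A))) \<cdot>\<^bsub>B\<^esub> F0 F \<cdot>\<^bsub>B\<^esub> runit B (unt B)"
    by (simp add: FA_inverse)
qed auto

end

lemma mt_post_F0:
  assumes "SMC A" "SMF B C F"
  shows "MT A C (smf_const A C) (smf_comp A C F (smf_const A B)) (\<lambda>a\<in>Ob A. F0 F)"
proof -
  interpret A: symmetric_monoidal_category A by fact
  interpret F: symmetric_monoidal_functor B C F by fact
  have c: "SMF A B (smf_const A B)" "SMF A C (smf_const A C)"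
    using assms smf_source[OF assms(2)] smf_target[OF assms(2)] by auto
  show ?thesis
    by (rule mtI) (use c smf_comp[OF c(1) assms(2)] in \<open>auto simp: F.F2_unt F.FA_inverse\<close>)
qed

text \<open>The tensor condition is \<open>F2_interchange\<close>, so it rests on the compatibility
  of \<open>F\<close> with the symmetry: for functors that are only monoidal, \<open>F2 F\<close>
  would not be a monoidal transformation.\<close>

lemma mt_post_F2:
  assumes "SMF B C F" "SMF A B H" "SMF A B K"
  shows "MT A C (smf_box A C (smf_comp A C F H) (smf_comp A C F K)) (smf_comp A C F (smf_box A B H K))
    (\<lambda>a\<in>Ob A. F2 F (FO H a) (FO K a))"
proof -
  interpret F: symmetric_monoidal_functor B C F by fact
  interpret H: symmetric_monoidal_functor A B H by fact
  interpret K: symmetric_monoidal_functor A B K by fact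
  note s = smf_box[OF smf_comp[OF assms(2,1)] smf_comp[OF assms(3,1)]] smf_comp[OF smf_box[OF assms(2,3)] assms(1)]
  show ?thesis
  proof (rule mtI)
    have "F2 F (FO H (unt A)) (FO K (unt A)) \<cdot>\<^bsub>C\<^esub> ((FA F (F0 H) \<cdot>\<^bsub>C\<^esub> F0 F) \<boxtimes>\<^bsub>C\<^esub> (FA F (F0 K) \<cdot>\<^bsub>C\<^esub> F0 F)) \<cdot>\<^bsub>C\<^esub> inverse_of C (runit C (unt C)) =
      F2 F (FO H (unt A)) (FO K (unt A)) \<cdot>\<^bsub>C\<^esub> (FA F (F0 H) \<boxtimes>\<^bsub>C\<^esub> FA F (F0 K)) \<cdot>\<^bsub>C\<^esub> (F0 F \<boxtimes>\<^bsub>C\<^esub> F0 F) \<cdot>\<^bsub>C\<^esub> inverse_of C (runit C (unt C))"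
      by (simp add: F.target.tens_cmp_extend)
    also have "\<dots> = FA F (F0 H \<boxtimes>\<^bsub>B\<^esub> F0 K) \<cdot>\<^bsub>C\<^esub> (F2 F (unt B) (unt B) \<cdot>\<^bsub>C\<^esub> (F0 F \<boxtimes>\<^bsub>C\<^esub> F0 F)) \<cdot>\<^bsub>C\<^esub> inverse_of C (runit C (unt C))"
      by (simp add: F.F2_natural_extend)
    also have "\<dots> = FA F (F0 H \<boxtimes>\<^bsub>B\<^esub> F0 K) \<cdot>\<^bsub>C\<^esub> FA F (inverse_of B (runit B (unt B))) \<cdot>\<^bsub>C\<^esub> F0 F"
      by (simp add: F.F2_unt)
    finally show "(\<lambda>a\<in>Ob A. F2 F (FO H a) (FO K a)) (unt A) \<cdot>\<^bsub>C\<^esub> F0 (smf_box A C (smf_comp A C F H) (smf_comp A C F K)) =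
        F0 (smf_comp A C F (smf_box A B H K))"
      by simp
  next
    fix x y assume [simp]: "x \<in> Ob A" "y \<in> Ob A"
    let ?H = "FO H" and ?K = "FO K"
    have "F2 F (?H (x \<otimes>\<^bsub>A\<^esub> y)) (?K (x \<otimes>\<^bsub>A\<^esub> y)) \<cdot>\<^bsub>C\<^esub>
      ((FA F (F2 H x y) \<cdot>\<^bsub>C\<^esub> F2 F (?H x) (?H y)) \<boxtimes>\<^bsub>C\<^esub> (FA F (F2 K x y) \<cdot>\<^bsub>C\<^esub> F2 F (?K x) (?K y))) \<cdot>\<^bsub>C\<^esub>
      interchange C (FO F (?H x)) (FO F (?K x)) (FO F (?H y)) (FO F (?K y)) =
      F2 F (?H (x \<otimes>\<^bsub>A\<^esub> y)) (?K (x \<otimes>\<^bsub>A\<^esub> y)) \<cdot>\<^bsub>C\<^esub> (FA F (F2 H x y) \<boxtimes>\<^bsub>C\<^esub> FA F (F2 K x y)) \<cdot>\<^bsub>C\<^esub>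
      (F2 F (?H x) (?H y) \<boxtimes>\<^bsub>C\<^esub> F2 F (?K x) (?K y)) \<cdot>\<^bsub>C\<^esub> interchange C (FO F (?H x)) (FO F (?K x)) (FO F (?H y)) (FO F (?K y))"
      by (simp add: F.target.tens_cmp_extend)
    also have "\<dots> = FA F (F2 H x y \<boxtimes>\<^bsub>B\<^esub> F2 K x y) \<cdot>\<^bsub>C\<^esub> FA F (interchange B (?H x) (?K x) (?H y) (?K y)) \<cdot>\<^bsub>C\<^esub>
        F2 F (?H x \<otimes>\<^bsub>B\<^esub> ?K x) (?H y \<otimes>\<^bsub>B\<^esub> ?K y) \<cdot>\<^bsub>C\<^esub> (F2 F (?H x) (?K x) \<boxtimes>\<^bsub>C\<^esub> F2 F (?H y) (?K y))"
      by (simp add: F.F2_natural_extend F.F2_interchange)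
    finally show "(\<lambda>a\<in>Ob A. F2 F (FO H a) (FO K a)) (x \<otimes>\<^bsub>A\<^esub> y) \<cdot>\<^bsub>C\<^esub> F2 (smf_box A C (smf_comp A C F H) (smf_comp A C F K)) x y =
      F2 (smf_comp A C F (smf_box A B H K)) x y \<cdot>\<^bsub>C\<^esub> ((\<lambda>a\<in>Ob A. F2 F (FO H a) (FO K a)) x \<boxtimes>\<^bsub>C\<^esub> (\<lambda>a\<in>Ob A. F2 F (FO H a) (FO K a)) y)"
      by simp
  qed (use s in \<open>auto simp: F.F2_natural\<close>)
qed

lemma smf_post:
  assumes "SMC A" "SMF B C F"
  shows "SMF (ihom A B) (ihom A C) (post A B C F)"
proof -
  interpret F: symmetric_monoidal_functor B C F by fact
  have [simp]: "SMC A" "SMC B" "SMC C" using assms smf_source smf_target by auto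
  interpret AB: symmetric_monoidal_category "ihom A B" by (rule smc_ihom) simp_all
  interpret AC: symmetric_monoidal_category "ihom A C" by (rule smc_ihom) simp_all
  interpret A: symmetric_monoidal_category A by simp
  note [simp] = smf_comp[OF _ assms(2)]
  have [simp]: "F0 (post A B C F) \<in> Ar (ihom A C)"
    using mt_post_F0[OF assms] by (simp add: post_def Ar_ihom_triple)
  have [simp]: "F2 (post A B C F) H K \<in> Ar (ihom A C)" if "SMF A B H" "SMF A B K" for H K
    using mt_post_F2[OF assms(2) that] that by (simp add: post_def Ar_ihom_triple)
  have [simp]: "FA (post A B C F) \<theta> \<in> Ar (ihom A C)" if "\<theta> \<in> Ar (ihom A B)" for \<theta>
    using mt_whisker_left[OF _ assms(2)] that by (simp add: post_def Ar_ihom_triple) (simp add: Ar_ihom)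
  show ?thesis
    by (rule smf_into_ihomI) (simp_all add: F.F2_natural F.F2_ass F.F2_runit F.F2_lunit F.F2_symm post_ext)
qed

section \<open>Functoriality of the internal hom\<close>

lemma post_comp:
  assumes "SMC A" "SMF B C F" "SMF C D G"
  shows "post A B D (smf_comp B D G F) = smf_comp (ihom A B) (ihom A D) (post A C D G) (post A B C F)"
proof -
  interpret F: symmetric_monoidal_functor B C F by fact
  interpret G: symmetric_monoidal_functor C D G by fact
  interpret A: symmetric_monoidal_category A by fact
  interpret PF: symmetric_monoidal_functor "ihom A B" "ihom A C" "post A B C F" by (rule smf_post) fact+
  interpret PG: symmetric_monoidal_functor "ihom A C" "ihom A D" "post A C D G" by (rule smf_post) fact+
  note [simp] = smf_comp[OF _ assms(2)] smf_comp[OF _ assms(3)]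
  show ?thesis
    by (rule smf_ihom_eqI[OF smf_post[OF assms(1) smf_comp[OF assms(2,3)]]
        smf_comp[OF smf_post[OF assms(1,2)] smf_post[OF assms(1,3)]]])
      (simp_all add: smf_comp_assoc[OF _ assms(2,3)])
qed

lemma post_id:
  assumes "SMC A" "SMC B"
  shows "post A B B (smf_id B) = smf_id (ihom A B)"
proof -
  interpret A: symmetric_monoidal_category A by fact
  interpret B: symmetric_monoidal_category B by fact
  interpret AB: symmetric_monoidal_category "ihom A B" by (rule smc_ihom) fact+
  show ?thesis
    by (rule smf_ihom_eqI[OF smf_post[OF assms(1) smf_id[OF assms(2)]] smf_id]) (use assms in simp_all)
qed

text \<open>Postcomposition acts on 2-cells, which makes \<open>[A, -]\<close> well defined on
  classes modulo \<open>\<sim>\<close>.\<close>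

lemma mt_post:
  assumes "SMC A" "MT B C F G \<sigma>"
  shows "MT (ihom A B) (ihom A C) (post A B C F) (post A B C G)
    (\<lambda>H\<in>Ob (ihom A B). (smf_comp A C F H, smf_comp A C G H, \<lambda>a\<in>Ob A. \<sigma> (FO H a)))"
proof -
  interpret s: monoidal_transformation B C F G \<sigma> by fact
  interpret A: symmetric_monoidal_category A by fact
  note FG = s.source.symmetric_monoidal_functor_axioms s.target.symmetric_monoidal_functor_axioms
  interpret PF: symmetric_monoidal_functor "ihom A B" "ihom A C" "post A B C F" by (rule smf_post) (rule assms FG)+
  interpret PG: symmetric_monoidal_functor "ihom A B" "ihom A C" "post A B C G" by (rule smf_post) (rule assms FG)+
  have [simp]: "(smf_comp A C F H, smf_comp A C G H, \<lambda>a\<in>Ob A. \<sigma> (FO H a)) \<in> Ar (ihom A C)" if "SMF A B H" for H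
    using mt_whisker_right[OF assms(2) that] by (simp add: Ar_ihom_triple)
  note [simp] = smf_comp[OF _ FG(1)] smf_comp[OF _ FG(2)]
  show ?thesis
  proof (rule mtI)
    fix \<theta> assume "\<theta> \<in> Ar (ihom A B)"
    then show "(\<lambda>H\<in>Ob (ihom A B). (smf_comp A C F H, smf_comp A C G H, \<lambda>a\<in>Ob A. \<sigma> (FO H a))) (cd (ihom A B) \<theta>) \<cdot>\<^bsub>ihom A C\<^esub> FA (post A B C F) \<theta> =
      FA (post A B C G) \<theta> \<cdot>\<^bsub>ihom A C\<^esub> (\<lambda>H\<in>Ob (ihom A B). (smf_comp A C F H, smf_comp A C G H, \<lambda>a\<in>Ob A. \<sigma> (FO H a))) (dm (ihom A B) \<theta>)"
      by (intro ihom_eqI[where A=A and B=C]) (simp_all add: s.tr_natural)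
  next
    show "(\<lambda>H\<in>Ob (ihom A B). (smf_comp A C F H, smf_comp A C G H, \<lambda>a\<in>Ob A. \<sigma> (FO H a))) (unt (ihom A B)) \<cdot>\<^bsub>ihom A C\<^esub> F0 (post A B C F) = F0 (post A B C G)"
      using smf_const[OF assms(1) s.source.source.symmetric_monoidal_category_axioms]
      by (intro ihom_eqI[where A=A and B=C]) (simp_all add: s.tr_unit)
  next
    fix H K assume "H \<in> Ob (ihom A B)" "K \<in> Ob (ihom A B)"
    then show "(\<lambda>H\<in>Ob (ihom A B). (smf_comp A C F H, smf_comp A C G H, \<lambda>a\<in>Ob A. \<sigma> (FO H a))) (H \<otimes>\<^bsub>ihom A B\<^esub> K) \<cdot>\<^bsub>ihom A C\<^esub> F2 (post A B C F) H K =
      F2 (post A B C G) H K \<cdot>\<^bsub>ihom A C\<^esub> ((\<lambda>H\<in>Ob (ihom A B). (smf_comp A C F H, smf_comp A C G H, \<lambda>a\<in>Ob A. \<sigma> (FO H a))) H \<boxtimes>\<^bsub>ihom A C\<^esub>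
        (\<lambda>H\<in>Ob (ihom A B). (smf_comp A C F H, smf_comp A C G H, \<lambda>a\<in>Ob A. \<sigma> (FO H a))) K)"
      by (intro ihom_eqI[where A=A and B=C]) (simp_all add: s.tr_tens)
  qed (simp_all add: PF.symmetric_monoidal_functor_axioms PG.symmetric_monoidal_functor_axioms)
qed

text \<open>This and \<open>post_const\<close> are equalities, not just isomorphisms, as both sides
  have the same values and components. They make \<open>post_functor\<close> strict, and they yield
  \<open>Rn_box\<close> and \<open>Rn_const\<close>.\<close>

lemma post_box:
  assumes "SMC A" "SMF B C F" "SMF B C G"
  shows "post A B C (smf_box B C F G) = smf_box (ihom A B) (ihom A C) (post A B C F) (post A B C G)"
proof -
  interpret F: symmetric_monoidal_functor B C F by fact
  interpret G: symmetric_monoidal_functor B C G by fact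
  interpret A: symmetric_monoidal_category A by fact
  interpret PF: symmetric_monoidal_functor "ihom A B" "ihom A C" "post A B C F" by (rule smf_post) fact+
  interpret PG: symmetric_monoidal_functor "ihom A B" "ihom A C" "post A B C G" by (rule smf_post) fact+
  note [simp] = smf_comp[OF _ assms(2)] smf_comp[OF _ assms(3)] assms(1)
    F.target.symmetric_monoidal_category_axioms F.source.symmetric_monoidal_category_axioms
  show ?thesis
    by (rule smf_ihom_eqI[OF smf_post[OF assms(1) smf_box[OF assms(2,3)]]
        smf_box[OF smf_post[OF assms(1,2)] smf_post[OF assms(1,3)]]])
      (simp_all add: smf_comp_box[OF _ assms(2,3)])
qed

lemma post_const:
  assumes "SMC A" "SMC B" "SMC C"
  shows "post A B C (smf_const B C) = smf_const (ihom A B) (ihom A C)"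
proof -
  interpret A: symmetric_monoidal_category A by fact
  interpret B: symmetric_monoidal_category B by fact
  interpret C: symmetric_monoidal_category C by fact
  interpret AC: symmetric_monoidal_category "ihom A C" by (rule smc_ihom) fact+
  show ?thesis
    by (rule smf_ihom_eqI[OF smf_post[OF assms(1) smf_const[OF assms(2,3)]] smf_const])
      (use assms in \<open>simp_all add: smf_comp_const[OF _ assms(3)]\<close>)
qed

text \<open>The internal form of postcomposition, from \<open>[B, C]\<close> to
  \<open>[[A, B], [A, C]]\<close>. It is one of the two factors of the internal transposition
  \<open>Rn_functor\<close>.\<close>

definition post_functor where
  "post_functor A B C = \<lparr>
     FO = (\<lambda>F\<in>Ob (ihom B C). post A B C F),
     FA = (\<lambda>\<theta>\<in>Ar (ihom B C). (post A B C (dm (ihom B C) \<theta>), post A B C (cd (ihom B C) \<theta>),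
        \<lambda>H\<in>Ob (ihom A B). (smf_comp A C (dm (ihom B C) \<theta>) H, smf_comp A C (cd (ihom B C) \<theta>) H,
          \<lambda>a\<in>Ob A. comp_at \<theta> (FO H a)))),
     F0 = idt (ihom (ihom A B) (ihom A C)) (unt (ihom (ihom A B) (ihom A C))),
     F2 = (\<lambda>F\<in>Ob (ihom B C). \<lambda>G\<in>Ob (ihom B C).
        idt (ihom (ihom A B) (ihom A C)) (smf_box (ihom A B) (ihom A C) (post A B C F) (post A B C G)))\<rparr>"

lemma post_functor_simps [simp]:
  "SMF B C F \<Longrightarrow> FO (post_functor A B C) F = post A B C F"
  "\<theta> \<in> Ar (ihom B C) \<Longrightarrow> SMF A B H \<Longrightarrow> a \<in> Ob A \<Longrightarrow>
    comp_at (comp_at (FA (post_functor A B C) \<theta>) H) a = comp_at \<theta> (FO H a)"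
  by (simp_all add: post_functor_def)

lemma post_functor_ext:
  "FO (post_functor A B C) \<in> extensional (Ob (ihom B C))" "FA (post_functor A B C) \<in> extensional (Ar (ihom B C))"
  "F2 (post_functor A B C) \<in> extensional (Ob (ihom B C))"
  "H \<in> Ob (ihom B C) \<Longrightarrow> F2 (post_functor A B C) H \<in> extensional (Ob (ihom B C))"
  by (simp_all add: post_functor_def del: ihom_simps)

lemma strict_post_functor: "strict (ihom B C) (ihom (ihom A B) (ihom A C)) (post_functor A B C)"
  by (simp add: strict_def post_functor_def)

lemma smf_post_functor:
  assumes "SMC A" "SMC B" "SMC C"
  shows "SMF (ihom B C) (ihom (ihom A B) (ihom A C)) (post_functor A B C)"
proof -
  note [simp] = assms
  interpret A: symmetric_monoidal_category A by fact
  interpret B: symmetric_monoidal_category B by fact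
  interpret BC: symmetric_monoidal_category "ihom B C" by (rule smc_ihom) fact+
  interpret AC: symmetric_monoidal_category "ihom A C" by (rule smc_ihom) fact+
  note [simp] = smf_comp[of A B _ C]
  have t [simp]: "FA (post_functor A B C) \<theta> \<in> Ar (ihom (ihom A B) (ihom A C))"
    "dm (ihom (ihom A B) (ihom A C)) (FA (post_functor A B C) \<theta>) = post A B C (dm (ihom B C) \<theta>)"
    "cd (ihom (ihom A B) (ihom A C)) (FA (post_functor A B C) \<theta>) = post A B C (cd (ihom B C) \<theta>)" if "\<theta> \<in> Ar (ihom B C)" for \<theta>
    using mt_post[OF assms(1), of B C "dm (ihom B C) \<theta>" "cd (ihom B C) \<theta>" "comp_at \<theta>"] that
    by (simp_all add: post_functor_def Ar_ihom_triple) (simp add: Ar_ihom)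
  have [simp]: "comp_at (FA (post_functor A B C) \<theta>) H \<in> Ar (ihom A C)"
    "dm (ihom A C) (comp_at (FA (post_functor A B C) \<theta>) H) = smf_comp A C (dm (ihom B C) \<theta>) H"
    "cd (ihom A C) (comp_at (FA (post_functor A B C) \<theta>) H) = smf_comp A C (cd (ihom B C) \<theta>) H"
    if "\<theta> \<in> Ar (ihom B C)" "SMF A B H" for \<theta> H
    using ihom_arrow(3-5)[OF t(1)[OF that(1)], of H] that by simp_all
  show ?thesis
    by (rule strict_into_ihomI[OF _ _ _ post_functor_ext strict_post_functor],
        simp_all add: smf_post post_box post_const, (rule ihom_eqI[where A=A and B=C]; simp add: smf_comp_box smf_comp_const)+)
qed

section \<open>Precomposition\<close>

lemma pre_simps [simp]:
  "SMF A B H \<Longrightarrow> FO (pre C A B F) H = smf_comp C B H F"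
  "\<theta> \<in> Ar (ihom A B) \<Longrightarrow> dm (ihom C B) (FA (pre C A B F) \<theta>) = smf_comp C B (dm (ihom A B) \<theta>) F"
  "\<theta> \<in> Ar (ihom A B) \<Longrightarrow> cd (ihom C B) (FA (pre C A B F) \<theta>) = smf_comp C B (cd (ihom A B) \<theta>) F"
  "\<theta> \<in> Ar (ihom A B) \<Longrightarrow> c \<in> Ob C \<Longrightarrow> comp_at (FA (pre C A B F) \<theta>) c = comp_at \<theta> (FO F c)"
  by (simp_all add: pre_def)

lemma pre_ext:
  "FO (pre C A B F) \<in> extensional (Ob (ihom A B))" "FA (pre C A B F) \<in> extensional (Ar (ihom A B))"
  "F2 (pre C A B F) \<in> extensional (Ob (ihom A B))"
  "H \<in> Ob (ihom A B) \<Longrightarrow> F2 (pre C A B F) H \<in> extensional (Ob (ihom A B))"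
  by (simp_all add: pre_def del: ihom_simps)

lemma strict_pre: "strict (ihom A B) (ihom C B) (pre C A B F)"
  by (simp add: strict_def pre_def)

lemma smf_pre:
  assumes "SMC B" "SMF C A F"
  shows "SMF (ihom A B) (ihom C B) (pre C A B F)"
proof -
  interpret F: symmetric_monoidal_functor C A F by fact
  have [simp]: "SMC C" "SMC A" "SMC B" using assms smf_source smf_target by auto
  interpret AB: symmetric_monoidal_category "ihom A B" by (rule smc_ihom) simp_all
  note [simp] = smf_comp[OF assms(2), of B]
  have [simp]: "FA (pre C A B F) \<theta> \<in> Ar (ihom C B)" if "\<theta> \<in> Ar (ihom A B)" for \<theta>
    using mt_whisker_right[OF _ assms(2)] that by (simp add: pre_def Ar_ihom_triple) (simp add: Ar_ihom)
  show ?thesis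
    by (rule strict_into_ihomI[OF _ _ _ pre_ext strict_pre])
      (simp_all add: smf_comp_box[OF assms(2)] smf_comp_const[OF assms(2)])
qed

lemma pre_comp:
  assumes "SMC D" "SMF A B F" "SMF B C G"
  shows "pre A C D (smf_comp A C G F) = smf_comp (ihom C D) (ihom A D) (pre A B D F) (pre B C D G)"
proof -
  interpret F: symmetric_monoidal_functor A B F by fact
  interpret G: symmetric_monoidal_functor B C G by fact
  interpret PF: symmetric_monoidal_functor "ihom B D" "ihom A D" "pre A B D F" by (rule smf_pre) fact+
  interpret PG: symmetric_monoidal_functor "ihom C D" "ihom B D" "pre B C D G" by (rule smf_pre) fact+
  note [simp] = smf_comp[OF assms(2), of D] smf_comp[OF assms(3), of D] smf_comp[OF assms(2,3)] assms(1)
  interpret PGF: symmetric_monoidal_functor "ihom C D" "ihom A D" "pre A C D (smf_comp A C G F)" by (rule smf_pre) simp_all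
  show ?thesis
    by (rule strict_eqI[OF smf_pre[OF assms(1) smf_comp[OF assms(2,3)]]
        smf_comp[OF smf_pre[OF assms(1,3)] smf_pre[OF assms(1,2)]] strict_pre
        strict_comp[OF smf_pre[OF assms(1,3)] smf_pre[OF assms(1,2)] strict_pre strict_pre]];
       (rule ihom_eqI[where A=A and B=D])?)
      (simp_all add: smf_comp_assoc[OF assms(2,3)] smf_pre assms(1,2))
qed

text \<open>Both composites send \<open>H\<close> to \<open>K \<circ> H \<circ> G\<close>. In the
  quotient this lets precompositions slide past postcompositions, the most frequent move in the
  naturality proofs.\<close>

lemma pre_post:
  assumes "SMF A A' G" "SMF C C' K"
  shows "smf_comp (ihom A' C) (ihom A C') (pre A A' C' G) (post A' C C' K) =
    smf_comp (ihom A' C) (ihom A C') (post A C C' K) (pre A A' C G)"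
proof -
  interpret G: symmetric_monoidal_functor A A' G by fact
  interpret K: symmetric_monoidal_functor C C' K by fact
  note [simp] = G.source.symmetric_monoidal_category_axioms G.target.symmetric_monoidal_category_axioms
    K.source.symmetric_monoidal_category_axioms K.target.symmetric_monoidal_category_axioms
  note p = smf_post[OF _ assms(2)] smf_pre[OF _ assms(1)]
  interpret P1: symmetric_monoidal_functor "ihom A' C'" "ihom A C'" "pre A A' C' G" by (rule p) simp
  interpret P2: symmetric_monoidal_functor "ihom A' C" "ihom A C" "pre A A' C G" by (rule p) simp
  interpret P3: symmetric_monoidal_functor "ihom A' C" "ihom A' C'" "post A' C C' K" by (rule p) simp
  interpret P4: symmetric_monoidal_functor "ihom A C" "ihom A C'" "post A C C' K" by (rule p) simp
  note [simp] = smf_comp[OF assms(1), of C] smf_comp[OF assms(1), of C'] smf_comp[OF _ assms(2)]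
  show ?thesis
    by (rule smf_ihom_eqI[OF smf_comp smf_comp]; (rule p)?)
      (simp_all add: smf_comp_assoc[OF assms(1) _ assms(2)] strictD[OF strict_pre])
qed

lemma mt_pre:
  assumes "SMC B" "MT C A F G \<sigma>"
  shows "MT (ihom A B) (ihom C B) (pre C A B F) (pre C A B G)
    (\<lambda>H\<in>Ob (ihom A B). (smf_comp C B H F, smf_comp C B H G, \<lambda>c\<in>Ob C. FA H (\<sigma> c)))"
proof -
  interpret s: monoidal_transformation C A F G \<sigma> by fact
  note FG = s.source.symmetric_monoidal_functor_axioms s.target.symmetric_monoidal_functor_axioms
  note [simp] = assms(1) s.source.source.symmetric_monoidal_category_axioms s.source.target.symmetric_monoidal_category_axioms
  interpret B: symmetric_monoidal_category B by fact
  interpret PF: symmetric_monoidal_functor "ihom A B" "ihom C B" "pre C A B F" by (rule smf_pre) (rule assms FG)+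
  interpret PG: symmetric_monoidal_functor "ihom A B" "ihom C B" "pre C A B G" by (rule smf_pre) (rule assms FG)+
  have [simp]: "(smf_comp C B H F, smf_comp C B H G, \<lambda>c\<in>Ob C. FA H (\<sigma> c)) \<in> Ar (ihom C B)" if "SMF A B H" for H
    using mt_whisker_left[OF assms(2) that] by (simp add: Ar_ihom_triple)
  note [simp] = smf_comp[OF FG(1), of B] smf_comp[OF FG(2), of B]
  have [simp]: "(smf_const C B, smf_const C B, \<lambda>c\<in>Ob C. FA (smf_const A B) (\<sigma> c)) \<in> Ar (ihom C B)"
    using mt_whisker_left[OF assms(2), of B "smf_const A B"]
    by (simp add: Ar_ihom_triple smf_comp_const[OF FG(1)] smf_comp_const[OF FG(2)])
  show ?thesis
  proof (rule mtI)
    fix \<theta> assume t: "\<theta> \<in> Ar (ihom A B)"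
    then interpret t: monoidal_transformation A B "dm (ihom A B) \<theta>" "cd (ihom A B) \<theta>" "comp_at \<theta>"
      by (simp add: Ar_ihom)
    show "(\<lambda>H\<in>Ob (ihom A B). (smf_comp C B H F, smf_comp C B H G, \<lambda>c\<in>Ob C. FA H (\<sigma> c))) (cd (ihom A B) \<theta>) \<cdot>\<^bsub>ihom C B\<^esub> FA (pre C A B F) \<theta> =
      FA (pre C A B G) \<theta> \<cdot>\<^bsub>ihom C B\<^esub> (\<lambda>H\<in>Ob (ihom A B). (smf_comp C B H F, smf_comp C B H G, \<lambda>c\<in>Ob C. FA H (\<sigma> c))) (dm (ihom A B) \<theta>)"
      using t by (intro ihom_eqI[where A=C and B=B]) (simp_all add: t.tr_natural)
  next
    show "(\<lambda>H\<in>Ob (ihom A B). (smf_comp C B H F, smf_comp C B H G, \<lambda>c\<in>Ob C. FA H (\<sigma> c))) (unt (ihom A B)) \<cdot>\<^bsub>ihom C B\<^esub> F0 (pre C A B F) = F0 (pre C A B G)"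
      by (intro ihom_eqI[where A=C and B=B]) (simp_all add: strictD[OF strict_pre] smf_comp_const[OF FG(1)] smf_comp_const[OF FG(2)])
  next
    fix H K assume hk: "H \<in> Ob (ihom A B)" "K \<in> Ob (ihom A B)"
    interpret H: symmetric_monoidal_functor A B H using hk by simp
    interpret K: symmetric_monoidal_functor A B K using hk by simp
    have [simp]: "(smf_box C B (smf_comp C B H F) (smf_comp C B K F), smf_box C B (smf_comp C B H G) (smf_comp C B K G),
        \<lambda>c\<in>Ob C. FA (smf_box A B H K) (\<sigma> c)) \<in> Ar (ihom C B)"
      using mt_whisker_left[OF assms(2), of B "smf_box A B H K"] hk
      by (simp add: Ar_ihom_triple smf_comp_box[OF FG(1)] smf_comp_box[OF FG(2)])
    show "(\<lambda>H\<in>Ob (ihom A B). (smf_comp C B H F, smf_comp C B H G, \<lambda>c\<in>Ob C. FA H (\<sigma> c))) (H \<otimes>\<^bsub>ihom A B\<^esub> K) \<cdot>\<^bsub>ihom C B\<^esub> F2 (pre C A B F) H K =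
      F2 (pre C A B G) H K \<cdot>\<^bsub>ihom C B\<^esub> ((\<lambda>H\<in>Ob (ihom A B). (smf_comp C B H F, smf_comp C B H G, \<lambda>c\<in>Ob C. FA H (\<sigma> c))) H \<boxtimes>\<^bsub>ihom C B\<^esub>
        (\<lambda>H\<in>Ob (ihom A B). (smf_comp C B H F, smf_comp C B H G, \<lambda>c\<in>Ob C. FA H (\<sigma> c))) K)"
      using hk by (intro ihom_eqI[where A=C and B=B]) (simp_all add: strictD[OF strict_pre] smf_comp_box[OF FG(1)] smf_comp_box[OF FG(2)])
  qed (simp_all add: PF.symmetric_monoidal_functor_axioms PG.symmetric_monoidal_functor_axioms)
qed

lemma pre_id:
  assumes "SMC A" "SMC B"
  shows "pre A A B (smf_id A) = smf_id (ihom A B)"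
proof -
  interpret A: symmetric_monoidal_category A by fact
  interpret AB: symmetric_monoidal_category "ihom A B" by (rule smc_ihom) fact+
  note [simp] = assms smf_id
  interpret P: symmetric_monoidal_functor "ihom A B" "ihom A B" "pre A A B (smf_id A)" by (rule smf_pre) simp_all
  show ?thesis
    by (rule smf_ihom_eqI[OF P.symmetric_monoidal_functor_axioms smf_id]) (simp_all add: strictD[OF strict_pre])
qed

section \<open>Duality\<close>

lemma comp_at_natural:
  assumes "\<theta> \<in> Ar (ihom A B)"
  shows "f \<in> Ar A \<Longrightarrow> comp_at \<theta> (cd A f) \<cdot>\<^bsub>B\<^esub> FA (dm (ihom A B) \<theta>) f = FA (cd (ihom A B) \<theta>) f \<cdot>\<^bsub>B\<^esub> comp_at \<theta> (dm A f)"
    and "comp_at \<theta> (unt A) \<cdot>\<^bsub>B\<^esub> F0 (dm (ihom A B) \<theta>) = F0 (cd (ihom A B) \<theta>)"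
    and "x \<in> Ob A \<Longrightarrow> y \<in> Ob A \<Longrightarrow> comp_at \<theta> (x \<otimes>\<^bsub>A\<^esub> y) \<cdot>\<^bsub>B\<^esub> F2 (dm (ihom A B) \<theta>) x y =
      F2 (cd (ihom A B) \<theta>) x y \<cdot>\<^bsub>B\<^esub> (comp_at \<theta> x \<boxtimes>\<^bsub>B\<^esub> comp_at \<theta> y)"
proof -
  interpret t: monoidal_transformation A B "dm (ihom A B) \<theta>" "cd (ihom A B) \<theta>" "comp_at \<theta>"
    using assms by (simp add: Ar_ihom)
  show "f \<in> Ar A \<Longrightarrow> comp_at \<theta> (cd A f) \<cdot>\<^bsub>B\<^esub> FA (dm (ihom A B) \<theta>) f = FA (cd (ihom A B) \<theta>) f \<cdot>\<^bsub>B\<^esub> comp_at \<theta> (dm A f)"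
    by (simp add: t.tr_natural)
  show "comp_at \<theta> (unt A) \<cdot>\<^bsub>B\<^esub> F0 (dm (ihom A B) \<theta>) = F0 (cd (ihom A B) \<theta>)"
    by (rule t.tr_unit)
  show "x \<in> Ob A \<Longrightarrow> y \<in> Ob A \<Longrightarrow> comp_at \<theta> (x \<otimes>\<^bsub>A\<^esub> y) \<cdot>\<^bsub>B\<^esub> F2 (dm (ihom A B) \<theta>) x y =
      F2 (cd (ihom A B) \<theta>) x y \<cdot>\<^bsub>B\<^esub> (comp_at \<theta> x \<boxtimes>\<^bsub>B\<^esub> comp_at \<theta> y)"
    by (rule t.tr_tens)
qed

lemma dual_ob_simps [simp]:
  "a \<in> Ob A \<Longrightarrow> FO (dual_ob A F b) a = FO (FO F a) b"
  "f \<in> Ar A \<Longrightarrow> FA (dual_ob A F b) f = comp_at (FA F f) b"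
  "F0 (dual_ob A F b) = comp_at (F0 F) b"
  "a \<in> Ob A \<Longrightarrow> a' \<in> Ob A \<Longrightarrow> F2 (dual_ob A F b) a a' = comp_at (F2 F a a') b"
  by (simp_all add: dual_ob_def)

lemma dual_ob_ext:
  "FO (dual_ob A F b) \<in> extensional (Ob A)" "FA (dual_ob A F b) \<in> extensional (Ar A)"
  "F2 (dual_ob A F b) \<in> extensional (Ob A)" "a \<in> Ob A \<Longrightarrow> F2 (dual_ob A F b) a \<in> extensional (Ob A)"
  by (simp_all add: dual_ob_def)

lemma dual_simps [simp]:
  "b \<in> Ob B \<Longrightarrow> FO (dual A B C F) b = dual_ob A F b"
  "g \<in> Ar B \<Longrightarrow> dm (ihom A C) (FA (dual A B C F) g) = dual_ob A F (dm B g)"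
  "g \<in> Ar B \<Longrightarrow> cd (ihom A C) (FA (dual A B C F) g) = dual_ob A F (cd B g)"
  "g \<in> Ar B \<Longrightarrow> a \<in> Ob A \<Longrightarrow> comp_at (FA (dual A B C F) g) a = FA (FO F a) g"
  "dm (ihom A C) (F0 (dual A B C F)) = smf_const A C"
  "cd (ihom A C) (F0 (dual A B C F)) = dual_ob A F (unt B)"
  "a \<in> Ob A \<Longrightarrow> comp_at (F0 (dual A B C F)) a = F0 (FO F a)"
  "b \<in> Ob B \<Longrightarrow> b' \<in> Ob B \<Longrightarrow> dm (ihom A C) (F2 (dual A B C F) b b') = smf_box A C (dual_ob A F b) (dual_ob A F b')"
  "b \<in> Ob B \<Longrightarrow> b' \<in> Ob B \<Longrightarrow> cd (ihom A C) (F2 (dual A B C F) b b') = dual_ob A F (b \<otimes>\<^bsub>B\<^esub> b')"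
  "b \<in> Ob B \<Longrightarrow> b' \<in> Ob B \<Longrightarrow> a \<in> Ob A \<Longrightarrow> comp_at (F2 (dual A B C F) b b') a = F2 (FO F a) b b'"
  by (simp_all add: dual_def)

lemma dual_ext:
  "FO (dual A B C F) \<in> extensional (Ob B)" "FA (dual A B C F) \<in> extensional (Ar B)"
  "F2 (dual A B C F) \<in> extensional (Ob B)" "b \<in> Ob B \<Longrightarrow> F2 (dual A B C F) b \<in> extensional (Ob B)"
  by (simp_all add: dual_def)

text \<open>A functor of two variables in curried form. All that is required in the second variable
  is hidden in the fact that values of \<open>F\<close> are functors and its structure arrows are
  monoidal transformations.\<close>

locale ihom_functor = symmetric_monoidal_functor A "ihom B C" F
  for A :: "('o, 'm) smc" and B :: "('p, 'n) smc" and C :: "('q, 'k) smc" and F +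
  assumes smc_B: "SMC B" and smc_C: "SMC C"
begin

sublocale B: symmetric_monoidal_category B by (rule smc_B)
sublocale C: symmetric_monoidal_category C by (rule smc_C)

lemma FO_smf [simp]: "a \<in> Ob A \<Longrightarrow> SMF B C (FO F a)"
  using FO_in by simp

lemma comp_at_typing [simp]:
  assumes "b \<in> Ob B"
  shows "f \<in> Ar A \<Longrightarrow> comp_at (FA F f) b \<in> Ar C"
    "f \<in> Ar A \<Longrightarrow> dm C (comp_at (FA F f) b) = FO (FO F (dm A f)) b"
    "f \<in> Ar A \<Longrightarrow> cd C (comp_at (FA F f) b) = FO (FO F (cd A f)) b"
    "comp_at (F0 F) b \<in> Ar C" "dm C (comp_at (F0 F) b) = unt C" "cd C (comp_at (F0 F) b) = FO (FO F (unt A)) b"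
    "a \<in> Ob A \<Longrightarrow> a' \<in> Ob A \<Longrightarrow> comp_at (F2 F a a') b \<in> Ar C"
    "a \<in> Ob A \<Longrightarrow> a' \<in> Ob A \<Longrightarrow> dm C (comp_at (F2 F a a') b) = FO (FO F a) b \<otimes>\<^bsub>C\<^esub> FO (FO F a') b"
    "a \<in> Ob A \<Longrightarrow> a' \<in> Ob A \<Longrightarrow> cd C (comp_at (F2 F a a') b) = FO (FO F (a \<otimes>\<^bsub>A\<^esub> a')) b"
  using assms ihom_arrow(3-5)[OF FA_typing(1), of f b] ihom_arrow(3-5)[OF F0_typing(1), of b] ihom_arrow(3-5)[OF F2_typing(1), of a a' b]
  by simp_all

lemmas FO_axioms = symmetric_monoidal_functor.F2_natural[OF FO_smf] symmetric_monoidal_functor.F2_ass[OF FO_smf]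
  symmetric_monoidal_functor.F2_runit[OF FO_smf] symmetric_monoidal_functor.F2_lunit[OF FO_smf]
  symmetric_monoidal_functor.F2_symm[OF FO_smf] symmetric_monoidal_functor.FA_idt[OF FO_smf]
  symmetric_monoidal_functor.FA_cmp'[OF FO_smf]

lemmas FO_typing [simp] = symmetric_monoidal_functor.FA_typing[OF FO_smf] symmetric_monoidal_functor.F0_typing[OF FO_smf]
  symmetric_monoidal_functor.F2_typing[OF FO_smf]

lemma smf_dual_ob:
  assumes [simp]: "b \<in> Ob B"
  shows "SMF A C (dual_ob A F b)"
proof (rule smfI[OF source.symmetric_monoidal_category_axioms smc_C dual_ob_ext])
  let ?c = "\<lambda>\<theta>. comp_at \<theta> b"
  show "FO (dual_ob A F b) x \<in> Ob C" if "x \<in> Ob A" for x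
    using that by (simp add: smf_FO_Ob[OF FO_smf])
  show "F2 (dual_ob A F b) (cd A f) (cd A g) \<cdot>\<^bsub>C\<^esub> (FA (dual_ob A F b) f \<boxtimes>\<^bsub>C\<^esub> FA (dual_ob A F b) g) =
      FA (dual_ob A F b) (f \<boxtimes>\<^bsub>A\<^esub> g) \<cdot>\<^bsub>C\<^esub> F2 (dual_ob A F b) (dm A f) (dm A g)" if "f \<in> Ar A" "g \<in> Ar A" for f g
    using arg_cong[OF F2_natural[OF that HOL.refl HOL.refl], of ?c] that by simp
  show "FA (dual_ob A F b) (ass A x y z) \<cdot>\<^bsub>C\<^esub> F2 (dual_ob A F b) x (y \<otimes>\<^bsub>A\<^esub> z) \<cdot>\<^bsub>C\<^esub>
      (idt C (FO (dual_ob A F b) x) \<boxtimes>\<^bsub>C\<^esub> F2 (dual_ob A F b) y z) =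
    F2 (dual_ob A F b) (x \<otimes>\<^bsub>A\<^esub> y) z \<cdot>\<^bsub>C\<^esub> (F2 (dual_ob A F b) x y \<boxtimes>\<^bsub>C\<^esub> idt C (FO (dual_ob A F b) z)) \<cdot>\<^bsub>C\<^esub>
      ass C (FO (dual_ob A F b) x) (FO (dual_ob A F b) y) (FO (dual_ob A F b) z)"
    if "x \<in> Ob A" "y \<in> Ob A" "z \<in> Ob A" for x y z
    using arg_cong[OF F2_ass[OF that], of ?c] that by simp
  show "FA (dual_ob A F b) (runit A x) \<cdot>\<^bsub>C\<^esub> F2 (dual_ob A F b) x (unt A) \<cdot>\<^bsub>C\<^esub>
      (idt C (FO (dual_ob A F b) x) \<boxtimes>\<^bsub>C\<^esub> F0 (dual_ob A F b)) = runit C (FO (dual_ob A F b) x)" if "x \<in> Ob A" for x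
    using arg_cong[OF F2_runit[OF that], of ?c] that by simp
  show "FA (dual_ob A F b) (lunit A x) \<cdot>\<^bsub>C\<^esub> F2 (dual_ob A F b) (unt A) x \<cdot>\<^bsub>C\<^esub>
      (F0 (dual_ob A F b) \<boxtimes>\<^bsub>C\<^esub> idt C (FO (dual_ob A F b) x)) = lunit C (FO (dual_ob A F b) x)" if "x \<in> Ob A" for x
    using arg_cong[OF F2_lunit[OF that], of ?c] that by simp
  show "FA (dual_ob A F b) (symm A x y) \<cdot>\<^bsub>C\<^esub> F2 (dual_ob A F b) x y =
      F2 (dual_ob A F b) y x \<cdot>\<^bsub>C\<^esub> symm C (FO (dual_ob A F b) x) (FO (dual_ob A F b) y)" if "x \<in> Ob A" "y \<in> Ob A" for x y
    using arg_cong[OF F2_symm[OF that], of ?c] that by simp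
qed (simp_all add: smf_FO_Ob[OF FO_smf])

text \<open>Each condition on the family \<open>F(-)(g)\<close> is naturality in \<open>g\<close> of
  an arrow of \<open>[B, C]\<close> belonging to \<open>F\<close>: of \<open>FA F f\<close>,
  \<open>F0 F\<close> and \<open>F2 F x y\<close> respectively. The unit and tensor conditions on
  the same arrows give the next two lemmas.\<close>

lemma mt_dual_arrow:
  assumes [simp]: "g \<in> Ar B"
  shows "MT A C (dual_ob A F (dm B g)) (dual_ob A F (cd B g)) (\<lambda>a\<in>Ob A. FA (FO F a) g)"
proof (rule mtI)
  show "(\<lambda>a\<in>Ob A. FA (FO F a) g) (cd A f) \<cdot>\<^bsub>C\<^esub> FA (dual_ob A F (dm B g)) f =
      FA (dual_ob A F (cd B g)) f \<cdot>\<^bsub>C\<^esub> (\<lambda>a\<in>Ob A. FA (FO F a) g) (dm A f)" if "f \<in> Ar A" for f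
    using comp_at_natural(1)[OF FA_typing(1)[OF that] assms] that by simp
  show "(\<lambda>a\<in>Ob A. FA (FO F a) g) (unt A) \<cdot>\<^bsub>C\<^esub> F0 (dual_ob A F (dm B g)) = F0 (dual_ob A F (cd B g))"
    using comp_at_natural(1)[OF F0_typing(1) assms] by simp
  show "(\<lambda>a\<in>Ob A. FA (FO F a) g) (x \<otimes>\<^bsub>A\<^esub> y) \<cdot>\<^bsub>C\<^esub> F2 (dual_ob A F (dm B g)) x y =
      F2 (dual_ob A F (cd B g)) x y \<cdot>\<^bsub>C\<^esub> ((\<lambda>a\<in>Ob A. FA (FO F a) g) x \<boxtimes>\<^bsub>C\<^esub> (\<lambda>a\<in>Ob A. FA (FO F a) g) y)"
    if "x \<in> Ob A" "y \<in> Ob A" for x y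
    using comp_at_natural(1)[OF F2_typing(1)[OF that] assms] that by simp
qed (simp_all add: smf_dual_ob)

lemma mt_dual_F0: "MT A C (smf_const A C) (dual_ob A F (unt B)) (\<lambda>a\<in>Ob A. F0 (FO F a))"
proof (rule mtI)
  show "(\<lambda>a\<in>Ob A. F0 (FO F a)) (cd A f) \<cdot>\<^bsub>C\<^esub> FA (smf_const A C) f =
      FA (dual_ob A F (unt B)) f \<cdot>\<^bsub>C\<^esub> (\<lambda>a\<in>Ob A. F0 (FO F a)) (dm A f)" if "f \<in> Ar A" for f
    using comp_at_natural(2)[OF FA_typing(1)[OF that]] that by simp
  show "(\<lambda>a\<in>Ob A. F0 (FO F a)) (unt A) \<cdot>\<^bsub>C\<^esub> F0 (smf_const A C) = F0 (dual_ob A F (unt B))"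
    using comp_at_natural(2)[OF F0_typing(1)] by simp
  show "(\<lambda>a\<in>Ob A. F0 (FO F a)) (x \<otimes>\<^bsub>A\<^esub> y) \<cdot>\<^bsub>C\<^esub> F2 (smf_const A C) x y =
      F2 (dual_ob A F (unt B)) x y \<cdot>\<^bsub>C\<^esub> ((\<lambda>a\<in>Ob A. F0 (FO F a)) x \<boxtimes>\<^bsub>C\<^esub> (\<lambda>a\<in>Ob A. F0 (FO F a)) y)"
    if "x \<in> Ob A" "y \<in> Ob A" for x y
    using comp_at_natural(2)[OF F2_typing(1)[OF that], symmetric] that by simp
qed (simp_all add: smf_dual_ob source.symmetric_monoidal_category_axioms smc_C)

lemma mt_dual_F2:
  assumes [simp]: "b \<in> Ob B" "b' \<in> Ob B"
  shows "MT A C (smf_box A C (dual_ob A F b) (dual_ob A F b')) (dual_ob A F (b \<otimes>\<^bsub>B\<^esub> b')) (\<lambda>a\<in>Ob A. F2 (FO F a) b b')"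
proof (rule mtI)
  show "(\<lambda>a\<in>Ob A. F2 (FO F a) b b') (cd A f) \<cdot>\<^bsub>C\<^esub> FA (smf_box A C (dual_ob A F b) (dual_ob A F b')) f =
      FA (dual_ob A F (b \<otimes>\<^bsub>B\<^esub> b')) f \<cdot>\<^bsub>C\<^esub> (\<lambda>a\<in>Ob A. F2 (FO F a) b b') (dm A f)" if "f \<in> Ar A" for f
    using comp_at_natural(3)[OF FA_typing(1)[OF that] assms] that by simp
  show "(\<lambda>a\<in>Ob A. F2 (FO F a) b b') (unt A) \<cdot>\<^bsub>C\<^esub> F0 (smf_box A C (dual_ob A F b) (dual_ob A F b')) = F0 (dual_ob A F (b \<otimes>\<^bsub>B\<^esub> b'))"
  proof -
    have "(F2 (FO F (unt A)) b b' \<cdot>\<^bsub>C\<^esub> (comp_at (F0 F) b \<boxtimes>\<^bsub>C\<^esub> comp_at (F0 F) b')) \<cdot>\<^bsub>C\<^esub> inverse_of C (runit C (unt C)) =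
      (comp_at (F0 F) (b \<otimes>\<^bsub>B\<^esub> b') \<cdot>\<^bsub>C\<^esub> runit C (unt C)) \<cdot>\<^bsub>C\<^esub> inverse_of C (runit C (unt C))"
      using comp_at_natural(3)[OF F0_typing(1) assms] by simp
    then show ?thesis by simp
  qed
  fix x y assume xy [simp]: "x \<in> Ob A" "y \<in> Ob A"
  let ?m = "interchange C (FO (FO F x) b) (FO (FO F x) b') (FO (FO F y) b) (FO (FO F y) b')"
  \<comment> \<open>The tensor condition of \<open>F2 F x y\<close> carries the interchange on the
    side of the \<open>B\<close>-structure, whereas the goal needs it on the side of the
    \<open>A\<close>-structure. \<open>interchange_interchange\<close> carries it across.\<close>
  have e: "comp_at (F2 F x y) (b \<otimes>\<^bsub>B\<^esub> b') \<cdot>\<^bsub>C\<^esub> (F2 (FO F x) b b' \<boxtimes>\<^bsub>C\<^esub> F2 (FO F y) b b') \<cdot>\<^bsub>C\<^esub>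
      interchange C (FO (FO F x) b) (FO (FO F y) b) (FO (FO F x) b') (FO (FO F y) b') =
    F2 (FO F (x \<otimes>\<^bsub>A\<^esub> y)) b b' \<cdot>\<^bsub>C\<^esub> (comp_at (F2 F x y) b \<boxtimes>\<^bsub>C\<^esub> comp_at (F2 F x y) b')"
    using comp_at_natural(3)[OF F2_typing(1)[OF xy] assms] by simp
  have "F2 (FO F (x \<otimes>\<^bsub>A\<^esub> y)) b b' \<cdot>\<^bsub>C\<^esub> (comp_at (F2 F x y) b \<boxtimes>\<^bsub>C\<^esub> comp_at (F2 F x y) b') \<cdot>\<^bsub>C\<^esub> ?m =
    (F2 (FO F (x \<otimes>\<^bsub>A\<^esub> y)) b b' \<cdot>\<^bsub>C\<^esub> (comp_at (F2 F x y) b \<boxtimes>\<^bsub>C\<^esub> comp_at (F2 F x y) b')) \<cdot>\<^bsub>C\<^esub> ?m"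
    by (simp add: smf_FO_Ob[OF FO_smf])
  also have "\<dots> = comp_at (F2 F x y) (b \<otimes>\<^bsub>B\<^esub> b') \<cdot>\<^bsub>C\<^esub> (F2 (FO F x) b b' \<boxtimes>\<^bsub>C\<^esub> F2 (FO F y) b b')"
    unfolding e[symmetric] by (simp add: smf_FO_Ob[OF FO_smf] C.interchange_interchange)
  finally show "(\<lambda>a\<in>Ob A. F2 (FO F a) b b') (x \<otimes>\<^bsub>A\<^esub> y) \<cdot>\<^bsub>C\<^esub> F2 (smf_box A C (dual_ob A F b) (dual_ob A F b')) x y =
      F2 (dual_ob A F (b \<otimes>\<^bsub>B\<^esub> b')) x y \<cdot>\<^bsub>C\<^esub> ((\<lambda>a\<in>Ob A. F2 (FO F a) b b') x \<boxtimes>\<^bsub>C\<^esub> (\<lambda>a\<in>Ob A. F2 (FO F a) b b') y)"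
    by simp
qed (simp_all add: smf_dual_ob smf_FO_Ob[OF FO_smf])

lemma smf_dual: "SMF B (ihom A C) (dual A B C F)"
proof -
  have [simp]: "FA (dual A B C F) g \<in> Ar (ihom A C)" if "g \<in> Ar B" for g
    using mt_dual_arrow[OF that] that by (simp add: dual_def Ar_ihom_triple)
  have [simp]: "F0 (dual A B C F) \<in> Ar (ihom A C)"
    using mt_dual_F0 by (simp add: dual_def Ar_ihom_triple)
  have [simp]: "F2 (dual A B C F) b b' \<in> Ar (ihom A C)" if "b \<in> Ob B" "b' \<in> Ob B" for b b'
    using mt_dual_F2[OF that] that by (simp add: dual_def Ar_ihom_triple)
  show ?thesis
    by (rule smf_into_ihomI[OF smc_B source.symmetric_monoidal_category_axioms smc_C dual_ext])
      (simp_all add: smf_dual_ob FO_axioms)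
qed

end

lemma ihom_functorI: "SMF A (ihom B C) F \<Longrightarrow> SMC B \<Longrightarrow> SMC C \<Longrightarrow> ihom_functor A B C F"
  by (simp add: ihom_functor_def ihom_functor_axioms_def)

lemma (in ihom_functor) dual_is_ihom_functor: "ihom_functor B A C (dual A B C F)"
  by (rule ihom_functorI[OF smf_dual source.symmetric_monoidal_category_axioms smc_C])

lemma (in ihom_functor) dual_dual: "dual B A C (dual A B C F) = F"
proof -
  interpret D: ihom_functor B A C "dual A B C F" by (rule dual_is_ihom_functor)
  have [simp]: "dual_ob B (dual A B C F) a = FO F a" if "a \<in> Ob A" for a
    by (rule smf_eqI[OF D.smf_dual_ob[OF that] FO_smf[OF that]]) (use that in simp_all)
  show ?thesis
    by (rule smf_ihom_eqI[OF D.smf_dual symmetric_monoidal_functor_axioms]) simp_all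
qed

lemma (in ihom_functor) dual_post:
  assumes "SMF C D K"
  shows "dual A B D (smf_comp A (ihom B D) (post B C D K) F) = smf_comp B (ihom A D) (post A C D K) (dual A B C F)"
proof -
  interpret K: symmetric_monoidal_functor C D K by fact
  have p: "SMF (ihom B C) (ihom B D) (post B C D K)" "SMF (ihom A C) (ihom A D) (post A C D K)"
    using smf_post[OF _ assms] smc_B source.symmetric_monoidal_category_axioms by auto
  interpret P: symmetric_monoidal_functor "ihom B C" "ihom B D" "post B C D K" by (rule p)
  interpret P': symmetric_monoidal_functor "ihom A C" "ihom A D" "post A C D K" by (rule p)
  interpret D: ihom_functor B A C "dual A B C F" by (rule dual_is_ihom_functor)
  interpret E: ihom_functor A B D "smf_comp A (ihom B D) (post B C D K) F"
    by (rule ihom_functorI[OF smf_comp[OF symmetric_monoidal_functor_axioms p(1)] smc_B K.target.symmetric_monoidal_category_axioms])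
  have [simp]: "dual_ob A (smf_comp A (ihom B D) (post B C D K) F) b = smf_comp A D K (dual_ob A F b)" if "b \<in> Ob B" for b
    by (rule smf_eqI[OF E.smf_dual_ob[OF that] smf_comp[OF smf_dual_ob[OF that] assms]]) (use that in simp_all)
  show ?thesis
    by (rule smf_ihom_eqI[OF E.smf_dual smf_comp[OF smf_dual p(2)]]) (simp_all add: smf_dual_ob)
qed

lemma (in ihom_functor) dual_comp:
  assumes "SMF A' A G"
  shows "dual A' B C (smf_comp A' (ihom B C) F G) = smf_comp B (ihom A' C) (pre A' A C G) (dual A B C F)"
proof -
  interpret G: symmetric_monoidal_functor A' A G by fact
  have p: "SMF (ihom A C) (ihom A' C) (pre A' A C G)"
    using smf_pre[OF smc_C assms] .
  interpret P: symmetric_monoidal_functor "ihom A C" "ihom A' C" "pre A' A C G" by (rule p)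
  interpret D: ihom_functor B A C "dual A B C F" by (rule dual_is_ihom_functor)
  interpret E: ihom_functor A' B C "smf_comp A' (ihom B C) F G"
    by (rule ihom_functorI[OF smf_comp[OF assms symmetric_monoidal_functor_axioms] smc_B smc_C])
  have [simp]: "dual_ob A' (smf_comp A' (ihom B C) F G) b = smf_comp A' C (dual_ob A F b) G" if "b \<in> Ob B" for b
    by (rule smf_eqI[OF E.smf_dual_ob[OF that] smf_comp[OF assms smf_dual_ob[OF that]]]) (use that in simp_all)
  show ?thesis
    by (rule smf_ihom_eqI[OF E.smf_dual smf_comp[OF smf_dual p]]) (simp_all add: smf_dual_ob strictD[OF strict_pre])
qed

text \<open>This is \<open>dual_comp\<close> for the dual functor, carried back by
  \<open>dual_dual\<close>.\<close>

lemma (in ihom_functor) dual_pre: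
  assumes "SMF B' B G"
  shows "dual A B' C (smf_comp A (ihom B' C) (pre B' B C G) F) = smf_comp B' (ihom A C) (dual A B C F) G"
proof -
  interpret D: ihom_functor B A C "dual A B C F" by (rule dual_is_ihom_functor)
  interpret E: ihom_functor B' A C "smf_comp B' (ihom A C) (dual A B C F) G"
    by (rule ihom_functorI[OF smf_comp[OF assms D.symmetric_monoidal_functor_axioms] D.smc_B smc_C])
  show ?thesis using E.dual_dual D.dual_comp[OF assms] by (simp add: dual_dual)
qed

lemma mt_dual:
  assumes "MT A (ihom B C) F G \<sigma>" "SMC B" "SMC C"
  shows "MT B (ihom A C) (dual A B C F) (dual A B C G)
    (\<lambda>b\<in>Ob B. (dual_ob A F b, dual_ob A G b, \<lambda>a\<in>Ob A. comp_at (\<sigma> a) b))"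
proof -
  interpret s: monoidal_transformation A "ihom B C" F G \<sigma> by fact
  interpret F: ihom_functor A B C F
    by (rule ihom_functorI[OF s.source.symmetric_monoidal_functor_axioms assms(2,3)])
  interpret G: ihom_functor A B C G
    by (rule ihom_functorI[OF s.target.symmetric_monoidal_functor_axioms assms(2,3)])
  interpret F': ihom_functor B A C "dual A B C F" by (rule F.dual_is_ihom_functor)
  interpret G': ihom_functor B A C "dual A B C G" by (rule G.dual_is_ihom_functor)
  note [simp] = F.smf_dual_ob G.smf_dual_ob
  have st [simp]: "comp_at (\<sigma> a) b \<in> Ar C" "dm C (comp_at (\<sigma> a) b) = FO (FO F a) b" "cd C (comp_at (\<sigma> a) b) = FO (FO G a) b"
    if "a \<in> Ob A" "b \<in> Ob B" for a b
    using ihom_arrow(3-5)[OF s.tr_typing(1)[OF that(1)], of b] that by simp_all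
  have c [simp]: "(dual_ob A F b, dual_ob A G b, \<lambda>a\<in>Ob A. comp_at (\<sigma> a) b) \<in> Ar (ihom A C)" if b: "b \<in> Ob B" for b
    unfolding Ar_ihom_triple
  proof (rule mtI)
    show "(\<lambda>a\<in>Ob A. comp_at (\<sigma> a) b) (cd A f) \<cdot>\<^bsub>C\<^esub> FA (dual_ob A F b) f = FA (dual_ob A G b) f \<cdot>\<^bsub>C\<^esub> (\<lambda>a\<in>Ob A. comp_at (\<sigma> a) b) (dm A f)"
      if "f \<in> Ar A" for f
      using arg_cong[OF s.tr_natural[OF that HOL.refl], of "\<lambda>\<theta>. comp_at \<theta> b"] that b by simp
    show "(\<lambda>a\<in>Ob A. comp_at (\<sigma> a) b) (unt A) \<cdot>\<^bsub>C\<^esub> F0 (dual_ob A F b) = F0 (dual_ob A G b)"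
      using arg_cong[OF s.tr_unit, of "\<lambda>\<theta>. comp_at \<theta> b"] b by simp
    show "(\<lambda>a\<in>Ob A. comp_at (\<sigma> a) b) (x \<otimes>\<^bsub>A\<^esub> y) \<cdot>\<^bsub>C\<^esub> F2 (dual_ob A F b) x y =
        F2 (dual_ob A G b) x y \<cdot>\<^bsub>C\<^esub> ((\<lambda>a\<in>Ob A. comp_at (\<sigma> a) b) x \<boxtimes>\<^bsub>C\<^esub> (\<lambda>a\<in>Ob A. comp_at (\<sigma> a) b) y)"
      if "x \<in> Ob A" "y \<in> Ob A" for x y
      using arg_cong[OF s.tr_tens[OF that], of "\<lambda>\<theta>. comp_at \<theta> b"] that b by simp
  qed (use b in simp_all)
  show ?thesis
  proof (rule mtI)
    fix g assume "g \<in> Ar B"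
    then show "(\<lambda>b\<in>Ob B. (dual_ob A F b, dual_ob A G b, \<lambda>a\<in>Ob A. comp_at (\<sigma> a) b)) (cd B g) \<cdot>\<^bsub>ihom A C\<^esub> FA (dual A B C F) g =
        FA (dual A B C G) g \<cdot>\<^bsub>ihom A C\<^esub> (\<lambda>b\<in>Ob B. (dual_ob A F b, dual_ob A G b, \<lambda>a\<in>Ob A. comp_at (\<sigma> a) b)) (dm B g)"
      using comp_at_natural(1)[OF s.tr_typing(1)]
      by (intro ihom_eqI[where A=A and B=C]) simp_all
  next
    show "(\<lambda>b\<in>Ob B. (dual_ob A F b, dual_ob A G b, \<lambda>a\<in>Ob A. comp_at (\<sigma> a) b)) (unt B) \<cdot>\<^bsub>ihom A C\<^esub> F0 (dual A B C F) = F0 (dual A B C G)"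
      using comp_at_natural(2)[OF s.tr_typing(1)]
      by (intro ihom_eqI[where A=A and B=C]) simp_all
  next
    fix x y assume "x \<in> Ob B" "y \<in> Ob B"
    then show "(\<lambda>b\<in>Ob B. (dual_ob A F b, dual_ob A G b, \<lambda>a\<in>Ob A. comp_at (\<sigma> a) b)) (x \<otimes>\<^bsub>B\<^esub> y) \<cdot>\<^bsub>ihom A C\<^esub> F2 (dual A B C F) x y =
        F2 (dual A B C G) x y \<cdot>\<^bsub>ihom A C\<^esub> ((\<lambda>b\<in>Ob B. (dual_ob A F b, dual_ob A G b, \<lambda>a\<in>Ob A. comp_at (\<sigma> a) b)) x \<boxtimes>\<^bsub>ihom A C\<^esub>
          (\<lambda>b\<in>Ob B. (dual_ob A F b, dual_ob A G b, \<lambda>a\<in>Ob A. comp_at (\<sigma> a) b)) y)"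
      using comp_at_natural(3)[OF s.tr_typing(1)]
      by (intro ihom_eqI[where A=A and B=C]) simp_all
  qed (simp_all add: F.smf_dual G.smf_dual)
qed

lemma dual_box:
  assumes "ihom_functor A B C F" "ihom_functor A B C G"
  shows "dual A B C (smf_box A (ihom B C) F G) = smf_box B (ihom A C) (dual A B C F) (dual A B C G)"
proof -
  interpret F: ihom_functor A B C F by fact
  interpret G: ihom_functor A B C G by fact
  interpret F': ihom_functor B A C "dual A B C F" by (rule F.dual_is_ihom_functor)
  interpret G': ihom_functor B A C "dual A B C G" by (rule G.dual_is_ihom_functor)
  note [simp] = F.smf_dual_ob G.smf_dual_ob F.smc_B F.smc_C F'.smc_B
  interpret E: ihom_functor A B C "smf_box A (ihom B C) F G"
    by (rule ihom_functorI[OF smf_box[OF F.symmetric_monoidal_functor_axioms G.symmetric_monoidal_functor_axioms] F.smc_B F.smc_C])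
  have [simp]: "dual_ob A (smf_box A (ihom B C) F G) b = smf_box A C (dual_ob A F b) (dual_ob A G b)" if "b \<in> Ob B" for b
    by (rule smf_eqI[OF E.smf_dual_ob[OF that] smf_box[OF F.smf_dual_ob[OF that] G.smf_dual_ob[OF that]]]) (use that in simp_all)
  show ?thesis
    by (rule smf_ihom_eqI[OF E.smf_dual smf_box[OF F.smf_dual G.smf_dual]]) simp_all
qed

lemma dual_const:
  assumes "SMC A" "SMC B" "SMC C"
  shows "dual A B C (smf_const A (ihom B C)) = smf_const B (ihom A C)"
proof -
  note [simp] = assms
  interpret F: ihom_functor A B C "smf_const A (ihom B C)" by (rule ihom_functorI) simp_all
  have [simp]: "dual_ob A (smf_const A (ihom B C)) b = smf_const A C" if "b \<in> Ob B" for b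
    by (rule smf_eqI[OF F.smf_dual_ob[OF that] smf_const]) (use that in simp_all)
  show ?thesis
    by (rule smf_ihom_eqI[OF F.smf_dual smf_const]) simp_all
qed

text \<open>Duality as a strict functor between internal homs. It expresses precomposition with the
  symmetry after transposition (\<open>Rn_functor_pre_S\<close>) and the second half of dualizing a
  functor of three variables (\<open>Rn_dual\<close>), the two facts that meet in the
  hexagon.\<close>

definition dual_functor where
  "dual_functor A B C = \<lparr>
     FO = (\<lambda>F\<in>Ob (ihom A (ihom B C)). dual A B C F),
     FA = (\<lambda>\<theta>\<in>Ar (ihom A (ihom B C)). (dual A B C (dm (ihom A (ihom B C)) \<theta>), dual A B C (cd (ihom A (ihom B C)) \<theta>),
        \<lambda>b\<in>Ob B. (dual_ob A (dm (ihom A (ihom B C)) \<theta>) b, dual_ob A (cd (ihom A (ihom B C)) \<theta>) b,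
          \<lambda>a\<in>Ob A. comp_at (comp_at \<theta> a) b))),
     F0 = idt (ihom B (ihom A C)) (unt (ihom B (ihom A C))),
     F2 = (\<lambda>F\<in>Ob (ihom A (ihom B C)). \<lambda>G\<in>Ob (ihom A (ihom B C)).
        idt (ihom B (ihom A C)) (smf_box B (ihom A C) (dual A B C F) (dual A B C G)))\<rparr>"

lemma dual_functor_simps [simp]:
  "SMF A (ihom B C) F \<Longrightarrow> FO (dual_functor A B C) F = dual A B C F"
  "\<theta> \<in> Ar (ihom A (ihom B C)) \<Longrightarrow> b \<in> Ob B \<Longrightarrow> a \<in> Ob A \<Longrightarrow>
    comp_at (comp_at (FA (dual_functor A B C) \<theta>) b) a = comp_at (comp_at \<theta> a) b"
  by (simp_all add: dual_functor_def)

lemma dual_functor_ext: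
  "FO (dual_functor A B C) \<in> extensional (Ob (ihom A (ihom B C)))"
  "FA (dual_functor A B C) \<in> extensional (Ar (ihom A (ihom B C)))"
  "F2 (dual_functor A B C) \<in> extensional (Ob (ihom A (ihom B C)))"
  "H \<in> Ob (ihom A (ihom B C)) \<Longrightarrow> F2 (dual_functor A B C) H \<in> extensional (Ob (ihom A (ihom B C)))"
  by (simp_all add: dual_functor_def del: ihom_simps)

lemma strict_dual_functor: "strict (ihom A (ihom B C)) (ihom B (ihom A C)) (dual_functor A B C)"
  by (simp add: strict_def dual_functor_def)

lemma smf_dual_functor:
  assumes "SMC A" "SMC B" "SMC C"
  shows "SMF (ihom A (ihom B C)) (ihom B (ihom A C)) (dual_functor A B C)"
proof -
  note [simp] = assms
  interpret A: symmetric_monoidal_category A by fact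
  interpret BC: symmetric_monoidal_category "ihom B C" by (rule smc_ihom) fact+
  interpret AC: symmetric_monoidal_category "ihom A C" by (rule smc_ihom) fact+
  interpret ABC: symmetric_monoidal_category "ihom A (ihom B C)" by (rule smc_ihom) simp_all
  have i: "ihom_functor A B C F" if "SMF A (ihom B C) F" for F
    using that by (simp add: ihom_functorI)
  note [simp] = ihom_functor.smf_dual_ob[OF i] ihom_functor.smf_dual[OF i]
  have t [simp]: "FA (dual_functor A B C) \<theta> \<in> Ar (ihom B (ihom A C))"
    "dm (ihom B (ihom A C)) (FA (dual_functor A B C) \<theta>) = dual A B C (dm (ihom A (ihom B C)) \<theta>)"
    "cd (ihom B (ihom A C)) (FA (dual_functor A B C) \<theta>) = dual A B C (cd (ihom A (ihom B C)) \<theta>)" if "\<theta> \<in> Ar (ihom A (ihom B C))" for \<theta>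
    using mt_dual[OF _ assms(2,3), of A "dm (ihom A (ihom B C)) \<theta>" "cd (ihom A (ihom B C)) \<theta>" "comp_at \<theta>"] that
    by (simp_all add: dual_functor_def Ar_ihom_triple) (simp add: Ar_ihom)
  have [simp]: "comp_at (FA (dual_functor A B C) \<theta>) b \<in> Ar (ihom A C)"
    "dm (ihom A C) (comp_at (FA (dual_functor A B C) \<theta>) b) = dual_ob A (dm (ihom A (ihom B C)) \<theta>) b"
    "cd (ihom A C) (comp_at (FA (dual_functor A B C) \<theta>) b) = dual_ob A (cd (ihom A (ihom B C)) \<theta>) b"
    if "\<theta> \<in> Ar (ihom A (ihom B C))" "b \<in> Ob B" for \<theta> b
    using ihom_arrow(3-5)[OF t(1)[OF that(1)], of b] that by simp_all
  have b: "dual_ob A (smf_box A (ihom B C) F G) b = smf_box A C (dual_ob A F b) (dual_ob A G b)"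
    if "SMF A (ihom B C) F" "SMF A (ihom B C) G" "b \<in> Ob B" for F G b
    using arg_cong[OF dual_box[OF i i, OF that(1,2)], of "\<lambda>H. FO H b"] that by simp
  have c: "dual_ob A (smf_const A (ihom B C)) b = smf_const A C" if "b \<in> Ob B" for b
    using arg_cong[OF dual_const[OF assms], of "\<lambda>H. FO H b"] that by simp
  show ?thesis
    by (rule strict_into_ihomI[OF _ _ _ dual_functor_ext strict_dual_functor],
        simp_all add: dual_box i dual_const, (rule ihom_eqI[where A=A and B=C]; simp add: b c)+)
qed

section \<open>Functors out of presented categories\<close>

lemma tm_eq_wf:
  "tm_eq P p q \<Longrightarrow> wf_tm P p \<and> wf_tm P q \<and> tdom (adom P) p = tdom (adom P) q \<and> tcod (acod P) p = tcod (acod P) q"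
  by (induction rule: tm_eq.induct) auto

lemma tm_class_eq_iff:
  assumes "wf_tm P p" shows "tm_class P p = tm_class P q \<longleftrightarrow> tm_eq P p q"
proof
  assume "tm_class P p = tm_class P q"
  moreover have "p \<in> tm_class P p" using tm_eq.refl[OF assms] by (simp add: tm_class_def)
  ultimately show "tm_eq P p q" by (auto simp: tm_class_def intro: tm_eq.sym)
next
  assume "tm_eq P p q"
  then show "tm_class P p = tm_class P q"
    unfolding tm_class_def using tm_eq.trans tm_eq.sym by blast
qed

lemma tm_class_eqI:
  assumes "smc_rel (adom P) (acod P) p q \<or> rels P p q" "wf_tm P p" "wf_tm P q"
    "tdom (adom P) p = tdom (adom P) q" "tcod (acod P) p = tcod (acod P) q"
  shows "tm_class P p = tm_class P q"
  using tm_class_eq_iff[OF assms(2)] tm_eq.base[OF assms] by simp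

lemma tm_rep_eq: assumes "wf_tm P p" shows "tm_eq P p (tm_rep (tm_class P p))"
proof -
  have "p \<in> tm_class P p" using tm_eq.refl[OF assms] by (simp add: tm_class_def)
  then have "tm_rep (tm_class P p) \<in> tm_class P p" unfolding tm_rep_def by (rule someI)
  then show ?thesis by (simp add: tm_class_def)
qed

locale presents =
  fixes P :: "('g, 'k) presentation"
  assumes gens: "\<And>k. k \<in> agens P \<Longrightarrow> adom P k \<in> words P \<and> acod P k \<in> words P"
begin

abbreviation "cl \<equiv> tm_class P"
abbreviation "wt \<equiv> wf_tm P"
abbreviation "td \<equiv> tdom (adom P)"
abbreviation "tc \<equiv> tcod (acod P)"
abbreviation "S \<equiv> presented P"

lemma words_td_tc: "wt p \<Longrightarrow> td p \<in> words P \<and> tc p \<in> words P"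
  by (induction p) (auto simp: gens)

lemma td_words [simp]: "wt p \<Longrightarrow> td p \<in> words P" and tc_words [simp]: "wt p \<Longrightarrow> tc p \<in> words P"
  using words_td_tc by auto

lemma presented_simps [simp]:
  "Ob S = words P" "X \<otimes>\<^bsub>S\<^esub> Y = TensW X Y" "unt S = UnitW" "idt S X = cl (IdT X)"
  "ass S X Y Z = cl (AssT X Y Z)" "runit S X = cl (RunitT X)" "lunit S X = cl (LunitT X)" "symm S X Y = cl (SymmT X Y)"
  by (simp_all add: presented_def)

lemma Ar_presented: "c \<in> Ar S \<longleftrightarrow> (\<exists>p. wt p \<and> c = cl p)"
  by (auto simp: presented_def)

lemma cl_Ar [simp]: "wt p \<Longrightarrow> cl p \<in> Ar S"
  by (auto simp: Ar_presented)

lemma rep_wf: "wt p \<Longrightarrow> wt (tm_rep (cl p)) \<and> td (tm_rep (cl p)) = td p \<and> tc (tm_rep (cl p)) = tc p"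
  using tm_eq_wf[OF tm_rep_eq] by metis

lemma dm_cl [simp]: "wt p \<Longrightarrow> dm S (cl p) = td p" and cd_cl [simp]: "wt p \<Longrightarrow> cd S (cl p) = tc p"
  using rep_wf by (simp_all add: presented_def)

text \<open>Operations on classes are defined through chosen representatives; since the relation is
  a congruence, any representative may be used instead.\<close>

lemma cmp_cl: "wt p \<Longrightarrow> wt q \<Longrightarrow> td q = tc p \<Longrightarrow> cl q \<cdot>\<^bsub>S\<^esub> cl p = cl (CompT q p)"
proof -
  assume a: "wt p" "wt q" "td q = tc p"
  have "tm_eq P (CompT q p) (CompT (tm_rep (cl q)) (tm_rep (cl p)))"
    using a by (intro tm_eq.comp tm_rep_eq) simp_all
  then have "cl (CompT q p) = cl (CompT (tm_rep (cl q)) (tm_rep (cl p)))"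
    using tm_class_eq_iff[of P "CompT q p"] a by simp
  then show ?thesis by (simp add: presented_def)
qed

lemma tens_cl: "wt p \<Longrightarrow> wt q \<Longrightarrow> cl p \<boxtimes>\<^bsub>S\<^esub> cl q = cl (tensT (adom P) (acod P) p q)"
proof -
  assume a: "wt p" "wt q"
  have "tm_eq P (tensT (adom P) (acod P) p q) (tensT (adom P) (acod P) (tm_rep (cl p)) (tm_rep (cl q)))"
    unfolding tensT_def using a rep_wf[of p] rep_wf[of q]
    by (auto intro!: tm_eq.comp tm_eq.left tm_eq.right tm_rep_eq)
  then have "cl (tensT (adom P) (acod P) p q) = cl (tensT (adom P) (acod P) (tm_rep (cl p)) (tm_rep (cl q)))"
    using tm_class_eq_iff[of P "tensT (adom P) (acod P) p q"] a by (simp add: tensT_def)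
  then show ?thesis by (simp add: presented_def)
qed

sublocale S: category S
proof unfold_locales
  fix f a b g c h d assume "f \<in> hom S a b" "g \<in> hom S b c" "h \<in> hom S c d"
  then obtain p q r where *: "wt p" "wt q" "wt r" "f = cl p" "g = cl q" "h = cl r" "td q = tc p" "td r = tc q"
    unfolding hom_iff Ar_presented by auto
  then show "(h \<cdot>\<^bsub>S\<^esub> g) \<cdot>\<^bsub>S\<^esub> f = h \<cdot>\<^bsub>S\<^esub> (g \<cdot>\<^bsub>S\<^esub> f)"
    by (simp add: cmp_cl tm_class_eqI smc_rel.comp_assoc)
next
  fix f a b assume "f \<in> hom S a b"
  then obtain p where *: "wt p" "f = cl p" "td p = a" "tc p = b"
    unfolding hom_iff Ar_presented by auto
  have 1: "CompT p (IdT a) = CompT p (IdT (td p))" and 2: "CompT (IdT b) p = CompT (IdT (tc p)) p" using * by auto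
  show "f \<cdot>\<^bsub>S\<^esub> idt S a = f"
    using * td_words[OF *(1)] tm_class_eqI[OF disjI1[OF smc_rel.id_right[of "adom P" "acod P" p]]] by (simp add: cmp_cl)
  show "idt S b \<cdot>\<^bsub>S\<^esub> f = f"
    using * tc_words[OF *(1)] tm_class_eqI[OF disjI1[OF smc_rel.id_left[of "adom P" "acod P" p]]] by (simp add: cmp_cl)
next
  show "g \<cdot>\<^bsub>S\<^esub> f \<in> hom S a c" if "f \<in> hom S a b" "g \<in> hom S b c" for f g a b c
  proof -
    obtain p q where "wt p" "wt q" "f = cl p" "g = cl q" "td q = tc p" "td p = a" "tc q = c"
      using \<open>f \<in> hom S a b\<close> \<open>g \<in> hom S b c\<close> unfolding hom_iff Ar_presented by auto
    then show ?thesis by (simp add: hom_iff cmp_cl)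
  qed
next
  show "idt S a \<in> hom S a a" if "a \<in> Ob S" for a
    using that by (simp add: hom_iff)
qed (auto simp: Ar_presented)

lemma cl_Right_Comp: "wt p \<Longrightarrow> wt q \<Longrightarrow> td q = tc p \<Longrightarrow> X \<in> words P \<Longrightarrow> cl (RightT (CompT q p) X) = cl (RightT q X) \<cdot>\<^bsub>S\<^esub> cl (RightT p X)"
  by (simp add: cmp_cl tm_class_eqI smc_rel.right_comp)

lemma cl_Left_Comp: "wt p \<Longrightarrow> wt q \<Longrightarrow> td q = tc p \<Longrightarrow> X \<in> words P \<Longrightarrow> cl (LeftT X (CompT q p)) = cl (LeftT X q) \<cdot>\<^bsub>S\<^esub> cl (LeftT X p)"
  by (simp add: cmp_cl tm_class_eqI smc_rel.left_comp)

lemma exchange: "wt p \<Longrightarrow> wt q \<Longrightarrow> cl (RightT p (tc q)) \<cdot>\<^bsub>S\<^esub> cl (LeftT (td p) q) = cl (LeftT (tc p) q) \<cdot>\<^bsub>S\<^esub> cl (RightT p (td q))"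
  by (simp add: cmp_cl tm_class_eqI smc_rel.left_right)

lemma tens_cl': "wt p \<Longrightarrow> wt q \<Longrightarrow> cl p \<boxtimes>\<^bsub>S\<^esub> cl q = cl (RightT p (tc q)) \<cdot>\<^bsub>S\<^esub> cl (LeftT (td p) q)"
  by (simp add: tens_cl tensT_def cmp_cl)

lemma Left_Id: "X \<in> words P \<Longrightarrow> Y \<in> words P \<Longrightarrow> cl (LeftT X (IdT Y)) = idt S (TensW X Y)"
  and Right_Id: "X \<in> words P \<Longrightarrow> Y \<in> words P \<Longrightarrow> cl (RightT (IdT Y) X) = idt S (TensW Y X)"
  by (simp_all add: tm_class_eqI smc_rel.left_id smc_rel.right_id)

lemma tens_Id_right: "wt p \<Longrightarrow> X \<in> words P \<Longrightarrow> cl p \<boxtimes>\<^bsub>S\<^esub> cl (IdT X) = cl (RightT p X)"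
  and tens_Id_left: "wt p \<Longrightarrow> X \<in> words P \<Longrightarrow> cl (IdT X) \<boxtimes>\<^bsub>S\<^esub> cl p = cl (LeftT X p)"
  using S.idt_r[of "cl (RightT p X)"] S.idt_l[of "cl (LeftT X p)"]
  by (simp_all add: tens_cl' Left_Id Right_Id)

lemma inv_cl:
  "X \<in> words P \<Longrightarrow> Y \<in> words P \<Longrightarrow> Z \<in> words P \<Longrightarrow> is_inv S (cl (AssT X Y Z)) (cl (AssInvT X Y Z))"
  "X \<in> words P \<Longrightarrow> is_inv S (cl (RunitT X)) (cl (RunitInvT X))"
  "X \<in> words P \<Longrightarrow> is_inv S (cl (LunitT X)) (cl (LunitInvT X))"
  by (rule S.is_invI; simp add: cmp_cl tm_class_eqI smc_rel.intros)+

lemma iso_cl: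
  "X \<in> words P \<Longrightarrow> Y \<in> words P \<Longrightarrow> Z \<in> words P \<Longrightarrow> iso S (cl (AssT X Y Z))"
  "X \<in> words P \<Longrightarrow> iso S (cl (RunitT X))" "X \<in> words P \<Longrightarrow> iso S (cl (LunitT X))"
  using inv_cl unfolding iso_def by blast+

text \<open>The tensor of arrows is put together from two whiskerings. Its functoriality is the
  exchange relation \<open>left_right\<close>, used once in the middle of four whiskered
  factors.\<close>

sublocale S: symmetric_monoidal_category S
proof unfold_locales
  show "idt S a \<boxtimes>\<^bsub>S\<^esub> idt S b = idt S (a \<otimes>\<^bsub>S\<^esub> b)" if "a \<in> Ob S" "b \<in> Ob S" for a b
    using that by (simp add: tens_Id_right) (simp add: Right_Id)
  show "(f' \<cdot>\<^bsub>S\<^esub> f) \<boxtimes>\<^bsub>S\<^esub> (g' \<cdot>\<^bsub>S\<^esub> g) = (f' \<boxtimes>\<^bsub>S\<^esub> g') \<cdot>\<^bsub>S\<^esub> (f \<boxtimes>\<^bsub>S\<^esub> g)"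
    if fg: "f \<in> hom S a b" "f' \<in> hom S b c" "g \<in> hom S a' b'" "g' \<in> hom S b' c'" for f f' g g' a b c a' b' c'
  proof -
    obtain p p' q q' where [simp]: "f = cl p" "f' = cl p'" "g = cl q" "g' = cl q'" "wt p" "wt p'" "wt q" "wt q'"
      and [simp]: "td p' = tc p" "td q' = tc q"
      using fg unfolding hom_iff Ar_presented by auto
    have e: "cl (RightT p (tc q')) \<cdot>\<^bsub>S\<^esub> cl (LeftT (td p) q') = cl (LeftT (tc p) q') \<cdot>\<^bsub>S\<^esub> cl (RightT p (tc q))"
      using exchange[of p q'] by simp
    have "(f' \<cdot>\<^bsub>S\<^esub> f) \<boxtimes>\<^bsub>S\<^esub> (g' \<cdot>\<^bsub>S\<^esub> g) = cl (RightT p' (tc q')) \<cdot>\<^bsub>S\<^esub> (cl (RightT p (tc q')) \<cdot>\<^bsub>S\<^esub> cl (LeftT (td p) q')) \<cdot>\<^bsub>S\<^esub> cl (LeftT (td p) q)"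
      by (simp add: cmp_cl tens_cl') (simp add: cmp_cl[symmetric] cl_Right_Comp cl_Left_Comp)
    also have "\<dots> = (f' \<boxtimes>\<^bsub>S\<^esub> g') \<cdot>\<^bsub>S\<^esub> (f \<boxtimes>\<^bsub>S\<^esub> g)"
      unfolding e by (simp add: tens_cl')
    finally show ?thesis .
  qed
  show "ass S a' b' c' \<cdot>\<^bsub>S\<^esub> (f \<boxtimes>\<^bsub>S\<^esub> (g \<boxtimes>\<^bsub>S\<^esub> h)) = ((f \<boxtimes>\<^bsub>S\<^esub> g) \<boxtimes>\<^bsub>S\<^esub> h) \<cdot>\<^bsub>S\<^esub> ass S a b c"
    if fg: "f \<in> hom S a a'" "g \<in> hom S b b'" "h \<in> hom S c c'" for f g h a b c a' b' c'
  proof -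
    obtain p q r where [simp]: "f = cl p" "g = cl q" "h = cl r" "wt p" "wt q" "wt r"
      and [simp]: "a = td p" "a' = tc p" "b = td q" "b' = tc q" "c = td r" "c' = tc r"
      using fg unfolding hom_iff Ar_presented by auto
    have [simp]: "wt (tensT (adom P) (acod P) p q)" "td (tensT (adom P) (acod P) p q) = TensW (td p) (td q)"
      "tc (tensT (adom P) (acod P) p q) = TensW (tc p) (tc q)" if "wt p" "wt q" for p q
      using that by (auto simp: tensT_def)
    show ?thesis using tm_class_eqI[OF disjI1[OF smc_rel.ass_nat[of "adom P" "acod P" p q r]]]
      by (simp add: tens_cl cmp_cl)
  qed
  show "runit S b \<cdot>\<^bsub>S\<^esub> (f \<boxtimes>\<^bsub>S\<^esub> idt S (unt S)) = f \<cdot>\<^bsub>S\<^esub> runit S a"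
    "lunit S b \<cdot>\<^bsub>S\<^esub> (idt S (unt S) \<boxtimes>\<^bsub>S\<^esub> f) = f \<cdot>\<^bsub>S\<^esub> lunit S a" if h: "f \<in> hom S a b" for f a b
  proof -
    obtain p where [simp]: "f = cl p" "wt p" "a = td p" "b = tc p"
      using h unfolding hom_iff Ar_presented by auto
    show "runit S b \<cdot>\<^bsub>S\<^esub> (f \<boxtimes>\<^bsub>S\<^esub> idt S (unt S)) = f \<cdot>\<^bsub>S\<^esub> runit S a"
      using tm_class_eqI[OF disjI1[OF smc_rel.runit_nat[of "adom P" "acod P" p]]] by (simp add: tens_Id_right cmp_cl)
    show "lunit S b \<cdot>\<^bsub>S\<^esub> (idt S (unt S) \<boxtimes>\<^bsub>S\<^esub> f) = f \<cdot>\<^bsub>S\<^esub> lunit S a"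
      using tm_class_eqI[OF disjI1[OF smc_rel.lunit_nat[of "adom P" "acod P" p]]] by (simp add: tens_Id_left cmp_cl)
  qed
  show "symm S a' b' \<cdot>\<^bsub>S\<^esub> (f \<boxtimes>\<^bsub>S\<^esub> g) = (g \<boxtimes>\<^bsub>S\<^esub> f) \<cdot>\<^bsub>S\<^esub> symm S a b"
    if fg: "f \<in> hom S a a'" "g \<in> hom S b b'" for f g a b a' b'
  proof -
    obtain p q where [simp]: "f = cl p" "g = cl q" "wt p" "wt q" "a = td p" "a' = tc p" "b = td q" "b' = tc q"
      using fg unfolding hom_iff Ar_presented by auto
    show ?thesis using tm_class_eqI[OF disjI1[OF smc_rel.symm_nat[of "adom P" "acod P" p q]]]
      by (simp add: tens_cl cmp_cl tensT_def)
  qed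
  show "f \<boxtimes>\<^bsub>S\<^esub> g \<in> hom S (a \<otimes>\<^bsub>S\<^esub> c) (b \<otimes>\<^bsub>S\<^esub> d)" if h: "f \<in> hom S a b" "g \<in> hom S c d" for f g a b c d
  proof -
    obtain p q where "wt p" "wt q" "f = cl p" "g = cl q" "a = td p" "b = tc p" "c = td q" "d = tc q"
      using h unfolding hom_iff Ar_presented by auto
    then show ?thesis by (simp add: hom_iff tens_cl tensT_def)
  qed
qed (auto simp: iso_cl hom_iff tens_Id_right tens_Id_left cmp_cl tm_class_eqI smc_rel.intros)

lemma eval_word_GenW [simp]: "eval_word S GenW X = X"
  by (induction X) simp_all

text \<open>Evaluating a term in the category that it helps to present gives its own class.
  Relations thereby become equations between evaluated terms, and representatives need not be
  handled any more.\<close>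

lemma eval_tm_GenT: "wt p \<Longrightarrow> eval_tm S GenW (\<lambda>k. cl (GenT k)) p = cl p"
  by (induction p) (simp_all add: cmp_cl tens_Id_left tens_Id_right S.inverse_of_eq[OF inv_cl(1)]
     S.inverse_of_eq[OF inv_cl(2)] S.inverse_of_eq[OF inv_cl(3)])

lemma assignment_GenW: "S.assignment P GenW (\<lambda>k. cl (GenT k))"
  by (auto simp: S.assignment_def hom_iff gens)

lemma rels_eval:
  assumes "rels P p q" "wt p" "wt q" "td p = td q" "tc p = tc q"
  shows "eval_tm S GenW (\<lambda>k. cl (GenT k)) p = eval_tm S GenW (\<lambda>k. cl (GenT k)) q"
  using assms by (simp add: eval_tm_GenT tm_class_eqI)

end

text \<open>The hypotheses of the universal property of a presented category: values for the
  generators, correctly typed and respecting the relations. The induced strict functor is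
  \<open>strict_ext\<close>.\<close>

locale sound_assignment = presents P + C: symmetric_monoidal_category C
  for P :: "('g, 'k) presentation" and C :: "('o, 'm) smc" +
  fixes u :: "'g \<Rightarrow> 'o" and w :: "'k \<Rightarrow> 'm"
  assumes asg: "C.assignment P u w"
    and sound: "\<And>p q. rels P p q \<Longrightarrow> wt p \<Longrightarrow> wt q \<Longrightarrow> td p = td q \<Longrightarrow> tc p = tc q \<Longrightarrow>
      eval_tm C u w p = eval_tm C u w q"
begin

lemma strict_ext_simps [simp]:
  "X \<in> words P \<Longrightarrow> FO (strict_ext P C u w) X = eval_word C u X"
  "wt p \<Longrightarrow> FA (strict_ext P C u w) (cl p) = eval_tm C u w p"
  "F0 (strict_ext P C u w) = idt C (unt C)"
  "X \<in> words P \<Longrightarrow> Y \<in> words P \<Longrightarrow> F2 (strict_ext P C u w) X Y = idt C (eval_word C u X \<otimes>\<^bsub>C\<^esub> eval_word C u Y)"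
proof -
  have e: "eval_tm C u w p = eval_tm C u w (tm_rep (cl p))" if "wt p"
    by (rule C.eval_tm_tm_eq[OF asg _ tm_rep_eq[OF that]]) (rule sound)
  show "wt p \<Longrightarrow> FA (strict_ext P C u w) (cl p) = eval_tm C u w p"
    by (simp add: strict_ext_def e[symmetric])
qed (simp_all add: strict_ext_def)

lemma strict_ext_ext:
  "FO (strict_ext P C u w) \<in> extensional (words P)" "FA (strict_ext P C u w) \<in> extensional (Ar S)"
  "F2 (strict_ext P C u w) \<in> extensional (words P)" "X \<in> words P \<Longrightarrow> F2 (strict_ext P C u w) X \<in> extensional (words P)"
  by (simp_all add: strict_ext_def)

lemma strict_strict_ext: "strict S C (strict_ext P C u w)"
  by (simp add: strict_def)

lemma smf_strict_ext: "SMF S C (strict_ext P C u w)"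
proof -
  note [simp] = C.eval_word_Ob[OF asg] C.eval_tm_typing[OF asg]
  show ?thesis
  proof (rule strict_smfI[OF S.symmetric_monoidal_category_axioms C.symmetric_monoidal_category_axioms _ _ _ _ strict_strict_ext])
    show "FA (strict_ext P C u w) (g \<cdot>\<^bsub>S\<^esub> f) = FA (strict_ext P C u w) g \<cdot>\<^bsub>C\<^esub> FA (strict_ext P C u w) f"
      if "f \<in> Ar S" "g \<in> Ar S" "dm S g = cd S f" for f g
      using that unfolding Ar_presented by (auto simp: cmp_cl)
    show "FA (strict_ext P C u w) (f \<boxtimes>\<^bsub>S\<^esub> g) = FA (strict_ext P C u w) f \<boxtimes>\<^bsub>C\<^esub> FA (strict_ext P C u w) g"
      if "f \<in> Ar S" "g \<in> Ar S" for f g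
      using that unfolding Ar_presented by (auto simp: tens_cl tensT_def C.tens_cmp)
    show "FA (strict_ext P C u w) f \<in> Ar C \<and> dm C (FA (strict_ext P C u w) f) = FO (strict_ext P C u w) (dm S f) \<and>
      cd C (FA (strict_ext P C u w) f) = FO (strict_ext P C u w) (cd S f)" if "f \<in> Ar S" for f
      using that unfolding Ar_presented by auto
  qed (simp_all add: strict_ext_ext)
qed

text \<open>A strict functor maps to every lax functor that receives suitable arrows on generators.
  The direction is forced by laxity, as \<open>F2\<close> goes from the tensor of values to the
  value of the tensor. This is the source of \<open>eps\<close>, of \<open>En\<close> on 2-cells,
  and of the comparison of functors out of the unit.\<close>

lemma mt_strict_ext:
  assumes F: "SMF S C F"
    and t: "\<And>g. g \<in> ogens P \<Longrightarrow> t g \<in> Ar C \<and> dm C (t g) = u g \<and> cd C (t g) = FO F (GenW g)"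
    and nat: "\<And>k. k \<in> agens P \<Longrightarrow> symmetric_monoidal_functor.lax_comp S C F GenW t (acod P k) \<cdot>\<^bsub>C\<^esub> w k =
      FA F (cl (GenT k)) \<cdot>\<^bsub>C\<^esub> symmetric_monoidal_functor.lax_comp S C F GenW t (adom P k)"
  shows "MT S C (strict_ext P C u w) F (\<lambda>X\<in>words P. symmetric_monoidal_functor.lax_comp S C F GenW t X)"
proof -
  interpret F: symmetric_monoidal_functor S C F by fact
  note ty [simp] = F.lax_comp_typing[OF assignment_GenW t]
  note n = F.lax_comp_natural[OF assignment_GenW asg t gens nat]
  show ?thesis
  proof (rule mtI[OF smf_strict_ext F])
    show "(\<lambda>X\<in>words P. F.lax_comp GenW t X) (cd S f) \<cdot>\<^bsub>C\<^esub> FA (strict_ext P C u w) f =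
        FA F f \<cdot>\<^bsub>C\<^esub> (\<lambda>X\<in>words P. F.lax_comp GenW t X) (dm S f)" if "f \<in> Ar S" for f
      using that n unfolding Ar_presented by (auto simp: eval_tm_GenT)
  qed (use C.eval_word_Ob[OF asg] in simp_all)
qed

end

section \<open>Transformations determined by their values on generators\<close>

definition strong :: "('o, 'm) smc \<Rightarrow> ('p, 'n) smc \<Rightarrow> ('o, 'm, 'p, 'n) smf \<Rightarrow> bool" where
  "strong A B F \<longleftrightarrow> iso B (F0 F) \<and> (\<forall>x\<in>Ob A. \<forall>y\<in>Ob A. iso B (F2 F x y))"

lemma strict_strong: "SMF A B F \<Longrightarrow> strict A B F \<Longrightarrow> strong A B F"
proof -
  assume F: "SMF A B F" and s: "strict A B F"
  interpret F: symmetric_monoidal_functor A B F by fact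
  show ?thesis using s by (simp add: strict_def strong_def)
qed

lemma strong_box:
  assumes "SMF A B F" "SMF A B G" "strong A B F" "strong A B G"
  shows "strong A B (smf_box A B F G)"
proof -
  interpret F: symmetric_monoidal_functor A B F by fact
  interpret G: symmetric_monoidal_functor A B G by fact
  have "iso B (interchange B a b c d)" if "a \<in> Ob B" "b \<in> Ob B" "c \<in> Ob B" "d \<in> Ob B" for a b c d
    using that by (simp add: interchange_def)
  then show ?thesis using assms(3,4) by (simp add: strong_def)
qed

lemma strong_const: "SMC A \<Longrightarrow> SMC B \<Longrightarrow> strong A B (smf_const A B)"
proof -
  assume "SMC A" "SMC B"
  interpret A: symmetric_monoidal_category A by fact
  interpret B: symmetric_monoidal_category B by fact
  show ?thesis by (simp add: strong_def)
qed

text \<open>For a strong source, the unit and tensor conditions can be solved for the components at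
  the unit and at tensor words, since \<open>F0 F\<close> and \<open>F2 F X Y\<close> can be
  cancelled on the right.\<close>

lemma (in presents) mt_unique:
  assumes "MT S C F G \<sigma>" "MT S C F G \<tau>" "strong S C F"
    and g: "\<And>g. g \<in> ogens P \<Longrightarrow> \<sigma> (GenW g) = \<tau> (GenW g)"
  shows "\<sigma> = \<tau>"
proof -
  interpret s: monoidal_transformation S C F G \<sigma> by fact
  interpret t: monoidal_transformation S C F G \<tau> by fact
  have i: "iso C (F0 F)" "\<And>X Y. X \<in> words P \<Longrightarrow> Y \<in> words P \<Longrightarrow> iso C (F2 F X Y)"
    using assms(3) by (auto simp: strong_def)
  have "\<sigma> X = \<tau> X" if "X \<in> words P" for X
    using that
  proof (induction X)
    case UnitW
    have "\<sigma> UnitW \<cdot>\<^bsub>C\<^esub> F0 F = \<tau> UnitW \<cdot>\<^bsub>C\<^esub> F0 F" using s.tr_unit t.tr_unit by simp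
    then show ?case
      by (rule s.source.target.iso_cancel_right[OF _ i(1)])
       (use s.tr_typing[of UnitW] t.tr_typing[of UnitW] s.source.F0_typing(3) in simp_all)
  next
    case (GenW g)
    then show ?case by (simp add: g)
  next
    case (TensW X Y)
    then have xy: "X \<in> words P" "Y \<in> words P" "\<sigma> X = \<tau> X" "\<sigma> Y = \<tau> Y" by auto
    have "\<sigma> (TensW X Y) \<cdot>\<^bsub>C\<^esub> F2 F X Y = \<tau> (TensW X Y) \<cdot>\<^bsub>C\<^esub> F2 F X Y"
      using s.tr_tens[of X Y] t.tr_tens[of X Y] xy by simp
    then show ?case
      by (rule s.source.target.iso_cancel_right[OF _ i(2)[OF xy(1,2)]])
       (use xy s.tr_typing[of "TensW X Y"] t.tr_typing[of "TensW X Y"] s.source.F2_typing(3)[of X Y] in simp_all)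
  qed
  then show ?thesis
    using s.tr_ext t.tr_ext by (intro extensionalityI[of _ "words P"]) simp_all
qed

section \<open>The tensor product\<close>

locale tensor_pair = A: symmetric_monoidal_category A + B: symmetric_monoidal_category B
  for A :: "('o, 'm) smc" and B :: "('p, 'n) smc"
begin

abbreviation "AB \<equiv> tensor A B"
abbreviation "gen \<equiv> gen_arrow A B"

lemma tensor_pres_simps [simp]:
  "ogens (tensor_pres A B) = Ob A \<times> Ob B"
  "adom (tensor_pres A B) = tgen_dom A B" "acod (tensor_pres A B) = tgen_cod A B" "rels (tensor_pres A B) = tensor_rel A B"
  "AlphaG b \<in> agens (tensor_pres A B) \<longleftrightarrow> b \<in> Ob B"
  "BetaG a \<in> agens (tensor_pres A B) \<longleftrightarrow> a \<in> Ob A"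
  "GammaG a a' b \<in> agens (tensor_pres A B) \<longleftrightarrow> a \<in> Ob A \<and> a' \<in> Ob A \<and> b \<in> Ob B"
  "DeltaG a b b' \<in> agens (tensor_pres A B) \<longleftrightarrow> a \<in> Ob A \<and> b \<in> Ob B \<and> b' \<in> Ob B"
  "ObAr a g \<in> agens (tensor_pres A B) \<longleftrightarrow> a \<in> Ob A \<and> g \<in> Ar B"
  "ArOb f b \<in> agens (tensor_pres A B) \<longleftrightarrow> f \<in> Ar A \<and> b \<in> Ob B"
  by (auto simp: tensor_pres_def)

sublocale presents "tensor_pres A B"
proof
  fix k assume "k \<in> agens (tensor_pres A B)"
  then show "adom (tensor_pres A B) k \<in> words (tensor_pres A B) \<and> acod (tensor_pres A B) k \<in> words (tensor_pres A B)"
    by (cases k) simp_all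
qed

sublocale AB: symmetric_monoidal_category AB
  unfolding tensor_def by (rule S.symmetric_monoidal_category_axioms)

lemma tensor_simps [simp]:
  "Ob AB = words (tensor_pres A B)" "X \<otimes>\<^bsub>AB\<^esub> Y = TensW X Y" "unt AB = UnitW"
  by (simp_all add: tensor_def)

lemma gen_typing [simp]:
  assumes "k \<in> agens (tensor_pres A B)"
  shows "gen k \<in> Ar AB" "dm AB (gen k) = tgen_dom A B k" "cd AB (gen k) = tgen_cod A B k"
  using assms by (simp_all add: gen_arrow_def tensor_def)

lemma tensor_equation:
  assumes "tensor_rel A B p q" "wt p" "wt q" "td p = td q" "tc p = tc q"
  shows "eval_tm AB GenW gen p = eval_tm AB GenW gen q"
proof -
  have "gen = (\<lambda>k. cl (GenT k))" by (rule ext) (simp add: gen_arrow_def)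
  then show ?thesis using rels_eval[of p q] assms by (simp add: tensor_def)
qed

lemma eval_word_AB [simp]: "eval_word AB GenW X = X"
  by (simp add: tensor_def)

lemma eta_ob_simps [simp]:
  "b \<in> Ob B \<Longrightarrow> FO (eta_ob A B a) b = GenW (a, b)"
  "g \<in> Ar B \<Longrightarrow> FA (eta_ob A B a) g = gen (ObAr a g)"
  "F0 (eta_ob A B a) = gen (BetaG a)"
  "b \<in> Ob B \<Longrightarrow> b' \<in> Ob B \<Longrightarrow> F2 (eta_ob A B a) b b' = gen (DeltaG a b b')"
  by (simp_all add: eta_ob_def)

lemma smf_eta_ob:
  assumes [simp]: "a \<in> Ob A"
  shows "SMF B AB (eta_ob A B a)"
proof -
  note eq = tensor_equation[OF tensor_rel.left_functor[OF assms]]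
  show ?thesis
  proof (rule smfI)
    show "FA (eta_ob A B a) (idt B x) = idt AB (FO (eta_ob A B a) x)" if "x \<in> Ob B" for x
      using eq[OF functor_rel.fun_id[of x]] that by simp
    show "FA (eta_ob A B a) (g \<cdot>\<^bsub>B\<^esub> f) = FA (eta_ob A B a) g \<cdot>\<^bsub>AB\<^esub> FA (eta_ob A B a) f"
      if "f \<in> Ar B" "g \<in> Ar B" "dm B g = cd B f" for f g
      using eq[OF functor_rel.fun_comp[of f B "dm B f" "cd B f" g "cd B g"]] that by (simp add: hom_iff)
    show "F2 (eta_ob A B a) (cd B f) (cd B g) \<cdot>\<^bsub>AB\<^esub> (FA (eta_ob A B a) f \<boxtimes>\<^bsub>AB\<^esub> FA (eta_ob A B a) g) =
      FA (eta_ob A B a) (f \<boxtimes>\<^bsub>B\<^esub> g) \<cdot>\<^bsub>AB\<^esub> F2 (eta_ob A B a) (dm B f) (dm B g)"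
      if "f \<in> Ar B" "g \<in> Ar B" for f g
      using eq[OF functor_rel.fun_nat[of f B "dm B f" "cd B f" g "dm B g" "cd B g"]] that by (simp add: hom_iff tensT_def AB.tens_cmp)
    show "FA (eta_ob A B a) (ass B x y z) \<cdot>\<^bsub>AB\<^esub> F2 (eta_ob A B a) x (y \<otimes>\<^bsub>B\<^esub> z) \<cdot>\<^bsub>AB\<^esub> (idt AB (FO (eta_ob A B a) x) \<boxtimes>\<^bsub>AB\<^esub> F2 (eta_ob A B a) y z) =
      F2 (eta_ob A B a) (x \<otimes>\<^bsub>B\<^esub> y) z \<cdot>\<^bsub>AB\<^esub> (F2 (eta_ob A B a) x y \<boxtimes>\<^bsub>AB\<^esub> idt AB (FO (eta_ob A B a) z)) \<cdot>\<^bsub>AB\<^esub>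
        ass AB (FO (eta_ob A B a) x) (FO (eta_ob A B a) y) (FO (eta_ob A B a) z)"
      if "x \<in> Ob B" "y \<in> Ob B" "z \<in> Ob B" for x y z
      using eq[OF functor_rel.fun_ass[of x B y z]] that by simp
    show "FA (eta_ob A B a) (runit B x) \<cdot>\<^bsub>AB\<^esub> F2 (eta_ob A B a) x (unt B) \<cdot>\<^bsub>AB\<^esub>
      (idt AB (FO (eta_ob A B a) x) \<boxtimes>\<^bsub>AB\<^esub> F0 (eta_ob A B a)) = runit AB (FO (eta_ob A B a) x)" if "x \<in> Ob B" for x
      using eq[OF functor_rel.fun_runit[of x B]] that by simp
    show "FA (eta_ob A B a) (lunit B x) \<cdot>\<^bsub>AB\<^esub> F2 (eta_ob A B a) (unt B) x \<cdot>\<^bsub>AB\<^esub>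
      (F0 (eta_ob A B a) \<boxtimes>\<^bsub>AB\<^esub> idt AB (FO (eta_ob A B a) x)) = lunit AB (FO (eta_ob A B a) x)" if "x \<in> Ob B" for x
      using eq[OF functor_rel.fun_lunit[of x B]] that by simp
    show "FA (eta_ob A B a) (symm B x y) \<cdot>\<^bsub>AB\<^esub> F2 (eta_ob A B a) x y =
      F2 (eta_ob A B a) y x \<cdot>\<^bsub>AB\<^esub> symm AB (FO (eta_ob A B a) x) (FO (eta_ob A B a) y)" if "x \<in> Ob B" "y \<in> Ob B" for x y
      using eq[OF functor_rel.fun_symm[of x B y]] that by simp
  qed (simp_all add: eta_ob_def B.symmetric_monoidal_category_axioms AB.symmetric_monoidal_category_axioms)
qed

lemma mt_eta_arrow:
  assumes [simp]: "f \<in> Ar A"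
  shows "MT B AB (eta_ob A B (dm A f)) (eta_ob A B (cd A f)) (\<lambda>b\<in>Ob B. gen (ArOb f b))"
proof (rule mtI)
  have f: "f \<in> hom A (dm A f) (cd A f)" by (simp add: hom_iff)
  show "(\<lambda>b\<in>Ob B. gen (ArOb f b)) (cd B g) \<cdot>\<^bsub>AB\<^esub> FA (eta_ob A B (dm A f)) g =
      FA (eta_ob A B (cd A f)) g \<cdot>\<^bsub>AB\<^esub> (\<lambda>b\<in>Ob B. gen (ArOb f b)) (dm B g)" if "g \<in> Ar B" for g
    using tensor_equation[OF tensor_rel.transf_nat[OF f, of g B "dm B g" "cd B g"]] that by (simp add: hom_iff)
  show "(\<lambda>b\<in>Ob B. gen (ArOb f b)) (unt B) \<cdot>\<^bsub>AB\<^esub> F0 (eta_ob A B (dm A f)) = F0 (eta_ob A B (cd A f))"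
    using tensor_equation[OF tensor_rel.left_transf_unit[OF f]] by simp
  show "(\<lambda>b\<in>Ob B. gen (ArOb f b)) (x \<otimes>\<^bsub>B\<^esub> y) \<cdot>\<^bsub>AB\<^esub> F2 (eta_ob A B (dm A f)) x y =
      F2 (eta_ob A B (cd A f)) x y \<cdot>\<^bsub>AB\<^esub> ((\<lambda>b\<in>Ob B. gen (ArOb f b)) x \<boxtimes>\<^bsub>AB\<^esub> (\<lambda>b\<in>Ob B. gen (ArOb f b)) y)"
    if "x \<in> Ob B" "y \<in> Ob B" for x y
    using tensor_equation[OF tensor_rel.left_transf_tens[OF f that]] that by (simp add: tensT_def AB.tens_cmp)
qed (simp_all add: smf_eta_ob)

lemma mt_eta_F0: "MT B AB (smf_const B AB) (eta_ob A B (unt A)) (\<lambda>b\<in>Ob B. gen (AlphaG b))"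
proof (rule mtI)
  show "(\<lambda>b\<in>Ob B. gen (AlphaG b)) (cd B g) \<cdot>\<^bsub>AB\<^esub> FA (smf_const B AB) g =
      FA (eta_ob A B (unt A)) g \<cdot>\<^bsub>AB\<^esub> (\<lambda>b\<in>Ob B. gen (AlphaG b)) (dm B g)" if "g \<in> Ar B" for g
    using tensor_equation[OF tensor_rel.right_transf_unit[of g B "dm B g" "cd B g"]] that AB.idt_r[of "gen (AlphaG (cd B g))"] by (simp add: hom_iff)
  show "(\<lambda>b\<in>Ob B. gen (AlphaG b)) (unt B) \<cdot>\<^bsub>AB\<^esub> F0 (smf_const B AB) = F0 (eta_ob A B (unt A))"
    using tensor_equation[OF tensor_rel.beta_alpha] AB.idt_r[of "gen (AlphaG (unt B))"] by simp
  show "(\<lambda>b\<in>Ob B. gen (AlphaG b)) (x \<otimes>\<^bsub>B\<^esub> y) \<cdot>\<^bsub>AB\<^esub> F2 (smf_const B AB) x y =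
      F2 (eta_ob A B (unt A)) x y \<cdot>\<^bsub>AB\<^esub> ((\<lambda>b\<in>Ob B. gen (AlphaG b)) x \<boxtimes>\<^bsub>AB\<^esub> (\<lambda>b\<in>Ob B. gen (AlphaG b)) y)"
    if "x \<in> Ob B" "y \<in> Ob B" for x y
    using tensor_equation[OF tensor_rel.alpha_tens[OF that]] that by (simp add: tensT_def AB.tens_cmp)
qed (simp_all add: smf_eta_ob B.symmetric_monoidal_category_axioms AB.symmetric_monoidal_category_axioms)

lemma mt_eta_F2:
  assumes [simp]: "a \<in> Ob A" "a' \<in> Ob A"
  shows "MT B AB (smf_box B AB (eta_ob A B a) (eta_ob A B a')) (eta_ob A B (a \<otimes>\<^bsub>A\<^esub> a')) (\<lambda>b\<in>Ob B. gen (GammaG a a' b))"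
proof (rule mtI)
  show "(\<lambda>b\<in>Ob B. gen (GammaG a a' b)) (cd B g) \<cdot>\<^bsub>AB\<^esub> FA (smf_box B AB (eta_ob A B a) (eta_ob A B a')) g =
      FA (eta_ob A B (a \<otimes>\<^bsub>A\<^esub> a')) g \<cdot>\<^bsub>AB\<^esub> (\<lambda>b\<in>Ob B. gen (GammaG a a' b)) (dm B g)" if "g \<in> Ar B" for g
    using tensor_equation[OF tensor_rel.right_transf_tens[OF _ assms, of g B "dm B g" "cd B g"]] that by (simp add: hom_iff tensT_def AB.tens_cmp)
  show "(\<lambda>b\<in>Ob B. gen (GammaG a a' b)) (unt B) \<cdot>\<^bsub>AB\<^esub> F0 (smf_box B AB (eta_ob A B a) (eta_ob A B a')) = F0 (eta_ob A B (a \<otimes>\<^bsub>A\<^esub> a'))"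
  proof -
    \<comment> \<open>The relation contains the canonical arrow from the tensor of two units, the
      unit arrow of \<open>smf_box\<close> its inverse; the relation is therefore composed with this
      inverse.\<close>
    have e: "gen (BetaG (a \<otimes>\<^bsub>A\<^esub> a')) \<cdot>\<^bsub>AB\<^esub> runit AB UnitW = gen (GammaG a a' (unt B)) \<cdot>\<^bsub>AB\<^esub> (gen (BetaG a) \<boxtimes>\<^bsub>AB\<^esub> gen (BetaG a'))"
      using tensor_equation[OF tensor_rel.beta_tens[OF assms]] by (simp add: tensT_def AB.tens_cmp)
    have "gen (GammaG a a' (unt B)) \<cdot>\<^bsub>AB\<^esub> (gen (BetaG a) \<boxtimes>\<^bsub>AB\<^esub> gen (BetaG a')) \<cdot>\<^bsub>AB\<^esub> inverse_of AB (runit AB UnitW) =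
      (gen (GammaG a a' (unt B)) \<cdot>\<^bsub>AB\<^esub> (gen (BetaG a) \<boxtimes>\<^bsub>AB\<^esub> gen (BetaG a'))) \<cdot>\<^bsub>AB\<^esub> inverse_of AB (runit AB UnitW)" by simp
    also have "\<dots> = gen (BetaG (a \<otimes>\<^bsub>A\<^esub> a'))" unfolding e[symmetric] by simp
    finally show ?thesis by simp
  qed
  fix x y assume xy [simp]: "x \<in> Ob B" "y \<in> Ob B"
  let ?m = "interchange AB (GenW (a, x)) (GenW (a, y)) (GenW (a', x)) (GenW (a', y))"
  let ?n = "interchange AB (GenW (a, x)) (GenW (a', x)) (GenW (a, y)) (GenW (a', y))"
  \<comment> \<open>The defining relation has the interchange next to the \<open>gamma\<close>
    arrows, but here it belongs to the source functor \<open>smf_box\<close>, next to the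
    \<open>delta\<close> arrows. The two forms differ by
    \<open>interchange_interchange\<close>.\<close>
  have e: "gen (GammaG a a' (x \<otimes>\<^bsub>B\<^esub> y)) \<cdot>\<^bsub>AB\<^esub> (gen (DeltaG a x y) \<boxtimes>\<^bsub>AB\<^esub> gen (DeltaG a' x y)) =
    gen (DeltaG (a \<otimes>\<^bsub>A\<^esub> a') x y) \<cdot>\<^bsub>AB\<^esub> (gen (GammaG a a' x) \<boxtimes>\<^bsub>AB\<^esub> gen (GammaG a a' y)) \<cdot>\<^bsub>AB\<^esub> ?m"
    using tensor_equation[OF tensor_rel.gamma_delta[OF assms xy]]
    by (simp add: tensT_def AB.tens_simps AB.eval_tm_interchangeT) (simp add: interchangeT_def AB.tens_simps)
  have "gen (GammaG a a' (x \<otimes>\<^bsub>B\<^esub> y)) \<cdot>\<^bsub>AB\<^esub> (gen (DeltaG a x y) \<boxtimes>\<^bsub>AB\<^esub> gen (DeltaG a' x y)) \<cdot>\<^bsub>AB\<^esub> ?n =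
    (gen (GammaG a a' (x \<otimes>\<^bsub>B\<^esub> y)) \<cdot>\<^bsub>AB\<^esub> (gen (DeltaG a x y) \<boxtimes>\<^bsub>AB\<^esub> gen (DeltaG a' x y))) \<cdot>\<^bsub>AB\<^esub> ?n" by simp
  also have "\<dots> = gen (DeltaG (a \<otimes>\<^bsub>A\<^esub> a') x y) \<cdot>\<^bsub>AB\<^esub> (gen (GammaG a a' x) \<boxtimes>\<^bsub>AB\<^esub> gen (GammaG a a' y))"
    unfolding e by (simp add: AB.interchange_interchange)
  finally show "(\<lambda>b\<in>Ob B. gen (GammaG a a' b)) (x \<otimes>\<^bsub>B\<^esub> y) \<cdot>\<^bsub>AB\<^esub> F2 (smf_box B AB (eta_ob A B a) (eta_ob A B a')) x y =
      F2 (eta_ob A B (a \<otimes>\<^bsub>A\<^esub> a')) x y \<cdot>\<^bsub>AB\<^esub> ((\<lambda>b\<in>Ob B. gen (GammaG a a' b)) x \<boxtimes>\<^bsub>AB\<^esub> (\<lambda>b\<in>Ob B. gen (GammaG a a' b)) y)"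
    by simp
qed (simp_all add: smf_eta_ob)

lemma eta_simps [simp]:
  "a \<in> Ob A \<Longrightarrow> FO (eta A B) a = eta_ob A B a"
  "f \<in> Ar A \<Longrightarrow> dm (ihom B AB) (FA (eta A B) f) = eta_ob A B (dm A f)"
  "f \<in> Ar A \<Longrightarrow> cd (ihom B AB) (FA (eta A B) f) = eta_ob A B (cd A f)"
  "f \<in> Ar A \<Longrightarrow> b \<in> Ob B \<Longrightarrow> comp_at (FA (eta A B) f) b = gen (ArOb f b)"
  "dm (ihom B AB) (F0 (eta A B)) = smf_const B AB"
  "cd (ihom B AB) (F0 (eta A B)) = eta_ob A B (unt A)"
  "b \<in> Ob B \<Longrightarrow> comp_at (F0 (eta A B)) b = gen (AlphaG b)"
  "a \<in> Ob A \<Longrightarrow> a' \<in> Ob A \<Longrightarrow> dm (ihom B AB) (F2 (eta A B) a a') = smf_box B AB (eta_ob A B a) (eta_ob A B a')"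
  "a \<in> Ob A \<Longrightarrow> a' \<in> Ob A \<Longrightarrow> cd (ihom B AB) (F2 (eta A B) a a') = eta_ob A B (a \<otimes>\<^bsub>A\<^esub> a')"
  "a \<in> Ob A \<Longrightarrow> a' \<in> Ob A \<Longrightarrow> b \<in> Ob B \<Longrightarrow> comp_at (F2 (eta A B) a a') b = gen (GammaG a a' b)"
  by (simp_all add: eta_def)

lemma eta_ext:
  "FO (eta A B) \<in> extensional (Ob A)" "FA (eta A B) \<in> extensional (Ar A)"
  "F2 (eta A B) \<in> extensional (Ob A)" "a \<in> Ob A \<Longrightarrow> F2 (eta A B) a \<in> extensional (Ob A)"
  by (simp_all add: eta_def)

lemma smf_eta: "SMF A (ihom B AB) (eta A B)"
proof -
  note [simp] = A.symmetric_monoidal_category_axioms B.symmetric_monoidal_category_axioms AB.symmetric_monoidal_category_axioms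
  have [simp]: "FA (eta A B) f \<in> Ar (ihom B AB)" if "f \<in> Ar A" for f
    using mt_eta_arrow[OF that] that by (simp add: eta_def Ar_ihom_triple)
  have [simp]: "F0 (eta A B) \<in> Ar (ihom B AB)"
    using mt_eta_F0 by (simp add: eta_def Ar_ihom_triple)
  have [simp]: "F2 (eta A B) a a' \<in> Ar (ihom B AB)" if "a \<in> Ob A" "a' \<in> Ob A" for a a'
    using mt_eta_F2[OF that] that by (simp add: eta_def Ar_ihom_triple)
  note eq = tensor_equation[OF tensor_rel.right_functor]
  show ?thesis
  proof (rule smf_into_ihomI[OF _ _ _ eta_ext])
    fix b assume b [simp]: "b \<in> Ob B"
    show "comp_at (FA (eta A B) (idt A x)) b = idt AB (FO (FO (eta A B) x) b)" if "x \<in> Ob A" for x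
      using eq[OF b functor_rel.fun_id[of x A]] that by simp
    show "comp_at (FA (eta A B) (g \<cdot>\<^bsub>A\<^esub> f)) b = comp_at (FA (eta A B) g) b \<cdot>\<^bsub>AB\<^esub> comp_at (FA (eta A B) f) b"
      if "f \<in> Ar A" "g \<in> Ar A" "dm A g = cd A f" for f g
      using eq[OF b functor_rel.fun_comp[of f A "dm A f" "cd A f" g "cd A g"]] that by (simp add: hom_iff)
    show "comp_at (F2 (eta A B) (cd A f) (cd A g)) b \<cdot>\<^bsub>AB\<^esub> (comp_at (FA (eta A B) f) b \<boxtimes>\<^bsub>AB\<^esub> comp_at (FA (eta A B) g) b) =
      comp_at (FA (eta A B) (f \<boxtimes>\<^bsub>A\<^esub> g)) b \<cdot>\<^bsub>AB\<^esub> comp_at (F2 (eta A B) (dm A f) (dm A g)) b" if "f \<in> Ar A" "g \<in> Ar A" for f g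
      using eq[OF b functor_rel.fun_nat[of f A "dm A f" "cd A f" g "dm A g" "cd A g"]] that by (simp add: hom_iff tensT_def AB.tens_cmp)
    show "comp_at (FA (eta A B) (ass A x y z)) b \<cdot>\<^bsub>AB\<^esub> comp_at (F2 (eta A B) x (y \<otimes>\<^bsub>A\<^esub> z)) b \<cdot>\<^bsub>AB\<^esub>
        (idt AB (FO (FO (eta A B) x) b) \<boxtimes>\<^bsub>AB\<^esub> comp_at (F2 (eta A B) y z) b) =
      comp_at (F2 (eta A B) (x \<otimes>\<^bsub>A\<^esub> y) z) b \<cdot>\<^bsub>AB\<^esub> (comp_at (F2 (eta A B) x y) b \<boxtimes>\<^bsub>AB\<^esub> idt AB (FO (FO (eta A B) z) b)) \<cdot>\<^bsub>AB\<^esub>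
        ass AB (FO (FO (eta A B) x) b) (FO (FO (eta A B) y) b) (FO (FO (eta A B) z) b)" if "x \<in> Ob A" "y \<in> Ob A" "z \<in> Ob A" for x y z
      using eq[OF b functor_rel.fun_ass[of x A y z]] that by simp
    show "comp_at (FA (eta A B) (runit A x)) b \<cdot>\<^bsub>AB\<^esub> comp_at (F2 (eta A B) x (unt A)) b \<cdot>\<^bsub>AB\<^esub>
        (idt AB (FO (FO (eta A B) x) b) \<boxtimes>\<^bsub>AB\<^esub> comp_at (F0 (eta A B)) b) = runit AB (FO (FO (eta A B) x) b)" if "x \<in> Ob A" for x
      using eq[OF b functor_rel.fun_runit[of x A]] that by simp
    show "comp_at (FA (eta A B) (lunit A x)) b \<cdot>\<^bsub>AB\<^esub> comp_at (F2 (eta A B) (unt A) x) b \<cdot>\<^bsub>AB\<^esub>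
        (comp_at (F0 (eta A B)) b \<boxtimes>\<^bsub>AB\<^esub> idt AB (FO (FO (eta A B) x) b)) = lunit AB (FO (FO (eta A B) x) b)" if "x \<in> Ob A" for x
      using eq[OF b functor_rel.fun_lunit[of x A]] that by simp
    show "comp_at (FA (eta A B) (symm A x y)) b \<cdot>\<^bsub>AB\<^esub> comp_at (F2 (eta A B) x y) b =
        comp_at (F2 (eta A B) y x) b \<cdot>\<^bsub>AB\<^esub> symm AB (FO (FO (eta A B) x) b) (FO (FO (eta A B) y) b)" if "x \<in> Ob A" "y \<in> Ob A" for x y
      using eq[OF b functor_rel.fun_symm[of x A y]] that by simp
  qed (simp_all add: smf_eta_ob)
qed

end

section \<open>The strict functor \<open>En F\<close> out of a tensor\<close>

context ihom_functor begin

sublocale tensor_pair A B ..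

definition En_ob :: "'o \<times> 'p \<Rightarrow> 'q" where
  "En_ob = (\<lambda>(a, b). FO (FO F a) b)"

definition En_gen :: "('o, 'm, 'p, 'n) tgen \<Rightarrow> 'k" where
  "En_gen k = (case k of
        AlphaG b \<Rightarrow> comp_at (F0 F) b
      | BetaG a \<Rightarrow> F0 (FO F a)
      | GammaG a a' b \<Rightarrow> comp_at (F2 F a a') b
      | DeltaG a b b' \<Rightarrow> F2 (FO F a) b b'
      | ObAr a g \<Rightarrow> FA (FO F a) g
      | ArOb f b \<Rightarrow> comp_at (FA F f) b)"

lemma En_eq: "En A B C F = strict_ext (tensor_pres A B) C En_ob En_gen"
  unfolding En_def En_ob_def En_gen_def ..

lemma En_ob_gen_simps [simp]:
  "En_ob (a, b) = FO (FO F a) b"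
  "En_gen (AlphaG b) = comp_at (F0 F) b" "En_gen (BetaG a) = F0 (FO F a)"
  "En_gen (GammaG a a' b) = comp_at (F2 F a a') b" "En_gen (DeltaG a b b') = F2 (FO F a) b b'"
  "En_gen (ObAr a g) = FA (FO F a) g" "En_gen (ArOb f b) = comp_at (FA F f) b"
  by (simp_all add: En_ob_def En_gen_def)

lemma FO_FO_Ob [simp]: "a \<in> Ob A \<Longrightarrow> b \<in> Ob B \<Longrightarrow> FO (FO F a) b \<in> Ob C"
  by (rule smf_FO_Ob[OF FO_smf])

lemma assignment_En: "C.assignment (tensor_pres A B) En_ob En_gen"
proof -
  have "En_gen k \<in> hom C (eval_word C En_ob (tgen_dom A B k)) (eval_word C En_ob (tgen_cod A B k))"
    if "k \<in> agens (tensor_pres A B)" for k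
    using that by (cases k) (simp_all add: hom_iff)
  then show ?thesis by (auto simp: C.assignment_def)
qed

text \<open>If the formal functor data evaluate to an actual functor \<open>G\<close>, every formal
  functor law evaluates to an axiom of \<open>G\<close>. The lemma is generic because it serves both
  families of the tensor, with \<open>G\<close> a value of \<open>F\<close> or a value of its
  dual.\<close>

lemma functor_rel_sound:
  assumes "functor_rel X T u v \<phi>0 \<phi>2 p q"
    and G: "SMF X C G"
    and t: "\<And>p q. eval_tm C En_ob En_gen (T p q) = 
      (eval_tm C En_ob En_gen p \<boxtimes>\<^bsub>C\<^esub> idt C (eval_word C En_ob (tcod (tgen_cod A B) q))) \<cdot>\<^bsub>C\<^esub> (idt C (eval_word C En_ob (tdom (tgen_dom A B) p)) \<boxtimes>\<^bsub>C\<^esub> eval_tm C En_ob En_gen q)"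
    and d: "\<And>f. f \<in> Ar X \<Longrightarrow> tdom (tgen_dom A B) (v f) = u (dm X f)" "\<And>f. f \<in> Ar X \<Longrightarrow> tcod (tgen_cod A B) (v f) = u (cd X f)"
    and e: "\<And>x. x \<in> Ob X \<Longrightarrow> eval_word C En_ob (u x) = FO G x"
      "\<And>f. f \<in> Ar X \<Longrightarrow> eval_tm C En_ob En_gen (v f) = FA G f"
      "eval_tm C En_ob En_gen \<phi>0 = F0 G"
      "\<And>x y. x \<in> Ob X \<Longrightarrow> y \<in> Ob X \<Longrightarrow> eval_tm C En_ob En_gen (\<phi>2 x y) = F2 G x y"
  shows "eval_tm C En_ob En_gen p = eval_tm C En_ob En_gen q"
proof -
  interpret G: symmetric_monoidal_functor X C G by fact
  show ?thesis
    using assms(1)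
    by cases (auto simp: hom_iff t d e C.tens_cmp G.F2_natural G.F2_ass G.F2_runit G.F2_lunit G.F2_symm)
qed

text \<open>The relations of the tensor are the axioms of a functor into \<open>[B, C]\<close>,
  unfolded. Those that concern the first variable, or compare \<open>beta\<close> and
  \<open>delta\<close> along it, are read off from the dual of \<open>F\<close>.\<close>

lemma sound_En:
  assumes "tensor_rel A B p q" "wt p" "wt q"
  shows "eval_tm C En_ob En_gen p = eval_tm C En_ob En_gen q"
proof -
  have t: "eval_tm C En_ob En_gen (tensT (tgen_dom A B) (tgen_cod A B) p q) = 
      (eval_tm C En_ob En_gen p \<boxtimes>\<^bsub>C\<^esub> idt C (eval_word C En_ob (tcod (tgen_cod A B) q))) \<cdot>\<^bsub>C\<^esub> (idt C (eval_word C En_ob (tdom (tgen_dom A B) p)) \<boxtimes>\<^bsub>C\<^esub> eval_tm C En_ob En_gen q)" for p q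
    by (simp add: tensT_def)
  show ?thesis using assms
  proof cases
    case (left_functor a)
    show ?thesis
      by (rule functor_rel_sound[OF left_functor(2), of "FO F a"]) (use left_functor(1) in \<open>simp_all add: t\<close>)
  next
    case (right_functor b)
    show ?thesis
      by (rule functor_rel_sound[OF right_functor(2), of "dual_ob A F b"]) (use right_functor(1) in \<open>simp_all add: t smf_dual_ob\<close>)
  next
    case (transf_nat f a a' g b b')
    then show ?thesis
      using comp_at_natural(1)[OF FA_typing(1), of f g] by (auto simp: hom_iff)
  next
    case (left_transf_unit f a a')
    then show ?thesis
      using comp_at_natural(2)[OF FA_typing(1), of f] by (auto simp: hom_iff)
  next
    case (left_transf_tens f a a' b b')
    then show ?thesis
      using comp_at_natural(3)[OF FA_typing(1), of f b b'] by (auto simp: hom_iff t C.tens_cmp)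
  next
    case (right_transf_unit g b b')
    then show ?thesis
      using comp_at_natural(1)[OF F0_typing(1), of g] by (auto simp: hom_iff)
  next
    case (right_transf_tens g b b' a a')
    then show ?thesis
      using comp_at_natural(1)[OF F2_typing(1), of a a' g] by (auto simp: hom_iff t C.tens_cmp)
  next
    case (alpha_tens b b')
    then show ?thesis
      using comp_at_natural(3)[OF F0_typing(1), of b b'] by (simp add: t C.tens_cmp)
  next
    case (beta_tens a a')
    then show ?thesis
      using monoidal_transformation.tr_tens[OF mt_dual_F0, of a a'] by (simp add: t C.tens_cmp)
  next
    case beta_alpha
    then show ?thesis
      using comp_at_natural(2)[OF F0_typing(1)] by simp
  next
    case (gamma_delta a a' b b')
    then show ?thesis
      using monoidal_transformation.tr_tens[OF mt_dual_F2, of b b' a a'] by (simp add: t C.tens_cmp C.tens_cmp_extend C.eval_tm_interchangeT)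
  qed
qed

sublocale En: sound_assignment "tensor_pres A B" C En_ob En_gen
  by unfold_locales (use assignment_En sound_En in auto)

lemma smf_En: "SMF AB C (En A B C F)" and strict_En: "strict AB C (En A B C F)"
  using En.smf_strict_ext En.strict_strict_ext by (simp_all add: En_eq tensor_def)

lemma En_simps [simp]:
  "X \<in> words (tensor_pres A B) \<Longrightarrow> FO (En A B C F) X = eval_word C En_ob X"
  "k \<in> agens (tensor_pres A B) \<Longrightarrow> FA (En A B C F) (gen k) = En_gen k"
  using En.strict_ext_simps by (simp_all add: En_eq gen_arrow_def)

end

section \<open>Transposition and the comparison 2-cell\<close>

lemma (in tensor_pair) Rn_is_ihom_functor:
  assumes "SMF AB C F"
  shows "ihom_functor A B C (Rn A B C F)"
  unfolding Rn_def
  by (rule ihom_functorI[OF smf_comp[OF smf_eta smf_post[OF _ assms]]])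
    (use assms B.symmetric_monoidal_category_axioms in \<open>auto dest: smf_target\<close>)

lemma (in tensor_pair) Rn_simps [simp]:
  assumes "SMF AB C F"
  shows "a \<in> Ob A \<Longrightarrow> FO (Rn A B C F) a = smf_comp B C F (eta_ob A B a)"
    "f \<in> Ar A \<Longrightarrow> b \<in> Ob B \<Longrightarrow> comp_at (FA (Rn A B C F) f) b = FA F (gen (ArOb f b))"
    "b \<in> Ob B \<Longrightarrow> comp_at (F0 (Rn A B C F)) b = FA F (gen (AlphaG b)) \<cdot>\<^bsub>C\<^esub> F0 F"
    "a \<in> Ob A \<Longrightarrow> a' \<in> Ob A \<Longrightarrow> b \<in> Ob B \<Longrightarrow> comp_at (F2 (Rn A B C F) a a') b = FA F (gen (GammaG a a' b)) \<cdot>\<^bsub>C\<^esub> F2 F (GenW (a, b)) (GenW (a', b))"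
proof -
  interpret F: symmetric_monoidal_functor AB C F by fact
  interpret eta: symmetric_monoidal_functor A "ihom B AB" "eta A B" by (rule smf_eta)
  show "a \<in> Ob A \<Longrightarrow> FO (Rn A B C F) a = smf_comp B C F (eta_ob A B a)"
    "f \<in> Ar A \<Longrightarrow> b \<in> Ob B \<Longrightarrow> comp_at (FA (Rn A B C F) f) b = FA F (gen (ArOb f b))"
    "b \<in> Ob B \<Longrightarrow> comp_at (F0 (Rn A B C F)) b = FA F (gen (AlphaG b)) \<cdot>\<^bsub>C\<^esub> F0 F"
    "a \<in> Ob A \<Longrightarrow> a' \<in> Ob A \<Longrightarrow> b \<in> Ob B \<Longrightarrow> comp_at (F2 (Rn A B C F) a a') b = FA F (gen (GammaG a a' b)) \<cdot>\<^bsub>C\<^esub> F2 F (GenW (a, b)) (GenW (a', b))"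
    by (simp_all add: Rn_def smf_eta_ob)
qed

text \<open>Strictness of \<open>En A B C F\<close> erases the structure arrows added by composition
  with \<open>eta\<close>, and the values on generators are the data of \<open>F\<close>. Hence an
  equality and not only a 2-cell.\<close>

lemma (in ihom_functor) Rn_En: "Rn A B C (En A B C F) = F"
proof -
  interpret E: symmetric_monoidal_functor AB C "En A B C F" by (rule smf_En)
  interpret R: ihom_functor A B C "Rn A B C (En A B C F)" by (rule Rn_is_ihom_functor[OF smf_En])
  note [simp] = Rn_simps[OF smf_En] strictD[OF strict_En]
  have o: "smf_comp B C (En A B C F) (eta_ob A B a) = FO F a" if "a \<in> Ob A" for a
  proof -
    interpret G: symmetric_monoidal_functor B C "FO F a" using that by simp
    show ?thesis
      by (rule smf_eqI[OF smf_comp[OF smf_eta_ob[OF that] smf_En] FO_smf[OF that]]) (use that in simp_all)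
  qed
  show ?thesis
    by (rule smf_ihom_eqI[OF R.symmetric_monoidal_functor_axioms symmetric_monoidal_functor_axioms]) (simp_all add: o)
qed

context tensor_pair begin

lemma eps_comp_eq_lax_comp:
  assumes "SMF AB C F"
  shows "eps_comp C F X = symmetric_monoidal_functor.lax_comp AB C F GenW (\<lambda>g. idt C (FO F (GenW g))) X"
proof -
  interpret F: symmetric_monoidal_functor AB C F by fact
  show ?thesis by (induction X) simp_all
qed

text \<open>An instance of \<open>mt_strict_ext\<close> with identities on object generators. The
  squares at arrow generators commute because \<open>Rn\<close> has already composed each generator
  with \<open>F0\<close> or \<open>F2\<close> where its source is the unit or a tensor.\<close>

lemma mt_eps:
  assumes "SMF AB C F"
  shows "MT AB C (En A B C (Rn A B C F)) F (\<lambda>X\<in>Ob AB. eps_comp C F X)"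
proof -
  interpret F: symmetric_monoidal_functor AB C F by fact
  interpret R: ihom_functor A B C "Rn A B C F" by (rule Rn_is_ihom_functor[OF assms])
  note [simp] = Rn_simps[OF assms] smf_eta_ob
  let ?t = "\<lambda>g. idt C (FO F (GenW g))"
  have n: "F.lax_comp GenW ?t (tgen_cod A B k) \<cdot>\<^bsub>C\<^esub> R.En_gen k = FA F (gen k) \<cdot>\<^bsub>C\<^esub> F.lax_comp GenW ?t (tgen_dom A B k)"
    if "k \<in> agens (tensor_pres A B)" for k
    using that by (cases k) simp_all
  have "MT AB C (En A B C (Rn A B C F)) F (\<lambda>X\<in>Ob AB. F.lax_comp GenW ?t X)"
    unfolding R.En_eq tensor_simps unfolding tensor_def
    by (rule R.En.mt_strict_ext) (use n assms in \<open>auto simp: tensor_def gen_arrow_def\<close>)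
  then show ?thesis using eps_comp_eq_lax_comp[OF assms] by simp
qed

lemma mt_En:
  assumes "MT A (ihom B C) F G \<sigma>" "SMC C"
  shows "MT AB C (En A B C F) (En A B C G) (\<lambda>X\<in>Ob AB. En_comp C (F, G, \<sigma>) X)"
proof -
  interpret s: monoidal_transformation A "ihom B C" F G \<sigma> by fact
  interpret F: ihom_functor A B C F
    by (rule ihom_functorI[OF s.source.symmetric_monoidal_functor_axioms B.symmetric_monoidal_category_axioms assms(2)])
  interpret G: ihom_functor A B C G
    by (rule ihom_functorI[OF s.target.symmetric_monoidal_functor_axioms B.symmetric_monoidal_category_axioms assms(2)])
  interpret E: symmetric_monoidal_functor AB C "En A B C G" by (rule G.smf_En)
  note [simp] = strictD[OF G.strict_En]
  let ?t = "\<lambda>(a, b). comp_at (\<sigma> a) b"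
  have st [simp]: "comp_at (\<sigma> a) b \<in> Ar C" "dm C (comp_at (\<sigma> a) b) = FO (FO F a) b" "cd C (comp_at (\<sigma> a) b) = FO (FO G a) b"
    if "a \<in> Ob A" "b \<in> Ob B" for a b
    using ihom_arrow(3-5)[OF s.tr_typing(1)[OF that(1)], of b] that by simp_all
  \<comment> \<open>Generators \<open>beta\<close>, \<open>delta\<close> and
    \<open>a \<otimes> g\<close> are covered by the components of \<open>\<sigma>\<close> as
    transformations in \<open>b\<close>; the other three need the components as transformations in
    \<open>a\<close>, that is, the dual of \<open>\<sigma>\<close>.\<close>
  interpret D: monoidal_transformation B "ihom A C" "dual A B C F" "dual A B C G" "\<lambda>b\<in>Ob B. (dual_ob A F b, dual_ob A G b, \<lambda>a\<in>Ob A. comp_at (\<sigma> a) b)"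
    by (rule mt_dual[OF assms(1) B.symmetric_monoidal_category_axioms assms(2)])
  have n: "E.lax_comp GenW ?t (tgen_cod A B k) \<cdot>\<^bsub>C\<^esub> F.En_gen k = FA (En A B C G) (gen k) \<cdot>\<^bsub>C\<^esub> E.lax_comp GenW ?t (tgen_dom A B k)"
    if "k \<in> agens (tensor_pres A B)" for k
  proof (cases k)
    case (AlphaG b)
    then show ?thesis using that comp_at_natural(2)[OF D.tr_typing(1), of b] by simp
  next
    case (BetaG a)
    then show ?thesis using that comp_at_natural(2)[OF s.tr_typing(1), of a] by simp
  next
    case (GammaG a a' b)
    then show ?thesis using that comp_at_natural(3)[OF D.tr_typing(1), of b a a'] by simp
  next
    case (DeltaG a b b')
    then show ?thesis using that comp_at_natural(3)[OF s.tr_typing(1), of a b b'] by simp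
  next
    case (ObAr a g)
    then show ?thesis using that comp_at_natural(1)[OF s.tr_typing(1), of a g] by simp
  next
    case (ArOb f b)
    then show ?thesis using that comp_at_natural(1)[OF D.tr_typing(1), of b f] by simp
  qed
  have t: "?t g \<in> Ar C \<and> dm C (?t g) = F.En_ob g \<and> cd C (?t g) = FO (En A B C G) (GenW g)" if "g \<in> ogens (tensor_pres A B)" for g
    using that by auto
  have "MT AB C (En A B C F) (En A B C G) (\<lambda>X\<in>Ob AB. E.lax_comp GenW ?t X)"
    unfolding F.En_eq tensor_simps unfolding tensor_def
    by (rule F.En.mt_strict_ext) (use n G.smf_En t in \<open>auto simp: tensor_def gen_arrow_def\<close>)
  \<comment> \<open>As \<open>En A B C G\<close> is strict, the factors \<open>F2\<close> in
    \<open>lax_comp\<close> are identities, and what remains is the recursion of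
    \<open>En_comp\<close>.\<close>
  moreover have "E.lax_comp GenW ?t X = En_comp C (F, G, \<sigma>) X \<and> E.lax_comp GenW ?t X \<in> Ar C \<and> cd C (E.lax_comp GenW ?t X) = eval_word C G.En_ob X"
    if "X \<in> words (tensor_pres A B)" for X
    using that by (induction X) (auto simp: F.C.eval_word_Ob[OF G.assignment_En])
  ultimately show ?thesis by (simp cong: restrict_cong)
qed

lemma mt_Rn:
  assumes "MT AB C F G \<sigma>"
  shows "MT A (ihom B C) (Rn A B C F) (Rn A B C G)
    (\<lambda>a\<in>Ob A. (smf_comp B C F (eta_ob A B a), smf_comp B C G (eta_ob A B a), \<lambda>b\<in>Ob B. \<sigma> (GenW (a, b))))"
  unfolding Rn_def
  using mt_whisker_right[OF mt_post[OF B.symmetric_monoidal_category_axioms assms] smf_eta]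
  by (simp add: smf_eta_ob cong: restrict_cong)

end

context tensor_pair begin

text \<open>The main tool for 2-cells out of a tensor: if the source is strong, they are compared at
  the words \<open>a \<otimes> b\<close> only, where \<open>eps\<close> and its inverses are
  identities.\<close>

lemma tensor_arrow_eqI:
  assumes "\<theta> \<in> Ar (ihom AB C)" "\<theta>' \<in> Ar (ihom AB C)"
    "dm (ihom AB C) \<theta> = dm (ihom AB C) \<theta>'" "cd (ihom AB C) \<theta> = cd (ihom AB C) \<theta>'" "strong AB C (dm (ihom AB C) \<theta>)"
    and g: "\<And>a b. a \<in> Ob A \<Longrightarrow> b \<in> Ob B \<Longrightarrow> comp_at \<theta> (GenW (a, b)) = comp_at \<theta>' (GenW (a, b))"
  shows "\<theta> = \<theta>'"
proof -
  have "comp_at \<theta> = comp_at \<theta>'"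
    using mt_unique[of C "dm (ihom AB C) \<theta>" "cd (ihom AB C) \<theta>" "comp_at \<theta>" "comp_at \<theta>'"] assms
    unfolding Ar_ihom tensor_def by auto
  then show ?thesis using ihom_eqI[OF assms(1-4)] by simp
qed

text \<open>Together with \<open>Rn_En\<close> this makes \<open>En (F \<box> G)\<close> the source
  of \<open>eps\<close> at \<open>En F \<box> En G\<close>, so that the inverse of that arrow has
  the type of a structure arrow for \<open>En_functor\<close>.\<close>

lemma Rn_box:
  assumes "SMF AB C F" "SMF AB C G"
  shows "Rn A B C (smf_box AB C F G) = smf_box A (ihom B C) (Rn A B C F) (Rn A B C G)"
  using smf_comp_box[OF smf_eta smf_post[OF _ assms(1)] smf_post[OF _ assms(2)]] post_box[OF B.symmetric_monoidal_category_axioms assms] B.symmetric_monoidal_category_axioms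
  by (simp add: Rn_def)

lemma Rn_const:
  assumes "SMC C"
  shows "Rn A B C (smf_const AB C) = smf_const A (ihom B C)"
  using smf_comp_const[OF smf_eta, of "ihom B C"] post_const[OF B.symmetric_monoidal_category_axioms AB.symmetric_monoidal_category_axioms assms]
    assms B.symmetric_monoidal_category_axioms
  by (simp add: Rn_def)

lemma eps_arrow [simp]:
  assumes "SMF AB C F"
  shows "eps A B C F \<in> Ar (ihom AB C)" "dm (ihom AB C) (eps A B C F) = En A B C (Rn A B C F)" "cd (ihom AB C) (eps A B C F) = F"
    "a \<in> Ob A \<Longrightarrow> b \<in> Ob B \<Longrightarrow> comp_at (eps A B C F) (GenW (a, b)) = idt C (FO F (GenW (a, b)))"
  using mt_eps[OF assms] by (simp_all add: eps_def Ar_ihom_triple)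

text \<open>The components are composites of \<open>F0\<close>, \<open>F2\<close> and tensors of
  earlier components, all invertible for strong \<open>F\<close>.\<close>

lemma iso_eps:
  assumes "SMF AB C F" "strong AB C F"
  shows "iso (ihom AB C) (eps A B C F)"
proof (rule iso_ihomI)
  interpret F: symmetric_monoidal_functor AB C F by fact
  fix X assume X: "X \<in> Ob AB"
  then have "iso C (eps_comp C F X) \<and> cd C (eps_comp C F X) = FO F X"
    by (induction X) (use assms(2) F.F0_typing(3) F.F2_typing(3) in \<open>auto simp: strong_def F.target.iso_Ar simp del: F.F0_typing F.F2_typing(3)\<close>)
  then show "iso C (comp_at (eps A B C F) X)" using X by (simp add: eps_def)
qed (simp add: assms)

end

section \<open>\<open>En\<close> as a functor between internal homs\<close>

locale tensor_triple = tensor_pair A B + C: symmetric_monoidal_category C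
  for A :: "('o, 'm) smc" and B :: "('p, 'n) smc" and C :: "('q, 'k) smc"
begin

lemma smcs [simp]: "SMC A" "SMC B" "SMC C" "SMC AB"
  by (rule A.symmetric_monoidal_category_axioms B.symmetric_monoidal_category_axioms
    C.symmetric_monoidal_category_axioms AB.symmetric_monoidal_category_axioms)+

lemma ihom_functor: "SMF A (ihom B C) F \<Longrightarrow> ihom_functor A B C F"
  by (simp add: ihom_functorI)

lemmas SMF_En [simp] = ihom_functor.smf_En[OF ihom_functor]
  and strict_En [simp] = ihom_functor.strict_En[OF ihom_functor]
  and Rn_En [simp] = ihom_functor.Rn_En[OF ihom_functor]

lemma strong_En [simp]: "SMF A (ihom B C) F \<Longrightarrow> strong AB C (En A B C F)"
  by (rule strict_strong) simp_all

lemma FO_En_GenW [simp]: "SMF A (ihom B C) F \<Longrightarrow> a \<in> Ob A \<Longrightarrow> b \<in> Ob B \<Longrightarrow> FO (En A B C F) (GenW (a, b)) = FO (FO F a) b"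
  by (simp add: ihom_functor.En_simps[OF ihom_functor] ihom_functor.En_ob_gen_simps[OF ihom_functor])

sublocale BC: symmetric_monoidal_category "ihom B C" by (rule smc_ihom) simp_all
sublocale A_BC: symmetric_monoidal_category "ihom A (ihom B C)" by (rule smc_ihom) simp_all
sublocale AB_C: symmetric_monoidal_category "ihom AB C" by (rule smc_ihom) simp_all

lemma En_functor_FA:
  assumes "\<sigma> \<in> Ar (ihom A (ihom B C))"
  shows "FA (En_functor A B C) \<sigma> \<in> Ar (ihom AB C)"
    "dm (ihom AB C) (FA (En_functor A B C) \<sigma>) = En A B C (dm (ihom A (ihom B C)) \<sigma>)"
    "cd (ihom AB C) (FA (En_functor A B C) \<sigma>) = En A B C (cd (ihom A (ihom B C)) \<sigma>)"
    "a \<in> Ob A \<Longrightarrow> b \<in> Ob B \<Longrightarrow> comp_at (FA (En_functor A B C) \<sigma>) (GenW (a, b)) = comp_at (comp_at \<sigma> a) b"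
proof -
  have "MT AB C (En A B C (dm (ihom A (ihom B C)) \<sigma>)) (En A B C (cd (ihom A (ihom B C)) \<sigma>)) (\<lambda>X\<in>Ob AB. En_comp C \<sigma> X)"
    using mt_En[of C "dm (ihom A (ihom B C)) \<sigma>" "cd (ihom A (ihom B C)) \<sigma>" "comp_at \<sigma>"] assms
      ihom_triple[of \<sigma> A "ihom B C"] by (simp add: Ar_ihom del: tensor_simps)
  then show "FA (En_functor A B C) \<sigma> \<in> Ar (ihom AB C)"
    using assms by (simp add: En_functor_def Ar_ihom_triple del: tensor_simps)
qed (use assms in \<open>simp_all add: En_functor_def\<close>)

lemma En_functor_ext:
  "FO (En_functor A B C) \<in> extensional (Ob (ihom A (ihom B C)))" "FA (En_functor A B C) \<in> extensional (Ar (ihom A (ihom B C)))"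
  "F2 (En_functor A B C) \<in> extensional (Ob (ihom A (ihom B C)))"
  "H \<in> Ob (ihom A (ihom B C)) \<Longrightarrow> F2 (En_functor A B C) H \<in> extensional (Ob (ihom A (ihom B C)))"
  by (simp_all add: En_functor_def del: ihom_simps)

lemma En_functor_simps:
  "SMF A (ihom B C) F \<Longrightarrow> FO (En_functor A B C) F = En A B C F"
  "F0 (En_functor A B C) = inverse_of (ihom AB C) (eps A B C (smf_const AB C))"
  "SMF A (ihom B C) F \<Longrightarrow> SMF A (ihom B C) G \<Longrightarrow> F2 (En_functor A B C) F G =
     inverse_of (ihom AB C) (eps A B C (smf_box AB C (En A B C F) (En A B C G)))"
  by (simp_all add: En_functor_def)

text \<open>Every axiom is an equation between 2-cells out of \<open>A \<otimes> B\<close> whose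
  source is strong. By \<open>tensor_arrow_eqI\<close> it suffices to look at generators, where the
  structure arrows vanish.\<close>

lemma smf_En_functor: "SMF (ihom A (ihom B C)) (ihom AB C) (En_functor A B C)"
proof -
  note [simp] = En_functor_FA En_functor_simps iso_eps strong_box strong_const Rn_box Rn_const
  have [simp]: "comp_at (comp_at \<sigma> a) b \<in> Ar C"
    "dm C (comp_at (comp_at \<sigma> a) b) = FO (FO (dm (ihom A (ihom B C)) \<sigma>) a) b"
    "cd C (comp_at (comp_at \<sigma> a) b) = FO (FO (cd (ihom A (ihom B C)) \<sigma>) a) b"
    if "\<sigma> \<in> Ar (ihom A (ihom B C))" "a \<in> Ob A" "b \<in> Ob B" for \<sigma> a b
    using ihom_arrow(3-5)[OF ihom_arrow(3)[OF that(1,2)], of b] that by simp_all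
  have [simp]: "FO (FO F a) b \<in> Ob C" if "SMF A (ihom B C) F" "a \<in> Ob A" "b \<in> Ob B" for F a b
    using smf_FO_Ob[OF that(1,2)] that(3) by simp
  show ?thesis
    by (rule smfI[OF _ _ En_functor_ext]; (rule tensor_arrow_eqI[where C=C])?) simp_all
qed

end

section \<open>Transposition modulo 2-cells\<close>

lemma sim_smf: "(F, G) \<in> sim A B \<Longrightarrow> SMF A B F \<and> SMF A B G"
  by (simp add: sim_def)

lemma sim_refl: "SMF A B F \<Longrightarrow> (F, F) \<in> sim A B"
  by (simp add: sim_def)

lemma sim_sym: "(F, G) \<in> sim A B \<Longrightarrow> (G, F) \<in> sim A B"
proof -
  have "sym (two_cells A B \<union> (two_cells A B)\<inverse>)" by (auto simp: sym_def)
  then show "(F, G) \<in> sim A B \<Longrightarrow> (G, F) \<in> sim A B"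
    using symD[OF sym_rtrancl] by (auto simp: sim_def)
qed

lemma sim_trans: "(F, G) \<in> sim A B \<Longrightarrow> (G, H) \<in> sim A B \<Longrightarrow> (F, H) \<in> sim A B"
  by (auto simp: sim_def)

lemma mt_sim: "MT A B F G \<sigma> \<Longrightarrow> (F, G) \<in> sim A B"
  by (auto simp: sim_def two_cells_def dest: mt_smf)

text \<open>An operation on functors that sends a 2-cell to related functors respects the generated
  equivalence, by induction along the zigzag. The congruence properties of \<open>\<sim>\<close>
  used below are obtained from this.\<close>

lemma sim_map:
  assumes h: "\<And>F G \<sigma>. MT A B F G \<sigma> \<Longrightarrow> (f F, f G) \<in> sim A' B'"
    and s: "\<And>F. SMF A B F \<Longrightarrow> SMF A' B' (f F)"
    and e: "(F, G) \<in> sim A B"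
  shows "(f F, f G) \<in> sim A' B'"
proof -
  have "SMF A B F" "(F, G) \<in> (two_cells A B \<union> (two_cells A B)\<inverse>)\<^sup>*" using e by (auto simp: sim_def)
  from this(2,1) show ?thesis
  proof (induction rule: rtrancl_induct)
    case base
    then show ?case by (simp add: sim_refl s)
  next
    case (step G H)
    have "(f G, f H) \<in> sim A' B'"
      using step(2) h[of G H] sim_sym[OF h[of H G]] by (auto simp: two_cells_def)
    then show ?case using step sim_trans by blast
  qed
qed

lemma sim_comp_left:
  assumes "(F, F') \<in> sim A B" "SMF B C G"
  shows "(smf_comp A C G F, smf_comp A C G F') \<in> sim A C"
  by (rule sim_map[OF _ _ assms(1)]) (use mt_whisker_left mt_sim smf_comp assms(2) in blast)+

lemma sim_comp_right:
  assumes "(G, G') \<in> sim B C" "SMF A B F"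
  shows "(smf_comp A C G F, smf_comp A C G' F) \<in> sim A C"
  by (rule sim_map[where f="\<lambda>G. smf_comp A C G F", OF _ _ assms(1)]) (use mt_whisker_right mt_sim smf_comp assms(2) in blast)+

lemma sim_comp:
  assumes "(F, F') \<in> sim A B" "(G, G') \<in> sim B C"
  shows "(smf_comp A C G F, smf_comp A C G' F') \<in> sim A C"
proof -
  have "SMF B C G" "SMF A B F'" using sim_smf assms by blast+
  then show ?thesis
    using sim_trans[OF sim_comp_left[OF assms(1)] sim_comp_right[OF assms(2)]] by blast
qed

lemma sim_post: "SMC A \<Longrightarrow> (F, G) \<in> sim B C \<Longrightarrow> (post A B C F, post A B C G) \<in> sim (ihom A B) (ihom A C)"
  by (rule sim_map[of B C]) (blast intro: mt_sim mt_post smf_post)+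

lemma sim_pre: "SMC B \<Longrightarrow> (F, G) \<in> sim C A \<Longrightarrow> (pre C A B F, pre C A B G) \<in> sim (ihom A B) (ihom C B)"
  by (rule sim_map[of C A]) (blast intro: mt_sim mt_pre smf_pre)+

lemma sim_dual: "SMC B \<Longrightarrow> SMC C \<Longrightarrow> (F, G) \<in> sim A (ihom B C) \<Longrightarrow> (dual A B C F, dual A B C G) \<in> sim B (ihom A C)"
  by (rule sim_map[of A "ihom B C"]) (blast intro: mt_sim mt_dual ihom_functor.smf_dual ihom_functorI)+

context tensor_pair begin

lemma smf_Rn: "SMF AB C F \<Longrightarrow> SMF A (ihom B C) (Rn A B C F)"
  using Rn_is_ihom_functor[of C F] by (simp add: ihom_functor_def)

lemma sim_Rn: "(F, G) \<in> sim AB C \<Longrightarrow> (Rn A B C F, Rn A B C G) \<in> sim A (ihom B C)"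
  by (rule sim_map[of AB C]) (blast intro: mt_sim mt_Rn smf_Rn)+

lemma sim_eps: "SMF AB C F \<Longrightarrow> (En A B C (Rn A B C F), F) \<in> sim AB C"
  by (rule mt_sim[OF mt_eps])

lemma Rn_comp:
  assumes "SMF AB C F" "SMF C D K"
  shows "Rn A B D (smf_comp AB D K F) = smf_comp A (ihom B D) (post B C D K) (Rn A B C F)"
  unfolding Rn_def post_comp[OF B.symmetric_monoidal_category_axioms assms]
  by (rule smf_comp_assoc[OF smf_eta smf_post[OF B.symmetric_monoidal_category_axioms assms(1)] smf_post[OF B.symmetric_monoidal_category_axioms assms(2)], symmetric])

lemma Rn_id: "Rn A B AB (smf_id AB) = eta A B"
  using post_id[OF B.symmetric_monoidal_category_axioms AB.symmetric_monoidal_category_axioms] smf_comp_id(2)[OF smf_eta]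
  by (simp add: Rn_def)

end

context tensor_triple begin

lemma sim_En: "(F, G) \<in> sim A (ihom B C) \<Longrightarrow> (En A B C F, En A B C G) \<in> sim AB C"
proof (rule sim_map[of A "ihom B C"])
  show "(En A B C F, En A B C G) \<in> sim AB C" if "MT A (ihom B C) F G \<sigma>" for F G \<sigma>
    using mt_sim[OF mt_En[OF that]] by simp
qed simp_all

text \<open>Both functors are linked by \<open>eps\<close> to \<open>En\<close> of their transposes,
  and \<open>En\<close> respects \<open>\<sim>\<close>. The resulting zigzag contains 2-cells in
  opposite directions, which is why only the quotient sees the injectivity.\<close>

lemma Rn_cancel:
  assumes "SMF AB C F" "SMF AB C G" "(Rn A B C F, Rn A B C G) \<in> sim A (ihom B C)"
  shows "(F, G) \<in> sim AB C"
  using sim_trans[OF sim_sym[OF sim_eps[OF assms(1)]] sim_trans[OF sim_En[OF assms(3)] sim_eps[OF assms(2)]]] .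

end

text \<open>Transposition sends \<open>F\<close> to \<open>[B, F] \<circ> eta\<close>. Composing the
  two internal functors for these operations, instead of listing components, gives functoriality and
  strictness at once.\<close>

definition Rn_functor where
  "Rn_functor A B C = smf_comp (ihom (tensor A B) C) (ihom A (ihom B C))
     (pre A (ihom B (tensor A B)) (ihom B C) (eta A B)) (post_functor B (tensor A B) C)"

context tensor_triple begin

lemma smf_Rn_functor: "SMF (ihom AB C) (ihom A (ihom B C)) (Rn_functor A B C)"
  and strict_Rn_functor: "strict (ihom AB C) (ihom A (ihom B C)) (Rn_functor A B C)"
  unfolding Rn_functor_def
  using smf_comp[OF smf_post_functor[of B AB C] smf_pre[of "ihom B C", OF _ smf_eta]]
    strict_comp[OF smf_post_functor[of B AB C] smf_pre[of "ihom B C", OF _ smf_eta] strict_post_functor strict_pre]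
  by (simp_all del: tensor_simps)

lemma Rn_functor_simps [simp]:
  "SMF AB C F \<Longrightarrow> FO (Rn_functor A B C) F = Rn A B C F"
  "\<theta> \<in> Ar (ihom AB C) \<Longrightarrow> a \<in> Ob A \<Longrightarrow> b \<in> Ob B \<Longrightarrow> comp_at (comp_at (FA (Rn_functor A B C) \<theta>) a) b = comp_at \<theta> (GenW (a, b))"
proof -
  interpret P: symmetric_monoidal_functor "ihom AB C" "ihom (ihom B AB) (ihom B C)" "post_functor B AB C"
    by (rule smf_post_functor) simp_all
  show "SMF AB C F \<Longrightarrow> FO (Rn_functor A B C) F = Rn A B C F"
    by (simp add: Rn_functor_def Rn_def smf_post del: tensor_simps)
  show "\<theta> \<in> Ar (ihom AB C) \<Longrightarrow> a \<in> Ob A \<Longrightarrow> b \<in> Ob B \<Longrightarrow> comp_at (comp_at (FA (Rn_functor A B C) \<theta>) a) b = comp_at \<theta> (GenW (a, b))"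
    by (simp add: Rn_functor_def smf_eta_ob)
qed

lemma Rn_functor_FA:
  assumes "\<theta> \<in> Ar (ihom AB C)"
  shows "FA (Rn_functor A B C) \<theta> \<in> Ar (ihom A (ihom B C))"
    "dm (ihom A (ihom B C)) (FA (Rn_functor A B C) \<theta>) = Rn A B C (dm (ihom AB C) \<theta>)"
    "cd (ihom A (ihom B C)) (FA (Rn_functor A B C) \<theta>) = Rn A B C (cd (ihom AB C) \<theta>)"
  using symmetric_monoidal_functor.FA_typing[OF smf_Rn_functor assms] assms by simp_all

lemma ihom_ihom_eqI:
  assumes "\<sigma> \<in> Ar (ihom A (ihom B C))" "\<tau> \<in> Ar (ihom A (ihom B C))"
    "dm (ihom A (ihom B C)) \<sigma> = dm (ihom A (ihom B C)) \<tau>" "cd (ihom A (ihom B C)) \<sigma> = cd (ihom A (ihom B C)) \<tau>"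
    and "\<And>a b. a \<in> Ob A \<Longrightarrow> b \<in> Ob B \<Longrightarrow> comp_at (comp_at \<sigma> a) b = comp_at (comp_at \<tau> a) b"
  shows "\<sigma> = \<tau>"
proof (rule ihom_eqI[OF assms(1-4)])
  fix a assume "a \<in> Ob A"
  then show "comp_at \<sigma> a = comp_at \<tau> a"
    using ihom_arrow(3-5)[OF assms(1), of a] ihom_arrow(3-5)[OF assms(2), of a] assms(3-5)
    by (intro ihom_eqI[where A=B and B=C]) simp_all
qed

text \<open>An equality, because arrows of \<open>[A, [B, C]]\<close> are compared at pairs
  \<open>(a, b)\<close>, and there \<open>En_functor\<close> adds only identities.\<close>

lemma Rn_functor_En_functor:
  "smf_comp (ihom A (ihom B C)) (ihom A (ihom B C)) (Rn_functor A B C) (En_functor A B C) = smf_id (ihom A (ihom B C))"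
proof -
  interpret R: symmetric_monoidal_functor "ihom AB C" "ihom A (ihom B C)" "Rn_functor A B C" by (rule smf_Rn_functor)
  interpret E: symmetric_monoidal_functor "ihom A (ihom B C)" "ihom AB C" "En_functor A B C" by (rule smf_En_functor)
  interpret RE: symmetric_monoidal_functor "ihom A (ihom B C)" "ihom A (ihom B C)" "smf_comp (ihom A (ihom B C)) (ihom A (ihom B C)) (Rn_functor A B C) (En_functor A B C)"
    by (rule smf_comp[OF smf_En_functor smf_Rn_functor])
  note [simp] = En_functor_FA En_functor_simps iso_eps strong_box strong_const Rn_box Rn_const Rn_functor_FA strictD[OF strict_Rn_functor]
  have [simp]: "FO (FO F a) b \<in> Ob C" if "SMF A (ihom B C) F" "a \<in> Ob A" "b \<in> Ob B" for F a b
    using smf_FO_Ob[OF that(1,2)] that(3) by simp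
  show ?thesis
  proof (rule smf_eqI[OF RE.symmetric_monoidal_functor_axioms smf_id])
    fix \<sigma> assume s: "\<sigma> \<in> Ar (ihom A (ihom B C))"
    show "FA (smf_comp (ihom A (ihom B C)) (ihom A (ihom B C)) (Rn_functor A B C) (En_functor A B C)) \<sigma> = FA (smf_id (ihom A (ihom B C))) \<sigma>"
      by (rule ihom_ihom_eqI) (use s in simp_all)
  next
    show "F0 (smf_comp (ihom A (ihom B C)) (ihom A (ihom B C)) (Rn_functor A B C) (En_functor A B C)) = F0 (smf_id (ihom A (ihom B C)))"
      by (rule ihom_ihom_eqI) simp_all
  next
    fix F G assume "F \<in> Ob (ihom A (ihom B C))" "G \<in> Ob (ihom A (ihom B C))"
    then show "F2 (smf_comp (ihom A (ihom B C)) (ihom A (ihom B C)) (Rn_functor A B C) (En_functor A B C)) F G = F2 (smf_id (ihom A (ihom B C))) F G"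
      by (intro ihom_ihom_eqI) simp_all
  qed simp_all
qed

text \<open>The arrows \<open>eps\<close> are themselves the components of a monoidal transformation
  in \<open>F\<close>. This one-way 2-cell between functors on \<open>[A \<otimes> B, C]\<close>
  becomes an identity in the quotient, so the internal transposition is invertible there.\<close>

lemma sim_En_functor_Rn_functor:
  "(smf_comp (ihom AB C) (ihom AB C) (En_functor A B C) (Rn_functor A B C), smf_id (ihom AB C)) \<in> sim (ihom AB C) (ihom AB C)"
proof (rule mt_sim[of _ _ _ _ "\<lambda>F\<in>Ob (ihom AB C). eps A B C F"])
  interpret R: symmetric_monoidal_functor "ihom AB C" "ihom A (ihom B C)" "Rn_functor A B C" by (rule smf_Rn_functor)
  interpret E: symmetric_monoidal_functor "ihom A (ihom B C)" "ihom AB C" "En_functor A B C" by (rule smf_En_functor)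
  note [simp] = En_functor_FA En_functor_simps iso_eps strong_box strong_const Rn_box Rn_const Rn_functor_FA strictD[OF strict_Rn_functor] smf_Rn
  have [simp]: "FO (FO F a) b \<in> Ob C" if "SMF A (ihom B C) F" "a \<in> Ob A" "b \<in> Ob B" for F a b
    using smf_FO_Ob[OF that(1,2)] that(3) by simp
  have s: "SMF (ihom AB C) (ihom AB C) (smf_comp (ihom AB C) (ihom AB C) (En_functor A B C) (Rn_functor A B C))"
    by (rule smf_comp[OF smf_Rn_functor smf_En_functor])
  show "MT (ihom AB C) (ihom AB C) (smf_comp (ihom AB C) (ihom AB C) (En_functor A B C) (Rn_functor A B C)) (smf_id (ihom AB C)) (\<lambda>F\<in>Ob (ihom AB C). eps A B C F)"
    by (rule mtI[OF s smf_id]; (rule tensor_arrow_eqI[where C=C])?) (simp_all add: smf_eta_ob)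
qed

lemma Rn_functor_cancel:
  assumes "SMF X (ihom AB C) F" "SMF X (ihom AB C) G"
    and "(smf_comp X (ihom A (ihom B C)) (Rn_functor A B C) F, smf_comp X (ihom A (ihom B C)) (Rn_functor A B C) G) \<in> sim X (ihom A (ihom B C))"
  shows "(F, G) \<in> sim X (ihom AB C)"
proof -
  let ?ER = "smf_comp (ihom AB C) (ihom AB C) (En_functor A B C) (Rn_functor A B C)"
  have *: "(smf_comp X (ihom AB C) ?ER H, H) \<in> sim X (ihom AB C)" if "SMF X (ihom AB C) H" for H
    using sim_comp_right[OF sim_En_functor_Rn_functor that] that by simp
  have "(smf_comp X (ihom AB C) ?ER F, smf_comp X (ihom AB C) ?ER G) \<in> sim X (ihom AB C)"
    using sim_comp_left[OF assms(3) smf_En_functor]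
    by (simp add: smf_comp_assoc[OF _ smf_Rn_functor smf_En_functor] assms)
  then show ?thesis by (rule sim_trans[OF sim_sym[OF *[OF assms(1)]] sim_trans[OF _ *[OF assms(2)]]])
qed

text \<open>The same cancellation under \<open>[D, -]\<close>. The pentagon has four factors, so a
  tensor remains inside an internal hom after two transpositions.\<close>

lemma post_Rn_functor_cancel:
  assumes "SMC D" "SMF X (ihom D (ihom AB C)) F" "SMF X (ihom D (ihom AB C)) G"
    and "(smf_comp X (ihom D (ihom A (ihom B C))) (post D (ihom AB C) (ihom A (ihom B C)) (Rn_functor A B C)) F,
      smf_comp X (ihom D (ihom A (ihom B C))) (post D (ihom AB C) (ihom A (ihom B C)) (Rn_functor A B C)) G) \<in> sim X (ihom D (ihom A (ihom B C)))"
  shows "(F, G) \<in> sim X (ihom D (ihom AB C))"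
proof -
  let ?R = "post D (ihom AB C) (ihom A (ihom B C)) (Rn_functor A B C)" and ?E = "post D (ihom A (ihom B C)) (ihom AB C) (En_functor A B C)"
  note R = smf_post[OF assms(1) smf_Rn_functor] and E = smf_post[OF assms(1) smf_En_functor]
  let ?ER = "smf_comp (ihom D (ihom AB C)) (ihom D (ihom AB C)) ?E ?R"
  have "(?ER, smf_id (ihom D (ihom AB C))) \<in> sim (ihom D (ihom AB C)) (ihom D (ihom AB C))"
    using sim_post[OF assms(1) sim_En_functor_Rn_functor] assms(1)
    by (simp add: post_comp[OF assms(1) smf_Rn_functor smf_En_functor] post_id)
  then have *: "(smf_comp X (ihom D (ihom AB C)) ?ER H, H) \<in> sim X (ihom D (ihom AB C))" if "SMF X (ihom D (ihom AB C)) H" for H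
    using sim_comp_right[OF _ that] that by fastforce
  have "(smf_comp X (ihom D (ihom AB C)) ?ER F, smf_comp X (ihom D (ihom AB C)) ?ER G) \<in> sim X (ihom D (ihom AB C))"
    using sim_comp_left[OF assms(4) E]
    by (simp add: smf_comp_assoc[OF _ R E] assms)
  then show ?thesis by (rule sim_trans[OF sim_sym[OF *[OF assms(2)]] sim_trans[OF _ *[OF assms(3)]]])
qed

end

lemma tensor_pairI: "SMC A \<Longrightarrow> SMC B \<Longrightarrow> tensor_pair A B"
  by (simp add: tensor_pair_def)

lemma tensor_tripleI: "SMC A \<Longrightarrow> SMC B \<Longrightarrow> SMC C \<Longrightarrow> tensor_triple A B C"
  by (simp add: tensor_triple_def tensor_pairI)

lemma smc_tensor [simp]: "SMC A \<Longrightarrow> SMC B \<Longrightarrow> SMC (tensor A B)"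
  by (rule tensor_triple.smcs(4)[OF tensor_tripleI])

lemmas smf_eta = tensor_pair.smf_eta[OF tensor_pairI]
  and smf_eta_ob = tensor_pair.smf_eta_ob[OF tensor_pairI]
  and smf_En = tensor_triple.SMF_En[OF tensor_tripleI]
  and strict_En = tensor_triple.strict_En[OF tensor_tripleI]
  and Rn_En = tensor_triple.Rn_En[OF tensor_tripleI]
  and FO_En_GenW = tensor_triple.FO_En_GenW[OF tensor_tripleI]
  and smf_Rn = tensor_pair.smf_Rn[OF tensor_pairI]
  and smf_Rn_functor = tensor_triple.smf_Rn_functor[OF tensor_tripleI]
  and strict_Rn_functor = tensor_triple.strict_Rn_functor[OF tensor_tripleI]
  and smf_En_functor = tensor_triple.smf_En_functor[OF tensor_tripleI]
  and Rn_functor_simps = tensor_triple.Rn_functor_simps[OF tensor_tripleI]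
  and Rn_functor_FA = tensor_triple.Rn_functor_FA[OF tensor_tripleI]

lemma smf_ihom2_eqI:
  assumes "SMF X (ihom A (ihom B C)) P" "SMF X (ihom A (ihom B C)) Q" "SMC A" "SMC B" "SMC C"
    and o: "\<And>x. x \<in> Ob X \<Longrightarrow> FO P x = FO Q x"
    and "\<And>f a b. f \<in> Ar X \<Longrightarrow> a \<in> Ob A \<Longrightarrow> b \<in> Ob B \<Longrightarrow> comp_at (comp_at (FA P f) a) b = comp_at (comp_at (FA Q f) a) b"
    and "\<And>a b. a \<in> Ob A \<Longrightarrow> b \<in> Ob B \<Longrightarrow> comp_at (comp_at (F0 P) a) b = comp_at (comp_at (F0 Q) a) b"
    and "\<And>x y a b. x \<in> Ob X \<Longrightarrow> y \<in> Ob X \<Longrightarrow> a \<in> Ob A \<Longrightarrow> b \<in> Ob B \<Longrightarrow>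
      comp_at (comp_at (F2 P x y) a) b = comp_at (comp_at (F2 Q x y) a) b"
  shows "P = Q"
proof -
  interpret P: symmetric_monoidal_functor X "ihom A (ihom B C)" P by fact
  interpret Q: symmetric_monoidal_functor X "ihom A (ihom B C)" Q by fact
  note e = tensor_triple.ihom_ihom_eqI[OF tensor_tripleI[OF assms(3-5)]]
  show ?thesis
    by (rule smf_eqI[OF assms(1,2) o]; (rule e)?) (simp_all add: assms(6-))
qed

lemma smf_ihom3_eqI:
  assumes "SMF X (ihom A (ihom B (ihom C D))) P" "SMF X (ihom A (ihom B (ihom C D))) Q" "SMC A" "SMC B" "SMC C" "SMC D"
    and o: "\<And>x. x \<in> Ob X \<Longrightarrow> FO P x = FO Q x"
    and f: "\<And>f a b c. f \<in> Ar X \<Longrightarrow> a \<in> Ob A \<Longrightarrow> b \<in> Ob B \<Longrightarrow> c \<in> Ob C \<Longrightarrow>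
      comp_at (comp_at (comp_at (FA P f) a) b) c = comp_at (comp_at (comp_at (FA Q f) a) b) c"
    and z: "\<And>a b c. a \<in> Ob A \<Longrightarrow> b \<in> Ob B \<Longrightarrow> c \<in> Ob C \<Longrightarrow> comp_at (comp_at (comp_at (F0 P) a) b) c = comp_at (comp_at (comp_at (F0 Q) a) b) c"
    and t: "\<And>x y a b c. x \<in> Ob X \<Longrightarrow> y \<in> Ob X \<Longrightarrow> a \<in> Ob A \<Longrightarrow> b \<in> Ob B \<Longrightarrow> c \<in> Ob C \<Longrightarrow>
      comp_at (comp_at (comp_at (F2 P x y) a) b) c = comp_at (comp_at (comp_at (F2 Q x y) a) b) c"
  shows "P = Q"
proof -
  interpret P: symmetric_monoidal_functor X "ihom A (ihom B (ihom C D))" P by fact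
  interpret Q: symmetric_monoidal_functor X "ihom A (ihom B (ihom C D))" Q by fact
  have e: "comp_at (comp_at \<theta> a) b = comp_at (comp_at \<theta>' a) b"
    if "\<theta> \<in> Ar (ihom A (ihom B (ihom C D)))" "\<theta>' \<in> Ar (ihom A (ihom B (ihom C D)))"
      "dm (ihom A (ihom B (ihom C D))) \<theta> = dm (ihom A (ihom B (ihom C D))) \<theta>'"
      "cd (ihom A (ihom B (ihom C D))) \<theta> = cd (ihom A (ihom B (ihom C D))) \<theta>'"
      "a \<in> Ob A" "b \<in> Ob B" "\<And>c. c \<in> Ob C \<Longrightarrow> comp_at (comp_at (comp_at \<theta> a) b) c = comp_at (comp_at (comp_at \<theta>' a) b) c"
    for \<theta> \<theta>' a b
  proof -
    note t = ihom_arrow(3-5)[OF ihom_arrow(3)[OF that(1,5)] that(6)] and t' = ihom_arrow(3-5)[OF ihom_arrow(3)[OF that(2,5)] that(6)]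
      and d = ihom_arrow(4,5)[OF that(1,5)] and d' = ihom_arrow(4,5)[OF that(2,5)]
    show ?thesis
      by (rule ihom_eqI[OF t(1) t'(1) _ _ that(7)]) (simp_all only: t t' d d' that(3,4))
  qed
  show ?thesis
    by (rule smf_ihom2_eqI[OF assms(1-4) _ o]; (rule e)?) (simp_all add: assms)
qed

section \<open>The tensor on 1-cells and naturality of transposition\<close>

lemma smf_tensor_left:
  assumes "SMF A A' F" "SMC B"
  shows "SMF (tensor A B) (tensor A' B) (tensor_left A A' B F)"
    and "strict (tensor A B) (tensor A' B) (tensor_left A A' B F)"
    and "Rn A B (tensor A' B) (tensor_left A A' B F) = smf_comp A (ihom B (tensor A' B)) (eta A' B) F"
    and "a \<in> Ob A \<Longrightarrow> b \<in> Ob B \<Longrightarrow> FO (tensor_left A A' B F) (GenW (a, b)) = GenW (FO F a, b)"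
proof -
  note s = smf_source[OF assms(1)] smf_target[OF assms(1)] assms(2)
  interpret tensor_pair A' B by (rule tensor_pairI) (rule s)+
  have e: "SMF A (ihom B (tensor A' B)) (smf_comp A (ihom B (tensor A' B)) (eta A' B) F)"
    by (rule smf_comp[OF assms(1) smf_eta])
  show "SMF (tensor A B) (tensor A' B) (tensor_left A A' B F)"
    and "strict (tensor A B) (tensor A' B) (tensor_left A A' B F)"
    and "Rn A B (tensor A' B) (tensor_left A A' B F) = smf_comp A (ihom B (tensor A' B)) (eta A' B) F"
    and "a \<in> Ob A \<Longrightarrow> b \<in> Ob B \<Longrightarrow> FO (tensor_left A A' B F) (GenW (a, b)) = GenW (FO F a, b)"
    using e s assms(1) by (simp_all add: tensor_left_def smf_En strict_En Rn_En FO_En_GenW)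
qed

lemma smf_tensor_right:
  assumes "SMF B B' G" "SMC A"
  shows "SMF (tensor A B) (tensor A B') (tensor_right A B B' G)"
    and "strict (tensor A B) (tensor A B') (tensor_right A B B' G)"
    and "Rn A B (tensor A B') (tensor_right A B B' G) = smf_comp A (ihom B (tensor A B')) (pre B B' (tensor A B') G) (eta A B')"
    and "a \<in> Ob A \<Longrightarrow> b \<in> Ob B \<Longrightarrow> FO (tensor_right A B B' G) (GenW (a, b)) = GenW (a, FO G b)"
proof -
  note s = smf_source[OF assms(1)] smf_target[OF assms(1)] assms(2)
  interpret tensor_pair A B' by (rule tensor_pairI) (rule s)+
  have e: "SMF A (ihom B (tensor A B')) (smf_comp A (ihom B (tensor A B')) (pre B B' (tensor A B') G) (eta A B'))"
    by (rule smf_comp[OF smf_eta smf_pre[OF _ assms(1)]]) (simp add: s)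
  show "SMF (tensor A B) (tensor A B') (tensor_right A B B' G)"
    and "strict (tensor A B) (tensor A B') (tensor_right A B B' G)"
    and "Rn A B (tensor A B') (tensor_right A B B' G) = smf_comp A (ihom B (tensor A B')) (pre B B' (tensor A B') G) (eta A B')"
    and "a \<in> Ob A \<Longrightarrow> b \<in> Ob B \<Longrightarrow> FO (tensor_right A B B' G) (GenW (a, b)) = GenW (a, FO G b)"
    using e s assms(1) smf_eta_ob by (simp_all add: tensor_right_def smf_En strict_En Rn_En FO_En_GenW)
qed

lemma Rn_comp:
  assumes "SMC A" "SMC B" "SMF (tensor A B) C F" "SMF C D K"
  shows "Rn A B D (smf_comp (tensor A B) D K F) = smf_comp A (ihom B D) (post B C D K) (Rn A B C F)"
  by (rule tensor_pair.Rn_comp[OF tensor_pairI]) fact+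

lemma Rn_tensor_left:
  assumes "SMF A A' G" "SMC B" "SMF (tensor A' B) C F"
  shows "Rn A B C (smf_comp (tensor A B) C F (tensor_left A A' B G)) = smf_comp A (ihom B C) (Rn A' B C F) G"
  using smf_comp_assoc[OF assms(1) smf_eta smf_post[OF assms(2,3)]] smf_source[OF assms(1)] smf_target[OF assms(1)] assms
  by (simp add: Rn_comp[OF _ _ smf_tensor_left(1)] smf_tensor_left(3)) (simp add: Rn_def)

lemma Rn_tensor_right:
  assumes "SMF B B' G" "SMC A" "SMF (tensor A B') C F"
  shows "Rn A B C (smf_comp (tensor A B) C F (tensor_right A B B' G)) = smf_comp A (ihom B C) (pre B B' C G) (Rn A B' C F)"
proof -
  note s [simp] = smf_source[OF assms(1)] smf_target[OF assms(1)] assms(2) smf_target[OF assms(3)]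
  let ?AB = "tensor A B'"
  have "Rn A B C (smf_comp (tensor A B) C F (tensor_right A B B' G)) =
      smf_comp A (ihom B C) (post B ?AB C F) (smf_comp A (ihom B ?AB) (pre B B' ?AB G) (eta A B'))"
    using assms by (simp add: Rn_comp[OF _ _ smf_tensor_right(1)] smf_tensor_right(3))
  also have "\<dots> = smf_comp A (ihom B C) (smf_comp (ihom B' ?AB) (ihom B C) (post B ?AB C F) (pre B B' ?AB G)) (eta A B')"
    by (rule smf_comp_assoc[OF smf_eta smf_pre[OF _ assms(1)] smf_post[OF _ assms(3)]]) simp_all
  also have "\<dots> = smf_comp A (ihom B C) (smf_comp (ihom B' ?AB) (ihom B C) (pre B B' C G) (post B' ?AB C F)) (eta A B')"
    by (simp only: pre_post[OF assms(1,3)])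
  also have "\<dots> = smf_comp A (ihom B C) (pre B B' C G) (Rn A B' C F)"
    unfolding Rn_def by (rule smf_comp_assoc[OF smf_eta smf_post[OF _ assms(3)] smf_pre[OF _ assms(1)], symmetric]) simp_all
  finally show ?thesis .
qed

text \<open>This and the next two lemmas are the naturality of internal transposition in
  \<open>C\<close>, \<open>A\<close> and \<open>B\<close>. They are equalities, since arrows are
  compared at generators \<open>a \<otimes> b\<close>, on which tensored functors act by their
  factors.\<close>

lemma Rn_functor_post:
  assumes "SMC A" "SMC B" "SMF C D K"
  shows "smf_comp (ihom (tensor A B) C) (ihom A (ihom B D)) (Rn_functor A B D) (post (tensor A B) C D K) =
    smf_comp (ihom (tensor A B) C) (ihom A (ihom B D)) (post A (ihom B C) (ihom B D) (post B C D K)) (Rn_functor A B C)"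
proof -
  note [simp] = assms smf_source[OF assms(3)] smf_target[OF assms(3)]
  interpret K: symmetric_monoidal_functor C D K by fact
  interpret T: tensor_triple A B C by (rule tensor_tripleI) simp_all
  interpret T': tensor_triple A B D by (rule tensor_tripleI) simp_all
  note pK = smf_post[OF _ assms(3)]
  interpret R: symmetric_monoidal_functor "ihom (tensor A B) C" "ihom A (ihom B C)" "Rn_functor A B C" by (rule smf_Rn_functor) simp_all
  interpret R': symmetric_monoidal_functor "ihom (tensor A B) D" "ihom A (ihom B D)" "Rn_functor A B D" by (rule smf_Rn_functor) simp_all
  interpret P: symmetric_monoidal_functor "ihom (tensor A B) C" "ihom (tensor A B) D" "post (tensor A B) C D K" by (rule pK) simp
  interpret P': symmetric_monoidal_functor "ihom B C" "ihom B D" "post B C D K" by (rule pK) simp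
  interpret PP: symmetric_monoidal_functor "ihom A (ihom B C)" "ihom A (ihom B D)" "post A (ihom B C) (ihom B D) (post B C D K)"
    by (rule smf_post[OF _ pK]) simp_all
  note [simp] = strictD[OF T.strict_Rn_functor] strictD[OF T'.strict_Rn_functor] T.smf_Rn smf_comp[OF _ assms(3)] T.Rn_functor_FA T'.Rn_functor_FA
  have c [simp]: "comp_at (FA (Rn_functor A B C) \<theta>) a \<in> Ar (ihom B C)" if "\<theta> \<in> Ar (ihom (tensor A B) C)" "a \<in> Ob A" for \<theta> a
    using ihom_arrow(3)[OF T.Rn_functor_FA(1)[OF that(1)] that(2)] .
  show ?thesis
    by (rule smf_ihom2_eqI[OF smf_comp[OF P.symmetric_monoidal_functor_axioms R'.symmetric_monoidal_functor_axioms]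
        smf_comp[OF R.symmetric_monoidal_functor_axioms PP.symmetric_monoidal_functor_axioms]])
      (simp_all add: Rn_comp[OF assms(1,2) _ assms(3)] T.smf_eta_ob smf_comp[OF T.smf_eta_ob] del: T.tensor_simps(2,3))
qed

lemma Rn_functor_pre_left:
  assumes "SMF A A' G" "SMC B" "SMC C"
  shows "smf_comp (ihom (tensor A' B) C) (ihom A (ihom B C)) (Rn_functor A B C) (pre (tensor A B) (tensor A' B) C (tensor_left A A' B G)) =
    smf_comp (ihom (tensor A' B) C) (ihom A (ihom B C)) (pre A A' (ihom B C) G) (Rn_functor A' B C)"
proof -
  note [simp] = assms smf_source[OF assms(1)] smf_target[OF assms(1)]
  interpret G: symmetric_monoidal_functor A A' G by fact
  interpret T: tensor_triple A B C by (rule tensor_tripleI) simp_all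
  interpret T': tensor_triple A' B C by (rule tensor_tripleI) simp_all
  note tl = smf_tensor_left[OF assms(1,2)]
  interpret R: symmetric_monoidal_functor "ihom (tensor A B) C" "ihom A (ihom B C)" "Rn_functor A B C" by (rule smf_Rn_functor) simp_all
  interpret R': symmetric_monoidal_functor "ihom (tensor A' B) C" "ihom A' (ihom B C)" "Rn_functor A' B C" by (rule smf_Rn_functor) simp_all
  interpret P: symmetric_monoidal_functor "ihom (tensor A' B) C" "ihom (tensor A B) C" "pre (tensor A B) (tensor A' B) C (tensor_left A A' B G)"
    by (rule smf_pre[OF _ tl(1)]) simp
  interpret P': symmetric_monoidal_functor "ihom A' (ihom B C)" "ihom A (ihom B C)" "pre A A' (ihom B C) G" by (rule smf_pre) simp_all
  note [simp] = strictD[OF T.strict_Rn_functor] strictD[OF T'.strict_Rn_functor] strictD[OF strict_pre] T.smf_Rn T'.smf_Rn smf_comp[OF tl(1)]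
    T.Rn_functor_FA T'.Rn_functor_FA tl(4)
  show ?thesis
    by (rule smf_ihom2_eqI[OF smf_comp[OF P.symmetric_monoidal_functor_axioms R.symmetric_monoidal_functor_axioms]
        smf_comp[OF R'.symmetric_monoidal_functor_axioms P'.symmetric_monoidal_functor_axioms]])
      (simp_all add: Rn_tensor_left[OF assms(1,2)] del: T.tensor_simps(2,3) T'.tensor_simps(2,3))
qed

lemma Rn_functor_pre_right:
  assumes "SMF B B' H" "SMC A" "SMC C"
  shows "smf_comp (ihom (tensor A B') C) (ihom A (ihom B C)) (Rn_functor A B C) (pre (tensor A B) (tensor A B') C (tensor_right A B B' H)) =
    smf_comp (ihom (tensor A B') C) (ihom A (ihom B C)) (post A (ihom B' C) (ihom B C) (pre B B' C H)) (Rn_functor A B' C)"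
proof -
  note [simp] = assms smf_source[OF assms(1)] smf_target[OF assms(1)]
  interpret H: symmetric_monoidal_functor B B' H by fact
  interpret T: tensor_triple A B C by (rule tensor_tripleI) simp_all
  interpret T': tensor_triple A B' C by (rule tensor_tripleI) simp_all
  note tr = smf_tensor_right[OF assms(1,2)]
  interpret R: symmetric_monoidal_functor "ihom (tensor A B) C" "ihom A (ihom B C)" "Rn_functor A B C" by (rule smf_Rn_functor) simp_all
  interpret R': symmetric_monoidal_functor "ihom (tensor A B') C" "ihom A (ihom B' C)" "Rn_functor A B' C" by (rule smf_Rn_functor) simp_all
  interpret P: symmetric_monoidal_functor "ihom (tensor A B') C" "ihom (tensor A B) C" "pre (tensor A B) (tensor A B') C (tensor_right A B B' H)"
    by (rule smf_pre[OF _ tr(1)]) simp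
  have pH: "SMF (ihom B' C) (ihom B C) (pre B B' C H)" by (rule smf_pre) simp_all
  interpret P': symmetric_monoidal_functor "ihom A (ihom B' C)" "ihom A (ihom B C)" "post A (ihom B' C) (ihom B C) (pre B B' C H)"
    by (rule smf_post[OF _ pH]) simp_all
  interpret pH: symmetric_monoidal_functor "ihom B' C" "ihom B C" "pre B B' C H" by (rule pH)
  note [simp] = strictD[OF T.strict_Rn_functor] strictD[OF T'.strict_Rn_functor] strictD[OF strict_pre] T.smf_Rn T'.smf_Rn smf_comp[OF tr(1)] smf_comp[OF assms(1)]
    T.Rn_functor_FA T'.Rn_functor_FA tr(4)
  have c [simp]: "comp_at (FA (Rn_functor A B' C) \<theta>) a \<in> Ar (ihom B' C)" if "\<theta> \<in> Ar (ihom (tensor A B') C)" "a \<in> Ob A" for \<theta> a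
    using ihom_arrow(3)[OF T'.Rn_functor_FA(1)[OF that(1)] that(2)] .
  show ?thesis
    by (rule smf_ihom2_eqI[OF smf_comp[OF P.symmetric_monoidal_functor_axioms R.symmetric_monoidal_functor_axioms]
        smf_comp[OF R'.symmetric_monoidal_functor_axioms P'.symmetric_monoidal_functor_axioms]])
      (simp_all add: Rn_tensor_right[OF assms(1,2)] T'.smf_eta_ob smf_comp[OF T'.smf_eta_ob] del: T.tensor_simps(2,3) T'.tensor_simps(2,3))
qed

section \<open>Transposes of the symmetry and the associativity\<close>

lemma smf_S:
  assumes "SMC A" "SMC B"
  shows "SMF (tensor A B) (tensor B A) (S_functor A B)"
    and "Rn A B (tensor B A) (S_functor A B) = dual B A (tensor B A) (eta B A)"
    and "a \<in> Ob A \<Longrightarrow> b \<in> Ob B \<Longrightarrow> FO (S_functor A B) (GenW (a, b)) = GenW (b, a)"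
proof -
  interpret BA: tensor_pair B A by (rule tensor_pairI) fact+
  have "SMF A (ihom B (tensor B A)) (dual B A (tensor B A) (eta B A))"
    by (rule ihom_functor.smf_dual[OF ihom_functorI[OF smf_eta]]) (use assms in simp_all)
  then show "SMF (tensor A B) (tensor B A) (S_functor A B)"
    and "Rn A B (tensor B A) (S_functor A B) = dual B A (tensor B A) (eta B A)"
    and "a \<in> Ob A \<Longrightarrow> b \<in> Ob B \<Longrightarrow> FO (S_functor A B) (GenW (a, b)) = GenW (b, a)"
    using assms by (simp_all add: S_functor_def smf_En strict_En Rn_En FO_En_GenW)
qed

lemma Rn_functor_pre_S:
  assumes "SMC A" "SMC B" "SMC C"
  shows "smf_comp (ihom (tensor B A) C) (ihom A (ihom B C)) (Rn_functor A B C) (pre (tensor A B) (tensor B A) C (S_functor A B)) =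
    smf_comp (ihom (tensor B A) C) (ihom A (ihom B C)) (dual_functor B A C) (Rn_functor B A C)"
proof -
  note [simp] = assms
  interpret T: tensor_triple A B C by (rule tensor_tripleI) simp_all
  interpret T': tensor_triple B A C by (rule tensor_tripleI) simp_all
  note S = smf_S[OF assms(1,2)]
  interpret R: symmetric_monoidal_functor "ihom (tensor A B) C" "ihom A (ihom B C)" "Rn_functor A B C" by (rule smf_Rn_functor) simp_all
  interpret R': symmetric_monoidal_functor "ihom (tensor B A) C" "ihom B (ihom A C)" "Rn_functor B A C" by (rule smf_Rn_functor) simp_all
  interpret P: symmetric_monoidal_functor "ihom (tensor B A) C" "ihom (tensor A B) C" "pre (tensor A B) (tensor B A) C (S_functor A B)"
    by (rule smf_pre[OF _ S(1)]) simp
  interpret D: symmetric_monoidal_functor "ihom B (ihom A C)" "ihom A (ihom B C)" "dual_functor B A C" by (rule smf_dual_functor) simp_all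
  interpret E: ihom_functor B A "tensor B A" "eta B A" by (rule ihom_functorI[OF T'.smf_eta]) simp_all
  note [simp] = strictD[OF T.strict_Rn_functor] strictD[OF T'.strict_Rn_functor] strictD[OF strict_pre] strictD[OF strict_dual_functor]
    T.smf_Rn T'.smf_Rn smf_comp[OF S(1)] T.Rn_functor_FA T'.Rn_functor_FA S(3)
  have o: "Rn A B C (smf_comp (tensor A B) C F (S_functor A B)) = dual B A C (Rn B A C F)" if "SMF (tensor B A) C F" for F
    using E.dual_post[OF that] that by (simp add: Rn_comp[OF _ _ S(1)] S(2)) (simp add: Rn_def)
  show ?thesis
    by (rule smf_ihom2_eqI[OF smf_comp[OF P.symmetric_monoidal_functor_axioms R.symmetric_monoidal_functor_axioms]
        smf_comp[OF R'.symmetric_monoidal_functor_axioms D.symmetric_monoidal_functor_axioms]])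
      (simp_all add: o del: T.tensor_simps(2,3) T'.tensor_simps(2,3))
qed

text \<open>The third claim is the usable description: the internal \<open>En\<close> in the
  definition of \<open>A\<close> is cancelled by a second transposition, leaving two instances of
  \<open>eta\<close>.\<close>

lemma smf_A:
  assumes "SMC A" "SMC B" "SMC C"
  defines "X \<equiv> tensor (tensor A B) C"
  shows "SMF (tensor A (tensor B C)) X (A_functor A B C)"
    and "Rn A (tensor B C) X (A_functor A B C) = smf_comp A (ihom (tensor B C) X) (En_functor B C X)
        (smf_comp A (ihom B (ihom C X)) (post B (tensor A B) (ihom C X) (eta (tensor A B) C)) (eta A B))"
    and "smf_comp A (ihom B (ihom C X)) (Rn_functor B C X) (Rn A (tensor B C) X (A_functor A B C)) =
      smf_comp A (ihom B (ihom C X)) (post B (tensor A B) (ihom C X) (eta (tensor A B) C)) (eta A B)"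
    and "a \<in> Ob A \<Longrightarrow> b \<in> Ob B \<Longrightarrow> c \<in> Ob C \<Longrightarrow> FO (A_functor A B C) (GenW (a, GenW (b, c))) = GenW (GenW (a, b), c)"
proof -
  note [simp] = assms(1-3)
  have X [simp]: "SMC X" by (simp add: X_def)
  have e: "SMF A (ihom B (tensor A B)) (eta A B)" "SMF (tensor A B) (ihom C X) (eta (tensor A B) C)"
    unfolding X_def by (simp_all add: smf_eta)
  let ?p = "smf_comp A (ihom B (ihom C X)) (post B (tensor A B) (ihom C X) (eta (tensor A B) C)) (eta A B)"
  have p: "SMF A (ihom B (ihom C X)) ?p"
    by (rule smf_comp[OF e(1) smf_post[OF _ e(2)]]) simp
  have q: "SMF A (ihom (tensor B C) X) (smf_comp A (ihom (tensor B C) X) (En_functor B C X) ?p)"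
    by (rule smf_comp[OF p smf_En_functor]) simp_all
  show 1: "SMF (tensor A (tensor B C)) X (A_functor A B C)"
    using q by (simp add: A_functor_def Let_def X_def[symmetric] smf_En)
  show 2: "Rn A (tensor B C) X (A_functor A B C) = smf_comp A (ihom (tensor B C) X) (En_functor B C X) ?p"
    using q by (simp add: A_functor_def Let_def X_def[symmetric] Rn_En)
  have "smf_comp A (ihom B (ihom C X)) (Rn_functor B C X) (smf_comp A (ihom (tensor B C) X) (En_functor B C X) ?p) =
    smf_comp A (ihom B (ihom C X)) (smf_comp (ihom B (ihom C X)) (ihom B (ihom C X)) (Rn_functor B C X) (En_functor B C X)) ?p"
    by (rule smf_comp_assoc[OF p smf_En_functor smf_Rn_functor]) simp_all
  also have "\<dots> = ?p"
    using p by (simp add: tensor_triple.Rn_functor_En_functor[OF tensor_tripleI])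
  finally show 3: "smf_comp A (ihom B (ihom C X)) (Rn_functor B C X) (Rn A (tensor B C) X (A_functor A B C)) = ?p"
    by (simp add: 2)
  assume abc [simp]: "a \<in> Ob A" "b \<in> Ob B" "c \<in> Ob C"
  interpret T: tensor_pair A B by (rule tensor_pairI) simp_all
  interpret T': tensor_pair "tensor A B" C by (rule tensor_pairI) simp_all
  interpret T2: tensor_pair B C by (rule tensor_pairI) simp_all
  interpret T3: tensor_pair A "tensor B C" by (rule tensor_pairI) simp_all
  \<comment> \<open>The value on a generator is read off from the twice transposed equation by
    evaluating at \<open>a\<close>, \<open>b\<close> and \<open>c\<close>.\<close>
  have "FO (FO (FO (smf_comp A (ihom B (ihom C X)) (Rn_functor B C X) (Rn A (tensor B C) X (A_functor A B C))) a) b) c = FO (FO (FO ?p a) b) c"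
    by (simp only: 3)
  then show "FO (A_functor A B C) (GenW (a, GenW (b, c))) = GenW (GenW (a, b), c)"
    using 1 T3.smf_eta_ob[OF abc(1)] smf_comp[OF T3.smf_eta_ob[OF abc(1)] 1]
    by (simp add: T3.Rn_simps T2.Rn_simps Rn_functor_simps T2.smf_eta_ob T.smf_eta_ob)
qed

text \<open>Both bracketings of three factors lead to \<open>[A, [B, [C, D]]]\<close>, and
  precomposition with \<open>A\<close> links the two ways of getting there. The pentagon uses this
  to change the bracketing of the last three of its four factors.\<close>

lemma Rn_functor_pre_A:
  assumes "SMC A" "SMC B" "SMC C" "SMC D"
  defines "L \<equiv> tensor (tensor A B) C"
  shows "smf_comp (ihom L D) (ihom A (ihom B (ihom C D))) (post A (ihom (tensor B C) D) (ihom B (ihom C D)) (Rn_functor B C D))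
      (smf_comp (ihom L D) (ihom A (ihom (tensor B C) D)) (Rn_functor A (tensor B C) D)
        (pre (tensor A (tensor B C)) L D (A_functor A B C))) =
    smf_comp (ihom L D) (ihom A (ihom B (ihom C D))) (Rn_functor A B (ihom C D)) (Rn_functor (tensor A B) C D)"
  (is "?l = ?r")
proof -
  note [simp] = assms(1-4)
  have L [simp]: "SMC L" by (simp add: L_def)
  note a = smf_A[OF assms(1-3), folded L_def]
  have e: "SMF A (ihom B (tensor A B)) (eta A B)" "SMF (tensor A B) (ihom C L) (eta (tensor A B) C)"
    unfolding L_def by (simp_all add: smf_eta)
  have r1: "SMF (ihom (tensor B C) D) (ihom B (ihom C D)) (Rn_functor B C D)"
    and r2: "SMF (ihom (tensor A (tensor B C)) D) (ihom A (ihom (tensor B C) D)) (Rn_functor A (tensor B C) D)"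
    and r3: "SMF (ihom L D) (ihom (tensor A B) (ihom C D)) (Rn_functor (tensor A B) C D)"
    and r4: "SMF (ihom (tensor A B) (ihom C D)) (ihom A (ihom B (ihom C D))) (Rn_functor A B (ihom C D))"
    unfolding L_def by (simp_all add: smf_Rn_functor)
  interpret r1: symmetric_monoidal_functor "ihom (tensor B C) D" "ihom B (ihom C D)" "Rn_functor B C D" by (rule r1)
  interpret r2: symmetric_monoidal_functor "ihom (tensor A (tensor B C)) D" "ihom A (ihom (tensor B C) D)" "Rn_functor A (tensor B C) D" by (rule r2)
  interpret r3: symmetric_monoidal_functor "ihom L D" "ihom (tensor A B) (ihom C D)" "Rn_functor (tensor A B) C D" by (rule r3)
  interpret r4: symmetric_monoidal_functor "ihom (tensor A B) (ihom C D)" "ihom A (ihom B (ihom C D))" "Rn_functor A B (ihom C D)" by (rule r4)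
  have pA: "SMF (ihom L D) (ihom (tensor A (tensor B C)) D) (pre (tensor A (tensor B C)) L D (A_functor A B C))"
    by (rule smf_pre[OF _ a(1)]) simp
  interpret pA: symmetric_monoidal_functor "ihom L D" "ihom (tensor A (tensor B C)) D" "pre (tensor A (tensor B C)) L D (A_functor A B C)" by (rule pA)
  have pr: "SMF (ihom A (ihom (tensor B C) D)) (ihom A (ihom B (ihom C D))) (post A (ihom (tensor B C) D) (ihom B (ihom C D)) (Rn_functor B C D))"
    by (rule smf_post[OF _ r1]) simp
  interpret pr: symmetric_monoidal_functor "ihom A (ihom (tensor B C) D)" "ihom A (ihom B (ihom C D))" "post A (ihom (tensor B C) D) (ihom B (ihom C D)) (Rn_functor B C D)"
    by (rule pr)
  have S: "SMF (ihom L D) (ihom A (ihom B (ihom C D))) ?l" "SMF (ihom L D) (ihom A (ihom B (ihom C D))) ?r"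
    by (rule smf_comp[OF smf_comp[OF pA r2] pr], rule smf_comp[OF r3 r4])
  interpret l: symmetric_monoidal_functor "ihom L D" "ihom A (ihom B (ihom C D))" ?l by (rule S)
  interpret r: symmetric_monoidal_functor "ihom L D" "ihom A (ihom B (ihom C D))" ?r by (rule S)
  interpret T: tensor_triple B C D by (rule tensor_tripleI) simp_all
  interpret T2: tensor_triple A "tensor B C" D by (rule tensor_tripleI) simp_all
  interpret T3: tensor_triple "tensor A B" C D by (rule tensor_tripleI) simp_all
  interpret T4: tensor_triple A B "ihom C D" by (rule tensor_tripleI) simp_all
  note [simp] = strictD[OF T.strict_Rn_functor] strictD[OF T2.strict_Rn_functor] strictD[OF T3.strict_Rn_functor, folded L_def]
    strictD[OF T4.strict_Rn_functor] strictD[OF strict_pre] T.smf_Rn T2.smf_Rn T3.smf_Rn[folded L_def] T4.smf_Rn smf_comp[OF a(1)]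
    T.Rn_functor_FA T2.Rn_functor_FA T3.Rn_functor_FA[folded L_def] T4.Rn_functor_FA T3.Rn_functor_simps[folded L_def] T3.Rn_simps[folded L_def] T3.smf_eta_ob a(4)
  have [simp]: "comp_at (FA (Rn_functor A (tensor B C) D) \<theta>) a \<in> Ar (ihom (tensor B C) D)"
    if "\<theta> \<in> Ar (ihom (tensor A (tensor B C)) D)" "a \<in> Ob A" for \<theta> a
    using ihom_arrow(3)[OF T2.Rn_functor_FA(1)[OF that(1)] that(2)] .
  have o: "FO ?l F = FO ?r F" if F [simp]: "SMF L D F" for F
  proof -
    let ?BC = "tensor B C" and ?AB = "tensor A B" and ?X = "ihom B (ihom C D)"
    note pF = smf_post[OF _ F]
    have 1: "SMF A (ihom ?BC L) (Rn A ?BC L (A_functor A B C))" by (rule smf_Rn[OF _ _ a(1)]) simp_all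
    have 2: "SMF (ihom ?BC L) (ihom ?BC D) (post ?BC L D F)" by (rule pF) simp
    have 3: "SMF (ihom B (ihom C L)) ?X (post B (ihom C L) (ihom C D) (post C L D F))" by (rule smf_post[OF _ pF]) simp_all
    have 4: "SMF (ihom ?BC L) (ihom B (ihom C L)) (Rn_functor B C L)" by (rule smf_Rn_functor) simp_all
    have 5: "SMF (ihom B ?AB) (ihom B (ihom C L)) (post B ?AB (ihom C L) (eta ?AB C))" by (rule smf_post[OF _ e(2)]) simp
    \<comment> \<open>On an object \<open>F\<close> the transposes are composites with
      \<open>F\<close>: naturality of transposition moves \<open>F\<close> outside,
      \<open>smf_A\<close> replaces the associativity by two \<open>eta\<close>, and
      \<open>F\<close> is then absorbed by the inner one.\<close>
    have "FO ?l F = smf_comp A ?X (Rn_functor B C D) (smf_comp A (ihom ?BC D) (post ?BC L D F) (Rn A ?BC L (A_functor A B C)))"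
      by (simp add: Rn_comp[OF _ _ a(1)] smf_comp[OF 1 2])
    also have "\<dots> = smf_comp A ?X (smf_comp (ihom ?BC L) ?X (post B (ihom C L) (ihom C D) (post C L D F)) (Rn_functor B C L)) (Rn A ?BC L (A_functor A B C))"
      by (simp add: smf_comp_assoc[OF 1 2 r1] Rn_functor_post)
    also have "\<dots> = smf_comp A ?X (post B (ihom C L) (ihom C D) (post C L D F)) (smf_comp A (ihom B (ihom C L)) (post B ?AB (ihom C L) (eta ?AB C)) (eta A B))"
      by (simp add: smf_comp_assoc[OF 1 4 3, symmetric] a(3))
    also have "\<dots> = smf_comp A ?X (post B ?AB (ihom C D) (Rn ?AB C D F)) (eta A B)"
      by (simp add: smf_comp_assoc[OF e(1) 5 3] post_comp[OF _ e(2) pF, symmetric]) (simp add: Rn_def L_def)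
    also have "\<dots> = Rn A B (ihom C D) (Rn ?AB C D F)"
      by (simp only: Rn_def[of A B "ihom C D" "Rn ?AB C D F"])
    also have "\<dots> = FO ?r F"
      by simp
    finally show ?thesis .
  qed
  show ?thesis
    by (rule smf_ihom3_eqI[OF S])
      (simp_all add: o T2.Rn_box T2.Rn_const T2.smf_eta_ob smf_comp[OF T2.smf_eta_ob] smf_comp_const[OF T2.smf_eta_ob]
        smf_comp_box[OF T2.smf_eta_ob] del: smf_comp_simps(1), simp_all add: T2.Rn_box T2.Rn_const T2.smf_eta_ob smf_comp[OF T2.smf_eta_ob])
qed

text \<open>To move \<open>C\<close> past \<open>A \<otimes> B\<close>, move it past
  \<open>A\<close>, which is \<open>dual\<close>, and then past \<open>B\<close> under the first
  variable, which is \<open>dual_functor\<close>. This is the content of the hexagon in terms of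
  internal homs.\<close>

lemma Rn_dual:
  assumes "SMC A" "SMC B" "SMF C (ihom (tensor A B) X) G"
    and X: "SMC X"
  shows "Rn A B (ihom C X) (dual C (tensor A B) X G) =
    smf_comp A (ihom B (ihom C X)) (dual_functor C B X)
      (dual C A (ihom B X) (smf_comp C (ihom A (ihom B X)) (Rn_functor A B X) G))"
    (is "_ = smf_comp A _ _ (dual C A _ ?H)")
proof -
  note [simp] = assms smf_source[OF assms(3)]
  interpret T: tensor_triple A B X by (rule tensor_tripleI) simp_all
  interpret T': tensor_triple A B "ihom C X" by (rule tensor_tripleI) simp_all
  interpret G: ihom_functor C "tensor A B" X G by (rule ihom_functorI) simp_all
  interpret G': ihom_functor "tensor A B" C X "dual C (tensor A B) X G" by (rule G.dual_is_ihom_functor)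
  interpret R: symmetric_monoidal_functor "ihom (tensor A B) X" "ihom A (ihom B X)" "Rn_functor A B X" by (rule T.smf_Rn_functor)
  have H: "SMF C (ihom A (ihom B X)) ?H" by (rule smf_comp[OF assms(3) T.smf_Rn_functor])
  interpret H: ihom_functor C A "ihom B X" ?H by (rule ihom_functorI[OF H]) simp_all
  interpret H': ihom_functor A C "ihom B X" "dual C A (ihom B X) ?H" by (rule H.dual_is_ihom_functor)
  interpret D: symmetric_monoidal_functor "ihom C (ihom B X)" "ihom B (ihom C X)" "dual_functor C B X" by (rule smf_dual_functor) simp_all
  note [simp] = strictD[OF T.strict_Rn_functor] strictD[OF strict_dual_functor] T.smf_Rn T.Rn_functor_FA T.Rn_simps[OF G.smf_dual] H.smf_dual_ob
  \<comment> \<open>Evaluating the internal transpose at \<open>a\<close> is precomposition with the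
    functor \<open>a \<otimes> -\<close>, so the question reduces to
    \<open>dual_pre\<close>.\<close>
  have d: "dual_ob C ?H a = smf_comp C (ihom B X) (pre B (tensor A B) X (eta_ob A B a)) G" if a [simp]: "a \<in> Ob A" for a
  proof -
    have p: "SMF (ihom (tensor A B) X) (ihom B X) (pre B (tensor A B) X (eta_ob A B a))" by (rule smf_pre[OF X T.smf_eta_ob[OF a]])
    interpret p: symmetric_monoidal_functor "ihom (tensor A B) X" "ihom B X" "pre B (tensor A B) X (eta_ob A B a)" by (rule p)
    show ?thesis
      by (rule smf_ihom_eqI[OF H.smf_dual_ob[OF a] smf_comp[OF assms(3) p]]) (simp_all add: strictD[OF strict_pre] smf_comp[OF T.smf_eta_ob])
  qed
  have o: "smf_comp B (ihom C X) (dual C (tensor A B) X G) (eta_ob A B a) = dual C B X (dual_ob C ?H a)" if "a \<in> Ob A" for a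
    using G.dual_pre[OF T.smf_eta_ob[OF that]] that by (simp add: d)
  show ?thesis
    by (rule smf_ihom2_eqI[OF T.smf_Rn[OF G.smf_dual] smf_comp[OF H.smf_dual D.symmetric_monoidal_functor_axioms]])
      (simp_all add: o)
qed

text \<open>The candidate inverse is forced: the transpose of the identity of
  \<open>A \<otimes> (B \<otimes> C)\<close> is \<open>eta\<close>; it is transposed once more
  internally, and the result is turned back into a functor out of the other bracketing by two
  \<open>En\<close>.\<close>

lemma smf_inverse_A:
  assumes "SMC A" "SMC B" "SMC C"
  defines "X \<equiv> tensor A (tensor B C)"
  defines "F \<equiv> En (tensor A B) C X (En A B (ihom C X) (smf_comp A (ihom B (ihom C X)) (Rn_functor B C X) (eta A (tensor B C))))"
  shows "SMF (tensor (tensor A B) C) X F"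
    and "Rn A B (ihom C X) (Rn (tensor A B) C X F) = smf_comp A (ihom B (ihom C X)) (Rn_functor B C X) (eta A (tensor B C))"
proof -
  have [simp]: "SMC A" "SMC B" "SMC C" "SMC X" using assms by (simp_all add: X_def)
  have r: "SMF A (ihom B (ihom C X)) (smf_comp A (ihom B (ihom C X)) (Rn_functor B C X) (eta A (tensor B C)))"
    unfolding X_def by (rule smf_comp[OF smf_eta smf_Rn_functor]) simp_all
  show "SMF (tensor (tensor A B) C) X F"
    and "Rn A B (ihom C X) (Rn (tensor A B) C X F) = smf_comp A (ihom B (ihom C X)) (Rn_functor B C X) (eta A (tensor B C))"
    using r by (simp_all add: F_def smf_En Rn_En)
qed

section \<open>The free symmetric monoidal category on one object, and the unit arrows\<close>

lemma presents_unit: "presents unit_pres"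
  by unfold_locales (simp add: unit_pres_def)

lemma smc_unit [simp]: "SMC unit_smc"
proof -
  interpret presents unit_pres by (rule presents_unit)
  show ?thesis unfolding unit_smc_def by (rule S.symmetric_monoidal_category_axioms)
qed

abbreviation star :: "unit_ob" where "star \<equiv> GenW ()"

lemma star_Ob [simp]: "star \<in> Ob unit_smc"
  by (simp add: unit_smc_def presented_def words_def unit_pres_def)

lemma smf_unit_ext:
  assumes "SMC X" "x \<in> Ob X"
  shows "SMF unit_smc X (strict_ext unit_pres X (\<lambda>_. x) (\<lambda>_. undefined))"
    and "FO (strict_ext unit_pres X (\<lambda>_. x) (\<lambda>_. undefined)) star = x"
    and "SMF unit_smc X F \<Longrightarrow> FO F star = x \<Longrightarrow> (strict_ext unit_pres X (\<lambda>_. x) (\<lambda>_. undefined), F) \<in> sim unit_smc X"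
proof -
  interpret X: symmetric_monoidal_category X by fact
  interpret presents unit_pres by (rule presents_unit)
  interpret sound_assignment unit_pres X "\<lambda>_. x" "\<lambda>_. undefined"
    by unfold_locales (use assms in \<open>auto simp: X.assignment_def unit_pres_def\<close>)
  show "SMF unit_smc X (strict_ext unit_pres X (\<lambda>_. x) (\<lambda>_. undefined))"
    unfolding unit_smc_def by (rule smf_strict_ext)
  show "FO (strict_ext unit_pres X (\<lambda>_. x) (\<lambda>_. undefined)) star = x"
    using strict_ext_simps(1)[of star] by (simp add: unit_pres_def)
  show "(strict_ext unit_pres X (\<lambda>_. x) (\<lambda>_. undefined), F) \<in> sim unit_smc X" if "SMF unit_smc X F" "FO F star = x"
  proof -
    have "MT S X (strict_ext unit_pres X (\<lambda>_. x) (\<lambda>_. undefined)) F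
      (\<lambda>Y\<in>words unit_pres. symmetric_monoidal_functor.lax_comp S X F GenW (\<lambda>_. idt X x) Y)"
      by (rule mt_strict_ext) (use that assms in \<open>auto simp: unit_smc_def unit_pres_def\<close>)
    then show ?thesis unfolding unit_smc_def by (rule mt_sim)
  qed
qed

text \<open>Both functors receive a 2-cell from the strict functor with the same value at the
  generator, hence a zigzag of length two.\<close>

lemma sim_unit:
  assumes "SMF unit_smc X F" "SMF unit_smc X G" "FO F star = FO G star"
  shows "(F, G) \<in> sim unit_smc X"
proof -
  have "SMC X" "FO F star \<in> Ob X" using assms(1) smf_target smf_FO_Ob[OF assms(1) star_Ob] by auto
  note e = smf_unit_ext(3)[OF this]
  show ?thesis by (rule sim_trans[OF sim_sym[OF e[OF assms(1)]] e[OF assms(2)]]) (simp_all add: assms(3))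
qed

lemma smf_v:
  assumes "SMC A"
  shows "SMF unit_smc (ihom A A) (v_functor A)" "FO (v_functor A) star = smf_id A"
  using smf_unit_ext(1,2)[of "ihom A A" "smf_id A"] assms smf_id[OF assms] by (simp_all add: v_functor_def)

text \<open>The last claim, which is the value at the generator of the transpose of
  \<open>L\<close>, provides a section of \<open>L\<close> and later its inverse in the
  quotient.\<close>

lemma smf_L:
  assumes "SMC A"
  shows "SMF (tensor unit_smc A) A (L_functor A)" "Rn unit_smc A A (L_functor A) = v_functor A"
    and "a \<in> Ob A \<Longrightarrow> FO (L_functor A) (GenW (star, a)) = a"
    and "smf_comp A A (L_functor A) (eta_ob unit_smc A star) = smf_id A"
proof -
  show 1: "SMF (tensor unit_smc A) A (L_functor A)" and 2: "Rn unit_smc A A (L_functor A) = v_functor A"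
    using assms smf_v[OF assms] by (simp_all add: L_functor_def smf_En Rn_En)
  show "a \<in> Ob A \<Longrightarrow> FO (L_functor A) (GenW (star, a)) = a"
    using assms smf_v[OF assms] by (simp add: L_functor_def FO_En_GenW)
  interpret tensor_pair unit_smc A by (rule tensor_pairI) (use assms in simp_all)
  show "smf_comp A A (L_functor A) (eta_ob unit_smc A star) = smf_id A"
    using Rn_simps(1)[OF 1 star_Ob] 2 smf_v(2)[OF assms] by simp
qed

lemma smf_R:
  assumes "SMC A"
  shows "SMF (tensor A unit_smc) A (R_functor A)" "Rn A unit_smc A (R_functor A) = dual unit_smc A A (v_functor A)"
  using assms ihom_functor.smf_dual[OF ihom_functorI[OF smf_v(1)[OF assms]]]
  by (simp_all add: R_functor_def smf_En Rn_En)

text \<open>Precomposing with \<open>L\<close> and transposing introduces a variable in the unit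
  category. Putting the generator there undoes it, because \<open>\<star> \<otimes> -\<close> is a
  section of \<open>L\<close>. This is the only value the triangle needs.\<close>

lemma triangle_dual_star:
  assumes "SMC B" "SMC X" "SMF A (ihom B X) H"
  shows "dual_ob A (smf_comp A (ihom unit_smc (ihom B X)) (Rn_functor unit_smc B X)
      (smf_comp A (ihom (tensor unit_smc B) X) (pre (tensor unit_smc B) B X (L_functor B)) H)) star = H"
    (is "dual_ob A ?K star = H")
proof -
  note [simp] = assms smf_source[OF assms(3)]
  note L = smf_L[OF assms(1)]
  interpret T: tensor_triple unit_smc B X by (rule tensor_tripleI) simp_all
  interpret H: ihom_functor A B X H by (rule ihom_functorI) simp_all
  have p: "SMF (ihom B X) (ihom (tensor unit_smc B) X) (pre (tensor unit_smc B) B X (L_functor B))" by (rule smf_pre[OF assms(2) L(1)])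
  interpret p: symmetric_monoidal_functor "ihom B X" "ihom (tensor unit_smc B) X" "pre (tensor unit_smc B) B X (L_functor B)" by (rule p)
  interpret R: symmetric_monoidal_functor "ihom (tensor unit_smc B) X" "ihom unit_smc (ihom B X)" "Rn_functor unit_smc B X" by (rule T.smf_Rn_functor)
  interpret K: ihom_functor A unit_smc "ihom B X" ?K
    by (rule ihom_functorI[OF smf_comp[OF smf_comp[OF assms(3) p] T.smf_Rn_functor]]) simp_all
  note [simp] = strictD[OF T.strict_Rn_functor] strictD[OF strict_pre] smf_comp[OF L(1)] L(3)
  have o: "smf_comp B X (smf_comp (tensor unit_smc B) X F (L_functor B)) (eta_ob unit_smc B star) = F" if "SMF B X F" for F
    using that smf_comp_assoc[OF T.smf_eta_ob[OF star_Ob] L(1) that] L(4) by simp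
  show ?thesis
    by (rule smf_ihom_eqI[OF K.smf_dual_ob[OF star_Ob] assms(3)]) (simp_all add: o smf_comp_const[OF L(1)] smf_comp_box[OF L(1)])
qed

section \<open>The quotient category\<close>

lemma qclass_eq: "(F, G) \<in> sim A B \<Longrightarrow> qclass A B F = qclass A B G"
proof -
  assume h: "(F, G) \<in> sim A B"
  have "sim A B `` {F} = sim A B `` {G}"
    using sim_trans[OF h] sim_trans[OF sim_sym[OF h]] by auto
  then show ?thesis by (simp add: qclass_def)
qed

lemma qclass_eq_iff: "SMF A B F \<Longrightarrow> qclass A B F = qclass A B G \<longleftrightarrow> (F, G) \<in> sim A B"
proof
  assume "SMF A B F" "qclass A B F = qclass A B G"
  then have "(G, F) \<in> sim A B" using sim_refl by (auto simp: qclass_def)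
  then show "(F, G) \<in> sim A B" by (rule sim_sym)
qed (rule qclass_eq)

text \<open>Operations on quotient arrows unite the classes coming from all representatives. If the
  operation respects \<open>\<sim>\<close>, the union is the class obtained from one
  representative.\<close>

lemma UN_sim:
  assumes "\<And>G. (F, G) \<in> sim A B \<Longrightarrow> (f F, f G) \<in> sim A' B'" "SMF A B F"
  shows "(\<Union>G\<in>sim A B `` {F}. sim A' B' `` {f G}) = sim A' B' `` {f F}"
  using sim_trans[OF assms(1)] sim_refl[OF assms(2)] by auto

text \<open>Well-formedness is separated from source and target, so that side conditions of the laws
  below become equations between \<open>qdom\<close> and \<open>qcod\<close>, which the simplifier
  decides.\<close>

definition qarr :: "('o, 'm, 'p, 'n) qarrow \<Rightarrow> bool" where
  "qarr P \<longleftrightarrow> P \<in> qhom (qdom P) (qcod P)"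

lemma qdom_qclass [simp]: "qdom (qclass A B F) = A" and qcod_qclass [simp]: "qcod (qclass A B F) = B"
  by (simp_all add: qclass_def)

lemma qhom_iff: "P \<in> qhom A B \<longleftrightarrow> qarr P \<and> qdom P = A \<and> qcod P = B"
  by (auto simp: qarr_def qhom_def)

lemma qarr_qclass [simp]: "SMF A B F \<Longrightarrow> qarr (qclass A B F)"
  by (auto simp: qarr_def qhom_def)

lemma qarrE:
  assumes "qarr P"
  obtains A B F where "P = qclass A B F" "SMF A B F" "SMC A" "SMC B"
  using assms smf_source smf_target by (fastforce simp: qarr_def qhom_def)

lemma qarr_SMC [simp]: "qarr P \<Longrightarrow> SMC (qdom P)" "qarr P \<Longrightarrow> SMC (qcod P)"
  by (auto elim: qarrE)

lemma qcomp_class: "SMF A B F \<Longrightarrow> SMF B C G \<Longrightarrow> qclass B C G \<odot> qclass A B F = qclass A C (smf_comp A C G F)"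
proof -
  assume F: "SMF A B F" and G: "SMF B C G"
  have "(\<Union>G'\<in>sim B C `` {G}. \<Union>F'\<in>sim A B `` {F}. sim A C `` {smf_comp A C G' F'}) = (\<Union>G'\<in>sim B C `` {G}. sim A C `` {smf_comp A C G' F})"
    by (rule SUP_cong[OF HOL.refl], rule UN_sim[OF _ F]) (auto dest: sim_smf intro: sim_comp_left)
  also have "\<dots> = sim A C `` {smf_comp A C G F}"
    by (rule UN_sim[OF _ G]) (rule sim_comp_right[OF _ F])
  finally show ?thesis by (simp add: qcomp_def qclass_def)
qed

lemma qdom_qcomp [simp]: "qdom (Q \<odot> P) = qdom P" and qcod_qcomp [simp]: "qcod (Q \<odot> P) = qcod Q"
  by (simp_all add: qcomp_def)

lemma qarr_qcomp [simp]: "qarr P \<Longrightarrow> qarr Q \<Longrightarrow> qdom Q = qcod P \<Longrightarrow> qarr (Q \<odot> P)"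
  by (elim qarrE) (auto simp: qcomp_class intro: qarr_qclass smf_comp)

lemma qcomp_assoc [simp]:
  "qarr P \<Longrightarrow> qarr Q \<Longrightarrow> qarr R \<Longrightarrow> qdom Q = qcod P \<Longrightarrow> qdom R = qcod Q \<Longrightarrow> (R \<odot> Q) \<odot> P = R \<odot> (Q \<odot> P)"
  by (elim qarrE) (auto simp: qcomp_class smf_comp smf_comp_assoc)

lemma qid_simps [simp]: "qdom (qid A) = A" "qcod (qid A) = A" "SMC A \<Longrightarrow> qarr (qid A)"
  by (simp_all add: qid_def smf_id)

lemma qcomp_qid [simp]: "qarr P \<Longrightarrow> qdom P = A \<Longrightarrow> P \<odot> qid A = P"
  by (elim qarrE) (auto simp: qid_def qcomp_class smf_id)

lemma qid_qcomp [simp]: "qarr P \<Longrightarrow> qcod P = A \<Longrightarrow> qid A \<odot> P = P"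
  by (elim qarrE) (auto simp: qid_def qcomp_class smf_id)

lemma qihom_class: "SMC B \<Longrightarrow> SMF C D F \<Longrightarrow> qihom B (qclass C D F) = qclass (ihom B C) (ihom B D) (post B C D F)"
  using UN_sim[of F C D "post B C D"] sim_post[of B F _ C D] by (simp add: qihom_def qclass_def)

lemma qdom_qihom [simp]: "qdom (qihom B P) = ihom B (qdom P)" and qcod_qihom [simp]: "qcod (qihom B P) = ihom B (qcod P)"
  by (simp_all add: qihom_def)

lemma qarr_qihom [simp]: "SMC B \<Longrightarrow> qarr P \<Longrightarrow> qarr (qihom B P)"
  by (elim qarrE) (simp add: qihom_class smf_post)

lemma qihom_comp: "SMC B \<Longrightarrow> qarr P \<Longrightarrow> qarr Q \<Longrightarrow> qdom Q = qcod P \<Longrightarrow> qihom B (Q \<odot> P) = qihom B Q \<odot> qihom B P"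
  by (elim qarrE) (auto simp: qcomp_class qihom_class smf_comp smf_post post_comp)

lemma qihom_id: "SMC B \<Longrightarrow> SMC C \<Longrightarrow> qihom B (qid C) = qid (ihom B C)"
  by (simp add: qid_def qihom_class smf_id post_id)

section \<open>Precomposition and duality on classes\<close>

definition qpre where
  "qpre C P = \<lparr>qdom = ihom (qcod P) C, qcod = ihom (qdom P) C,
     qcls = (\<Union>F\<in>qcls P. sim (ihom (qcod P) C) (ihom (qdom P) C) `` {pre (qdom P) (qcod P) C F})\<rparr>"

lemma qpre_class: "SMC C \<Longrightarrow> SMF A B F \<Longrightarrow> qpre C (qclass A B F) = qclass (ihom B C) (ihom A C) (pre A B C F)"
  using UN_sim[of F A B "pre A B C"] sim_pre[of C F _ A B] by (simp add: qpre_def qclass_def)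

lemma qdom_qpre [simp]: "qdom (qpre C P) = ihom (qcod P) C" and qcod_qpre [simp]: "qcod (qpre C P) = ihom (qdom P) C"
  by (simp_all add: qpre_def)

lemma qarr_qpre [simp]: "SMC C \<Longrightarrow> qarr P \<Longrightarrow> qarr (qpre C P)"
  by (elim qarrE) (simp add: qpre_class smf_pre)

lemma qpre_comp: "SMC C \<Longrightarrow> qarr P \<Longrightarrow> qarr Q \<Longrightarrow> qdom Q = qcod P \<Longrightarrow> qpre C (Q \<odot> P) = qpre C P \<odot> qpre C Q"
  by (elim qarrE) (auto simp: qcomp_class qpre_class smf_comp smf_pre pre_comp)

lemma qpre_qihom:
  "qarr P \<Longrightarrow> qarr Q \<Longrightarrow> qdom P = B \<Longrightarrow> qcod P = B' \<Longrightarrow> qdom Q = C \<Longrightarrow> qcod Q = C' \<Longrightarrow>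
   qpre C' P \<odot> qihom B' Q = qihom B Q \<odot> qpre C P"
  by (elim qarrE) (auto simp: qcomp_class qpre_class qihom_class smf_post smf_pre pre_post)

definition qdual where
  "qdual B C P = \<lparr>qdom = B, qcod = ihom (qdom P) C,
     qcls = (\<Union>F\<in>qcls P. sim B (ihom (qdom P) C) `` {dual (qdom P) B C F})\<rparr>"

lemma qdual_class: "SMC B \<Longrightarrow> SMC C \<Longrightarrow> SMF A (ihom B C) F \<Longrightarrow> qdual B C (qclass A (ihom B C) F) = qclass B (ihom A C) (dual A B C F)"
  using UN_sim[of F A "ihom B C" "dual A B C"] sim_dual[of B C F _ A] by (simp add: qdual_def qclass_def)

lemma smf_dual': "SMC B \<Longrightarrow> SMC C \<Longrightarrow> SMF A (ihom B C) F \<Longrightarrow> SMF B (ihom A C) (dual A B C F)"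
  by (rule ihom_functor.smf_dual[OF ihom_functorI])

lemma qdom_qdual [simp]: "qdom (qdual B C P) = B" and qcod_qdual [simp]: "qcod (qdual B C P) = ihom (qdom P) C"
  by (simp_all add: qdual_def)

lemma qarr_qdual [simp]: "SMC B \<Longrightarrow> SMC C \<Longrightarrow> qarr P \<Longrightarrow> qcod P = ihom B C \<Longrightarrow> qarr (qdual B C P)"
  by (elim qarrE) (simp add: qdual_class smf_dual')

lemma qdual_qdual: "SMC B \<Longrightarrow> SMC C \<Longrightarrow> qarr P \<Longrightarrow> qdom P = A \<Longrightarrow> qcod P = ihom B C \<Longrightarrow> qdual A C (qdual B C P) = P"
  by (elim qarrE) (auto simp: qdual_class smf_dual' ihom_functor.dual_dual[OF ihom_functorI])

lemma qdual_qihom: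
  "SMC B \<Longrightarrow> SMC C \<Longrightarrow> qarr P \<Longrightarrow> qarr K \<Longrightarrow> qcod P = ihom B C \<Longrightarrow> qdom K = C \<Longrightarrow> qcod K = D \<Longrightarrow>
   qdual B D (qihom B K \<odot> P) = qihom (qdom P) K \<odot> qdual B C P"
  by (elim qarrE) (auto simp: qdual_class qcomp_class qihom_class smf_post smf_comp smf_dual' ihom_functor.dual_post[OF ihom_functorI])

lemma qdual_comp:
  "SMC B \<Longrightarrow> SMC C \<Longrightarrow> qarr P \<Longrightarrow> qarr G \<Longrightarrow> qcod P = ihom B C \<Longrightarrow> qdom P = qcod G \<Longrightarrow>
   qdual B C (P \<odot> G) = qpre C G \<odot> qdual B C P"
  by (elim qarrE) (auto simp: qdual_class qcomp_class qpre_class smf_pre smf_comp smf_dual' ihom_functor.dual_comp[OF ihom_functorI])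

section \<open>Classes of the canonical functors, and cancellation of transpositions\<close>

definition "qeta A B = qclass A (ihom B (tensor A B)) (eta A B)"
definition "qRnf A B C = qclass (ihom (tensor A B) C) (ihom A (ihom B C)) (Rn_functor A B C)"
definition "qdualf A B C = qclass (ihom A (ihom B C)) (ihom B (ihom A C)) (dual_functor A B C)"
definition "qv A = qclass unit_smc (ihom A A) (v_functor A)"

lemma canonical_simps [simp]:
  "qdom (qeta A B) = A" "qcod (qeta A B) = ihom B (tensor A B)" "SMC A \<Longrightarrow> SMC B \<Longrightarrow> qarr (qeta A B)"
  "qdom (qRnf A B C) = ihom (tensor A B) C" "qcod (qRnf A B C) = ihom A (ihom B C)"
  "SMC A \<Longrightarrow> SMC B \<Longrightarrow> SMC C \<Longrightarrow> qarr (qRnf A B C)"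
  "qdom (qdualf A B C) = ihom A (ihom B C)" "qcod (qdualf A B C) = ihom B (ihom A C)"
  "SMC A \<Longrightarrow> SMC B \<Longrightarrow> SMC C \<Longrightarrow> qarr (qdualf A B C)"
  "qdom (qv A) = unit_smc" "qcod (qv A) = ihom A A" "SMC A \<Longrightarrow> qarr (qv A)"
  "qdom (qA A B C) = tensor A (tensor B C)" "qcod (qA A B C) = tensor (tensor A B) C"
  "SMC A \<Longrightarrow> SMC B \<Longrightarrow> SMC C \<Longrightarrow> qarr (qA A B C)"
  "qdom (qS A B) = tensor A B" "qcod (qS A B) = tensor B A" "SMC A \<Longrightarrow> SMC B \<Longrightarrow> qarr (qS A B)"
  "qdom (qL A) = tensor unit_smc A" "qcod (qL A) = A" "SMC A \<Longrightarrow> qarr (qL A)"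
  "qdom (qR A) = tensor A unit_smc" "qcod (qR A) = A" "SMC A \<Longrightarrow> qarr (qR A)"
  by (simp_all add: qeta_def qRnf_def qdualf_def qv_def qA_def qS_def qL_def qR_def smf_eta smf_Rn_functor smf_dual_functor
    smf_v smf_A smf_S smf_L smf_R)

lemma qRn_class:
  "SMC A \<Longrightarrow> SMC B \<Longrightarrow> SMF (tensor A B) C F \<Longrightarrow> qRn A B (qclass (tensor A B) C F) = qclass A (ihom B C) (Rn A B C F)"
  using UN_sim[of F "tensor A B" C "Rn A B C"] tensor_pair.sim_Rn[OF tensor_pairI, of A B F _ C]
  by (simp add: qRn_def qclass_def)

lemma qRn_eq:
  "SMC A \<Longrightarrow> SMC B \<Longrightarrow> qarr P \<Longrightarrow> qdom P = tensor A B \<Longrightarrow> qRn A B P = qihom B P \<odot> qeta A B"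
  by (elim qarrE) (auto simp: qRn_class qihom_class qeta_def qcomp_class smf_eta smf_post Rn_def)

text \<open>Composition of \<open>qihom B P\<close> with \<open>qeta A B\<close> is transposition of
  \<open>P\<close> (\<open>qRn_eq\<close>), so this is injectivity of transposition, in the form in
  which diagrams out of a tensor are tested.\<close>

lemma qeta_cancel:
  assumes "SMC A" "SMC B" "qarr P" "qarr Q" "qdom P = tensor A B" "qdom Q = tensor A B" "qcod P = qcod Q"
    and "qihom B P \<odot> qeta A B = qihom B Q \<odot> qeta A B"
  shows "P = Q"
  using assms(3,4)
proof (elim qarrE)
  fix A1 A2 C1 C2 F G assume h: "P = qclass A1 C1 F" "SMF A1 C1 F" "Q = qclass A2 C2 G" "SMF A2 C2 G" "SMC C1"
  then have [simp]: "A1 = tensor A B" "A2 = tensor A B" "C2 = C1" using assms by auto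
  have "qRn A B P = qRn A B Q" using assms by (simp add: qRn_eq)
  then have "(Rn A B C1 F, Rn A B C1 G) \<in> sim A (ihom B C1)"
    using h assms by (simp add: qRn_class qclass_eq_iff smf_Rn)
  then have "(F, G) \<in> sim (tensor A B) C1"
    using h assms by (intro tensor_triple.Rn_cancel[OF tensor_tripleI]) simp_all
  then show ?thesis using h by (simp add: qclass_eq)
qed

lemma qRnf_cancel:
  assumes "SMC A" "SMC B" "SMC C" "qarr P" "qarr Q" "qdom P = qdom Q" "qcod P = ihom (tensor A B) C" "qcod Q = ihom (tensor A B) C"
    and "qRnf A B C \<odot> P = qRnf A B C \<odot> Q"
  shows "P = Q"
  using assms(4,5)
proof (elim qarrE)
  fix A1 A2 C1 C2 F G assume h: "P = qclass A1 C1 F" "SMF A1 C1 F" "Q = qclass A2 C2 G" "SMF A2 C2 G"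
  then have [simp]: "A2 = A1" "C1 = ihom (tensor A B) C" "C2 = ihom (tensor A B) C" using assms by auto
  have "(smf_comp A1 (ihom A (ihom B C)) (Rn_functor A B C) F, smf_comp A1 (ihom A (ihom B C)) (Rn_functor A B C) G) \<in> sim A1 (ihom A (ihom B C))"
    using h assms by (simp add: qRnf_def qcomp_class smf_Rn_functor qclass_eq_iff smf_comp[OF _ smf_Rn_functor])
  then have "(F, G) \<in> sim A1 (ihom (tensor A B) C)"
    using h assms by (intro tensor_triple.Rn_functor_cancel[OF tensor_tripleI]) simp_all
  then show ?thesis using h by (simp add: qclass_eq)
qed

lemma qihom_qRnf_cancel:
  assumes "SMC A" "SMC B" "SMC C" "SMC D" "qarr P" "qarr Q" "qdom P = qdom Q" "qcod P = ihom D (ihom (tensor A B) C)" "qcod Q = ihom D (ihom (tensor A B) C)"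
    and "qihom D (qRnf A B C) \<odot> P = qihom D (qRnf A B C) \<odot> Q"
  shows "P = Q"
  using assms(5,6)
proof (elim qarrE)
  fix A1 A2 C1 C2 F G assume h: "P = qclass A1 C1 F" "SMF A1 C1 F" "Q = qclass A2 C2 G" "SMF A2 C2 G"
  then have [simp]: "A2 = A1" "C1 = ihom D (ihom (tensor A B) C)" "C2 = ihom D (ihom (tensor A B) C)" using assms by auto
  let ?p = "post D (ihom (tensor A B) C) (ihom A (ihom B C)) (Rn_functor A B C)"
  have p: "SMF (ihom D (ihom (tensor A B) C)) (ihom D (ihom A (ihom B C))) ?p"
    by (rule smf_post[OF _ smf_Rn_functor]) (use assms in simp_all)
  have "(smf_comp A1 (ihom D (ihom A (ihom B C))) ?p F, smf_comp A1 (ihom D (ihom A (ihom B C))) ?p G) \<in> sim A1 (ihom D (ihom A (ihom B C)))"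
    using h assms p by (simp add: qRnf_def qihom_class qcomp_class smf_Rn_functor qclass_eq_iff smf_comp[OF _ p])
  then have "(F, G) \<in> sim A1 (ihom D (ihom (tensor A B) C))"
    using h assms by (intro tensor_triple.post_Rn_functor_cancel[OF tensor_tripleI]) simp_all
  then show ?thesis using h by (simp add: qclass_eq)
qed

text \<open>By definition the functor is \<open>En\<close> applied to the transpose of the identity,
  so \<open>eps\<close> at the identity provides the 2-cell.\<close>

lemma sim_tensor_right_id:
  assumes "SMC A" "SMC B"
  shows "(tensor_right A B B (smf_id B), smf_id (tensor A B)) \<in> sim (tensor A B) (tensor A B)"
proof -
  interpret T: tensor_pair A B by (rule tensor_pairI) fact+
  have "tensor_right A B B (smf_id B) = En A B (tensor A B) (Rn A B (tensor A B) (smf_id (tensor A B)))"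
    using assms by (simp add: tensor_right_def pre_id T.Rn_id smf_eta)
  then show ?thesis
    using tensor_pair.sim_eps[OF tensor_pairI[OF assms] smf_id[of "tensor A B"]] assms by simp
qed

lemma sim_tensor_left_id:
  assumes "SMC A" "SMC B"
  shows "(tensor_left A A B (smf_id A), smf_id (tensor A B)) \<in> sim (tensor A B) (tensor A B)"
proof -
  interpret T: tensor_pair A B by (rule tensor_pairI) fact+
  have "tensor_left A A B (smf_id A) = En A B (tensor A B) (Rn A B (tensor A B) (smf_id (tensor A B)))"
    using assms by (simp add: tensor_left_def T.Rn_id smf_eta)
  then show ?thesis
    using tensor_pair.sim_eps[OF tensor_pairI[OF assms] smf_id[of "tensor A B"]] assms by simp
qed

lemma sim_tensor_left:
  assumes "(F, G) \<in> sim A A'" "SMC B"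
  shows "(tensor_left A A' B F, tensor_left A A' B G) \<in> sim (tensor A B) (tensor A' B)"
proof -
  have F: "SMF A A' F" using sim_smf[OF assms(1)] by simp
  note s [simp] = smf_source[OF F] smf_target[OF F] assms(2)
  show ?thesis
    unfolding tensor_left_def
    by (rule tensor_triple.sim_En[OF tensor_tripleI]) (simp_all add: sim_comp_left[OF assms(1)] smf_eta)
qed

lemma sim_tensor_right:
  assumes "(F, G) \<in> sim B B'" "SMC A"
  shows "(tensor_right A B B' F, tensor_right A B B' G) \<in> sim (tensor A B) (tensor A B')"
proof -
  have F: "SMF B B' F" using sim_smf[OF assms(1)] by simp
  note s [simp] = smf_source[OF F] smf_target[OF F] assms(2)
  show ?thesis
    unfolding tensor_right_def
    by (rule tensor_triple.sim_En[OF tensor_tripleI]) (simp_all add: sim_comp_right[OF sim_pre[OF _ assms(1)]] smf_eta)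
qed

lemma smf_tensor_smf:
  "SMF A A' F \<Longrightarrow> SMF B B' G \<Longrightarrow> SMF (tensor A B) (tensor A' B') (tensor_smf A A' B B' F G)"
  unfolding tensor_smf_def
  by (rule smf_comp[OF smf_tensor_right(1) smf_tensor_left(1)]) (auto dest: smf_source smf_target)

lemma sim_tensor_smf:
  assumes "(F, F') \<in> sim A A'" "(G, G') \<in> sim B B'"
  shows "(tensor_smf A A' B B' F G, tensor_smf A A' B B' F' G') \<in> sim (tensor A B) (tensor A' B')"
  unfolding tensor_smf_def
  using sim_smf[OF assms(1)] sim_smf[OF assms(2)]
  by (intro sim_comp[OF sim_tensor_right[OF assms(2)] sim_tensor_left[OF assms(1)]]) (auto dest: smf_source smf_target)

lemma qtensor_class:
  assumes F: "SMF A A' F" and G: "SMF B B' G"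
  shows "qclass A A' F @@ qclass B B' G = qclass (tensor A B) (tensor A' B') (tensor_smf A A' B B' F G)"
proof -
  let ?s = "sim (tensor A B) (tensor A' B')"
  have "(\<Union>F'\<in>sim A A' `` {F}. \<Union>G'\<in>sim B B' `` {G}. ?s `` {tensor_smf A A' B B' F' G'}) =
    (\<Union>F'\<in>sim A A' `` {F}. ?s `` {tensor_smf A A' B B' F' G})"
    by (rule SUP_cong[OF HOL.refl], rule UN_sim[OF _ G]) (auto dest: sim_smf intro: sim_tensor_smf sim_refl)
  also have "\<dots> = ?s `` {tensor_smf A A' B B' F G}"
    by (rule UN_sim[OF _ F]) (rule sim_tensor_smf[OF _ sim_refl[OF G]])
  finally show ?thesis by (simp add: qtensor_def qclass_def)
qed

lemma qdom_qtensor [simp]: "qdom (P @@ Q) = tensor (qdom P) (qdom Q)"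
  and qcod_qtensor [simp]: "qcod (P @@ Q) = tensor (qcod P) (qcod Q)"
  by (simp_all add: qtensor_def)

lemma qarr_qtensor [simp]: "qarr P \<Longrightarrow> qarr Q \<Longrightarrow> qarr (P @@ Q)"
  by (elim qarrE) (simp add: qtensor_class smf_tensor_smf)

lemma qtensor_left:
  assumes "SMF A A' F" "SMC B"
  shows "qclass A A' F @@ qid B = qclass (tensor A B) (tensor A' B) (tensor_left A A' B F)"
proof -
  note s = smf_source[OF assms(1)] smf_target[OF assms(1)] and l = smf_tensor_left(1)[OF assms]
  have "(tensor_smf A A' B B F (smf_id B), tensor_left A A' B F) \<in> sim (tensor A B) (tensor A' B)"
    using sim_comp_left[OF sim_tensor_right_id[OF s(1) assms(2)] l] l by (simp add: tensor_smf_def)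
  then show ?thesis using assms by (simp add: qid_def qtensor_class smf_id qclass_eq)
qed

lemma qtensor_right:
  assumes "SMF B B' G" "SMC A"
  shows "qid A @@ qclass B B' G = qclass (tensor A B) (tensor A B') (tensor_right A B B' G)"
proof -
  note s = smf_source[OF assms(1)] smf_target[OF assms(1)] and r = smf_tensor_right(1)[OF assms]
  have "(tensor_smf A A B B' (smf_id A) G, tensor_right A B B' G) \<in> sim (tensor A B) (tensor A B')"
    using sim_comp_right[OF sim_tensor_left_id[OF assms(2) s(2)] r] r by (simp add: tensor_smf_def)
  then show ?thesis using assms by (simp add: qid_def qtensor_class smf_id qclass_eq)
qed

text \<open>The tensor of 1-cells is defined as a composite of two one-sided tensors; modulo
  \<open>\<sim>\<close> these are tensors with an identity class.\<close>

lemma qtensor_split: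
  "qarr P \<Longrightarrow> qarr Q \<Longrightarrow> P @@ Q = (P @@ qid (qcod Q)) \<odot> (qid (qdom P) @@ Q)"
  by (elim qarrE) (simp add: qtensor_left qtensor_right qtensor_class tensor_smf_def
    qcomp_class[OF smf_tensor_right(1) smf_tensor_left(1)])

lemma qtensor_id: "SMC A \<Longrightarrow> SMC B \<Longrightarrow> qid A @@ qid B = qid (tensor A B)"
  using qtensor_left[OF smf_id[of A], of B] qclass_eq[OF sim_tensor_left_id[of A B]] by (simp add: qid_def)

lemma qeta_left:
  "SMC B \<Longrightarrow> qarr P \<Longrightarrow> qdom P = A \<Longrightarrow> qihom B (P @@ qid B) \<odot> qeta A B = qeta (qcod P) B \<odot> P"
  by (elim qarrE) (simp add: qtensor_left qihom_class smf_tensor_left qeta_def qcomp_class smf_eta smf_post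
     smf_tensor_left(3)[unfolded Rn_def])

lemma qeta_right:
  "SMC A \<Longrightarrow> qarr Q \<Longrightarrow> qdom Q = B \<Longrightarrow> qihom B (qid A @@ Q) \<odot> qeta A B = qpre (tensor A (qcod Q)) Q \<odot> qeta A (qcod Q)"
  by (elim qarrE) (simp add: qtensor_right qihom_class qpre_class smf_tensor_right qeta_def qcomp_class smf_eta smf_post smf_pre
     smf_tensor_right(3)[unfolded Rn_def])

text \<open>The universal arrow is natural in \<open>A\<close> and extranatural in \<open>B\<close>.
  By \<open>qeta_cancel\<close> the equation characterizes the tensor of two classes, and the
  definition of the tensor of functors is no longer needed.\<close>

lemma qeta_tensor:
  assumes "qarr P" "qarr Q" "qdom P = A" "qdom Q = B"
  shows "qihom B (P @@ Q) \<odot> qeta A B = qpre (tensor (qcod P) (qcod Q)) Q \<odot> qeta (qcod P) (qcod Q) \<odot> P"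
proof -
  have [simp]: "SMC A" "SMC B" using assms by auto
  have "qihom B (P @@ Q) \<odot> qeta A B = qihom B (P @@ qid (qcod Q)) \<odot> qihom B (qid A @@ Q) \<odot> qeta A B"
    using assms by (subst qtensor_split) (simp_all add: qihom_comp)
  also have "\<dots> = (qihom B (P @@ qid (qcod Q)) \<odot> qpre (tensor A (qcod Q)) Q) \<odot> qeta A (qcod Q)"
    using assms by (simp add: qeta_right)
  also have "\<dots> = (qpre (tensor (qcod P) (qcod Q)) Q \<odot> qihom (qcod Q) (P @@ qid (qcod Q))) \<odot> qeta A (qcod Q)"
    using assms by (simp only: qpre_qihom[of "P @@ qid (qcod Q)" Q] qpre_qihom[symmetric] qarr_qtensor qid_simps qarr_SMC qdom_qtensor qcod_qtensor)
  also have "\<dots> = qpre (tensor (qcod P) (qcod Q)) Q \<odot> qeta (qcod P) (qcod Q) \<odot> P"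
    using assms by (simp add: qeta_left)
  finally show ?thesis .
qed

text \<open>Both sides are transposed. The only real move is to slide precomposition with
  \<open>Q\<close> past postcomposition with the tensor of \<open>P'\<close> and \<open>Q'\<close>,
  after which \<open>qeta_tensor\<close> applies a second time.\<close>

lemma qtensor_comp:
  assumes "qarr P" "qarr Q" "qarr P'" "qarr Q'" "qdom P' = qcod P" "qdom Q' = qcod Q"
  shows "(P' \<odot> P) @@ (Q' \<odot> Q) = (P' @@ Q') \<odot> (P @@ Q)"
proof (rule qeta_cancel[of "qdom P" "qdom Q"])
  let ?A = "qdom P" and ?B = "qdom Q" and ?A' = "qcod P" and ?B' = "qcod Q" and ?A'' = "qcod P'" and ?B'' = "qcod Q'"
  have "qihom ?B ((P' @@ Q') \<odot> (P @@ Q)) \<odot> qeta ?A ?B = qihom ?B (P' @@ Q') \<odot> qpre (tensor ?A' ?B') Q \<odot> qeta ?A' ?B' \<odot> P"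
    using assms by (simp add: qihom_comp qeta_tensor)
  also have "\<dots> = (qihom ?B (P' @@ Q') \<odot> qpre (tensor ?A' ?B') Q) \<odot> qeta ?A' ?B' \<odot> P"
    using assms by simp
  also have "\<dots> = (qpre (tensor ?A'' ?B'') Q \<odot> qihom ?B' (P' @@ Q')) \<odot> qeta ?A' ?B' \<odot> P"
    using assms by (simp add: qpre_qihom[of Q "P' @@ Q'"] del: qcomp_assoc)
  also have "\<dots> = qpre (tensor ?A'' ?B'') Q \<odot> (qihom ?B' (P' @@ Q') \<odot> qeta ?A' ?B') \<odot> P"
    using assms by simp
  also have "\<dots> = qpre (tensor ?A'' ?B'') (Q' \<odot> Q) \<odot> qeta ?A'' ?B'' \<odot> (P' \<odot> P)"
    using assms by (simp add: qeta_tensor qpre_comp)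
  also have "\<dots> = qihom ?B ((P' \<odot> P) @@ (Q' \<odot> Q)) \<odot> qeta ?A ?B"
    using assms by (simp add: qeta_tensor)
  finally show "qihom ?B ((P' \<odot> P) @@ (Q' \<odot> Q)) \<odot> qeta ?A ?B = qihom ?B ((P' @@ Q') \<odot> (P @@ Q)) \<odot> qeta ?A ?B" ..
qed (use assms in simp_all)

section \<open>Rules for transposing composites with canonical arrows\<close>

lemma qRnf_qihom:
  "SMC A \<Longrightarrow> SMC B \<Longrightarrow> qarr K \<Longrightarrow> qcod K = D \<Longrightarrow>
   qRnf A B D \<odot> qihom (tensor A B) K = qihom A (qihom B K) \<odot> qRnf A B (qdom K)"
  by (elim qarrE) (simp add: qRnf_def qihom_class smf_post qcomp_class smf_Rn_functor Rn_functor_post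
    qcomp_class[OF _ smf_Rn_functor] qcomp_class[OF smf_Rn_functor])

lemma qRnf_left:
  "SMC B \<Longrightarrow> SMC C \<Longrightarrow> qarr P \<Longrightarrow> qdom P = A \<Longrightarrow>
   qRnf A B C \<odot> qpre C (P @@ qid B) = qpre (ihom B C) P \<odot> qRnf (qcod P) B C"
  by (elim qarrE) (simp add: qRnf_def qtensor_left smf_tensor_left qpre_class smf_pre Rn_functor_pre_left
    qcomp_class[OF _ smf_Rn_functor] qcomp_class[OF smf_Rn_functor])

lemma qRnf_right:
  "SMC A \<Longrightarrow> SMC C \<Longrightarrow> qarr Q \<Longrightarrow> qdom Q = B \<Longrightarrow>
   qRnf A B C \<odot> qpre C (qid A @@ Q) = qihom A (qpre C Q) \<odot> qRnf A (qcod Q) C"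
  by (elim qarrE) (simp add: qRnf_def qtensor_right smf_tensor_right qpre_class qihom_class smf_pre smf_post Rn_functor_pre_right
    qcomp_class[OF _ smf_Rn_functor] qcomp_class[OF smf_Rn_functor])

lemma qRnf_S:
  "SMC A \<Longrightarrow> SMC B \<Longrightarrow> SMC C \<Longrightarrow> qRnf A B C \<odot> qpre C (qS A B) = qdualf B A C \<odot> qRnf B A C"
  by (simp add: qRnf_def qS_def qdualf_def smf_S qpre_class smf_pre smf_dual_functor Rn_functor_pre_S
    qcomp_class[OF _ smf_Rn_functor] qcomp_class[OF smf_Rn_functor])

lemma qeta_S: "SMC A \<Longrightarrow> SMC B \<Longrightarrow> qihom B (qS A B) \<odot> qeta A B = qdual A (tensor B A) (qeta B A)"
  by (simp add: qeta_def qS_def smf_S qihom_class smf_post smf_eta qdual_class qcomp_class smf_S(2)[unfolded Rn_def])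

lemma qRnf_pre_A:
  assumes "SMC A" "SMC B" "SMC C" "SMC D"
  shows "qihom A (qRnf B C D) \<odot> qRnf A (tensor B C) D \<odot> qpre D (qA A B C) = qRnf A B (ihom C D) \<odot> qRnf (tensor A B) C D"
proof -
  note [simp] = assms
  have 1: "SMF (ihom (tensor (tensor A B) C) D) (ihom (tensor A (tensor B C)) D) (pre (tensor A (tensor B C)) (tensor (tensor A B) C) D (A_functor A B C))"
    by (rule smf_pre[OF _ smf_A(1)]) simp_all
  show ?thesis
    using Rn_functor_pre_A[OF assms]
    by (simp add: qRnf_def qA_def smf_A qpre_class qihom_class smf_Rn_functor qcomp_class[OF 1 smf_Rn_functor]
      qcomp_class[OF smf_comp[OF 1 smf_Rn_functor] smf_post[OF _ smf_Rn_functor]] qcomp_class[OF smf_Rn_functor smf_Rn_functor])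
qed

lemma qeta_A:
  assumes "SMC A" "SMC B" "SMC C"
  defines "X \<equiv> tensor (tensor A B) C"
  shows "qRnf B C X \<odot> qihom (tensor B C) (qA A B C) \<odot> qeta A (tensor B C) = qihom B (qeta (tensor A B) C) \<odot> qeta A B"
proof -
  note [simp] = assms(1-3)
  have 1: "qihom (tensor B C) (qA A B C) \<odot> qeta A (tensor B C) = qclass A (ihom (tensor B C) X) (Rn A (tensor B C) X (A_functor A B C))"
    using qRn_eq[of A "tensor B C" "qA A B C"] by (simp add: X_def qA_def qRn_class smf_A(1))
  show ?thesis
    using smf_A(3)[OF assms(1-3)] unfolding 1
    by (simp add: qRnf_def X_def qcomp_class smf_Rn smf_A(1) smf_Rn_functor qeta_def qihom_class smf_eta
      qcomp_class[OF smf_eta smf_post[OF _ smf_eta]])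
qed

lemma qdual_qpre:
  "SMC C \<Longrightarrow> qarr G \<Longrightarrow> qarr F \<Longrightarrow> qcod F = ihom (qcod G) C \<Longrightarrow> qdom G = B \<Longrightarrow>
   qdual B C (qpre C G \<odot> F) = qdual (qcod G) C F \<odot> G"
  by (elim qarrE) (auto simp: qdual_class qcomp_class qpre_class smf_pre smf_comp smf_dual' ihom_functor.dual_pre[OF ihom_functorI])

text \<open>The transpose of a composite with a tensor is the transpose of \<open>K\<close>,
  precomposed in both variables.\<close>

lemma qihom_comp_tensor:
  assumes "qarr P" "qarr Q" "qdom P = A" "qdom Q = B" "qarr K" "qdom K = tensor (qcod P) (qcod Q)"
  shows "qihom B (K \<odot> (P @@ Q)) \<odot> qeta A B = qpre (qcod K) Q \<odot> qihom (qcod Q) K \<odot> qeta (qcod P) (qcod Q) \<odot> P"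
proof -
  have "qihom B (K \<odot> (P @@ Q)) \<odot> qeta A B = (qihom B K \<odot> qpre (tensor (qcod P) (qcod Q)) Q) \<odot> qeta (qcod P) (qcod Q) \<odot> P"
    using assms by (auto simp: qihom_comp qeta_tensor)
  also have "\<dots> = (qpre (qcod K) Q \<odot> qihom (qcod Q) K) \<odot> qeta (qcod P) (qcod Q) \<odot> P"
    using assms by (simp only: qpre_qihom[OF assms(2,5) assms(4) HOL.refl assms(6) HOL.refl])
  finally show ?thesis using assms by simp
qed

lemma qRnf_tensor:
  assumes "qarr P" "qarr Q" "qdom P = A" "qdom Q = B" "SMC X"
  shows "qRnf A B X \<odot> qpre X (P @@ Q) = qihom A (qpre X Q) \<odot> qpre (ihom (qcod Q) X) P \<odot> qRnf (qcod P) (qcod Q) X"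
proof -
  have [simp]: "SMC A" "SMC B" using assms by auto
  have "qRnf A B X \<odot> qpre X (P @@ Q) = (qRnf A B X \<odot> qpre X (qid A @@ Q)) \<odot> qpre X (P @@ qid (qcod Q))"
    using assms by (subst qtensor_split) (simp_all add: qpre_comp)
  also have "\<dots> = qihom A (qpre X Q) \<odot> qRnf A (qcod Q) X \<odot> qpre X (P @@ qid (qcod Q))"
    using assms by (subst qRnf_right) simp_all
  finally show ?thesis using assms by (simp add: qRnf_left)
qed

text \<open>Composition with the associativity disappears on transposing twice: the right side is
  the ordinary double transpose of \<open>K\<close> from the other bracketing. Read from right to
  left, it introduces an associativity where the calculation needs one.\<close>

lemma qA_transpose:
  assumes "SMC A" "SMC B" "SMC C" "qarr K" "qdom K = tensor (tensor A B) C" "qcod K = X"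
  shows "qRnf B C X \<odot> qihom (tensor B C) (K \<odot> qA A B C) \<odot> qeta A (tensor B C) =
    qihom B (qihom C K \<odot> qeta (tensor A B) C) \<odot> qeta A B"
proof -
  let ?Y = "tensor (tensor A B) C"
  have [simp]: "SMC X" using assms by auto
  note [simp] = assms
  have "qRnf B C X \<odot> qihom (tensor B C) (K \<odot> qA A B C) \<odot> qeta A (tensor B C) =
    (qRnf B C X \<odot> qihom (tensor B C) K) \<odot> qihom (tensor B C) (qA A B C) \<odot> qeta A (tensor B C)"
    by (simp add: qihom_comp)
  also have "\<dots> = qihom B (qihom C K) \<odot> qRnf B C ?Y \<odot> qihom (tensor B C) (qA A B C) \<odot> qeta A (tensor B C)"
    by (subst qRnf_qihom) simp_all
  also have "\<dots> = qihom B (qihom C K) \<odot> qihom B (qeta (tensor A B) C) \<odot> qeta A B"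
    by (simp only: qeta_A assms)
  finally show ?thesis by (simp add: qihom_comp)
qed

lemma qA_cancel:
  assumes "SMC A" "SMC B" "SMC C" "qarr P" "qarr Q" "qdom P = tensor A (tensor B C)" "qdom Q = tensor A (tensor B C)" "qcod P = X" "qcod Q = X"
    and "qRnf B C X \<odot> qihom (tensor B C) P \<odot> qeta A (tensor B C) = qRnf B C X \<odot> qihom (tensor B C) Q \<odot> qeta A (tensor B C)"
  shows "P = Q"
proof (rule qeta_cancel)
  have "SMC X" using assms by auto
  then show "qihom (tensor B C) P \<odot> qeta A (tensor B C) = qihom (tensor B C) Q \<odot> qeta A (tensor B C)"
    using assms by (intro qRnf_cancel[where A=B and B=C and C=X]) simp_all
qed (use assms in simp_all)

text \<open>The transpose of the symmetry is the dual of \<open>eta\<close>, so the claim is that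
  duality is an involution.\<close>

lemma qS_qS:
  assumes [simp]: "SMC A" "SMC B"
  shows "qS B A \<odot> qS A B = qid (tensor A B)"
proof (rule qeta_cancel[of A B])
  have "qihom B (qS B A \<odot> qS A B) \<odot> qeta A B = qihom B (qS B A) \<odot> qdual A (tensor B A) (qeta B A)"
    by (simp add: qihom_comp qeta_S)
  also have "\<dots> = qdual A (tensor A B) (qihom A (qS B A) \<odot> qeta B A)"
    by (subst qdual_qihom[where C="tensor B A"]) simp_all
  also have "\<dots> = qeta A B"
    by (simp add: qeta_S qdual_qdual)
  finally show "qihom B (qS B A \<odot> qS A B) \<odot> qeta A B = qihom B (qid (tensor A B)) \<odot> qeta A B"
    by (simp add: qihom_id)
qed simp_all

lemma qS_natural:
  assumes P: "qarr P" "qdom P = A" "qcod P = A'" and Q: "qarr Q" "qdom Q = B" "qcod Q = B'"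
  shows "qS A' B' \<odot> (P @@ Q) = (Q @@ P) \<odot> qS A B"
proof (rule qeta_cancel[of A B])
  have [simp]: "SMC A" "SMC A'" "SMC B" "SMC B'" using assms by auto
  note [simp] = assms
  let ?X = "tensor B' A'"
  have "qihom B ((Q @@ P) \<odot> qS A B) \<odot> qeta A B = qihom B (Q @@ P) \<odot> qdual A (tensor B A) (qeta B A)"
    by (simp add: qihom_comp qeta_S)
  also have "\<dots> = qdual A ?X (qihom A (Q @@ P) \<odot> qeta B A)"
    by (subst qdual_qihom[where C="tensor B A"]) simp_all
  also have "\<dots> = qdual A ?X ((qpre ?X P \<odot> qeta B' A') \<odot> Q)"
    by (simp add: qeta_tensor)
  also have "\<dots> = qpre ?X Q \<odot> qdual A ?X (qpre ?X P \<odot> qeta B' A')"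
    by (rule qdual_comp) simp_all
  also have "\<dots> = qihom B (qS A' B' \<odot> (P @@ Q)) \<odot> qeta A B"
    by (simp add: qdual_qpre qihom_comp_tensor qeta_S[symmetric])
  finally show "qihom B (qS A' B' \<odot> (P @@ Q)) \<odot> qeta A B = qihom B ((Q @@ P) \<odot> qS A B) \<odot> qeta A B" ..
qed (use assms in auto)

lemma qiso_qS: "SMC A \<Longrightarrow> SMC B \<Longrightarrow> qiso (qS A B)"
  unfolding qiso_def by (rule bexI[of _ "qS B A"]) (simp_all add: qS_qS qhom_iff)

text \<open>After two transpositions both associativities have become instances of
  \<open>qeta\<close>. The rest is \<open>qeta_tensor\<close> for the inner and the outer tensor,
  and one exchange of pre- and postcomposition.\<close>

lemma qA_natural:
  assumes P: "qarr P" "qdom P = A" "qcod P = A'" and Q: "qarr Q" "qdom Q = B" "qcod Q = B'"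
    and R: "qarr R" "qdom R = C" "qcod R = C'"
  shows "qA A' B' C' \<odot> (P @@ (Q @@ R)) = ((P @@ Q) @@ R) \<odot> qA A B C"
proof (rule qA_cancel[of A B C])
  have [simp]: "SMC A" "SMC A'" "SMC B" "SMC B'" "SMC C" "SMC C'" using assms by auto
  note [simp] = assms
  let ?X = "tensor (tensor A' B') C'"
  have "qRnf B C ?X \<odot> qihom (tensor B C) (qA A' B' C' \<odot> (P @@ (Q @@ R))) \<odot> qeta A (tensor B C) =
    (qRnf B C ?X \<odot> qpre ?X (Q @@ R)) \<odot> qihom (tensor B' C') (qA A' B' C') \<odot> qeta A' (tensor B' C') \<odot> P"
    by (simp add: qihom_comp_tensor)
  also have "\<dots> = qihom B (qpre ?X R) \<odot> qpre (ihom C' ?X) Q \<odot>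
      (qRnf B' C' ?X \<odot> qihom (tensor B' C') (qA A' B' C') \<odot> qeta A' (tensor B' C')) \<odot> P"
    by (subst qRnf_tensor) simp_all
  also have "\<dots> = (qihom B (qpre ?X R) \<odot> qpre (ihom C' ?X) Q) \<odot> qihom B' (qeta (tensor A' B') C') \<odot> qeta A' B' \<odot> P"
    by (subst qeta_A) simp_all
  also have "\<dots> = (qpre (ihom C ?X) Q \<odot> qihom B' (qpre ?X R)) \<odot> qihom B' (qeta (tensor A' B') C') \<odot> qeta A' B' \<odot> P"
    using qpre_qihom[of Q "qpre ?X R" B B' "ihom C' ?X" "ihom C ?X"] by (simp del: qcomp_assoc)
  also have "\<dots> = qihom B ((qpre ?X R \<odot> qeta (tensor A' B') C') \<odot> (P @@ Q)) \<odot> qeta A B"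
    by (subst qihom_comp_tensor) (simp_all add: qihom_comp)
  also have "\<dots> = qihom B (qihom C ((P @@ Q) @@ R) \<odot> qeta (tensor A B) C) \<odot> qeta A B"
    by (simp add: qeta_tensor)
  also have "\<dots> = qRnf B C ?X \<odot> qihom (tensor B C) (((P @@ Q) @@ R) \<odot> qA A B C) \<odot> qeta A (tensor B C)"
    by (simp add: qA_transpose)
  finally show "qRnf B C ?X \<odot> qihom (tensor B C) (qA A' B' C' \<odot> (P @@ (Q @@ R))) \<odot> qeta A (tensor B C) =
    qRnf B C ?X \<odot> qihom (tensor B C) (((P @@ Q) @@ R) \<odot> qA A B C) \<odot> qeta A (tensor B C)" .
qed (use assms in auto)

lemma qiso_qA:
  assumes [simp]: "SMC A" "SMC B" "SMC C"
  shows "qiso (qA A B C)"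
proof -
  let ?X = "tensor A (tensor B C)" and ?Y = "tensor (tensor A B) C"
  obtain F where F: "SMF ?Y ?X F" "Rn A B (ihom C ?X) (Rn (tensor A B) C ?X F) = smf_comp A (ihom B (ihom C ?X)) (Rn_functor B C ?X) (eta A (tensor B C))"
    using smf_inverse_A[OF assms] by blast
  define Q where "Q = qclass ?Y ?X F"
  have Q [simp]: "qarr Q" "qdom Q = ?Y" "qcod Q = ?X" using F by (simp_all add: Q_def)
  have "qRn A B (qRn (tensor A B) C Q) = qRnf B C ?X \<odot> qeta A (tensor B C)"
    using F by (simp add: Q_def qRn_class smf_Rn qRnf_def qeta_def qcomp_class smf_eta smf_Rn_functor)
  then have t: "qihom B (qihom C Q \<odot> qeta (tensor A B) C) \<odot> qeta A B = qRnf B C ?X \<odot> qeta A (tensor B C)"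
    by (simp add: qRn_eq)
  have "Q \<odot> qA A B C = qid ?X"
    by (rule qA_cancel[of A B C _ _ ?X]) (simp_all add: qA_transpose t qihom_id)
  \<comment> \<open>This composite starts at \<open>(A \<otimes> B) \<otimes> C\<close>, where two
    external transpositions suffice; \<open>qA_cancel\<close> is for the other bracketing.\<close>
  moreover have "qA A B C \<odot> Q = qid ?Y"
  proof (rule qeta_cancel[of "tensor A B" C], simp_all, rule qeta_cancel[of A B], simp_all)
    have "qihom B (qihom C (qA A B C \<odot> Q) \<odot> qeta (tensor A B) C) \<odot> qeta A B = qihom B (qihom C (qA A B C)) \<odot> qihom B (qihom C Q \<odot> qeta (tensor A B) C) \<odot> qeta A B"
      by (simp add: qihom_comp)
    also have "\<dots> = (qihom B (qihom C (qA A B C)) \<odot> qRnf B C ?X) \<odot> qeta A (tensor B C)"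
      by (simp add: t)
    also have "\<dots> = (qRnf B C ?Y \<odot> qihom (tensor B C) (qA A B C)) \<odot> qeta A (tensor B C)"
      by (subst qRnf_qihom) simp_all
    also have "\<dots> = qihom B (qihom C (qid ?Y) \<odot> qeta (tensor A B) C) \<odot> qeta A B"
      by (simp add: qeta_A qihom_id)
    finally show "qihom B (qihom C (qA A B C \<odot> Q) \<odot> qeta (tensor A B) C) \<odot> qeta A B = qihom B (qihom C (qid ?Y) \<odot> qeta (tensor A B) C) \<odot> qeta A B" .
  qed
  ultimately show ?thesis
    unfolding qiso_def by (intro bexI[of _ Q]) (simp_all add: qhom_iff)
qed

text \<open>Three transpositions bring both paths into \<open>[B, [C, [D, X]]]\<close>. The path of
  two associativities becomes a chain of three \<open>qeta\<close>. The other path is recovered from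
  this chain by reading the transposition rules backwards.\<close>

lemma pentagon:
  assumes [simp]: "SMC A" "SMC B" "SMC C" "SMC D"
  shows "qA (tensor A B) C D \<odot> qA A B (tensor C D) = (qA A B C @@ qid D) \<odot> qA A (tensor B C) D \<odot> (qid A @@ qA B C D)"
    (is "?L = ?R")
proof (rule qA_cancel[of A B "tensor C D"], simp_all, rule qihom_qRnf_cancel[of C D _ B], simp_all)
  let ?X = "tensor (tensor (tensor A B) C) D" and ?Y = "tensor B (tensor C D)" and ?Z = "tensor (tensor B C) D"
  let ?M = "(qA A B C @@ qid D) \<odot> qA A (tensor B C) D"
  have "qihom B (qRnf C D ?X) \<odot> qRnf B (tensor C D) ?X \<odot> qihom ?Y ?L \<odot> qeta A ?Y =
    qihom B (qRnf C D ?X \<odot> qihom (tensor C D) (qA (tensor A B) C D) \<odot> qeta (tensor A B) (tensor C D)) \<odot> qeta A B"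
    by (subst qA_transpose) (simp_all add: qihom_comp)
  also have "\<dots> = qihom B (qihom C (qeta (tensor (tensor A B) C) D) \<odot> qeta (tensor A B) C) \<odot> qeta A B"
    by (simp add: qeta_A)
  \<comment> \<open>\<open>qA_transpose\<close> from right to left, with the outermost
    \<open>qeta\<close> in the role of \<open>K\<close>; this creates the associativity of
    \<open>A\<close>, \<open>B\<close>, \<open>C\<close>.\<close>
  also have "\<dots> = qRnf B C (ihom D ?X) \<odot> qihom (tensor B C) (qeta (tensor (tensor A B) C) D \<odot> qA A B C) \<odot> qeta A (tensor B C)"
    by (simp add: qA_transpose)
  also have "\<dots> = qRnf B C (ihom D ?X) \<odot> qihom (tensor B C) (qihom D (qA A B C @@ qid D) \<odot> qeta (tensor A (tensor B C)) D) \<odot> qeta A (tensor B C)"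
    by (simp add: qeta_left)
  also have "\<dots> = (qRnf B C (ihom D ?X) \<odot> qRnf (tensor B C) D ?X) \<odot> qihom ?Z ?M \<odot> qeta A ?Z"
    by (simp add: qA_transpose)
  \<comment> \<open>So far the last three factors were bracketed as
    \<open>(B \<otimes> C) \<otimes> D\<close>. Rebracketing them costs a precomposition with the
    associativity of \<open>B\<close>, \<open>C\<close>, \<open>D\<close>, which is the last factor
    of the second path.\<close>
  also have "\<dots> = (qihom B (qRnf C D ?X) \<odot> qRnf B (tensor C D) ?X \<odot> qpre ?X (qA B C D)) \<odot> qihom ?Z ?M \<odot> qeta A ?Z"
    by (subst qRnf_pre_A) simp_all
  also have "\<dots> = qihom B (qRnf C D ?X) \<odot> qRnf B (tensor C D) ?X \<odot> qihom ?Y (?M \<odot> (qid A @@ qA B C D)) \<odot> qeta A ?Y"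
    by (subst qihom_comp_tensor) simp_all
  finally show "qihom B (qRnf C D ?X) \<odot> qRnf B (tensor C D) ?X \<odot> qihom ?Y ?L \<odot> qeta A ?Y =
      qihom B (qRnf C D ?X) \<odot> qRnf B (tensor C D) ?X \<odot> qihom ?Y ?R \<odot> qeta A ?Y"
    by simp
qed

lemma qRn_dual:
  assumes "SMC A" "SMC B" "SMC X" "qarr G" "qdom G = C" "qcod G = ihom (tensor A B) X"
  shows "qihom B (qdual (tensor A B) X G) \<odot> qeta A B = qdualf C B X \<odot> qdual A (ihom B X) (qRnf A B X \<odot> G)"
  using assms(4)
proof (elim qarrE)
  fix C' Y F assume "G = qclass C' Y F" "SMF C' Y F" "SMC C'"
  then have G: "G = qclass C (ihom (tensor A B) X) F" and F: "SMF C (ihom (tensor A B) X) F" and C: "SMC C"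
    using assms by auto
  note [simp] = C assms(1-3)
  note R = smf_comp[OF F smf_Rn_functor[OF assms(1-3)]]
  have "qihom B (qdual (tensor A B) X G) \<odot> qeta A B = qclass A (ihom B (ihom C X)) (Rn A B (ihom C X) (dual C (tensor A B) X F))"
    using qRn_eq[of A B "qdual (tensor A B) X G"] F by (simp add: G qdual_class smf_dual' qRn_class)
  then show ?thesis
    using F R Rn_dual[OF assms(1,2) F assms(3)]
    by (simp add: G qRnf_def qdualf_def qcomp_class smf_Rn_functor qdual_class smf_dual' qcomp_class[OF smf_dual'[OF _ _ R] smf_dual_functor])
qed

text \<open>The two variables \<open>A\<close> and \<open>B\<close> are moved past \<open>C\<close>
  together on one side and separately on the other. In internal homs, the former is the dual of a
  functor into \<open>[A \<otimes> B, X]\<close>, the latter two successive dualities.\<close>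

lemma hexagon:
  assumes [simp]: "SMC A" "SMC B" "SMC C"
  shows "qA C A B \<odot> qS (tensor A B) C \<odot> qA A B C = (qS A C @@ qid B) \<odot> qA A C B \<odot> (qid A @@ qS B C)"
    (is "?L = ?R")
proof (rule qA_cancel[of A B C], simp_all)
  let ?X = "tensor (tensor C A) B" and ?Y = "tensor B C" and ?Z = "tensor C B"
  let ?G = "qihom (tensor A B) (qA C A B) \<odot> qeta C (tensor A B)" and ?M = "(qS A C @@ qid B) \<odot> qA A C B"
  have "qRnf B C ?X \<odot> qihom ?Y ((qA C A B \<odot> qS (tensor A B) C) \<odot> qA A B C) \<odot> qeta A ?Y =
      qihom B (qihom C (qA C A B) \<odot> qdual (tensor A B) (tensor C (tensor A B)) (qeta C (tensor A B))) \<odot> qeta A B"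
    by (subst qA_transpose) (simp_all add: qihom_comp qeta_S)
  also have "\<dots> = qihom B (qdual (tensor A B) ?X ?G) \<odot> qeta A B"
    by (subst qdual_qihom[where C="tensor C (tensor A B)"]) simp_all
  \<comment> \<open>Here the joint move is split into the two separate ones.\<close>
  also have "\<dots> = qdualf C B ?X \<odot> qdual A (ihom B ?X) (qRnf A B ?X \<odot> ?G)"
    by (rule qRn_dual) simp_all
  also have "\<dots> = qdualf C B ?X \<odot> qdual A (ihom B ?X) (qihom A (qeta (tensor C A) B) \<odot> qeta C A)"
    by (simp add: qeta_A)
  also have "\<dots> = qdualf C B ?X \<odot> qihom C (qeta (tensor C A) B) \<odot> qdual A (tensor C A) (qeta C A)"
    by (subst qdual_qihom[where C="tensor C A"]) simp_all
  also have "\<dots> = qdualf C B ?X \<odot> qihom C (qihom B (qS A C @@ qid B) \<odot> qeta (tensor A C) B) \<odot> qeta A C"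
    by (simp add: qeta_left qihom_comp qeta_S)
  also have "\<dots> = (qdualf C B ?X \<odot> qRnf C B ?X) \<odot> qihom ?Z ?M \<odot> qeta A ?Z"
    by (simp add: qA_transpose)
  \<comment> \<open>The internal duality is traded for precomposition with the symmetry of
    \<open>B\<close> and \<open>C\<close>, available because a transposition in these variables has
    been produced just before.\<close>
  also have "\<dots> = (qRnf B C ?X \<odot> qpre ?X (qS B C)) \<odot> qihom ?Z ?M \<odot> qeta A ?Z"
    by (simp only: qRnf_S assms smc_tensor)
  also have "\<dots> = qRnf B C ?X \<odot> qihom ?Y (?M \<odot> (qid A @@ qS B C)) \<odot> qeta A ?Y"
    by (subst qihom_comp_tensor) simp_all
  finally show "qRnf B C ?X \<odot> qihom ?Y ?L \<odot> qeta A ?Y = qRnf B C ?X \<odot> qihom ?Y ?R \<odot> qeta A ?Y"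
    by simp
qed

text \<open>A functor out of \<open>\<I> \<otimes> A\<close> is determined up to \<open>\<sim>\<close> by its restriction along \<open>\<star> \<otimes> -\<close>,
  because its transpose starts from the free symmetric monoidal category on \<open>\<star>\<close>.\<close>

lemma qclass_unit_tensor_eqI:
  assumes "SMC A" and F: "SMF (tensor unit_smc A) B F" and G: "SMF (tensor unit_smc A) B G"
    and "smf_comp A B F (eta_ob unit_smc A star) = smf_comp A B G (eta_ob unit_smc A star)"
  shows "qclass (tensor unit_smc A) B F = qclass (tensor unit_smc A) B G"
proof (rule qclass_eq)
  note s [simp] = assms(1) smf_target[OF F]
  interpret tensor_pair unit_smc A by (rule tensor_pairI) simp_all
  have "(Rn unit_smc A B F, Rn unit_smc A B G) \<in> sim unit_smc (ihom A B)"
    by (rule sim_unit) (use assms in \<open>simp_all add: smf_Rn Rn_simps\<close>)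
  then show "(F, G) \<in> sim (tensor unit_smc A) B"
    using F G by (intro tensor_triple.Rn_cancel[OF tensor_tripleI]) simp_all
qed

text \<open>The inverse is \<open>\<star> \<otimes> -\<close>. One composite is an identity already
  before passing to classes; the other is compared with the identity by restricting along
  \<open>\<star> \<otimes> -\<close> once more.\<close>

lemma qiso_qL:
  assumes [simp]: "SMC A"
  shows "qiso (qL A)"
proof -
  let ?I = "tensor unit_smc A" and ?e = "eta_ob unit_smc A star"
  interpret tensor_pair unit_smc A by (rule tensor_pairI) simp_all
  have e: "SMF A ?I ?e" by (rule smf_eta_ob[OF star_Ob])
  note L = smf_L[OF assms]
  have "smf_comp A ?I (smf_comp ?I ?I ?e (L_functor A)) ?e = smf_comp A ?I (smf_id ?I) ?e"
    by (simp only: smf_comp_assoc[OF e L(1) e, symmetric] L(4) smf_comp_id[OF e])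
  then have "qclass ?I ?I (smf_comp ?I ?I ?e (L_functor A)) = qclass ?I ?I (smf_id ?I)"
    using L e by (intro qclass_unit_tensor_eqI[OF assms smf_comp[OF L(1) e] smf_id]) simp_all
  then have "qclass A ?I ?e \<odot> qL A = qid ?I"
    using e L(1) by (simp add: qL_def qcomp_class qid_def)
  moreover have "qL A \<odot> qclass A ?I ?e = qid A"
    using e L by (simp add: qL_def qcomp_class qid_def)
  ultimately show ?thesis
    unfolding qiso_def using e by (intro bexI[of _ "qclass A ?I ?e"]) (simp_all add: qhom_iff)
qed

lemma qL_natural:
  assumes "qarr P" "qdom P = A" "qcod P = A'"
  shows "qL A' \<odot> (qid unit_smc @@ P) = P \<odot> qL A"
  using assms(1)
proof (elim qarrE)
  fix X Y F assume "P = qclass X Y F" "SMF X Y F" "SMC X" "SMC Y"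
  then have P: "P = qclass A A' F" and F: "SMF A A' F" and [simp]: "SMC A" "SMC A'"
    using assms by auto
  let ?I = "tensor unit_smc A" and ?e = "eta_ob unit_smc A star"
  interpret tensor_pair unit_smc A by (rule tensor_pairI) simp_all
  have e: "SMF A ?I ?e" by (rule smf_eta_ob[OF star_Ob])
  note L = smf_L(1)[OF \<open>SMC A\<close>] and L' = smf_L(1)[OF \<open>SMC A'\<close>] and T = smf_tensor_right(1)[OF F smc_unit]
  interpret V: symmetric_monoidal_functor unit_smc "ihom A' A'" "v_functor A'" by (rule smf_v) simp
  note LT = smf_comp[OF T L'] and FL = smf_comp[OF L F]
  \<comment> \<open>Restriction along \<open>\<star> \<otimes> -\<close> is the value of the
    transpose at the generator. For the left path this is the value of \<open>v\<close> there, an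
    identity functor, precomposed with \<open>F\<close>.\<close>
  have "smf_comp A A' (smf_comp ?I A' (L_functor A') (tensor_right unit_smc A A' F)) ?e = FO (Rn unit_smc A A' (smf_comp ?I A' (L_functor A') (tensor_right unit_smc A A' F))) star"
    using LT by (simp add: Rn_simps)
  also have "\<dots> = F"
    using F by (simp add: Rn_tensor_right[OF F smc_unit L'] smf_L(2) smf_v(2) smf_id)
  also have "\<dots> = smf_comp A A' (smf_comp ?I A' F (L_functor A)) ?e"
    by (simp only: smf_comp_assoc[OF e L F, symmetric] smf_L(4)[OF \<open>SMC A\<close>] smf_comp_id[OF F])
  finally have "qclass ?I A' (smf_comp ?I A' (L_functor A') (tensor_right unit_smc A A' F)) = qclass ?I A' (smf_comp ?I A' F (L_functor A))"
    by (rule qclass_unit_tensor_eqI[OF \<open>SMC A\<close> LT FL])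
  then show ?thesis
    using F T L L' by (simp add: P qL_def qtensor_right qcomp_class)
qed

lemma qeta_L: "SMC A \<Longrightarrow> qihom A (qL A) \<odot> qeta unit_smc A = qv A"
  using qRn_eq[of unit_smc A "qL A"] by (simp add: qL_def qRn_class smf_L(1,2) qv_def)

lemma qeta_R: "SMC A \<Longrightarrow> qihom unit_smc (qR A) \<odot> qeta A unit_smc = qdual A A (qv A)"
  using qRn_eq[of A unit_smc "qR A"] by (simp add: qR_def qRn_class smf_R(1,2) qv_def qdual_class smf_v(1))

text \<open>Both transposes are the dual of \<open>v\<close>. The equation is an axiom, and it also
  transfers invertibility and naturality from \<open>L\<close> to \<open>R\<close>.\<close>

lemma qL_qS:
  assumes [simp]: "SMC A"
  shows "qL A \<odot> qS A unit_smc = qR A"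
proof (rule qeta_cancel[of A unit_smc])
  have "qihom unit_smc (qL A \<odot> qS A unit_smc) \<odot> qeta A unit_smc = qihom unit_smc (qL A) \<odot> qdual A (tensor unit_smc A) (qeta unit_smc A)"
    by (simp add: qihom_comp qeta_S)
  also have "\<dots> = qdual A A (qihom A (qL A) \<odot> qeta unit_smc A)"
    by (subst qdual_qihom[where C="tensor unit_smc A"]) simp_all
  finally show "qihom unit_smc (qL A \<odot> qS A unit_smc) \<odot> qeta A unit_smc = qihom unit_smc (qR A) \<odot> qeta A unit_smc"
    by (simp add: qeta_L qeta_R)
qed simp_all

lemma qiso_qcomp:
  assumes "qiso P" "qiso Q" "qarr P" "qarr Q" "qdom Q = qcod P"
  shows "qiso (Q \<odot> P)"
proof -
  obtain P' Q' where [simp]: "qarr P'" "qdom P' = qcod P" "qcod P' = qdom P" "qarr Q'" "qdom Q' = qcod Q" "qcod Q' = qdom Q"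
    and i: "P' \<odot> P = qid (qdom P)" "P \<odot> P' = qid (qcod P)" "Q' \<odot> Q = qid (qdom Q)" "Q \<odot> Q' = qid (qcod Q)"
    using assms(1,2) by (auto simp: qiso_def qhom_iff)
  have "(P' \<odot> Q') \<odot> (Q \<odot> P) = P' \<odot> (Q' \<odot> Q) \<odot> P" "(Q \<odot> P) \<odot> (P' \<odot> Q') = Q \<odot> (P \<odot> P') \<odot> Q'"
    using assms by simp_all
  then show ?thesis
    unfolding qiso_def using assms i by (intro bexI[of _ "P' \<odot> Q'"]) (simp_all add: qhom_iff del: qcomp_assoc)
qed

lemma qiso_qR: "SMC A \<Longrightarrow> qiso (qR A)"
  using qiso_qcomp[OF qiso_qS qiso_qL, of A unit_smc A] by (simp add: qL_qS)

lemma qR_natural: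
  assumes "qarr P" "qdom P = A" "qcod P = A'"
  shows "qR A' \<odot> (P @@ qid unit_smc) = P \<odot> qR A"
proof -
  have [simp]: "SMC A" "SMC A'" using assms by auto
  have "qR A' \<odot> (P @@ qid unit_smc) = qL A' \<odot> qS A' unit_smc \<odot> (P @@ qid unit_smc)"
    using assms by (simp add: qL_qS[symmetric])
  also have "\<dots> = (qL A' \<odot> (qid unit_smc @@ P)) \<odot> qS A unit_smc"
    using assms by (simp add: qS_natural[of P A A' "qid unit_smc"])
  finally show ?thesis
    using assms by (simp add: qL_natural qL_qS)
qed

lemma qclass_unit_eqI:
  "SMF unit_smc X F \<Longrightarrow> SMF unit_smc X G \<Longrightarrow> FO F star = FO G star \<Longrightarrow> qclass unit_smc X F = qclass unit_smc X G"
  by (rule qclass_eq) (rule sim_unit)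

text \<open>The unit sits in the middle, so after two transpositions the functors start at
  \<open>A\<close> and cannot be tested at the generator. Duality moves the unit category to the
  front, where a single value decides.\<close>

lemma triangle:
  assumes [simp]: "SMC A" "SMC B"
  shows "(qR A @@ qid B) \<odot> qA A unit_smc B = qid A @@ qL B"
proof (rule qA_cancel[of A unit_smc B], simp_all)
  let ?X = "tensor A B" and ?I = unit_smc
  let ?K = "qRnf ?I B ?X \<odot> qpre ?X (qL B) \<odot> qeta A B"
  have "qRnf ?I B ?X \<odot> qihom (tensor ?I B) ((qR A @@ qid B) \<odot> qA A ?I B) \<odot> qeta A (tensor ?I B) = qihom ?I (qeta A B \<odot> qR A) \<odot> qeta A ?I"
    by (simp add: qA_transpose qeta_left)
  also have "\<dots> = qdual A (ihom B ?X) (qihom A (qeta A B) \<odot> qv A)"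
    by (subst qdual_qihom[where C=A]) (simp_all add: qihom_comp qeta_R)
  \<comment> \<open>\<open>?K\<close> is the double transpose of the right path. It is an arrow from
    \<open>A\<close> into \<open>[I, [B, X]]\<close>, and its dual is an arrow out of the unit
    category.\<close>
  also have "qihom A (qeta A B) \<odot> qv A = qdual ?I (ihom B ?X) ?K"
  proof -
    note e = smf_eta[OF assms]
    interpret v: symmetric_monoidal_functor ?I "ihom A A" "v_functor A" by (rule smf_v) simp
    note pe = smf_post[OF \<open>SMC A\<close> e] and L = smf_pre[OF _ smf_L(1)[OF \<open>SMC B\<close>], of ?X]
      and R = smf_Rn_functor[OF smc_unit \<open>SMC B\<close>, of ?X]
    note l = smf_comp[OF smf_v(1)[OF \<open>SMC A\<close>] pe] and Le = smf_comp[OF e L]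
    have [simp]: "SMC ?X" by simp
    note r = smf_comp[OF Le R]
    have K: "?K = qclass A (ihom ?I (ihom B ?X)) (smf_comp A (ihom ?I (ihom B ?X)) (Rn_functor ?I B ?X)
        (smf_comp A (ihom (tensor ?I B) ?X) (pre (tensor ?I B) B ?X (L_functor B)) (eta A B)))"
      by (simp add: qRnf_def qL_def qeta_def smf_L qpre_class qcomp_class[OF e L] qcomp_class[OF Le R])
    interpret d: ihom_functor A ?I "ihom B ?X" "smf_comp A (ihom ?I (ihom B ?X)) (Rn_functor ?I B ?X)
        (smf_comp A (ihom (tensor ?I B) ?X) (pre (tensor ?I B) B ?X (L_functor B)) (eta A B))"
      by (rule ihom_functorI[OF r]) simp_all
    \<comment> \<open>At the generator both functors have the value \<open>eta A B\<close>: on the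
      left because \<open>v\<close> sends it to the identity, on the right by
      \<open>triangle_dual_star\<close>.\<close>
    have "qclass ?I (ihom A (ihom B ?X)) (smf_comp ?I (ihom A (ihom B ?X)) (post A A (ihom B ?X) (eta A B)) (v_functor A)) =
      qclass ?I (ihom A (ihom B ?X)) (dual A ?I (ihom B ?X) (smf_comp A (ihom ?I (ihom B ?X)) (Rn_functor ?I B ?X)
        (smf_comp A (ihom (tensor ?I B) ?X) (pre (tensor ?I B) B ?X (L_functor B)) (eta A B))))"
      by (rule qclass_unit_eqI[OF l d.smf_dual]) (use e in \<open>simp add: triangle_dual_star smf_v(2) smf_id\<close>)
    then show ?thesis
      unfolding K by (simp add: qeta_def qv_def e qihom_class qdual_class r qcomp_class[OF smf_v(1) pe])
  qed
  also have "qdual A (ihom B ?X) (qdual ?I (ihom B ?X) ?K) = ?K"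
    by (rule qdual_qdual) simp_all
  also have "\<dots> = qRnf ?I B ?X \<odot> qihom (tensor ?I B) (qid A @@ qL B) \<odot> qeta A (tensor ?I B)"
    by (simp add: qeta_right)
  finally show "qRnf ?I B ?X \<odot> qihom (tensor ?I B) ((qR A @@ qid B) \<odot> qA A ?I B) \<odot> qeta A (tensor ?I B) =
    qRnf ?I B ?X \<odot> qihom (tensor ?I B) (qid A @@ qL B) \<odot> qeta A (tensor ?I B)" .
qed

text \<open>Injectivity is \<open>qeta_cancel\<close>; surjectivity holds already for functors,
  since \<open>En\<close> is a section of \<open>Rn\<close>.\<close>

lemma bij_betw_qRn:
  assumes [simp]: "SMC A" "SMC B" "SMC C"
  shows "bij_betw (qRn A B) (qhom (tensor A B) C) (qhom A (ihom B C))"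
  unfolding bij_betw_def
proof (intro conjI inj_onI)
  fix P Q assume "P \<in> qhom (tensor A B) C" "Q \<in> qhom (tensor A B) C" "qRn A B P = qRn A B Q"
  then show "P = Q"
    by (intro qeta_cancel[of A B]) (simp_all add: qhom_iff qRn_eq)
next
  show "qRn A B ` qhom (tensor A B) C = qhom A (ihom B C)"
  proof (intro equalityI subsetI)
    show "Q \<in> qhom A (ihom B C)" if "Q \<in> qRn A B ` qhom (tensor A B) C" for Q
      using that by (auto simp: qhom_iff qRn_eq)
    fix Q assume "Q \<in> qhom A (ihom B C)"
    then obtain G where G: "SMF A (ihom B C) G" "Q = qclass A (ihom B C) G" by (auto simp: qhom_def)
    then have "qRn A B (qclass (tensor A B) C (En A B C G)) = Q"
      by (simp add: qRn_class smf_En Rn_En)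
    moreover have "qclass (tensor A B) C (En A B C G) \<in> qhom (tensor A B) C"
      using G by (simp add: qhom_iff smf_En)
    ultimately show "Q \<in> qRn A B ` qhom (tensor A B) C" by blast
  qed
qed

lemma qRn_natural_left:
  "SMC B \<Longrightarrow> qarr P \<Longrightarrow> qarr Q \<Longrightarrow> qdom P = tensor A B \<Longrightarrow> qdom Q = A' \<Longrightarrow> qcod Q = A \<Longrightarrow>
   qRn A' B (P \<odot> (Q @@ qid B)) = qRn A B P \<odot> Q"
  by (auto simp: qRn_eq qihom_comp qeta_left)

lemma qRn_natural_right:
  "SMC A \<Longrightarrow> SMC B \<Longrightarrow> qarr P \<Longrightarrow> qarr Q \<Longrightarrow> qdom P = tensor A B \<Longrightarrow> qdom Q = qcod P \<Longrightarrow>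
   qRn A B (Q \<odot> P) = qihom B Q \<odot> qRn A B P"
  by (simp add: qRn_eq qihom_comp)

text \<open>The ten categories live over independent pairs of type variables, so that the
  conjunction speaks of arbitrary small categories at arbitrary types. The adjunction is expressed
  by hom-set bijections, natural in both remaining variables, rather than by unit and
  counit.\<close>

theorem theorem20p2:
  fixes A :: "('a, 'a1) smc" and A' :: "('b, 'b1) smc" and A'' :: "('c, 'c1) smc"
    and B :: "('d, 'd1) smc" and B' :: "('e, 'e1) smc" and B'' :: "('f, 'f1) smc"
    and C :: "('g, 'g1) smc" and C' :: "('h, 'h1) smc" and C'' :: "('i, 'i1) smc"
    and D :: "('j, 'j1) smc"
  assumes "symmetric_monoidal_category A" "symmetric_monoidal_category A'" "symmetric_monoidal_category A''"
    and "symmetric_monoidal_category B" "symmetric_monoidal_category B'" "symmetric_monoidal_category B''"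
    and "symmetric_monoidal_category C" "symmetric_monoidal_category C'" "symmetric_monoidal_category C''"
    and "symmetric_monoidal_category D"
  shows
    \<comment> \<open>SMC modulo \<open>\<sim>\<close> is a category, with composition and identities induced from SMC\<close>
    "(qid A \<in> qhom A A) \<and>
     (\<forall>F G. symmetric_monoidal_functor A B F \<longrightarrow> symmetric_monoidal_functor B C G \<longrightarrow>
        qclass B C G \<odot> qclass A B F = qclass A C (smf_comp A C G F)) \<and>
     (\<forall>P\<in>qhom A B. \<forall>Q\<in>qhom B C. Q \<odot> P \<in> qhom A C) \<and>
     (\<forall>P\<in>qhom A B. P \<odot> qid A = P \<and> qid B \<odot> P = P) \<and>
     (\<forall>P\<in>qhom A B. \<forall>Q\<in>qhom B C. \<forall>R\<in>qhom C D. (R \<odot> Q) \<odot> P = R \<odot> (Q \<odot> P)) \<and>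

     \<comment> \<open>the objects: tensor, unit and internal hom\<close>
     symmetric_monoidal_category (tensor A B) \<and>
     symmetric_monoidal_category unit_smc \<and>
     symmetric_monoidal_category (ihom B C) \<and>

     \<comment> \<open>the tensor is a functor of two variables, induced by the tensor of 1-cells\<close>
     (\<forall>F G. symmetric_monoidal_functor A A' F \<longrightarrow> symmetric_monoidal_functor B B' G \<longrightarrow>
        qclass A A' F @@ qclass B B' G =
        qclass (tensor A B) (tensor A' B') (tensor_smf A A' B B' F G)) \<and>
     (\<forall>P\<in>qhom A A'. \<forall>Q\<in>qhom B B'. P @@ Q \<in> qhom (tensor A B) (tensor A' B')) \<and>
     (qid A @@ qid B = qid (tensor A B)) \<and>
     (\<forall>P\<in>qhom A A'. \<forall>P'\<in>qhom A' A''. \<forall>Q\<in>qhom B B'. \<forall>Q'\<in>qhom B' B''.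
        (P' \<odot> P) @@ (Q' \<odot> Q) = (P' @@ Q') \<odot> (P @@ Q)) \<and>

     \<comment> \<open>natural isomorphisms\<close>
     qA A B C \<in> qhom (tensor A (tensor B C)) (tensor (tensor A B) C) \<and> qiso (qA A B C) \<and>
     (\<forall>P\<in>qhom A A'. \<forall>Q\<in>qhom B B'. \<forall>R\<in>qhom C C'.
        qA A' B' C' \<odot> (P @@ (Q @@ R)) = ((P @@ Q) @@ R) \<odot> qA A B C) \<and>
     qR A \<in> qhom (tensor A unit_smc) A \<and> qiso (qR A) \<and>
     (\<forall>P\<in>qhom A A'. qR A' \<odot> (P @@ qid unit_smc) = P \<odot> qR A) \<and>
     qL A \<in> qhom (tensor unit_smc A) A \<and> qiso (qL A) \<and>
     (\<forall>P\<in>qhom A A'. qL A' \<odot> (qid unit_smc @@ P) = P \<odot> qL A) \<and>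
     qS A B \<in> qhom (tensor A B) (tensor B A) \<and> qiso (qS A B) \<and>
     (\<forall>P\<in>qhom A A'. \<forall>Q\<in>qhom B B'. qS A' B' \<odot> (P @@ Q) = (Q @@ P) \<odot> qS A B) \<and>

     \<comment> \<open>coherence: pentagon, triangle, symmetry, unit and symmetry, hexagon\<close>
     (qA (tensor A B) C D \<odot> qA A B (tensor C D) =
        (qA A B C @@ qid D) \<odot> qA A (tensor B C) D \<odot> (qid A @@ qA B C D)) \<and>
     ((qR A @@ qid B) \<odot> qA A unit_smc B = qid A @@ qL B) \<and>
     (qS B A \<odot> qS A B = qid (tensor A B)) \<and>
     (qL A \<odot> qS A unit_smc = qR A) \<and>
     (qA C A B \<odot> qS (tensor A B) C \<odot> qA A B C =
        (qS A C @@ qid B) \<odot> qA A C B \<odot> (qid A @@ qS B C)) \<and>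

     \<comment> \<open>\<open>C \<mapsto> [B, C]\<close>, \<open>F \<mapsto> [B, F]\<close> induces a functor\<close>
     (\<forall>F. symmetric_monoidal_functor C C' F \<longrightarrow>
        qihom B (qclass C C' F) = qclass (ihom B C) (ihom B C') (post B C C' F)) \<and>
     (\<forall>P\<in>qhom C C'. qihom B P \<in> qhom (ihom B C) (ihom B C')) \<and>
     (qihom B (qid C) = qid (ihom B C)) \<and>
     (\<forall>P\<in>qhom C C'. \<forall>Q\<in>qhom C' C''. qihom B (Q \<odot> P) = qihom B Q \<odot> qihom B P) \<and>

     \<comment> \<open>which is right adjoint to \<open>- @ B\<close>: a bijection of hom-sets, natural in \<open>A\<close> and \<open>C\<close>\<close>
     (\<forall>F. symmetric_monoidal_functor (tensor A B) C F \<longrightarrow>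
        qRn A B (qclass (tensor A B) C F) = qclass A (ihom B C) (Rn A B C F)) \<and>
     bij_betw (qRn A B) (qhom (tensor A B) C) (qhom A (ihom B C)) \<and>
     (\<forall>P\<in>qhom (tensor A B) C. \<forall>Q\<in>qhom A' A.
        qRn A' B (P \<odot> (Q @@ qid B)) = qRn A B P \<odot> Q) \<and>
     (\<forall>P\<in>qhom (tensor A B) C. \<forall>Q\<in>qhom C C'.
        qRn A B (Q \<odot> P) = qihom B Q \<odot> qRn A B P)"
proof -
  note [simp] = assms
  show ?thesis
    by (intro conjI ballI allI impI;
      simp only: qhom_iff smc_tensor smc_unit smc_ihom assms qtensor_class qcomp_class qihom_class qRn_class bij_betw_qRn
        pentagon triangle qS_qS qL_qS hexagon qtensor_id qihom_id qiso_qA qiso_qS qiso_qL qiso_qR;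
      (rule qRn_natural_left qRn_natural_right)?;
      simp add: qA_natural qS_natural qL_natural qR_natural qtensor_comp qihom_comp)
qed

end
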